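(* Let $\mathbf{A}\in\mathbb{R}^{\#\mathcal{T}\times\#\mathcal{T}}$ be the Gram matrix of the $H^{-1}(\Omega)$ scalar product $(\cdot,\cdot)_{-1}$ on $\mathcal{P}^0(\mathcal{T})$ with respect to the basis of characteristic functions $\{\chi_T: T\in\mathcal{T}\}$. Let $\mathbf{I}\in\mathbb{R}^{\#\mathcal{T}\times\#\mathcal{E}}$ be the sparse matrix whose column belonging to $E\in\mathcal{E}$ is the coefficient vector of $\mathrm{div}\,\boldsymbol\psi_E$ in this basis, let $\mathbf{D}\in\mathbb{R}^{\#\mathcal{E}\times\#\mathcal{E}}$ be the diagonal matrix with diagonal entry $|E|^{-n/(n-1)}$ for $E\in\mathcal{E}$, and set $\mathbf{B}^{-1}:=\mathbf{I}\,\mathbf{D}\,\mathbf{I}^t$. Then there is a constant $C_{\mathrm{cond}}<\infty$ depending only on $\Omega$, $n$, and the shape regularity (constant $\gamma$) of $\mathcal{T}$ such that $$\kappa(\mathbf{B}^{-1}\mathbf{A})\le C_{\mathrm{cond}}.$$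
   Context: Domain: $n\ge 2$ and $\Omega\subset\mathbb{R}^n$ is a bounded connected polyhedral domain with Lipschitz boundary $\Gamma$. $(\cdot,\cdot)$ and $\|\cdot\|$ are the $L^2(\Omega)$ scalar product and norm; $H^{-1}(\Omega)=(H_0^1(\Omega))^*$ with duality extending $(\cdot,\cdot)$ and norm $\|\phi\|_{-1}:=\sup_{0\ne v\in H_0^1(\Omega)}\frac{(\phi,v)}{\|\nabla v\|}$; $(\cdot,\cdot)_{-1}$ is the scalar product inducing $\|\cdot\|_{-1}$. Mesh: $\mathcal{T}$ is a regular (finite, conforming, i.e. without hanging nodes) mesh of open, pairwise disjoint $n$-simplices with $\overline\Omega=\bigcup_{T\in\mathcal{T}}\overline T$. It is shape regular with constant $\gamma$: $\max_{T\in\mathcal{T}}\mathrm{diam}(T)^n/|T|\le\gamma<\infty$, where $|T|$ is the volume of $T$. $\mathcal{E}$ is the set of all facets (relatively open $(n-1)$-dimensional boundary simplices) of elements of $\mathcal{T}$; $|E|$ is the $(n-1)$-dimensional measure of $E$. $\mathcal{P}^0(\mathcal{T})$ is the space of $\mathcal{T}$-piecewise constant functions. Raviart--Thomas functions: an interior facet $E$ (not contained in $\Gamma$) is shared by exactly two elements $T^+,T^-$ (with a fixed labelling), $\overline{T^+}\cap\overline{T^-}=\overline E$; for a boundary facet $E\subset\Gamma$, $T^+$ is the unique element having $E$ as a facet and $T^-=\emptyset$. $\boldsymbol p_E^\pm$ is the vertex of $T^\pm$ opposite to $E$. Define $\boldsymbol\psi_E(\boldsymbol x):=\pm\frac{|E|}{n|T^\pm|}(\boldsymbol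 x-\boldsymbol p_E^\pm)$ for $\boldsymbol x\in T^\pm$, and $\boldsymbol\psi_E:=0$ elsewhere. Thus $\mathrm{div}\,\boldsymbol\psi_E=\frac{|E|}{|T^+|}\chi_{T^+}-\frac{|E|}{|T^-|}\chi_{T^-}$ for interior $E$, and $\mathrm{div}\,\boldsymbol\psi_E=\frac{|E|}{|T^+|}\chi_{T^+}$ for boundary $E$. $\kappa(\mathbf{B}^{-1}\mathbf{A})$ denotes the ratio of the largest to the smallest eigenvalue of $\mathbf{B}^{-1}\mathbf{A}$ (this matrix is symmetric with respect to the inner product induced by $\mathbf{A}$). *)

theory Defs
  imports
    "HOL-Analysis.Analysis"
    "Jordan_Normal_Form.Spectral_Radius"
begin

no_notation Matrix.scalar_prod (infix "\<bullet>" 70)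

section \<open>Lipschitz polyhedra\<close>

text \<open>Locally, after a rigid motion, \<open>\<Omega>\<close> is the strict subgraph of a Lipschitz function \<open>\<zeta>\<close> of the
  coordinates orthogonal to a unit vector \<open>e\<close>.\<close>

definition lipschitz_boundary :: "'a::euclidean_space set \<Rightarrow> bool" where
  "lipschitz_boundary \<Omega> \<longleftrightarrow>
     (\<forall>x\<in>frontier \<Omega>. \<exists>U e L \<zeta>. open U \<and> x \<in> U \<and> norm e = 1 \<and>
        L-lipschitz_on {y. y \<bullet> e = 0} (\<zeta> :: 'a \<Rightarrow> real) \<and>
        \<Omega> \<inter> U = {z \<in> U. z \<bullet> e < \<zeta> (z - (z \<bullet> e) *\<^sub>R e)})"

definition polyhedral_lipschitz_domain :: "'a::euclidean_space set \<Rightarrow> bool" where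
  "polyhedral_lipschitz_domain \<Omega> \<longleftrightarrow>
     open \<Omega> \<and> connected \<Omega> \<and> \<Omega> \<noteq> {} \<and> bounded \<Omega> \<and>
     (\<exists>\<P>. finite \<P> \<and> (\<forall>P\<in>\<P>. polytope P) \<and> closure \<Omega> = \<Union>\<P>) \<and>
     lipschitz_boundary \<Omega>"


section \<open>Sobolev spaces\<close>

text \<open>Functions are total representatives; everything below only depends on their values almost
  everywhere in \<open>\<Omega>\<close>.\<close>

definition L2 :: "'a::euclidean_space set \<Rightarrow> ('a \<Rightarrow> 'b::euclidean_space) \<Rightarrow> bool" where
  "L2 \<Omega> f \<longleftrightarrow> f \<in> borel_measurable (lebesgue_on \<Omega>) \<and>
     integrable (lebesgue_on \<Omega>) (\<lambda>x. (norm (f x))\<^sup>2)"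

definition L2_norm :: "'a::euclidean_space set \<Rightarrow> ('a \<Rightarrow> 'b::euclidean_space) \<Rightarrow> real" where
  "L2_norm \<Omega> f = sqrt (LINT x|lebesgue_on \<Omega>. (norm (f x))\<^sup>2)"

primrec C_k :: "nat \<Rightarrow> ('a::euclidean_space \<Rightarrow> real) \<Rightarrow> bool" where
  "C_k 0 f \<longleftrightarrow> continuous_on UNIV f"
| "C_k (Suc k) f \<longleftrightarrow> (\<forall>x. f differentiable (at x)) \<and>
     (\<forall>b\<in>Basis. C_k k (\<lambda>x. frechet_derivative f (at x) b))"

definition test_function :: "'a::euclidean_space set \<Rightarrow> ('a \<Rightarrow> real) \<Rightarrow> bool" where
  "test_function \<Omega> \<phi> \<longleftrightarrow> (\<forall>k. C_k k \<phi>) \<and>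
     compact (closure {x. \<phi> x \<noteq> 0}) \<and> closure {x. \<phi> x \<noteq> 0} \<subseteq> \<Omega>"

definition grad :: "('a::euclidean_space \<Rightarrow> real) \<Rightarrow> 'a \<Rightarrow> 'a" where
  "grad \<phi> x = (\<Sum>b\<in>Basis. frechet_derivative \<phi> (at x) b *\<^sub>R b)"

definition has_weak_grad ::
    "'a::euclidean_space set \<Rightarrow> ('a \<Rightarrow> real) \<Rightarrow> ('a \<Rightarrow> 'a) \<Rightarrow> bool" where
  "has_weak_grad \<Omega> v g \<longleftrightarrow> L2 \<Omega> v \<and> L2 \<Omega> g \<and>
     (\<forall>\<phi> b. test_function \<Omega> \<phi> \<longrightarrow> b \<in> Basis \<longrightarrow>
        (LINT x|lebesgue_on \<Omega>. v x * (grad \<phi> x \<bullet> b)) =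
        - (LINT x|lebesgue_on \<Omega>. (g x \<bullet> b) * \<phi> x))"

definition weak_grad :: "'a::euclidean_space set \<Rightarrow> ('a \<Rightarrow> real) \<Rightarrow> 'a \<Rightarrow> 'a" where
  "weak_grad \<Omega> v = (SOME g. has_weak_grad \<Omega> v g)"

definition H1 :: "'a::euclidean_space set \<Rightarrow> ('a \<Rightarrow> real) set" where
  "H1 \<Omega> = {v. \<exists>g. has_weak_grad \<Omega> v g}"

definition H1_norm :: "'a::euclidean_space set \<Rightarrow> ('a \<Rightarrow> real) \<Rightarrow> real" where
  "H1_norm \<Omega> v = sqrt ((L2_norm \<Omega> v)\<^sup>2 + (L2_norm \<Omega> (weak_grad \<Omega> v))\<^sup>2)"

definition H10 :: "'a::euclidean_space set \<Rightarrow> ('a \<Rightarrow> real) set" where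
  "H10 \<Omega> = {v \<in> H1 \<Omega>. \<forall>\<epsilon>>0. \<exists>\<phi>. test_function \<Omega> \<phi> \<and> H1_norm \<Omega> (\<lambda>x. v x - \<phi> x) < \<epsilon>}"

definition has_weak_div ::
    "'a::euclidean_space set \<Rightarrow> ('a \<Rightarrow> 'a) \<Rightarrow> ('a \<Rightarrow> real) \<Rightarrow> bool" where
  "has_weak_div \<Omega> \<sigma> d \<longleftrightarrow> L2 \<Omega> \<sigma> \<and> L2 \<Omega> d \<and>
     (\<forall>\<phi>. test_function \<Omega> \<phi> \<longrightarrow>
        (LINT x|lebesgue_on \<Omega>. \<sigma> x \<bullet> grad \<phi> x) = - (LINT x|lebesgue_on \<Omega>. d x * \<phi> x))"

definition Hm1_norm :: "'a::euclidean_space set \<Rightarrow> (('a \<Rightarrow> real) \<Rightarrow> real) \<Rightarrow> real" where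
  "Hm1_norm \<Omega> F =
     (SUP v \<in> {v \<in> H10 \<Omega>. \<not> (AE x in lebesgue_on \<Omega>. v x = 0)}. F v / L2_norm \<Omega> (weak_grad \<Omega> v))"

text \<open>The scalar product inducing the dual norm, recovered by polarization; the lemma
  \<open>Hm1_inner_unique\<close> confirms that there is no other choice.\<close>

definition Hm1_inner :: "'a::euclidean_space set \<Rightarrow>
    (('a \<Rightarrow> real) \<Rightarrow> real) \<Rightarrow> (('a \<Rightarrow> real) \<Rightarrow> real) \<Rightarrow> real" where
  "Hm1_inner \<Omega> F G =
     ((Hm1_norm \<Omega> (\<lambda>v. F v + G v))\<^sup>2 - (Hm1_norm \<Omega> (\<lambda>v. F v - G v))\<^sup>2) / 4"

definition L2_functional :: "'a::euclidean_space set \<Rightarrow> ('a \<Rightarrow> real) \<Rightarrow> ('a \<Rightarrow> real) \<Rightarrow> real" where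
  "L2_functional \<Omega> \<phi> = (\<lambda>v. LINT x|lebesgue_on \<Omega>. \<phi> x * v x)"

lemma Hm1_inner_unique:
  assumes V_add: "\<And>F G. F \<in> V \<Longrightarrow> G \<in> V \<Longrightarrow> (\<lambda>v. F v + G v) \<in> V"
    and V_scale: "\<And>c F. F \<in> V \<Longrightarrow> (\<lambda>v. c * F v) \<in> V"
    and sym: "\<And>F G. F \<in> V \<Longrightarrow> G \<in> V \<Longrightarrow> ip F G = ip G F"
    and add: "\<And>F G H. F \<in> V \<Longrightarrow> G \<in> V \<Longrightarrow> H \<in> V \<Longrightarrow>
                ip (\<lambda>v. F v + G v) H = ip F H + ip G H"
    and scale: "\<And>c F H. F \<in> V \<Longrightarrow> H \<in> V \<Longrightarrow> ip (\<lambda>v. c * F v) H = c * ip F H"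
    and induces: "\<And>F. F \<in> V \<Longrightarrow> ip F F = (Hm1_norm \<Omega> F)\<^sup>2"
    and FG: "F \<in> V" "G \<in> V"
  shows "ip F G = Hm1_inner \<Omega> F G"
proof -
  define N where "N = (\<lambda>v. (-1) * G v)"
  have N: "N \<in> V" unfolding N_def by (rule V_scale[OF FG(2)])
  have NH: "ip N H = - ip G H" if "H \<in> V" for H
    unfolding N_def using scale[OF FG(2) that, of "-1"] by simp
  have quad: "ip (\<lambda>v. X v + Y v) (\<lambda>v. X v + Y v) = ip X X + 2 * ip X Y + ip Y Y"
    if "X \<in> V" "Y \<in> V" for X Y
    using add[OF that V_add[OF that]] sym[OF that(1) V_add[OF that]]
      sym[OF that(2) V_add[OF that]] add[OF that that(1)] add[OF that that(2)] sym[OF that]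
    by simp
  have "(\<lambda>v. F v + N v) = (\<lambda>v. F v - G v)" by (simp add: N_def)
  moreover have "ip F N = - ip F G" "ip N N = ip G G"
    using sym[OF FG(1) N] NH[OF FG(1)] sym[OF FG] NH[OF N] sym[OF N FG(2)] NH[OF FG(2)] by simp_all
  ultimately show ?thesis
    unfolding Hm1_inner_def
    using quad[OF FG] quad[OF FG(1) N] induces[OF V_add[OF FG]] induces[OF V_add[OF FG(1) N]]
    by simp
qed


section \<open>Simplicial meshes\<close>

definition open_simplex :: "'a::euclidean_space set \<Rightarrow> bool" where
  "open_simplex T \<longleftrightarrow> (\<exists>S. int DIM('a) simplex S \<and> T = interior S)"

text \<open>The library's \<^const>\<open>triangulation\<close> requires that the intersection of any two (closed)
  simplices is a face of each of them, which excludes hanging nodes.\<close>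

definition regular_mesh :: "'a::euclidean_space set \<Rightarrow> 'a set set \<Rightarrow> bool" where
  "regular_mesh \<Omega> \<T> \<longleftrightarrow>
     finite \<T> \<and> (\<forall>T\<in>\<T>. open_simplex T) \<and> disjoint \<T> \<and>
     triangulation (closure ` \<T>) \<and> closure \<Omega> = (\<Union>T\<in>\<T>. closure T)"

definition shape_regular :: "real \<Rightarrow> 'a::euclidean_space set set \<Rightarrow> bool" where
  "shape_regular \<gamma> \<T> \<longleftrightarrow> (\<forall>T\<in>\<T>. diameter T ^ DIM('a) / measure lebesgue T \<le> \<gamma>)"

definition is_facet :: "'a::euclidean_space set \<Rightarrow> 'a set \<Rightarrow> bool" where
  "is_facet E T \<longleftrightarrow> (\<exists>F. F facet_of closure T \<and> E = rel_interior F)"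

definition facets :: "'a::euclidean_space set set \<Rightarrow> 'a set set" where
  "facets \<T> = {E. \<exists>T\<in>\<T>. is_facet E T}"

text \<open>Lebesgue measure of the dimension of the affine hull of \<open>E\<close>: expressed in coordinates with
  respect to an orthonormal basis \<open>B\<close> of the linear space parallel to that affine hull.\<close>

definition flat_measure :: "'a::euclidean_space set \<Rightarrow> real" where
  "flat_measure E =
     (let B = (SOME B. pairwise real_inner_class.orthogonal B \<and> (\<forall>b\<in>B. norm b = 1) \<and>
                 span B = span {x - y |x y. x \<in> E \<and> y \<in> E})
      in measure (\<Pi>\<^sub>M b\<in>B. lborel) ((\<lambda>x. \<lambda>b\<in>B. x \<bullet> b) ` E))"

definition opposite_vertex :: "'a::euclidean_space set \<Rightarrow> 'a set \<Rightarrow> 'a" where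
  "opposite_vertex T E = (THE p. p extreme_point_of closure T \<and> p \<notin> closure E)"

definition facet_labelling ::
    "'a::euclidean_space set \<Rightarrow> 'a set set \<Rightarrow> ('a set \<Rightarrow> 'a set) \<Rightarrow> ('a set \<Rightarrow> 'a set) \<Rightarrow> bool" where
  "facet_labelling \<Omega> \<T> Tp Tm \<longleftrightarrow>
     (\<forall>E\<in>facets \<T>.
        if E \<subseteq> frontier \<Omega> then {T\<in>\<T>. is_facet E T} = {Tp E} \<and> Tm E = {}
        else {T\<in>\<T>. is_facet E T} = {Tp E, Tm E} \<and> Tp E \<noteq> Tm E)"


section \<open>Raviart--Thomas functions and the matrices\<close>

definition rt_function ::
    "('a::euclidean_space set \<Rightarrow> 'a set) \<Rightarrow> ('a set \<Rightarrow> 'a set) \<Rightarrow> 'a set \<Rightarrow> 'a \<Rightarrow> 'a" where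
  "rt_function Tp Tm E x =
     (if x \<in> Tp E then
        (flat_measure E / (real DIM('a) * measure lebesgue (Tp E))) *\<^sub>R (x - opposite_vertex (Tp E) E)
      else if x \<in> Tm E then
        - (flat_measure E / (real DIM('a) * measure lebesgue (Tm E))) *\<^sub>R (x - opposite_vertex (Tm E) E)
      else 0)"

definition div_coeffs :: "'a::euclidean_space set \<Rightarrow> 'a set set \<Rightarrow> ('a \<Rightarrow> 'a) \<Rightarrow> 'a set \<Rightarrow> real" where
  "div_coeffs \<Omega> \<T> \<sigma> = (SOME c. has_weak_div \<Omega> \<sigma> (\<lambda>x. \<Sum>T\<in>\<T>. c T * indicator T x))"

text \<open>In the matrices the lists \<open>Ts\<close> and \<open>Es\<close> number the elements and the facets.\<close>

definition gram_matrix :: "'a::euclidean_space set \<Rightarrow> 'a set list \<Rightarrow> real mat" where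
  "gram_matrix \<Omega> Ts = Matrix.mat (length Ts) (length Ts)
     (\<lambda>(i, j). Hm1_inner \<Omega> (L2_functional \<Omega> (indicator (Ts ! i))) (L2_functional \<Omega> (indicator (Ts ! j))))"

definition div_matrix :: "'a::euclidean_space set \<Rightarrow> ('a set \<Rightarrow> 'a set) \<Rightarrow> ('a set \<Rightarrow> 'a set) \<Rightarrow>
    'a set list \<Rightarrow> 'a set list \<Rightarrow> real mat" where
  "div_matrix \<Omega> Tp Tm Ts Es = Matrix.mat (length Ts) (length Es)
     (\<lambda>(i, j). div_coeffs \<Omega> (set Ts) (rt_function Tp Tm (Es ! j)) (Ts ! i))"

definition facet_matrix :: "'a::euclidean_space set list \<Rightarrow> real mat" where
  "facet_matrix Es = mat_diag (length Es)
     (\<lambda>j. flat_measure (Es ! j) powr (- (real DIM('a) / (real DIM('a) - 1))))"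

definition cond_number :: "real mat \<Rightarrow> real" where
  "cond_number M = Max (spectrum M) / Min (spectrum M)"

end

theory Submission
  imports Defs
begin

text \<open>
  Both spectral bounds are estimates of the dual norm. For the upper one, the field \<open>\<Sum>E. c E *\<^sub>R \<psi> E\<close> has the
  divergence with coefficient vector \<open>I c\<close>, so its \<open>L2\<close> norm bounds the dual norm of that divergence, and scaling
  on the elements bounds the \<open>L2\<close> norm by \<open>c\<^sup>T D\<inverse> c\<close>.

  For the lower one, let \<open>w\<close> be the piecewise constant function with integral \<open>y T\<close> over \<open>T\<close>, extended by zero.
  Then \<open>y\<^sup>T B\<inverse> y\<close> is the sum of the squared jumps of \<open>w\<close> across the facets \<open>E\<close>, weighted with
  \<open>|E| powr ((n - 2) / (n - 1))\<close>. Up to a constant it bounds the energy of a test function with the same integrals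
  as \<open>w\<close>: take the continuous piecewise affine function whose value at an interior vertex is that of \<open>w\<close> on one
  of the adjacent elements, and zero at a boundary vertex; mollify it, truncate it near zero to make the support
  compact, and correct its means by bubbles. The elements at a vertex are linked to each other, or to a boundary
  facet, by a bounded number of facets at that vertex, so the jumps there control the deviation of \<open>w\<close> from the
  vertex value. Testing the functional given by \<open>x\<close> with this function bounds \<open>x \<bullet> y\<close> by the product of the dual
  norm of \<open>x\<close> and the square root of \<open>y\<^sup>T B\<inverse> y\<close>.
\<close>

text \<open>Two one-sided bounds suffice because \<open>B\<inverse> A\<close> is self-adjoint for
  the inner product of \<open>A\<close>: for an eigenpair \<open>(l, x)\<close> the first is applied
  to \<open>c = D I\<^sup>T A x\<close>, for which \<open>I c = l x\<close>, and the second to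
  \<open>y = A x\<close>. No power of the mesh size enters, since the diagonal has the right
  homogeneity: \<open>|E| powr ((n - 2) / (n - 1))\<close> scales like \<open>h ^ (n - 2)\<close>,
  as does the energy of a hat function on an element of diameter \<open>h\<close>. Hence all
  comparisons are made on one element or within one vertex patch. The obstacle lies in the lower
  bound. The jumps must control the values at a vertex, also where the patch touches the boundary.
  For \<open>n \<ge> 3\<close> the elements at a vertex have no cyclic order that could be followed,
  so their connectedness through facets is derived from a generic segment. Quantities that depend on
  the particular mesh, such as the Lipschitz constant of the piecewise affine function, serve only
  to approximate it by test functions and vanish from the estimate. The Poincare inequality makes
  the dual norm finite and contributes nothing to the constant, which is a product of expressions in
  \<open>n\<close> and \<gamma>.\<close>

no_notation vec_nth (infixl "$" 90)

section \<open>Eigenvalues of a product of two symmetric matrices\<close>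

lemma scalar_prod_mult_mat_vec:
  fixes A :: "'a::comm_ring_1 mat"
  assumes "A \<in> carrier_mat r c" "x \<in> carrier_vec r" "y \<in> carrier_vec c"
  shows "scalar_prod x (A *\<^sub>v y) = scalar_prod (transpose_mat A *\<^sub>v x) y"
proof -
  have "scalar_prod x (A *\<^sub>v y) = (\<Sum>i<r. \<Sum>j<c. x $ i * (A $$ (i,j) * y $ j))"
    using assms by (auto simp: scalar_prod_def sum_distrib_left atLeast0LessThan intro!: sum.cong)
  also have "... = (\<Sum>j<c. \<Sum>i<r. x $ i * (A $$ (i,j) * y $ j))"
    by (rule sum.swap)
  also have "... = scalar_prod (transpose_mat A *\<^sub>v x) y"
    using assms by (auto simp: scalar_prod_def sum_distrib_left sum_distrib_right atLeast0LessThan mult_ac intro!: sum.cong)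
  finally show ?thesis .
qed

lemma Re_Im_mult_mat_vec:
  fixes N :: "real mat" and x :: "complex Matrix.vec"
  assumes "N \<in> carrier_mat m m" "x \<in> carrier_vec m"
  shows "map_vec Re (map_mat of_real N *\<^sub>v x) = N *\<^sub>v map_vec Re x"
    and "map_vec Im (map_mat of_real N *\<^sub>v x) = N *\<^sub>v map_vec Im x"
  using assms by (auto simp: vec_eq_iff scalar_prod_def intro!: sum.cong)

text \<open>The complex spectrum is nonempty, and its members are real because \<open>M * A\<close>
  is self-adjoint for the inner product induced by \<open>A\<close>. The real and imaginary parts of
  a complex eigenvector then satisfy the same eigenvalue equation, and one of them is
  nonzero.\<close>

lemma real_eigenvalue_exists:
  fixes A M :: "real mat"
  assumes A: "A \<in> carrier_mat m m" and M: "M \<in> carrier_mat m m" and "0 < m"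
    and symA: "transpose_mat A = A" and symM: "transpose_mat M = M"
    and pos: "\<And>x. x \<in> carrier_vec m \<Longrightarrow> x \<noteq> 0\<^sub>v m \<Longrightarrow> 0 < scalar_prod x (A *\<^sub>v x)"
  shows "spectrum (M * A) \<noteq> {}"
proof -
  let ?N = "map_mat complex_of_real (M * A)"
  have MA: "M * A \<in> carrier_mat m m" using A M by simp
  have "spectrum ?N \<noteq> {}"
    by (rule spectrum_non_empty) (use MA \<open>0 < m\<close> in auto)
  then obtain l x where x: "x \<in> carrier_vec m" "x \<noteq> 0\<^sub>v m" "?N *\<^sub>v x = l \<cdot>\<^sub>v x"
    using MA by (auto simp: spectrum_def eigenvalue_def eigenvector_def)
  define a where "a = map_vec Re x"
  define b where "b = map_vec Im x"
  have ab: "a \<in> carrier_vec m" "b \<in> carrier_vec m" using x by (auto simp: a_def b_def)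
  have Na: "M * A *\<^sub>v a = Re l \<cdot>\<^sub>v a - Im l \<cdot>\<^sub>v b"
    unfolding a_def Re_Im_mult_mat_vec(1)[OF MA x(1), symmetric] x(3)
    using x(1) by (auto simp: vec_eq_iff b_def)
  have Nb: "M * A *\<^sub>v b = Re l \<cdot>\<^sub>v b + Im l \<cdot>\<^sub>v a"
    unfolding b_def Re_Im_mult_mat_vec(2)[OF MA x(1), symmetric] x(3)
    using x(1) by (auto simp: vec_eq_iff a_def)
  have Aab: "A *\<^sub>v a \<in> carrier_vec m" "A *\<^sub>v b \<in> carrier_vec m" using A ab by auto
  \<comment> \<open>This is the symmetry of \<open>M\<close>. Inserting the equations for
    \<open>a\<close> and \<open>b\<close> cancels the terms with \<open>Re l\<close> and leaves
    \<open>Im l\<close> times a positive number.\<close>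
  have "scalar_prod (A *\<^sub>v a) (M * A *\<^sub>v b) = scalar_prod (A *\<^sub>v b) (M * A *\<^sub>v a)"
  proof -
    have "scalar_prod (A *\<^sub>v a) (M *\<^sub>v (A *\<^sub>v b)) = scalar_prod (M *\<^sub>v (A *\<^sub>v a)) (A *\<^sub>v b)"
      using scalar_prod_mult_mat_vec[OF M Aab] symM by simp
    also have "... = scalar_prod (A *\<^sub>v b) (M *\<^sub>v (A *\<^sub>v a))"
      using M Aab by (intro comm_scalar_prod[of _ m]) auto
    finally show ?thesis using assoc_mult_mat_vec[OF M A] ab by simp
  qed
  moreover have "scalar_prod (A *\<^sub>v a) (M * A *\<^sub>v b)
      = Re l * scalar_prod (A *\<^sub>v a) b + Im l * scalar_prod (A *\<^sub>v a) a"
    unfolding Nb using Aab ab by (subst scalar_prod_add_distrib[of _ m]) auto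
  moreover have "scalar_prod (A *\<^sub>v b) (M * A *\<^sub>v a)
      = Re l * scalar_prod (A *\<^sub>v b) a - Im l * scalar_prod (A *\<^sub>v b) b"
    unfolding Na using Aab ab by (subst scalar_prod_minus_distrib[of _ m]) auto
  moreover have "scalar_prod (A *\<^sub>v b) a = scalar_prod (A *\<^sub>v a) b"
    using scalar_prod_mult_mat_vec[OF A ab(2,1)] symA comm_scalar_prod[OF Aab(1) ab(2)] by simp
  ultimately have "Im l * (scalar_prod (A *\<^sub>v a) a + scalar_prod (A *\<^sub>v b) b) = 0"
    by (simp add: algebra_simps)
  moreover have nz: "a \<noteq> 0\<^sub>v m \<or> b \<noteq> 0\<^sub>v m"
  proof (rule ccontr)
    assume "\<not> ?thesis"
    then have "x = 0\<^sub>v m" using x(1) unfolding a_def b_def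
      by (auto simp: vec_eq_iff complex_eq_iff)
    with x show False by simp
  qed
  have "0 < scalar_prod (A *\<^sub>v a) a + scalar_prod (A *\<^sub>v b) b"
  proof -
    have g: "0 \<le> scalar_prod (A *\<^sub>v z) z \<and> (z \<noteq> 0\<^sub>v m \<longrightarrow> 0 < scalar_prod (A *\<^sub>v z) z)"
      if "z \<in> carrier_vec m" for z
      using pos[OF that] comm_scalar_prod[of "A *\<^sub>v z" m z] A that
      by (cases "z = 0\<^sub>v m") auto
    show ?thesis using g[OF ab(1)] g[OF ab(2)] nz by linarith
  qed
  ultimately have im: "Im l = 0" by simp
  have "M * A *\<^sub>v a = Re l \<cdot>\<^sub>v a" "M * A *\<^sub>v b = Re l \<cdot>\<^sub>v b"
    using Na Nb im ab by (auto simp: vec_eq_iff)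
  then have "eigenvalue (M * A) (Re l)"
    using nz ab carrier_matD[OF MA] unfolding eigenvalue_def eigenvector_def by (metis (no_types))
  then show ?thesis by (auto simp: spectrum_def)
qed

text \<open>For an eigenpair \<open>(l, x)\<close> put \<open>y = A x\<close>,
  \<open>g = J\<^sup>T y\<close> and \<open>c = D g\<close>. Then \<open>J c = l x\<close>, and both
  \<open>y\<^sup>T M y\<close> and the sum of \<open>(c $ j)\<^sup>2 / d j\<close> equal
  \<open>l * q\<close> with \<open>q = x\<^sup>T A x\<close>. So \<open>lower\<close> becomes
  \<open>1 \<le> C2 * sqrt l\<close> and \<open>upper\<close> becomes
  \<open>l \<le> C1\<close>.\<close>

lemma cond_number_diag_preconditioner:
  fixes A J :: "real mat" and d :: "nat \<Rightarrow> real"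
  assumes A: "A \<in> carrier_mat m m" and J: "J \<in> carrier_mat m e" and "0 < m"
    and symA: "transpose_mat A = A"
    and pos: "\<And>x. x \<in> carrier_vec m \<Longrightarrow> x \<noteq> 0\<^sub>v m \<Longrightarrow> 0 < scalar_prod x (A *\<^sub>v x)"
    and d: "\<And>j. j < e \<Longrightarrow> 0 < d j"
    and upper: "\<And>c. c \<in> carrier_vec e \<Longrightarrow>
      scalar_prod (J *\<^sub>v c) (A *\<^sub>v (J *\<^sub>v c)) \<le> C1 * (\<Sum>j<e. (c $ j)\<^sup>2 / d j)"
    and lower: "\<And>x y. x \<in> carrier_vec m \<Longrightarrow> y \<in> carrier_vec m \<Longrightarrow>
      scalar_prod x y \<le> C2 * sqrt (scalar_prod x (A *\<^sub>v x)) *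
        sqrt (\<Sum>j<e. d j * ((transpose_mat J *\<^sub>v y) $ j)\<^sup>2)"
    and "0 < C2"
  shows "spectrum (J * mat_diag e d * transpose_mat J * A) \<noteq> {}"
    and "0 < Min (spectrum (J * mat_diag e d * transpose_mat J * A))"
    and "cond_number (J * mat_diag e d * transpose_mat J * A) \<le> C1 * C2\<^sup>2"
proof -
  define D where "D = mat_diag e d"
  define M where "M = J * D * transpose_mat J"
  have D: "D \<in> carrier_mat e e" and M: "M \<in> carrier_mat m m"
    using J by (auto simp: D_def M_def mat_diag_def)
  have symD: "transpose_mat D = D" by (auto simp: D_def mat_diag_def)
  have symM: "transpose_mat M = M"
    unfolding M_def using J D symD
    by (subst transpose_mult[of _ m e], simp, simp, subst transpose_mult[of _ m e], simp, simp,
        subst assoc_mult_mat[of _ m e _ e _ m]) auto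
  have ne: "spectrum (M * A) \<noteq> {}"
    by (rule real_eigenvalue_exists[OF A M \<open>0 < m\<close> symA symM pos])
  have MA: "M * A \<in> carrier_mat m m" using A M by simp
  have fin: "finite (spectrum (M * A))" by (rule card_finite_spectrum(1)[OF MA])
  have bounds: "1 / C2\<^sup>2 \<le> l \<and> l \<le> C1" if l: "l \<in> spectrum (M * A)" for l
  proof -
    obtain x where x: "x \<in> carrier_vec m" "x \<noteq> 0\<^sub>v m" "M * A *\<^sub>v x = l \<cdot>\<^sub>v x"
      using l MA by (auto simp: spectrum_def eigenvalue_def eigenvector_def)
    define y where "y = A *\<^sub>v x"
    have y: "y \<in> carrier_vec m" using A x by (simp add: y_def)
    define g where "g = transpose_mat J *\<^sub>v y"
    define c where "c = D *\<^sub>v g"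
    define q where "q = scalar_prod x (A *\<^sub>v x)"
    have q: "0 < q" using pos x by (simp add: q_def)
    have g: "g \<in> carrier_vec e" using J y by (simp add: g_def)
    have c: "c \<in> carrier_vec e" using D g by (simp add: c_def)
    have cj: "c $ j = d j * g $ j" if "j < e" for j
    proof -
      have "c $ j = (\<Sum>i<e. D $$ (j,i) * g $ i)"
        using that g D by (simp add: c_def scalar_prod_def atLeast0LessThan)
      also have "... = (\<Sum>i<e. if i = j then d j * g $ j else 0)"
        using that by (intro sum.cong) (auto simp: D_def mat_diag_def)
      finally show ?thesis using that by simp
    qed
    have My: "M *\<^sub>v y = l \<cdot>\<^sub>v x"
      using x assoc_mult_mat_vec[OF M A x(1)] by (simp add: y_def)
    have Jc: "J *\<^sub>v c = l \<cdot>\<^sub>v x"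
    proof -
      have "M *\<^sub>v y = J * D *\<^sub>v g"
        unfolding M_def g_def using J D y by (intro assoc_mult_mat_vec[of _ m e]) auto
      also have "... = J *\<^sub>v c"
        unfolding c_def using J D g by (intro assoc_mult_mat_vec[of _ m e]) auto
      finally show ?thesis using My by simp
    qed
    define Q where "Q = (\<Sum>j<e. d j * (g $ j)\<^sup>2)"
    have Q: "Q = l * q"
    proof -
      have "l * q = scalar_prod y (l \<cdot>\<^sub>v x)"
        using x A comm_scalar_prod[of x m y] y by (simp add: q_def y_def)
      also have "... = scalar_prod y (J *\<^sub>v c)" by (simp add: Jc)
      also have "... = scalar_prod g c"
        using scalar_prod_mult_mat_vec[OF J y c] by (simp add: g_def)
      also have "... = Q"
        using cj c by (auto simp: scalar_prod_def Q_def atLeast0LessThan power2_eq_square intro!: sum.cong)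
      finally show ?thesis by simp
    qed
    have Q0: "0 \<le> Q" unfolding Q_def using d by (intro sum_nonneg mult_nonneg_nonneg) (auto simp: less_imp_le)
    then have l0: "0 \<le> l" using Q q by (simp add: zero_le_mult_iff)
    have "q \<le> C2 * sqrt q * sqrt (l * q)"
    proof -
      have "q = scalar_prod x y" by (simp add: q_def y_def)
      also have "... \<le> C2 * sqrt q * sqrt Q"
        using lower[OF x(1) y] unfolding q_def Q_def g_def .
      finally show ?thesis by (simp add: Q)
    qed
    also have "... = C2 * sqrt l * q"
      using q by (simp add: real_sqrt_mult)
    finally have "1 \<le> C2 * sqrt l" using q by simp
    then have "1\<^sup>2 \<le> (C2 * sqrt l)\<^sup>2" by (intro power_mono) auto
    then have lo: "1 \<le> C2\<^sup>2 * l" using l0 by (simp add: power_mult_distrib)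
    have lpos: "0 < l" using lo l0 by (cases "l = 0") auto
    have "l\<^sup>2 * q = scalar_prod (J *\<^sub>v c) (A *\<^sub>v (J *\<^sub>v c))"
      unfolding Jc using x A by (simp add: mult_mat_vec[of _ m m] q_def power2_eq_square)
    also have "... \<le> C1 * (\<Sum>j<e. (c $ j)\<^sup>2 / d j)" by (rule upper[OF c])
    also have "(\<Sum>j<e. (c $ j)\<^sup>2 / d j) = Q"
      unfolding Q_def using cj d by (intro sum.cong) (auto simp: power2_eq_square field_simps)
    finally have "l * (l * q) \<le> C1 * (l * q)" by (simp add: Q power2_eq_square mult_ac)
    then have "l \<le> C1" using lpos q by simp
    with lo \<open>0 < C2\<close> show ?thesis by (simp add: field_simps)
  qed
  let ?S = "spectrum (M * A)"
  have mn: "Min ?S \<in> ?S" and mx: "Max ?S \<in> ?S" using fin ne by auto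
  have a: "1 / C2\<^sup>2 \<le> Min ?S" and b: "Max ?S \<le> C1" using bounds mn mx by auto
  have a0: "0 < 1 / C2\<^sup>2" using \<open>0 < C2\<close> by simp
  have c0: "0 \<le> C1" using bounds[OF mn] a0 by linarith
  have "Max ?S / Min ?S \<le> C1 / (1 / C2\<^sup>2)"
    using a b a0 c0 by (intro frac_le) auto
  then have "Max ?S / Min ?S \<le> C1 * C2\<^sup>2" by simp
  then show "spectrum (J * mat_diag e d * transpose_mat J * A) \<noteq> {}"
    "0 < Min (spectrum (J * mat_diag e d * transpose_mat J * A))"
    "cond_number (J * mat_diag e d * transpose_mat J * A) \<le> C1 * C2\<^sup>2"
    using ne less_le_trans[OF a0 a] unfolding M_def D_def cond_number_def by simp_all
qed

section \<open>Smooth functions\<close>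

definition smooth :: "('a::euclidean_space \<Rightarrow> real) \<Rightarrow> bool" where
  "smooth f \<longleftrightarrow> (\<forall>k. C_k k f)"

definition pd :: "('a::euclidean_space \<Rightarrow> real) \<Rightarrow> 'a \<Rightarrow> 'a \<Rightarrow> real" where
  "pd f b x = frechet_derivative f (at x) b"

lemma C_k_Suc_iff: "C_k (Suc k) f \<longleftrightarrow> (\<forall>x. f differentiable (at x)) \<and> (\<forall>b\<in>Basis. C_k k (pd f b))"
  by (simp add: pd_def[abs_def])

lemma C_k_continuous: "C_k k f \<Longrightarrow> continuous_on UNIV f"
  by (cases k) (auto intro!: continuous_at_imp_continuous_on differentiable_imp_continuous_within)

lemma C_k_Suc_D: "C_k (Suc k) f \<Longrightarrow> C_k k f"
proof (induction k arbitrary: f)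
  case 0
  then show ?case using C_k_continuous[OF 0] by simp
next
  case (Suc k)
  then show ?case unfolding C_k_Suc_iff[of "Suc k"] C_k_Suc_iff[of k] by blast
qed

lemma pd_eqI: "(f has_derivative D) (at x) \<Longrightarrow> pd f b x = D b"
  unfolding pd_def by (metis frechet_derivative_at)

lemma differentiable_pd: "f differentiable (at x) \<Longrightarrow> (f has_derivative (\<lambda>h. pd f h x)) (at x)"
  unfolding pd_def by (simp add: frechet_derivative_works[symmetric])

lemma C_k_const: "C_k k (\<lambda>_. c)"
proof (induction k arbitrary: c)
  case (Suc k)
  have "pd (\<lambda>_. c) b = (\<lambda>_. 0)" for b :: 'a
    by (intro ext pd_eqI[of _ "\<lambda>_. 0"]) auto
  then show ?case using Suc unfolding C_k_Suc_iff by simp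
qed simp

lemma C_k_add: "C_k k f \<Longrightarrow> C_k k g \<Longrightarrow> C_k k (\<lambda>x. f x + g x)"
proof (induction k arbitrary: f g)
  case 0
  then show ?case by (auto intro: continuous_intros)
next
  case (Suc k)
  have "pd (\<lambda>x. f x + g x) b = (\<lambda>x. pd f b x + pd g b x)" for b
    using Suc.prems unfolding C_k_Suc_iff
    by (intro ext pd_eqI[of _ "\<lambda>h. pd f h _ + pd g h _"] has_derivative_add differentiable_pd) auto
  then show ?case using Suc unfolding C_k_Suc_iff by auto
qed

lemma C_k_mult: "C_k k f \<Longrightarrow> C_k k g \<Longrightarrow> C_k k (\<lambda>x. f x * g x)"
proof (induction k arbitrary: f g)
  case 0
  then show ?case by (auto intro: continuous_intros)
next
  case (Suc k)
  have "pd (\<lambda>x. f x * g x) b = (\<lambda>x. f x * pd g b x + pd f b x * g x)" for b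
    using Suc.prems unfolding C_k_Suc_iff
    by (intro ext pd_eqI[of _ "\<lambda>h. f _ * pd g h _ + pd f h _ * g _"] has_derivative_mult differentiable_pd) auto
  moreover have "C_k k f" "C_k k g" by (rule C_k_Suc_D, rule Suc.prems)+
  ultimately show ?case using Suc unfolding C_k_Suc_iff by (auto intro!: C_k_add differentiable_mult)
qed

lemma C_k_affine: "C_k k (\<lambda>x. c + x \<bullet> d)"
proof (cases k)
  case 0
  then show ?thesis by (auto intro!: continuous_intros)
next
  case (Suc m)
  have d: "((\<lambda>x. c + x \<bullet> d) has_derivative (\<lambda>h. h \<bullet> d)) (at x)" for x
    by (auto intro!: derivative_eq_intros)
  have "pd (\<lambda>x. c + x \<bullet> d) b = (\<lambda>_. b \<bullet> d)" for b
    by (intro ext pd_eqI[OF d])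
  then show ?thesis using d unfolding Suc C_k_Suc_iff by (auto simp: differentiable_def C_k_const)
qed

subsection \<open>The flat exponential\<close>

text \<open>Polynomials in \<open>1 / t\<close> times \<open>exp (- 1 / t)\<close>, continued by
  zero, form a family closed under differentiation. This is why a polynomial is carried along:
  smoothness follows by induction with \<open>P\<close> arbitrary.\<close>

definition flat_exp :: "real poly \<Rightarrow> real \<Rightarrow> real" where
  "flat_exp P t = (if t > 0 then poly P (1 / t) * exp (- (1 / t)) else 0)"

lemma poly_exp_decay: "((\<lambda>s. poly P s * exp (- s)) \<longlongrightarrow> 0) at_top" for P :: "real poly"
proof -
  have "((\<lambda>s. \<Sum>i\<le>degree P. coeff P i * (s ^ i / exp s)) \<longlongrightarrow> (\<Sum>i\<le>degree P. coeff P i * 0)) at_top"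
    by (intro tendsto_sum tendsto_mult tendsto_const tendsto_power_div_exp_0)
  moreover have "(\<Sum>i\<le>degree P. coeff P i * (s ^ i / exp s)) = poly P s * exp (- s)" for s
    unfolding poly_altdef sum_distrib_right exp_minus by (rule sum.cong) (simp_all add: divide_inverse mult.assoc)
  ultimately show ?thesis by (simp only: mult_zero_right sum.neutral_const)
qed

lemma flat_exp_tendsto_0: "(flat_exp P \<longlongrightarrow> 0) (at 0)"
proof -
  have "((\<lambda>t. poly P (inverse t) * exp (- inverse t)) \<longlongrightarrow> 0) (at_right 0)"
    by (rule filterlim_compose[OF poly_exp_decay[of P] filterlim_inverse_at_top_right])
  moreover have "\<forall>\<^sub>F t in at_right 0. poly P (inverse t) * exp (- inverse t) = flat_exp P t"
    by (rule eventually_mono[OF eventually_at_right_less]) (simp add: flat_exp_def divide_inverse)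
  ultimately have r: "(flat_exp P \<longlongrightarrow> 0) (at_right 0)"
    by (rule Lim_transform_eventually)
  have "\<forall>\<^sub>F t in at_left 0. 0 = flat_exp P t"
    by (rule eventually_at_leftI[of "-1"]) (simp_all add: flat_exp_def)
  then have l: "(flat_exp P \<longlongrightarrow> 0) (at_left 0)"
    by (rule Lim_transform_eventually[OF tendsto_const])
  show ?thesis by (rule filterlim_split_at[OF l r])
qed

text \<open>For positive \<open>t\<close> the chain rule produces the factor
  \<open>(1 / t)\<^sup>2\<close>, which is the value of \<open>[:0,0,1:]\<close> at
  \<open>1 / t\<close>.\<close>

lemma DERIV_flat_exp: "(flat_exp P has_real_derivative flat_exp ((P - pderiv P) * [:0,0,1:]) t) (at t)"
proof -
  consider "t > 0" | "t < 0" | "t = 0" by linarith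
  then show ?thesis
  proof cases
    case 1
    have "((\<lambda>t. poly P (1 / t) * exp (- (1 / t))) has_real_derivative
        flat_exp ((P - pderiv P) * [:0,0,1:]) t) (at t)"
    proof -
      have i: "((\<lambda>t. 1 / t) has_real_derivative - (1 / t\<^sup>2)) (at t)"
        using 1 by (auto intro!: derivative_eq_intros simp: power2_eq_square)
      have e: "((\<lambda>t. exp (- (1 / t))) has_real_derivative exp (- (1 / t)) * (1 / t\<^sup>2)) (at t)"
        using 1 by (auto intro!: derivative_eq_intros simp: power2_eq_square)
      have p: "((\<lambda>t. poly P (1 / t)) has_real_derivative poly (pderiv P) (1 / t) * - (1 / t\<^sup>2)) (at t)"
        by (rule DERIV_chain2[OF poly_DERIV i])
      have q: "poly ((P - pderiv P) * [:0,0,1:]) (1 / t)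
          = (poly P (1 / t) - poly (pderiv P) (1 / t)) * (1 / t\<^sup>2)"
        by (simp add: power2_eq_square)
      have "flat_exp ((P - pderiv P) * [:0,0,1:]) t
          = (poly P (1 / t) - poly (pderiv P) (1 / t)) * (1 / t\<^sup>2) * exp (- (1 / t))"
        using 1 unfolding flat_exp_def q by simp
      also have "... = poly (pderiv P) (1 / t) * - (1 / t\<^sup>2) * exp (- (1 / t)) +
          exp (- (1 / t)) * (1 / t\<^sup>2) * poly P (1 / t)"
        by (simp add: left_diff_distrib right_diff_distrib diff_divide_distrib mult_ac)
      finally have eq: "flat_exp ((P - pderiv P) * [:0,0,1:]) t = ..." .
      show ?thesis unfolding eq by (rule DERIV_mult[OF p e])
    qed
    then show ?thesis
      by (rule has_field_derivative_transform_within_open[where S="{0<..}"])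
        (use 1 in "simp_all add: flat_exp_def")
  next
    case 2
    have "((\<lambda>t. 0) has_real_derivative 0) (at t)" by simp
    then have "(flat_exp P has_real_derivative 0) (at t)"
      by (rule has_field_derivative_transform_within_open[where S="{..<0}"])
        (use 2 in "simp_all add: flat_exp_def")
    then show ?thesis using 2 by (simp add: flat_exp_def)
  next
    case 3
    have "((\<lambda>h. (flat_exp P (0 + h) - flat_exp P 0) / h) \<longlongrightarrow> 0) (at 0)"
    proof -
      \<comment> \<open>Dividing by \<open>h\<close> multiplies the polynomial by its variable, so
        the difference quotient at zero is again a member of the family and tends to zero.\<close>
      have "(\<lambda>h. (flat_exp P (0 + h) - flat_exp P 0) / h) = flat_exp (P * [:0,1:])"
        by (auto simp: flat_exp_def)
      then show ?thesis using flat_exp_tendsto_0[of "P * [:0,1:]"] by simp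
    qed
    then show ?thesis using 3 by (simp add: DERIV_def flat_exp_def)
  qed
qed

lemma C_k_flat_exp: "C_k k q \<Longrightarrow> C_k k (\<lambda>x. flat_exp P (q x))"
proof (induction k arbitrary: P)
  case 0
  have "continuous_on UNIV (flat_exp P)"
    by (intro continuous_at_imp_continuous_on ballI DERIV_isCont[OF DERIV_flat_exp])
  from continuous_on_compose2[OF this, of UNIV q] show ?case using 0 by simp
next
  case (Suc k)
  let ?Q = "(P - pderiv P) * [:0,0,1:]"
  have d: "((\<lambda>x. flat_exp P (q x)) has_derivative (\<lambda>h. flat_exp ?Q (q x) * pd q h x)) (at x)" for x
  proof -
    have "(q has_derivative (\<lambda>h. pd q h x)) (at x)"
      by (rule differentiable_pd[OF Suc.prems[unfolded C_k_Suc_iff, THEN conjunct1, rule_format]])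
    from has_derivative_compose[OF this DERIV_flat_exp[of P "q x", unfolded has_field_derivative_def]]
    show ?thesis .
  qed
  have "pd (\<lambda>x. flat_exp P (q x)) b = (\<lambda>x. flat_exp ?Q (q x) * pd q b x)" for b
    by (intro ext pd_eqI[OF d])
  moreover have "C_k k q" by (rule C_k_Suc_D[OF Suc.prems])
  moreover have "(\<lambda>x. flat_exp P (q x)) differentiable (at x)" for x
    unfolding differentiable_def by (rule exI, rule d)
  moreover have "C_k k (\<lambda>x. flat_exp ?Q (q x) * pd q b x)" if "b \<in> Basis" for b
    by (rule C_k_mult[OF Suc.IH[OF \<open>C_k k q\<close>]
          Suc.prems[unfolded C_k_Suc_iff, THEN conjunct2, rule_format, OF that]])
  ultimately show ?case unfolding C_k_Suc_iff by simp
qed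

lemma smooth_const: "smooth (\<lambda>_. c)" by (simp add: smooth_def C_k_const)
lemma smooth_add: "smooth f \<Longrightarrow> smooth g \<Longrightarrow> smooth (\<lambda>x. f x + g x)" by (simp add: smooth_def C_k_add)
lemma smooth_mult: "smooth f \<Longrightarrow> smooth g \<Longrightarrow> smooth (\<lambda>x. f x * g x)" by (simp add: smooth_def C_k_mult)
lemma smooth_affine: "smooth (\<lambda>x. c + x \<bullet> d)" by (simp add: smooth_def C_k_affine)
lemma smooth_flat_exp: "smooth q \<Longrightarrow> smooth (\<lambda>x. flat_exp P (q x))" by (simp add: smooth_def C_k_flat_exp)

lemma smooth_diff: "smooth f \<Longrightarrow> smooth g \<Longrightarrow> smooth (\<lambda>x. f x - g x)"
  using smooth_add[OF _ smooth_mult[OF smooth_const[of "-1"]], of f g] by simp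

lemma smooth_cmult: "smooth f \<Longrightarrow> smooth (\<lambda>x. c * f x)"
  by (rule smooth_mult[OF smooth_const])

lemma smooth_sum: "(\<And>i. i \<in> I \<Longrightarrow> smooth (f i)) \<Longrightarrow> smooth (\<lambda>x. \<Sum>i\<in>I. f i x)"
  by (induction I rule: infinite_finite_induct) (auto intro: smooth_const smooth_add)

lemma smooth_prod: "(\<And>i. i \<in> I \<Longrightarrow> smooth (f i)) \<Longrightarrow> smooth (\<lambda>x. \<Prod>i\<in>I. f i x)"
  by (induction I rule: infinite_finite_induct) (auto intro: smooth_const smooth_mult)

lemma smooth_pd: "smooth f \<Longrightarrow> b \<in> Basis \<Longrightarrow> smooth (pd f b)"
  unfolding smooth_def using C_k_Suc_iff by blast

lemma smooth_differentiable: "smooth f \<Longrightarrow> f differentiable (at x)"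
  unfolding smooth_def using C_k_Suc_iff by blast

lemma smooth_continuous: "smooth f \<Longrightarrow> continuous_on S f"
  unfolding smooth_def using C_k_continuous continuous_on_subset by blast

lemma grad_alt: "grad f x = (\<Sum>b\<in>Basis. pd f b x *\<^sub>R b)"
  by (simp add: grad_def pd_def)

lemma grad_inner_Basis: "b \<in> Basis \<Longrightarrow> grad f x \<bullet> b = pd f b x"
  by (simp add: grad_alt)

lemma has_derivative_grad:
  assumes "f differentiable (at x)"
  shows "(f has_derivative (\<lambda>h. grad f x \<bullet> h)) (at x)"
proof -
  have d: "(f has_derivative (\<lambda>h. pd f h x)) (at x)" by (rule differentiable_pd[OF assms])
  then interpret bounded_linear "\<lambda>h. pd f h x" by (rule has_derivative_bounded_linear)
  have "pd f h x = grad f x \<bullet> h" for h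
  proof -
    have "pd f h x = pd f (\<Sum>b\<in>Basis. (h \<bullet> b) *\<^sub>R b) x" by (simp add: euclidean_representation)
    also have "... = (\<Sum>b\<in>Basis. (h \<bullet> b) * pd f b x)" unfolding sum scaleR by simp
    also have "... = (\<Sum>b\<in>Basis. pd f b x * (b \<bullet> h))"
      by (rule sum.cong) (simp_all add: inner_commute)
    also have "... = grad f x \<bullet> h"
      unfolding grad_alt inner_sum_left by simp
    finally show ?thesis .
  qed
  with d show ?thesis by simp
qed

lemma grad_eqI:
  assumes "(f has_derivative (\<lambda>h. g \<bullet> h)) (at x)"
  shows "grad f x = g"
  by (rule euclidean_eqI) (simp add: grad_inner_Basis pd_eqI[OF assms])

lemma continuous_on_grad: "smooth f \<Longrightarrow> continuous_on S (grad f)"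
  unfolding grad_alt[abs_def]
  by (intro continuous_on_sum continuous_on_scaleR continuous_on_const smooth_continuous smooth_pd)

lemma smooth_has_derivative_grad: "smooth f \<Longrightarrow> (f has_derivative (\<lambda>h. grad f x \<bullet> h)) (at x)"
  by (rule has_derivative_grad[OF smooth_differentiable])

lemma grad_add:
  assumes "smooth f" "smooth g" shows "grad (\<lambda>x. f x + g x) x = grad f x + grad g x"
  using has_derivative_add[OF smooth_has_derivative_grad[OF assms(1), of x] smooth_has_derivative_grad[OF assms(2), of x]]
  by (intro grad_eqI) (simp add: inner_add_left)

lemma grad_diff:
  assumes "smooth f" "smooth g" shows "grad (\<lambda>x. f x - g x) x = grad f x - grad g x"
  using has_derivative_diff[OF smooth_has_derivative_grad[OF assms(1), of x] smooth_has_derivative_grad[OF assms(2), of x]]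
  by (intro grad_eqI) (simp add: inner_diff_left)

lemma grad_cmult:
  assumes "smooth f" shows "grad (\<lambda>x. c * f x) x = c *\<^sub>R grad f x"
  using has_derivative_mult_right[OF smooth_has_derivative_grad[OF assms, of x], of c]
  by (intro grad_eqI) simp

lemma grad_mult:
  assumes "smooth f" "smooth g"
  shows "grad (\<lambda>x. f x * g x) x = f x *\<^sub>R grad g x + g x *\<^sub>R grad f x"
  using has_derivative_mult[OF smooth_has_derivative_grad[OF assms(1), of x] smooth_has_derivative_grad[OF assms(2), of x]]
  by (intro grad_eqI) (simp add: inner_add_left mult.commute)

lemma grad_sum:
  assumes "\<And>i. i \<in> I \<Longrightarrow> smooth (f i)"
  shows "grad (\<lambda>x. \<Sum>i\<in>I. f i x) x = (\<Sum>i\<in>I. grad (f i) x)"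
  using has_derivative_sum[OF smooth_has_derivative_grad[OF assms], of I id x]
  by (intro grad_eqI) (simp add: inner_sum_left)

lemma grad_eq_0_outside:
  assumes "x \<notin> closure {x. f x \<noteq> 0}"
  shows "grad f x = 0"
proof -
  have "((\<lambda>_. 0) has_derivative (\<lambda>h. 0)) (at x)" by simp
  then have "(f has_derivative (\<lambda>h. 0)) (at x)"
    by (rule has_derivative_transform_within_open[where s="- closure {x. f x \<noteq> 0}"])
      (use assms closure_subset[of "{x. f x \<noteq> 0}"] in \<open>auto\<close>)
  then show ?thesis by (intro grad_eqI) simp
qed

lemma test_function_smooth: "test_function \<Omega> \<phi> \<longleftrightarrow> smooth \<phi> \<and>
     compact (closure {x. \<phi> x \<noteq> 0}) \<and> closure {x. \<phi> x \<noteq> 0} \<subseteq> \<Omega>"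
  by (simp add: test_function_def smooth_def)

lemma test_functionI:
  assumes "smooth \<phi>" "compact K" "K \<subseteq> \<Omega>" "\<And>x. \<phi> x \<noteq> 0 \<Longrightarrow> x \<in> K"
  shows "test_function \<Omega> \<phi>"
proof -
  have "closure {x. \<phi> x \<noteq> 0} \<subseteq> K" using assms by (intro closure_minimal compact_imp_closed) auto
  moreover have "bounded {x. \<phi> x \<noteq> 0}"
    by (rule bounded_subset[OF compact_imp_bounded[OF assms(2)]]) (use assms(4) in blast)
  then have "compact (closure {x. \<phi> x \<noteq> 0})" by (simp add: compact_closure)
  ultimately show ?thesis using assms unfolding test_function_smooth by auto
qed

lemma test_function_lin:
  assumes "test_function \<Omega> f" "test_function \<Omega> g"
  shows "test_function \<Omega> (\<lambda>x. a * f x + b * g x)"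
proof (rule test_functionI[where K="closure {x. f x \<noteq> 0} \<union> closure {x. g x \<noteq> 0}"])
  fix x assume "a * f x + b * g x \<noteq> 0"
  then have "x \<in> {x. f x \<noteq> 0} \<or> x \<in> {x. g x \<noteq> 0}" by auto
  then show "x \<in> closure {x. f x \<noteq> 0} \<union> closure {x. g x \<noteq> 0}"
    using closure_subset[of "{x. f x \<noteq> 0}"] closure_subset[of "{x. g x \<noteq> 0}"] by blast
next
  show "smooth (\<lambda>x. a * f x + b * g x)"
    using assms unfolding test_function_smooth by (intro smooth_add smooth_cmult) simp_all
qed (use assms in "simp_all add: test_function_smooth compact_Un")

lemma test_function_mult:
  assumes "test_function \<Omega> f" "smooth g"
  shows "test_function \<Omega> (\<lambda>x. f x * g x)"
proof (rule test_functionI[where K="closure {x. f x \<noteq> 0}"])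
  show "smooth (\<lambda>x. f x * g x)"
    using assms unfolding test_function_smooth by (intro smooth_mult) simp_all
  show "x \<in> closure {x. f x \<noteq> 0}" if "f x * g x \<noteq> 0" for x
    using that closure_subset[of "{x. f x \<noteq> 0}"] by auto
qed (use assms in "simp_all add: test_function_smooth")

subsection \<open>Box bumps and truncation\<close>

abbreviation "fe \<equiv> flat_exp 1"

lemma fe_bounds: "0 \<le> fe t" "fe t \<le> 1" "0 < t \<Longrightarrow> 0 < fe t" "fe t \<noteq> 0 \<longleftrightarrow> 0 < t" "t \<le> 0 \<Longrightarrow> fe t = 0"
  by (auto simp: flat_exp_def)

text \<open>The parameter \<open>m\<close> controls the steepness: the bump is positive exactly on
  the open box and tends to 1 there as \<open>m\<close> grows.\<close>

definition box_bump :: "real \<Rightarrow> 'a::euclidean_space \<Rightarrow> 'a \<Rightarrow> 'a \<Rightarrow> real" where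
  "box_bump m a c x = (\<Prod>b\<in>Basis. fe (m * (x \<bullet> b - a \<bullet> b)) * fe (m * (c \<bullet> b - x \<bullet> b)))"

lemma smooth_box_bump: "smooth (box_bump m a c)"
proof -
  have "smooth (\<lambda>x. m * (x \<bullet> b - a \<bullet> b))" "smooth (\<lambda>x. m * (c \<bullet> b - x \<bullet> b))" for b
    using smooth_affine[of "- m * (a \<bullet> b)" "m *\<^sub>R b"] smooth_affine[of "m * (c \<bullet> b)" "- (m *\<^sub>R b)"]
    by (simp_all add: algebra_simps)
  then show ?thesis unfolding box_bump_def[abs_def]
    by (intro smooth_prod smooth_mult[OF smooth_flat_exp smooth_flat_exp])
qed

lemma box_bump_bounds: "0 \<le> box_bump m a c x" "box_bump m a c x \<le> 1"
  unfolding box_bump_def by (auto intro!: prod_nonneg prod_le_1 mult_nonneg_nonneg mult_le_one fe_bounds(1,2))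

lemma box_bump_nonzero: "m > 0 \<Longrightarrow> box_bump m a c x \<noteq> 0 \<longleftrightarrow> x \<in> box a c"
  by (auto simp: box_bump_def fe_bounds(4) box_def zero_less_mult_iff)

lemma fe_tendsto_1: "t > 0 \<Longrightarrow> (\<lambda>j. fe (real j * t)) \<longlonglongrightarrow> 1"
proof -
  assume t: "t > 0"
  have "filterlim (\<lambda>j. t * real j) at_top sequentially"
    by (rule filterlim_tendsto_pos_mult_at_top[OF tendsto_const t filterlim_real_sequentially])
  then have "filterlim (\<lambda>j. real j * t) at_infinity sequentially"
    by (simp add: mult.commute filterlim_at_top_imp_at_infinity)
  then have "(\<lambda>j. 1 / (real j * t)) \<longlonglongrightarrow> 0"
    by (rule tendsto_divide_0[OF tendsto_const])
  then have "(\<lambda>j. exp (- (1 / (real j * t)))) \<longlonglongrightarrow> exp (- 0)"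
    by (intro tendsto_intros)
  then have "(\<lambda>j. exp (- (1 / (real j * t)))) \<longlonglongrightarrow> 1" by simp
  moreover have "\<forall>\<^sub>F j in sequentially. exp (- (1 / (real j * t))) = fe (real j * t)"
    using eventually_gt_at_top[of 0] by eventually_elim (use t in "auto simp: flat_exp_def")
  ultimately show ?thesis by (rule Lim_transform_eventually)
qed

lemma box_bump_tendsto:
  assumes "x \<in> box a c"
  shows "(\<lambda>j. box_bump (real j) a c x) \<longlonglongrightarrow> 1"
proof -
  have "(\<lambda>j. \<Prod>b\<in>Basis. fe (real j * (x \<bullet> b - a \<bullet> b)) * fe (real j * (c \<bullet> b - x \<bullet> b)))
      \<longlonglongrightarrow> (\<Prod>b\<in>(Basis::'a set). 1 * 1)"
    using assms by (intro tendsto_prod tendsto_mult fe_tendsto_1) (auto simp: box_def)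
  then show ?thesis by (simp add: box_bump_def)
qed

text \<open>A smooth removal of small values. Since \<open>trunc e s = e * trunc 1 (s / e)\<close>
  for positive \<open>e\<close>, the slope is bounded independently of \<open>e\<close>, which keeps
  the energy under control while \<open>e\<close> tends to zero.\<close>

definition trunc :: "real \<Rightarrow> real \<Rightarrow> real" where
  "trunc e s = s * fe (s\<^sup>2 / e\<^sup>2 - 1)"

lemma smooth_trunc:
  assumes "smooth f" shows "smooth (\<lambda>x. trunc e (f x))"
proof -
  have "smooth (\<lambda>x. (1 / e\<^sup>2) * (f x * f x) - 1)"
    by (intro smooth_diff smooth_cmult smooth_mult smooth_const assms)
  from smooth_mult[OF assms smooth_flat_exp[OF this, of 1]] show ?thesis
    by (simp add: trunc_def power2_eq_square)
qed

lemma trunc_eq_0: "e > 0 \<Longrightarrow> \<bar>s\<bar> \<le> e \<Longrightarrow> trunc e s = 0"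
proof -
  assume "e > 0" "\<bar>s\<bar> \<le> e"
  then have "s\<^sup>2 / e\<^sup>2 \<le> 1" by (simp add: abs_le_square_iff[symmetric])
  then show ?thesis by (simp add: trunc_def fe_bounds)
qed

lemma trunc_close:
  assumes "e > 0" shows "\<bar>trunc e s - s\<bar> \<le> 2 * e"
proof (cases "\<bar>s\<bar> \<le> 2 * e")
  case True
  have "\<bar>trunc e s - s\<bar> = \<bar>s * (fe (s\<^sup>2 / e\<^sup>2 - 1) - 1)\<bar>" by (simp add: trunc_def algebra_simps)
  also have "... = \<bar>s\<bar> * (1 - fe (s\<^sup>2 / e\<^sup>2 - 1))"
    using fe_bounds(2)[of "s\<^sup>2 / e\<^sup>2 - 1"] by (simp add: abs_mult)
  also have "... \<le> \<bar>s\<bar> * 1" by (intro mult_left_mono) (use fe_bounds(1) in auto)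
  finally show ?thesis using True by simp
next
  case False
  define q where "q = s\<^sup>2 / e\<^sup>2 - 1"
  have s0: "0 < \<bar>s\<bar>" using False assms by linarith
  have "(2 * e)\<^sup>2 \<le> s\<^sup>2" using False assms by (subst abs_le_square_iff[symmetric]) simp
  then have "4 \<le> s\<^sup>2 / e\<^sup>2" using assms by (simp add: field_simps)
  then have q: "q > 0" "s\<^sup>2 / e\<^sup>2 \<le> 2 * q" by (auto simp: q_def)
  \<comment> \<open>Away from the threshold the relative defect is of order
    \<open>e\<^sup>2 / s\<^sup>2\<close>, so that multiplication with \<open>\<bar>s\<bar>\<close>
    leaves a multiple of \<open>e\<close>.\<close>
  have "1 - exp (- (1 / q)) \<le> 1 / q" using exp_ge_add_one_self[of "- (1/q)"] by linarith
  also have "... \<le> 2 / (s\<^sup>2 / e\<^sup>2)" using q assms s0 by (auto simp: field_simps)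
  finally have "1 - fe q \<le> 2 * e\<^sup>2 / s\<^sup>2" using q by (simp add: flat_exp_def)
  have "\<bar>trunc e s - s\<bar> = \<bar>s * (fe q - 1)\<bar>" by (simp add: trunc_def q_def algebra_simps)
  also have "... = \<bar>s\<bar> * (1 - fe q)" using fe_bounds(2)[of q] by (simp add: abs_mult)
  also have "... \<le> \<bar>s\<bar> * (2 * e\<^sup>2 / s\<^sup>2)" by (intro mult_left_mono) (use \<open>1 - fe q \<le> _\<close> in auto)
  also have "... = 2 * e\<^sup>2 / \<bar>s\<bar>" using s0
    by (subst power2_abs[of s, symmetric]) (simp add: power2_eq_square field_simps)
  also have "... \<le> 2 * e" using False assms s0 by (simp add: field_simps power2_eq_square)
  finally show ?thesis .
qed

text \<open>The bound is \<open>1 + 6\<close>: the factor \<open>fe\<close> contributes at most 1,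
  and with \<open>u = 1 / q\<close> the other term is \<open>2 * (u + u\<^sup>2) / exp u\<close>, at
  most 6 by the quadratic Taylor bound. Its square is the factor 49 of the later energy
  estimates.\<close>

lemma DERIV_trunc:
  assumes "e > 0"
  shows "\<exists>D. (trunc e has_real_derivative D) (at s) \<and> \<bar>D\<bar> \<le> 7"
proof -
  define q where "q = s\<^sup>2 / e\<^sup>2 - 1"
  define F where "F = flat_exp ((1 - pderiv 1) * [:0,0,1:]) q"
  have F: "F = (if q > 0 then exp (- (1 / q)) / q\<^sup>2 else 0)"
    by (auto simp: F_def flat_exp_def power2_eq_square)
  have dq: "((\<lambda>s. s\<^sup>2 / e\<^sup>2 - 1) has_real_derivative 2 * s / e\<^sup>2) (at s)"
    using assms by (auto intro!: derivative_eq_intros simp: power2_eq_square)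
  have "(trunc e has_real_derivative (fe q + s * (F * (2 * s / e\<^sup>2)))) (at s)"
    unfolding trunc_def[abs_def] q_def F_def
    by (rule DERIV_cong[OF DERIV_mult[OF DERIV_ident DERIV_chain2[OF DERIV_flat_exp dq]]]) simp
  moreover have "\<bar>fe q + s * (F * (2 * s / e\<^sup>2))\<bar> \<le> 7"
  proof (cases "q > 0")
    case True
    define u where "u = 1 / q"
    have u: "u > 0" using True by (simp add: u_def)
    have ex: "1 + u + u\<^sup>2 / 2 \<le> exp u" using exp_lower_Taylor_quadratic[of u] u by simp
    have "s * (F * (2 * s / e\<^sup>2)) = 2 * (q + 1) * F" by (simp add: q_def power2_eq_square)
    also have "... = 2 * (u + u\<^sup>2) * exp (- u)" using True by (simp add: F u_def field_simps power2_eq_square)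
    also have "... = 2 * (u + u\<^sup>2) / exp u" by (simp add: exp_minus field_simps)
    finally have eq: "s * (F * (2 * s / e\<^sup>2)) = 2 * (u + u\<^sup>2) / exp u" .
    define v where "v = u\<^sup>2"
    have "0 \<le> v" by (simp add: v_def)
    then have "2 * (u + u\<^sup>2) \<le> 6 * exp u" using ex u unfolding v_def[symmetric] by (smt (verit) field_sum_of_halves)
    then have "2 * (u + u\<^sup>2) / exp u \<le> 6" by (simp add: field_simps)
    moreover have "0 \<le> 2 * (u + u\<^sup>2) / exp u" using u by simp
    ultimately show ?thesis using fe_bounds(1,2)[of q] unfolding eq by linarith
  next
    case False
    then show ?thesis by (simp add: F flat_exp_def)
  qed
  ultimately show ?thesis by blast
qed

lemma norm_grad_trunc:
  assumes "e > 0" "smooth f"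
  shows "norm (grad (\<lambda>x. trunc e (f x)) x) \<le> 7 * norm (grad f x)"
proof -
  obtain D where D: "(trunc e has_real_derivative D) (at (f x))" "\<bar>D\<bar> \<le> 7"
    using DERIV_trunc[OF assms(1)] by blast
  have "((\<lambda>x. trunc e (f x)) has_derivative (\<lambda>h. D * (grad f x \<bullet> h))) (at x)"
    using has_derivative_compose[OF has_derivative_grad[OF smooth_differentiable[OF assms(2)]] D(1)[unfolded has_field_derivative_def]] .
  then have "grad (\<lambda>x. trunc e (f x)) x = D *\<^sub>R grad f x" by (intro grad_eqI) simp
  then show ?thesis using D(2) by (simp add: mult_right_mono)
qed

section \<open>Integration\<close>

lemmas LINT_add = Bochner_Integration.integral_add
lemmas LINT_diff = Bochner_Integration.integral_diff
lemmas LINT_sum = Bochner_Integration.integral_sum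
lemmas LINT_cong = Bochner_Integration.integral_cong

text \<open>Translations, dilations and product measures are handled with \<open>lborel\<close>,
  whereas the statement speaks of Lebesgue measure restricted to a set; this is the passage between
  the two.\<close>

lemma lebesgue_on_eq_lborel:
  fixes f :: "'a::euclidean_space \<Rightarrow> real"
  assumes "S \<in> sets borel" "f \<in> borel_measurable borel"
  shows "integral\<^sup>L (lebesgue_on S) f = (LINT x|lborel. indicator S x * f x)"
    and "integrable (lebesgue_on S) f \<longleftrightarrow> integrable lborel (\<lambda>x. indicator S x * f x)"
proof -
  have S: "S \<inter> space lebesgue \<in> sets lebesgue" using assms(1) by simp
  have m: "(\<lambda>x. indicator S x * f x) \<in> borel_measurable lborel" using assms by measurable
  show "integral\<^sup>L (lebesgue_on S) f = (LINT x|lborel. indicator S x * f x)"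
    using integral_restrict_space[OF S, of f] integral_completion[OF m] by simp
  show "integrable (lebesgue_on S) f \<longleftrightarrow> integrable lborel (\<lambda>x. indicator S x * f x)"
    using integrable_restrict_space[OF S, of f] integrable_completion[OF m] by simp
qed

section \<open>Integrals over bounded sets and integration by parts\<close>

lemma integrable_bounded_on:
  fixes f :: "'a::euclidean_space \<Rightarrow> 'b::euclidean_space"
  assumes "S \<in> lmeasurable" "f \<in> borel_measurable (lebesgue_on S)" "\<And>x. x \<in> S \<Longrightarrow> norm (f x) \<le> B"
  shows "integrable (lebesgue_on S) f"
proof -
  interpret finite_measure "lebesgue_on S" by (rule finite_measure_lebesgue_on[OF assms(1)])
  show ?thesis by (rule integrable_const_bound[OF AE_I2 assms(2)]) (use assms(3) in simp)
qed

lemma continuous_measurable_lebesgue_on: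
  fixes f :: "'a::euclidean_space \<Rightarrow> 'b::euclidean_space"
  assumes "continuous_on UNIV f" "S \<in> sets lebesgue"
  shows "f \<in> borel_measurable (lebesgue_on S)"
  by (rule continuous_imp_measurable_on_sets_lebesgue[OF continuous_on_subset[OF assms(1)] assms(2)]) simp

lemma continuous_bounded_on:
  fixes f :: "'a::euclidean_space \<Rightarrow> 'b::euclidean_space"
  assumes "continuous_on UNIV f" "bounded S"
  obtains B where "B > 0" "\<And>x. x \<in> S \<Longrightarrow> norm (f x) \<le> B"
proof -
  have "compact (f ` closure S)"
    by (rule compact_continuous_image[OF continuous_on_subset[OF assms(1)]]) (use assms(2) in "simp_all add: compact_closure")
  then have "bounded (f ` closure S)" by (rule compact_imp_bounded)
  then obtain B where B: "B > 0" "\<And>y. y \<in> f ` closure S \<Longrightarrow> norm y \<le> B" using bounded_pos by metis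
  show ?thesis by (rule that[OF B(1)]) (use B(2) closure_subset[of S] in blast)
qed

lemma bounded_borel_lmeasurable: "bounded S \<Longrightarrow> S \<in> sets borel \<Longrightarrow> S \<in> lmeasurable"
  by (rule bounded_set_imp_lmeasurable) simp_all

lemma integrable_continuous_bounded:
  fixes f :: "'a::euclidean_space \<Rightarrow> 'b::euclidean_space"
  assumes "continuous_on UNIV f" "S \<in> lmeasurable" "bounded S"
  shows "integrable (lebesgue_on S) f"
proof -
  obtain B where "\<And>x. x \<in> S \<Longrightarrow> norm (f x) \<le> B" using continuous_bounded_on[OF assms(1,3)] by metis
  then show ?thesis
    using integrable_bounded_on[OF assms(2) continuous_measurable_lebesgue_on[OF assms(1)]] assms(2)
    by (metis fmeasurableD)
qed

lemma DERIV_integral: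
  fixes F :: "real \<Rightarrow> 'a \<Rightarrow> real"
  assumes "finite_measure M" and "0 < d"
    and der: "\<And>x. x \<in> space M \<Longrightarrow> ((\<lambda>s. F s x) has_real_derivative F' x) (at s0)"
    and lip: "\<And>s x. x \<in> space M \<Longrightarrow> \<bar>s - s0\<bar> < d \<Longrightarrow> \<bar>F s x - F s0 x\<bar> \<le> B * \<bar>s - s0\<bar>"
    and int: "\<And>s. integrable M (F s)" and F': "F' \<in> borel_measurable M"
  shows "((\<lambda>s. integral\<^sup>L M (F s)) has_real_derivative integral\<^sup>L M F') (at s0)"
  unfolding has_field_derivative_iff tendsto_at_iff_sequentially
proof (intro allI impI)
  interpret finite_measure M by fact
  fix X assume X: "\<forall>i. X i \<in> UNIV - {s0}" "X \<longlonglongrightarrow> s0"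
  obtain N where N: "\<And>i. N \<le> i \<Longrightarrow> \<bar>X i - s0\<bar> < d" using LIMSEQ_D[OF X(2) \<open>0 < d\<close>] by auto
  let ?q = "\<lambda>i x. (F (X (i + N)) x - F s0 x) / (X (i + N) - s0)"
  have "(\<lambda>i. integral\<^sup>L M (?q i)) \<longlonglongrightarrow> integral\<^sup>L M F'"
  proof (rule integral_dominated_convergence[where w="\<lambda>_. B"])
    have [measurable]: "F s \<in> borel_measurable M" for s using int by (rule borel_measurable_integrable)
    show "?q i \<in> borel_measurable M" for i by measurable
    show "AE x in M. (\<lambda>i. ?q i x) \<longlonglongrightarrow> F' x"
    proof (rule AE_I2)
      fix x assume x: "x \<in> space M"
      have l: "(\<lambda>i. (F (X i) x - F s0 x) / (X i - s0)) \<longlonglongrightarrow> F' x"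
        using der[OF x] X unfolding has_field_derivative_iff tendsto_at_iff_sequentially comp_def by blast
      show "(\<lambda>i. ?q i x) \<longlonglongrightarrow> F' x" using LIMSEQ_ignore_initial_segment[OF l, of N] .
    qed
    show "AE x in M. norm (?q i x) \<le> B" for i
      by (rule AE_I2) (use lip[OF _ N[of "i + N"]] X(1) in "simp add: pos_divide_le_eq")
  qed (use F' in simp_all)
  moreover have "integral\<^sup>L M (?q i)
      = ((\<lambda>s. (integral\<^sup>L M (F s) - integral\<^sup>L M (F s0)) / (s - s0)) \<circ> X) (i + N)" for i
    using int by (simp add: LINT_diff)
  ultimately have "(\<lambda>i. ((\<lambda>s. (integral\<^sup>L M (F s) - integral\<^sup>L M (F s0)) / (s - s0)) \<circ> X) (i + N))
      \<longlonglongrightarrow> integral\<^sup>L M F'"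
    by (simp only:)
  then show "((\<lambda>s. (integral\<^sup>L M (F s) - integral\<^sup>L M (F s0)) / (s - s0)) \<circ> X) \<longlonglongrightarrow> integral\<^sup>L M F'"
    by (rule LIMSEQ_offset)
qed

lemma smooth_compact_lipschitz:
  assumes "smooth f" "bounded {x. f x \<noteq> 0}"
  obtains B where "B > 0" "\<And>x. norm (grad f x) \<le> B" "\<And>x y. \<bar>f x - f y\<bar> \<le> B * norm (x - y)"
proof -
  obtain B where B: "B > 0" "\<And>x. x \<in> closure {x. f x \<noteq> 0} \<Longrightarrow> norm (grad f x) \<le> B"
    using continuous_bounded_on[OF continuous_on_grad[OF assms(1)], of "closure {x. f x \<noteq> 0}"]
      bounded_closure[OF assms(2)] by metis
  have B': "norm (grad f x) \<le> B" for x
    using B(2)[of x] grad_eq_0_outside[of x f] B(1) by (cases "x \<in> closure {x. f x \<noteq> 0}") auto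
  have "norm (f x - f y) \<le> B * norm (x - y)" for x y
  proof (rule differentiable_bound[of UNIV f "\<lambda>x h. grad f x \<bullet> h"])
    show "(f has_derivative (\<bullet>) (grad f x)) (at x within UNIV)" for x
      using has_derivative_grad[OF smooth_differentiable[OF assms(1)]] by simp
    show "onorm ((\<bullet>) (grad f x)) \<le> B" for x
    proof (rule onorm_le)
      fix h show "norm (grad f x \<bullet> h) \<le> B * norm h"
        using Cauchy_Schwarz_ineq2[of "grad f x" h] mult_right_mono[OF B'[of x] norm_ge_zero[of h]] by simp
    qed
  qed simp_all
  then show ?thesis using that[OF B(1) B'] by simp
qed

text \<open>By translation invariance the integral of \<open>f (s *\<^sub>R b + x)\<close> does not
  depend on \<open>s\<close>; its derivative at zero is the integral of
  \<open>pd f b\<close>.\<close>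

lemma integral_pd_eq_0:
  fixes f :: "'a::euclidean_space \<Rightarrow> real"
  assumes f: "smooth f" "bounded {x. f x \<noteq> 0}" and b: "b \<in> Basis"
    and S: "bounded S" "S \<in> sets borel" "closure {x. f x \<noteq> 0} \<subseteq> S"
  shows "integral\<^sup>L (lebesgue_on S) (pd f b) = 0"
proof -
  obtain R where R: "R > 0" "{x. f x \<noteq> 0} \<subseteq> ball 0 R" "S \<subseteq> ball 0 R"
  proof -
    have "bounded ({x. f x \<noteq> 0} \<union> S)" using f(2) S(1) by simp
    then obtain R where "R > 0" "{x. f x \<noteq> 0} \<union> S \<subseteq> ball 0 R" using bounded_subset_ballD by blast
    then show ?thesis using that by simp
  qed
  \<comment> \<open>The radius exceeds that of the support by 1, so that all translates with
    \<open>\<bar>s\<bar> < 1\<close> remain supported in \<open>K\<close>.\<close>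
  define K where "K = cball (0::'a) (R + 1)"
  have K: "K \<in> lmeasurable" "bounded K" "K \<in> sets borel" by (simp_all add: K_def)
  obtain B where B: "B > 0" "\<And>x y. \<bar>f x - f y\<bar> \<le> B * norm (x - y)"
    using smooth_compact_lipschitz[OF f] by metis
  have cf: "continuous_on UNIV f" by (rule smooth_continuous[OF f(1)])
  have fb: "f \<in> borel_measurable borel" by (rule borel_measurable_continuous_onI[OF cf])
  have pdb: "pd f b \<in> borel_measurable borel"
    by (rule borel_measurable_continuous_onI[OF smooth_continuous[OF smooth_pd[OF f(1) b]]])
  have cs: "continuous_on UNIV (\<lambda>x. f (s *\<^sub>R b + x))" for s
    by (rule continuous_on_compose2[OF cf]) (auto intro!: continuous_intros)
  have const: "integral\<^sup>L (lebesgue_on K) (\<lambda>x. f (s *\<^sub>R b + x)) = integral\<^sup>L lborel f" if "\<bar>s - 0\<bar> < 1" for s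
  proof -
    have "indicator K x * f (s *\<^sub>R b + x) = f (s *\<^sub>R b + x)" for x
    proof (cases "x \<in> K")
      case False
      then have "norm x > R + 1" by (simp add: K_def)
      moreover have "norm (s *\<^sub>R b) < 1" using that b by simp
      ultimately have "norm (s *\<^sub>R b + x) > R" using norm_triangle_ineq4[of "s *\<^sub>R b + x" "s *\<^sub>R b"] by simp
      then have "s *\<^sub>R b + x \<notin> ball 0 R" by simp
      then have "f (s *\<^sub>R b + x) = 0" using R(2) by blast
      then show ?thesis by simp
    qed simp
    then have "(\<lambda>x. indicator K x * f (s *\<^sub>R b + x)) = (\<lambda>x. f (s *\<^sub>R b + x))" by (intro ext)
    then have "integral\<^sup>L (lebesgue_on K) (\<lambda>x. f (s *\<^sub>R b + x)) = (LINT x|lborel. f (s *\<^sub>R b + x))"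
      using lebesgue_on_eq_lborel(1)[OF K(3) borel_measurable_continuous_onI[OF cs[of s]]] by (simp only:)
    also have "... = (LINT x|distr lborel borel ((+) (s *\<^sub>R b)). f x)"
      by (rule integral_distr[symmetric]) (use fb in simp_all)
    finally show ?thesis by (simp add: lborel_distr_plus)
  qed
  have D: "((\<lambda>s. integral\<^sup>L (lebesgue_on K) (\<lambda>x. f (s *\<^sub>R b + x))) has_real_derivative
      integral\<^sup>L (lebesgue_on K) (pd f b)) (at 0)"
  proof (rule DERIV_integral[where d=1 and B=B])
    show "finite_measure (lebesgue_on K)" by (rule finite_measure_lebesgue_on[OF K(1)])
    show "((\<lambda>s. f (s *\<^sub>R b + x)) has_real_derivative pd f b x) (at 0)" for x
    proof -
      have 1: "((\<lambda>s. s *\<^sub>R b + x) has_derivative (\<lambda>s. s *\<^sub>R b)) (at 0)"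
        by (auto intro!: derivative_eq_intros)
      have 2: "(f has_derivative (\<lambda>h. grad f x \<bullet> h)) (at (0 *\<^sub>R b + x))"
        using has_derivative_grad[OF smooth_differentiable[OF f(1)], of x] by simp
      have "((\<lambda>s. f (s *\<^sub>R b + x)) has_derivative (\<lambda>s. grad f x \<bullet> (s *\<^sub>R b))) (at 0)"
        by (rule has_derivative_compose[OF 1 2])
      moreover have "(\<lambda>s. grad f x \<bullet> (s *\<^sub>R b)) = (*) (pd f b x)"
        by (simp add: fun_eq_iff grad_inner_Basis[OF b])
      ultimately show ?thesis by (simp add: has_field_derivative_def)
    qed
    show "\<bar>f (s *\<^sub>R b + x) - f (0 *\<^sub>R b + x)\<bar> \<le> B * \<bar>s - 0\<bar>" for s x
      using B(2)[of "s *\<^sub>R b + x" x] b by simp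
    show "integrable (lebesgue_on K) (\<lambda>x. f (s *\<^sub>R b + x))" for s
      by (rule integrable_continuous_bounded[OF cs K(1,2)])
    show "pd f b \<in> borel_measurable (lebesgue_on K)"
      by (rule continuous_measurable_lebesgue_on[OF smooth_continuous[OF smooth_pd[OF f(1) b]]]) (use K in auto)
  qed simp
  moreover have "((\<lambda>s. integral\<^sup>L (lebesgue_on K) (\<lambda>x. f (s *\<^sub>R b + x))) has_real_derivative 0) (at 0)"
  proof (rule has_field_derivative_transform_within_open[where S="ball 0 1"])
    show "((\<lambda>s. integral\<^sup>L lborel f) has_real_derivative 0) (at 0)" by simp
    show "integral\<^sup>L lborel f = integral\<^sup>L (lebesgue_on K) (\<lambda>x. f (s *\<^sub>R b + x))" if "s \<in> ball 0 1" for s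
      using const[of s] that by (simp add: dist_real_def)
  qed simp_all
  ultimately have z: "integral\<^sup>L (lebesgue_on K) (pd f b) = 0" by (rule DERIV_unique)
  have out: "pd f b x = 0" if "x \<notin> closure {x. f x \<noteq> 0}" for x
    using grad_eq_0_outside[OF that] grad_inner_Basis[OF b, of f x] by simp
  have "indicator S x * pd f b x = indicator K x * pd f b x" for x
  proof (cases "x \<in> S")
    case True
    then have "x \<in> K" using R(3) by (auto simp: K_def)
    then show ?thesis using True by simp
  next
    case False
    then have "pd f b x = 0" using out S(3) by blast
    then show ?thesis by simp
  qed
  then have "(\<lambda>x. indicator S x * pd f b x) = (\<lambda>x. indicator K x * pd f b x)" by (intro ext)
  then show ?thesis
    using z lebesgue_on_eq_lborel(1)[OF S(2) pdb] lebesgue_on_eq_lborel(1)[OF K(3) pdb] by (simp only:)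
qed

lemma test_function_closure: "test_function \<Omega> \<phi> \<Longrightarrow> closure {x. \<phi> x \<noteq> 0} \<subseteq> \<Omega>"
  by (simp add: test_function_smooth)

lemma test_function_bounded: "test_function \<Omega> \<phi> \<Longrightarrow> bounded {x. \<phi> x \<noteq> 0}"
  by (simp add: test_function_smooth compact_closure)

lemma integral_by_parts:
  fixes f :: "'a::euclidean_space \<Rightarrow> real"
  assumes f: "test_function \<Omega> f" and g: "smooth g" and b: "b \<in> Basis"
    and S: "bounded \<Omega>" "\<Omega> \<in> sets borel"
  shows "(LINT x|lebesgue_on \<Omega>. f x * pd g b x) = - (LINT x|lebesgue_on \<Omega>. pd f b x * g x)"
proof -
  have sf: "smooth f" using f by (simp add: test_function_smooth)
  have L: "\<Omega> \<in> lmeasurable" by (rule bounded_borel_lmeasurable[OF S])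
  have i: "integrable (lebesgue_on \<Omega>) h" if "smooth h" for h :: "'a \<Rightarrow> real"
    by (rule integrable_continuous_bounded[OF smooth_continuous[OF that] L S(1)])
  have t: "test_function \<Omega> (\<lambda>x. f x * g x)" by (rule test_function_mult[OF f g])
  have "0 = (LINT x|lebesgue_on \<Omega>. pd (\<lambda>x. f x * g x) b x)"
    using integral_pd_eq_0[OF _ test_function_bounded[OF t] b S test_function_closure[OF t]] t
    by (simp add: test_function_smooth)
  also have "... = (LINT x|lebesgue_on \<Omega>. f x * pd g b x + pd f b x * g x)"
    by (rule arg_cong[where f="integral\<^sup>L _"])
      (simp add: fun_eq_iff grad_inner_Basis[OF b, symmetric] grad_mult[OF sf g] inner_add_left mult.commute)
  also have "... = (LINT x|lebesgue_on \<Omega>. f x * pd g b x) + (LINT x|lebesgue_on \<Omega>. pd f b x * g x)"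
    by (intro LINT_add i smooth_mult sf g smooth_pd b)
  finally show ?thesis by simp
qed

text \<open>The coordinate \<open>x \<bullet> b\<close> has derivative 1 in direction
  \<open>b\<close> and is bounded by \<open>R\<close> on the domain. Integration by parts against it
  turns the square of \<phi> into \<phi> times its derivative.\<close>

lemma poincare_test_function:
  fixes \<Omega> :: "'a::euclidean_space set"
  assumes "bounded \<Omega>" "\<Omega> \<in> sets borel"
  obtains C where "C > 0" "\<And>\<phi>. test_function \<Omega> \<phi> \<Longrightarrow>
    (LINT x|lebesgue_on \<Omega>. (\<phi> x)\<^sup>2) \<le> C * (LINT x|lebesgue_on \<Omega>. (norm (grad \<phi> x))\<^sup>2)"
proof -
  obtain b :: 'a where b: "b \<in> Basis" using nonempty_Basis by blast
  obtain R where R: "R > 0" "\<And>x. x \<in> \<Omega> \<Longrightarrow> norm x \<le> R" using assms(1) bounded_pos by metis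
  have L: "\<Omega> \<in> lmeasurable" by (rule bounded_borel_lmeasurable[OF assms])
  show ?thesis
  proof (rule that[of "4 * R\<^sup>2"])
    fix \<phi> assume t: "test_function \<Omega> \<phi>"
    then have s: "smooth \<phi>" by (simp add: test_function_smooth)
    let ?I = "\<lambda>f. LINT x|lebesgue_on \<Omega>. f x"
    have i: "integrable (lebesgue_on \<Omega>) h" if "continuous_on UNIV h" for h :: "'a \<Rightarrow> real"
      by (rule integrable_continuous_bounded[OF that L assms(1)])
    have cs: "continuous_on UNIV \<phi>" "continuous_on UNIV (grad \<phi>)" "continuous_on UNIV (pd \<phi> b)"
      by (intro smooth_continuous continuous_on_grad smooth_pd s b)+
    have "(\<lambda>x. x \<bullet> b) = (\<lambda>x. 0 + x \<bullet> b)" by simp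
    then have sb: "smooth (\<lambda>x. x \<bullet> b)" using smooth_affine[of 0 b] by simp
    have gb: "pd (\<lambda>x. x \<bullet> b) b x = 1" for x
      using pd_eqI[of "\<lambda>x. x \<bullet> b" "\<lambda>x. x \<bullet> b" x b] b by (simp add: bounded_linear_imp_has_derivative bounded_linear_inner_left)
    have t2: "test_function \<Omega> (\<lambda>x. \<phi> x * \<phi> x)" by (rule test_function_mult[OF t s])
    have p2: "pd (\<lambda>x. \<phi> x * \<phi> x) b x = 2 * \<phi> x * pd \<phi> b x" for x
      by (simp add: grad_inner_Basis[OF b, symmetric] grad_mult[OF s s] inner_add_left)
    have "?I (\<lambda>x. (\<phi> x)\<^sup>2) = ?I (\<lambda>x. - (2 * \<phi> x * pd \<phi> b x) * (x \<bullet> b))"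
      using integral_by_parts[OF t2 sb b assms] by (simp add: gb p2 power2_eq_square)
    also have "... \<le> ?I (\<lambda>x. (\<phi> x)\<^sup>2 / 2 + 2 * R\<^sup>2 * (norm (grad \<phi> x))\<^sup>2)"
    proof (rule integral_mono)
      fix x assume "x \<in> space (lebesgue_on \<Omega>)"
      then have x: "norm x \<le> R" using R by simp
      have 1: "\<bar>x \<bullet> b\<bar> \<le> R" using Basis_le_norm[OF b, of x] x by simp
      have 2: "\<bar>pd \<phi> b x\<bar> \<le> norm (grad \<phi> x)" using Basis_le_norm[OF b, of "grad \<phi> x"] grad_inner_Basis[OF b] by metis
      have "- (2 * \<phi> x * pd \<phi> b x) * (x \<bullet> b) \<le> \<bar>2 * \<phi> x * pd \<phi> b x * (x \<bullet> b)\<bar>" by simp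
      also have "... = 2 * \<bar>\<phi> x\<bar> * (\<bar>pd \<phi> b x\<bar> * \<bar>x \<bullet> b\<bar>)" by (simp add: abs_mult)
      also have "... \<le> 2 * \<bar>\<phi> x\<bar> * (norm (grad \<phi> x) * R)"
        by (intro mult_left_mono mult_mono 1 2) simp_all
      \<comment> \<open>Young's inequality, weighted such that half of the left-hand side can be
        absorbed; this produces the constant \<open>4 * R\<^sup>2\<close>.\<close>
      also have "... \<le> (\<phi> x)\<^sup>2 / 2 + 2 * R\<^sup>2 * (norm (grad \<phi> x))\<^sup>2"
        using zero_le_power2[of "\<bar>\<phi> x\<bar> / 2 - norm (grad \<phi> x) * R"]
        by (simp add: power2_diff power_mult_distrib power_divide mult_ac)
      finally show "- (2 * \<phi> x * pd \<phi> b x) * (x \<bullet> b) \<le> (\<phi> x)\<^sup>2 / 2 + 2 * R\<^sup>2 * (norm (grad \<phi> x))\<^sup>2" .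
    next
      show "integrable (lebesgue_on \<Omega>) (\<lambda>x. - (2 * \<phi> x * pd \<phi> b x) * (x \<bullet> b))"
        by (intro i continuous_intros cs)
      show "integrable (lebesgue_on \<Omega>) (\<lambda>x. (\<phi> x)\<^sup>2 / 2 + 2 * R\<^sup>2 * (norm (grad \<phi> x))\<^sup>2)"
        by (intro i continuous_intros cs) simp_all
    qed
    also have "?I (\<lambda>x. (\<phi> x)\<^sup>2 / 2 + 2 * R\<^sup>2 * (norm (grad \<phi> x))\<^sup>2)
        = ?I (\<lambda>x. (\<phi> x)\<^sup>2) / 2 + 2 * R\<^sup>2 * ?I (\<lambda>x. (norm (grad \<phi> x))\<^sup>2)"
    proof -
      have "?I (\<lambda>x. (\<phi> x)\<^sup>2 / 2 + 2 * R\<^sup>2 * (norm (grad \<phi> x))\<^sup>2)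
        = ?I (\<lambda>x. (\<phi> x)\<^sup>2 / 2) + ?I (\<lambda>x. 2 * R\<^sup>2 * (norm (grad \<phi> x))\<^sup>2)"
        by (intro LINT_add i continuous_intros cs) simp_all
      then show "?I (\<lambda>x. (\<phi> x)\<^sup>2 / 2 + 2 * R\<^sup>2 * (norm (grad \<phi> x))\<^sup>2)
        = ?I (\<lambda>x. (\<phi> x)\<^sup>2) / 2 + 2 * R\<^sup>2 * ?I (\<lambda>x. (norm (grad \<phi> x))\<^sup>2)" by simp
    qed
    finally show "?I (\<lambda>x. (\<phi> x)\<^sup>2) \<le> 4 * R\<^sup>2 * ?I (\<lambda>x. (norm (grad \<phi> x))\<^sup>2)" by simp
  qed (use R in simp)
qed

text \<open>An open set is a countable union of open boxes whose closed boxes it contains. The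
  product of the \<open>1 - box_bump\<close> over the first \<open>j\<close> boxes, each with
  steepness \<open>j\<close>, is a smooth version of the complement of their union.\<close>

lemma test_function_approx_open:
  fixes U :: "'a::euclidean_space set"
  assumes "open U" "U \<subseteq> \<Omega>"
  obtains \<phi> where "\<And>j::nat. test_function \<Omega> (\<phi> j)" "\<And>j x. 0 \<le> \<phi> j x \<and> \<phi> j x \<le> 1"
    "\<And>x. (\<lambda>j. \<phi> j x) \<longlonglongrightarrow> indicator U x"
proof -
  have ex: "\<exists>a c. x \<in> box a c \<and> cbox a c \<subseteq> U" if "x \<in> U" for x
    using open_contains_cbox[of U] assms(1) that by (metis box_subset_cbox subsetD interior_cbox mem_Collect_eq)
  define \<B> where "\<B> = {box a c |a c. cbox a c \<subseteq> U}"
  have o: "open S" if "S \<in> \<B>" for S using that by (auto simp: \<B>_def)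
  obtain \<D> where D0: "\<D> \<subseteq> \<B>" "countable \<D>" "\<Union>\<D> = \<Union>\<B>"
    using Lindelof[of \<B>, OF o] by metis
  have "\<Union>\<B> \<subseteq> U" unfolding \<B>_def using box_subset_cbox by fast
  moreover have "U \<subseteq> \<Union>\<B>" unfolding \<B>_def using ex by blast
  ultimately have D: "\<D> \<subseteq> {box a c |a c. cbox a c \<subseteq> U}" "countable \<D>" "\<Union>\<D> = U"
    using D0 unfolding \<B>_def by simp_all
  \<comment> \<open>The additional empty set makes the enumeration total even if no box occurs; it
    is itself a box with empty closed box.\<close>
  define e where "e = from_nat_into (insert {} \<D>)"
  have re: "range e = insert {} \<D>" unfolding e_def using D(2) by (intro range_from_nat_into) simp_all
  have "\<exists>a c. e i = box a c \<and> cbox a c \<subseteq> U" for i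
  proof -
    have "e i \<in> insert {} \<D>" using re by blast
    moreover have "\<exists>a c::'a. {} = box a c \<and> cbox a c \<subseteq> U"
    proof -
      obtain b :: 'a where "b \<in> Basis" using nonempty_Basis by blast
      then have "box One (0::'a) = {}" "cbox One (0::'a) = {}"
        by (auto simp: box_eq_empty intro!: bexI[of _ b])
      then show ?thesis by (intro exI[of _ One] exI[of _ 0]) simp
    qed
    ultimately show ?thesis using D(1) by blast
  qed
  then obtain a c where ac: "\<And>i. e i = box (a i) (c i)" "\<And>i. cbox (a i) (c i) \<subseteq> U" by metis
  define \<phi> where "\<phi> j x = 1 - (\<Prod>i<j. 1 - box_bump (real j) (a i) (c i) x)" for j x
  have bb: "0 \<le> 1 - box_bump m a' c' x" "1 - box_bump m a' c' x \<le> 1" for m a' c' and x :: 'a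
    using box_bump_bounds[of m a' c' x] by simp_all
  have pb: "0 \<le> (\<Prod>i<j. 1 - box_bump (real j) (a i) (c i) x)" "(\<Prod>i<j. 1 - box_bump (real j) (a i) (c i) x) \<le> 1" for j x
    by (intro prod_nonneg bb ballI) (intro prod_le_1 conjI bb)
  have nz: "\<exists>i<j. x \<in> box (a i) (c i)" if nzx: "\<phi> j x \<noteq> 0" for j x
  proof (rule ccontr)
    assume n: "\<not> ?thesis"
    have "box_bump (real j) (a i) (c i) x = 0" if "i < j" for i
      using n box_bump_nonzero[of "real j" "a i" "c i" x] that by auto
    then have "\<phi> j x = 0" by (simp add: \<phi>_def)
    then show False using nzx by simp
  qed
  show ?thesis
  proof (rule that[of \<phi>])
    show "test_function \<Omega> (\<phi> j)" for j
    proof (rule test_functionI[where K="\<Union>i<j. cbox (a i) (c i)"])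
      show "smooth (\<phi> j)" unfolding \<phi>_def[abs_def] by (intro smooth_diff smooth_const smooth_prod smooth_box_bump)
      show "compact (\<Union>i<j. cbox (a i) (c i))" by (intro compact_UN finite_lessThan compact_cbox)
      show "(\<Union>i<j. cbox (a i) (c i)) \<subseteq> \<Omega>" using ac(2) assms(2) by blast
      show "x \<in> (\<Union>i<j. cbox (a i) (c i))" if "\<phi> j x \<noteq> 0" for x
        using nz[OF that] box_subset_cbox by fast
    qed
    show "0 \<le> \<phi> j x \<and> \<phi> j x \<le> 1" for j x using pb[of j x] by (simp add: \<phi>_def)
    show "(\<lambda>j. \<phi> j x) \<longlonglongrightarrow> indicator U x" for x
    proof (cases "x \<in> U")
      case True
      then obtain k where k: "x \<in> box (a k) (c k)" using D(3) re ac(1) by (metis UnionE insertI2 rangeE)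
      have "(\<lambda>j. \<Prod>i<j. 1 - box_bump (real j) (a i) (c i) x) \<longlonglongrightarrow> 0"
      proof (rule tendsto_sandwich[OF _ _ tendsto_const])
        show "(\<lambda>j. 1 - box_bump (real j) (a k) (c k) x) \<longlonglongrightarrow> 0"
          using tendsto_diff[OF tendsto_const[of 1] box_bump_tendsto[OF k]] by simp
        show "\<forall>\<^sub>F j in sequentially. (\<Prod>i<j. 1 - box_bump (real j) (a i) (c i) x) \<le> 1 - box_bump (real j) (a k) (c k) x"
          using eventually_gt_at_top[of k]
        proof eventually_elim
          case (elim j)
          have "(\<Prod>i<j. 1 - box_bump (real j) (a i) (c i) x)
              = (1 - box_bump (real j) (a k) (c k) x) * (\<Prod>i\<in>{..<j} - {k}. 1 - box_bump (real j) (a i) (c i) x)"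
            using elim by (intro prod.remove) simp_all
          also have "... \<le> (1 - box_bump (real j) (a k) (c k) x) * 1"
            by (intro mult_left_mono prod_le_1 conjI bb)
          finally show ?case by simp
        qed
      qed (use pb in simp)
      then have "(\<lambda>j. \<phi> j x) \<longlonglongrightarrow> 1 - 0" unfolding \<phi>_def by (intro tendsto_diff tendsto_const)
      then show ?thesis using True by simp
    next
      case False
      have "\<phi> j x = 0" for j using nz[of j x] ac(2) box_subset_cbox False by (meson subsetD)
      then show ?thesis using False by simp
    qed
  qed
qed

text \<open>The set where \<open>f\<close> is positive is approximated from inside by closed sets, whose indicators are in turn
  limits of test functions.\<close>

lemma fundamental_lemma_le:
  fixes f :: "'a::euclidean_space \<Rightarrow> real"
  assumes \<Omega>: "open \<Omega>" and f: "integrable (lebesgue_on \<Omega>) f"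
    and orth: "\<And>\<phi>. test_function \<Omega> \<phi> \<Longrightarrow> (LINT x|lebesgue_on \<Omega>. f x * \<phi> x) = 0"
  shows "AE x in lebesgue_on \<Omega>. f x \<le> 0"
proof -
  have \<Omega>L: "\<Omega> \<in> sets lebesgue" using \<Omega> by simp
  have U0: "(LINT x|lebesgue_on \<Omega>. f x * indicator U x) = 0" if U: "open U" "U \<subseteq> \<Omega>" for U
  proof -
    obtain \<phi> where p: "\<And>j::nat. test_function \<Omega> (\<phi> j)" "\<And>j x. 0 \<le> \<phi> j x \<and> \<phi> j x \<le> 1"
      "\<And>x. (\<lambda>j. \<phi> j x) \<longlonglongrightarrow> indicator U x" using test_function_approx_open[OF U] by metis
    have "(\<lambda>j. LINT x|lebesgue_on \<Omega>. f x * \<phi> j x) \<longlonglongrightarrow> (LINT x|lebesgue_on \<Omega>. f x * indicator U x)"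
    proof (rule integral_dominated_convergence[where w="\<lambda>x. \<bar>f x\<bar>"])
      have ph: "\<phi> j \<in> borel_measurable (lebesgue_on \<Omega>)" for j
        using p(1)[of j] by (intro continuous_measurable_lebesgue_on[OF smooth_continuous \<Omega>L]) (simp add: test_function_smooth)
      show "(\<lambda>x. f x * \<phi> j x) \<in> borel_measurable (lebesgue_on \<Omega>)" for j
        using ph[of j] borel_measurable_integrable[OF f] by measurable
      show "AE x in lebesgue_on \<Omega>. norm (f x * \<phi> j x) \<le> \<bar>f x\<bar>" for j
        using p(2) by (intro AE_I2) (simp add: abs_mult mult_left_le)
      show "AE x in lebesgue_on \<Omega>. (\<lambda>j. f x * \<phi> j x) \<longlonglongrightarrow> f x * indicator U x"
        by (intro AE_I2 tendsto_mult tendsto_const p(3))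
      have "U \<in> sets (lebesgue_on \<Omega>)" using U \<Omega>L by (auto simp: sets_restrict_space_iff)
      then show "(\<lambda>x. f x * indicator U x) \<in> borel_measurable (lebesgue_on \<Omega>)"
        using borel_measurable_integrable[OF f] by measurable
    qed (use f in simp)
    then show ?thesis using orth[OF p(1)] by (simp add: LIMSEQ_const_iff)
  qed
  have K0: "(LINT x|lebesgue_on \<Omega>. f x * indicator K x) = 0" if K: "closed K" "K \<subseteq> \<Omega>" for K
  proof -
    have m: "\<Omega> - K \<in> sets (lebesgue_on \<Omega>)" using K \<Omega>L by (auto simp: sets_restrict_space_iff)
    have "(LINT x|lebesgue_on \<Omega>. f x * indicator K x)
      = (LINT x|lebesgue_on \<Omega>. f x * indicator \<Omega> x - f x * indicator (\<Omega> - K) x)"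
      by (intro LINT_cong) (use K in "auto simp: indicator_def")
    also have "... = (LINT x|lebesgue_on \<Omega>. f x * indicator \<Omega> x) - (LINT x|lebesgue_on \<Omega>. f x * indicator (\<Omega> - K) x)"
    proof (rule LINT_diff)
      have "\<Omega> \<in> sets (lebesgue_on \<Omega>)" using \<Omega>L by (simp add: sets_restrict_space_iff)
      from integrable_mult_indicator[OF this f] show "integrable (lebesgue_on \<Omega>) (\<lambda>x. f x * indicator \<Omega> x)"
        by (simp add: mult.commute)
      from integrable_mult_indicator[OF m f] show "integrable (lebesgue_on \<Omega>) (\<lambda>x. f x * indicator (\<Omega> - K) x)"
        by (simp add: mult.commute)
    qed
    also have "... = 0" using U0[OF \<Omega>] U0[of "\<Omega> - K"] \<Omega> K by (simp add: open_Diff)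
    finally show ?thesis .
  qed
  define P where "P = {x \<in> \<Omega>. f x > 0}"
  have PL: "P \<in> sets lebesgue"
  proof -
    have "P = f -` {0<..} \<inter> space (lebesgue_on \<Omega>)" by (auto simp: P_def)
    also have "... \<in> sets (lebesgue_on \<Omega>)"
      by (rule measurable_sets[OF borel_measurable_integrable[OF f]]) simp
    finally show ?thesis using \<Omega>L by (simp add: sets_restrict_space_iff)
  qed
  \<comment> \<open>On \<open>K\<close> the function \<open>f\<close> is positive, yet its integral
    over \<open>K\<close> vanishes, so \<open>K\<close> can carry no measure.\<close>
  have null: "K \<in> null_sets lebesgue" if K: "closed K" "K \<subseteq> P" for K
  proof -
    have KO: "K \<subseteq> \<Omega>" using K by (auto simp: P_def)
    have Km: "K \<in> sets (lebesgue_on \<Omega>)" using K KO \<Omega>L by (auto simp: sets_restrict_space_iff)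
    have i: "integrable (lebesgue_on \<Omega>) (\<lambda>x. f x * indicator K x)"
      using integrable_mult_indicator[OF Km f] by (simp add: mult.commute)
    have "AE x in lebesgue_on \<Omega>. f x * indicator K x = 0"
    proof -
      have "AE x in lebesgue_on \<Omega>. 0 \<le> f x * indicator K x"
        by (rule AE_I2) (use K in "auto simp: P_def indicator_def")
      from integral_nonneg_eq_0_iff_AE[OF i this] show ?thesis using K0[OF K(1) KO] by blast
    qed
    then have "AE x in lebesgue. x \<in> \<Omega> \<longrightarrow> f x * indicator K x = 0"
      using \<Omega>L by (simp add: AE_restrict_space_iff)
    then have "AE x in lebesgue. x \<notin> K"
      by eventually_elim (use K in "auto simp: P_def indicator_def split: if_splits")
    then show ?thesis using K by (simp add: AE_iff_null_sets)
  qed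
  have le: "emeasure lebesgue P \<le> ennreal e" if e: "e > 0" for e
  proof -
    obtain T where T: "closed T" "T \<subseteq> P" "emeasure lebesgue (P - T) < ennreal e"
      using sets_lebesgue_inner_closed[OF PL e] by metis
    have "emeasure lebesgue P = emeasure lebesgue (P - T)"
      using emeasure_Diff_null_set[OF null[OF T(1,2)] PL] by simp
    then show ?thesis using T by simp
  qed
  have "emeasure lebesgue P \<le> 0"
  proof (rule ennreal_le_epsilon)
    show "emeasure lebesgue P \<le> 0 + ennreal e" if "0 < e" for e
      unfolding add_0 by (rule le[OF that])
  qed
  then have "emeasure lebesgue P = 0" by simp
  then have "P \<in> null_sets lebesgue" using PL by blast
  then have "AE x in lebesgue. x \<notin> P" by (simp add: AE_not_in)
  then show ?thesis using \<Omega>L unfolding P_def by (simp add: AE_restrict_space_iff not_less)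
qed

lemma fundamental_lemma:
  fixes f :: "'a::euclidean_space \<Rightarrow> real"
  assumes "open \<Omega>" "integrable (lebesgue_on \<Omega>) f"
    and orth: "\<And>\<phi>. test_function \<Omega> \<phi> \<Longrightarrow> (LINT x|lebesgue_on \<Omega>. f x * \<phi> x) = 0"
  shows "AE x in lebesgue_on \<Omega>. f x = 0"
proof -
  have "AE x in lebesgue_on \<Omega>. f x \<le> 0" by (rule fundamental_lemma_le[OF assms])
  moreover have "AE x in lebesgue_on \<Omega>. - f x \<le> 0"
    by (rule fundamental_lemma_le[OF assms(1)]) (use assms(2) orth in simp_all)
  ultimately show ?thesis by eventually_elim simp
qed

subsection \<open>Linear changes of variables\<close>

text \<open>Evaluate the integral of \<open>indicator (- B) x * indicator A (x + y)\<close> over both measures in both orders.\<close>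

lemma translation_invariant_unique:
  fixes M :: "'a::euclidean_space measure"
  assumes M: "sigma_finite_measure M" "sets M = sets borel"
    and inv: "\<And>c. distr M borel ((+) c) = M"
    and A: "A \<in> sets borel" and B: "B \<in> sets borel"
  shows "emeasure M A * emeasure lborel B = emeasure M (uminus -` B) * emeasure lborel A"
proof -
  interpret M: sigma_finite_measure M by fact
  interpret pair_sigma_finite M lborel ..
  have sp: "space M = UNIV" using sets_eq_imp_space_eq[OF M(2)] by simp
  have [measurable_cong]: "sets M = sets borel" by fact
  have B': "uminus -` B \<in> sets borel" using measurable_sets[of uminus borel borel B] B by simp
  note [measurable] = A B B'
  let ?f = "\<lambda>(x, y). indicator (uminus -` B) x * indicator A (x + y) :: ennreal"
  have tl: "(\<integral>\<^sup>+ y. g (c + y) \<partial>lborel) = (\<integral>\<^sup>+ y. g y \<partial>lborel)" if "g \<in> borel_measurable borel" for g :: "'a \<Rightarrow> ennreal" and c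
    using nn_integral_distr[of "(+) c" lborel borel g] that by (simp add: lborel_distr_plus)
  have tM: "(\<integral>\<^sup>+ y. g (c + y) \<partial>M) = (\<integral>\<^sup>+ y. g y \<partial>M)" if "g \<in> borel_measurable borel" for g :: "'a \<Rightarrow> ennreal" and c
    using nn_integral_distr[of "(+) c" M borel g] that by (simp add: inv)
  have "(\<integral>\<^sup>+ x. (\<integral>\<^sup>+ y. ?f (x, y) \<partial>lborel) \<partial>M) = (\<integral>\<^sup>+ x. indicator (uminus -` B) x * emeasure lborel A \<partial>M)"
  proof (rule nn_integral_cong)
    fix x
    have "(\<integral>\<^sup>+ y. ?f (x, y) \<partial>lborel) = indicator (uminus -` B) x * (\<integral>\<^sup>+ y. indicator A (x + y) \<partial>lborel)"
      by (simp add: nn_integral_cmult)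
    also have "(\<integral>\<^sup>+ y. indicator A (x + y) \<partial>lborel) = emeasure lborel A"
      using tl[of "indicator A" x] A by simp
    finally show "(\<integral>\<^sup>+ y. ?f (x, y) \<partial>lborel) = indicator (uminus -` B) x * emeasure lborel A" .
  qed
  also have "... = emeasure M (uminus -` B) * emeasure lborel A"
    using B' M(2) by (simp add: nn_integral_multc)
  finally have 1: "(\<integral>\<^sup>+ x. (\<integral>\<^sup>+ y. ?f (x, y) \<partial>lborel) \<partial>M) = emeasure M (uminus -` B) * emeasure lborel A" .
  have "(\<integral>\<^sup>+ x. (\<integral>\<^sup>+ y. ?f (x, y) \<partial>lborel) \<partial>M) = (\<integral>\<^sup>+ y. (\<integral>\<^sup>+ x. ?f (x, y) \<partial>M) \<partial>lborel)"
    by (rule Fubini[symmetric]) measurable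
  \<comment> \<open>Invariance of \<open>M\<close> allows the substitution of \<open>x - y\<close>
    for \<open>x\<close>, which moves the dependence on \<open>y\<close> from \<open>A\<close> to
    \<open>B\<close>.\<close>
  also have "... = (\<integral>\<^sup>+ y. (\<integral>\<^sup>+ x. indicator B (y - x) * indicator A x \<partial>M) \<partial>lborel)"
  proof (rule nn_integral_cong)
    fix y
    have "(\<lambda>x. ?f (- y + x, y)) = (\<lambda>x. indicator B (y - x) * indicator A x)"
      by (auto simp: fun_eq_iff indicator_def)
    then show "(\<integral>\<^sup>+ x. ?f (x, y) \<partial>M) = (\<integral>\<^sup>+ x. indicator B (y - x) * indicator A x \<partial>M)"
      using tM[of "\<lambda>x. ?f (x, y)" "- y"] by simp
  qed
  also have "... = (\<integral>\<^sup>+ x. (\<integral>\<^sup>+ y. indicator B (y - x) * indicator A x \<partial>lborel) \<partial>M)"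
    using Fubini[of "\<lambda>(x, y). indicator B (y - x) * indicator A x"] by simp
  also have "... = (\<integral>\<^sup>+ x. emeasure lborel B * indicator A x \<partial>M)"
  proof (rule nn_integral_cong)
    fix x
    have "(\<integral>\<^sup>+ y. indicator B (y - x) * indicator A x \<partial>lborel) = (\<integral>\<^sup>+ y. indicator B (y - x) \<partial>lborel) * indicator A x"
      by (simp add: nn_integral_multc)
    also have "(\<integral>\<^sup>+ y. indicator B (y - x) \<partial>lborel) = emeasure lborel B"
      using tl[of "indicator B" "- x"] B by simp
    finally show "(\<integral>\<^sup>+ y. indicator B (y - x) * indicator A x \<partial>lborel) = emeasure lborel B * indicator A x" .
  qed
  also have "... = emeasure lborel B * emeasure M A"
    using A M(2) by (simp add: nn_integral_cmult)
  finally show ?thesis using 1 by (simp add: mult.commute)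
qed

lemma emeasure_lborel_open_pos:
  fixes S :: "'a::euclidean_space set"
  assumes "open S" "x \<in> S"
  shows "0 < emeasure lborel S"
proof -
  obtain e where e: "e > 0" "ball x e \<subseteq> S" using assms open_contains_ball by blast
  have "emeasure lborel (ball x e) = ennreal (measure lborel (ball x e))"
    by (intro emeasure_eq_ennreal_measure) (use emeasure_lborel_ball_finite[of x e] in simp)
  moreover have "measure lborel (ball x e) > 0" by (rule content_ball_pos[OF e(1)])
  ultimately have "0 < emeasure lborel (ball x e)" by simp
  also have "... \<le> emeasure lborel S" by (rule emeasure_mono[OF e(2)]) (use assms in simp)
  finally show ?thesis .
qed

text \<open>The image of Lebesgue measure under \<open>f\<close> is translation invariant, because
  \<open>f\<close> carries translation by \<open>g c\<close> to translation by \<open>c\<close>.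
  Comparison with a fixed set \<open>B\<close> replaces any use of determinants.\<close>

lemma linear_vimage_measure:
  fixes f :: "'a::euclidean_space \<Rightarrow> 'a"
  assumes f: "linear f" "bij f" and A: "A \<in> sets borel" and B: "B \<in> sets borel"
  shows "emeasure lborel (f -` A) * emeasure lborel B = emeasure lborel (f -` uminus -` B) * emeasure lborel A"
proof -
  interpret linear f by fact
  define g where "g = inv_into UNIV f"
  have g: "linear g" "f \<circ> g = id" "g \<circ> f = id"
    using inj_linear_imp_inv_linear[OF f(1) bij_is_inj[OF f(2)]] bij_is_surj[OF f(2)]
      inv_o_cancel[OF bij_is_inj[OF f(2)]] unfolding g_def by (simp_all add: surj_iff)
  have [measurable]: "f \<in> borel_measurable borel" "g \<in> borel_measurable borel"
    by (auto intro!: borel_measurable_continuous_onI linear_continuous_on linear_conv_bounded_linear[THEN iffD1] f g)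
  let ?M = "distr lborel borel f"
  have e: "emeasure ?M X = emeasure lborel (f -` X)" if "X \<in> sets borel" for X
    using that by (simp add: emeasure_distr)
  have "emeasure ?M A * emeasure lborel B = emeasure ?M (uminus -` B) * emeasure lborel A"
  proof (rule translation_invariant_unique[OF _ _ _ A B])
    show "sigma_finite_measure ?M"
    proof
      let ?C = "range (\<lambda>k::nat. g -` cball 0 (real k))"
      have m: "g -` cball 0 (real k) \<in> sets borel" for k
        using measurable_sets[of g borel borel "cball 0 (real k)"] by simp
      have "f -` g -` cball 0 (real k) = cball 0 (real k)" for k using g(3) by (auto simp: fun_eq_iff)
      then have "emeasure ?M (g -` cball 0 (real k)) \<noteq> \<infinity>" for k
        using e[OF m] emeasure_lborel_cball_finite[of 0 "real k"] by (simp add: less_top)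
      moreover have "\<Union>?C = UNIV"
      proof -
        have "\<exists>k. norm (g x) \<le> real k" for x by (rule real_arch_simple)
        then show ?thesis by auto
      qed
      ultimately show "\<exists>A. countable A \<and> A \<subseteq> sets ?M \<and> \<Union>A = space ?M \<and> (\<forall>a\<in>A. emeasure ?M a \<noteq> \<infinity>)"
        using m by (intro exI[of _ ?C]) auto
    qed
    show "distr ?M borel ((+) c) = ?M" for c
    proof -
      have "(+) c \<circ> f = f \<circ> (+) (g c)" using g(2) by (auto simp: fun_eq_iff add)
      then have "distr ?M borel ((+) c) = distr (distr lborel borel ((+) (g c))) borel f"
        by (simp add: distr_distr)
      then show ?thesis by (simp add: lborel_distr_plus)
    qed
  qed simp
  moreover have "uminus -` B \<in> sets borel" using measurable_sets[of uminus borel borel B] B by simp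
  ultimately show ?thesis using e A by simp
qed

lemma linear_bij_measurable:
  fixes f :: "'a::euclidean_space \<Rightarrow> 'a"
  assumes "linear f" shows "f \<in> borel_measurable borel"
  by (rule borel_measurable_continuous_onI[OF linear_continuous_on]) (use assms linear_conv_bounded_linear in blast)

text \<open>The factor is the volume ratio of the preimage of the unit ball and the unit ball. Its
  value does not matter later: it cancels when an integral is divided by the volume of the
  element.\<close>

lemma linear_vimage_scale:
  fixes f :: "'a::euclidean_space \<Rightarrow> 'a"
  assumes f: "linear f" "bij f"
  obtains c where "c > 0" "\<And>A. A \<in> sets borel \<Longrightarrow> emeasure lborel (f -` A) = ennreal c * emeasure lborel A"
    "\<And>g::'a \<Rightarrow> real. g \<in> borel_measurable borel \<Longrightarrow> (LINT x|lborel. g (f x)) = c * (LINT x|lborel. g x)"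
proof -
  note fm[measurable] = linear_bij_measurable[OF f(1)]
  define B where "B = ball (0::'a) 1"
  have B: "B \<in> sets borel" by (simp add: B_def)
  define \<beta> where "\<beta> = measure lborel B"
  have "\<beta> > 0" unfolding \<beta>_def B_def by (simp add: content_ball_pos)
  have eB: "emeasure lborel B = ennreal \<beta>"
    unfolding \<beta>_def B_def
    by (intro emeasure_eq_ennreal_measure) (use emeasure_lborel_ball_finite[of "0::'a" 1] in simp)
  define D where "D = f -` uminus -` B"
  obtain K where K: "K > 0" "\<And>x. norm x \<le> K * norm (f x)"
  proof -
    obtain b where "b > 0" "\<And>x. norm (f x) \<ge> b * norm x"
      using linear_inj_bounded_below_pos[OF f(1)] f(2) by (metis bij_is_inj mult.commute)
    then show ?thesis by (intro that[of "1 / b"]) (simp_all add: field_simps)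
  qed
  have "D \<subseteq> cball 0 K"
  proof
    fix x assume "x \<in> D"
    then have "norm (f x) \<le> 1" by (simp add: D_def B_def)
    then have "K * norm (f x) \<le> K * 1" using K(1) by (intro mult_left_mono) simp_all
    then show "x \<in> cball 0 K" using K(2)[of x] by simp
  qed
  then have "emeasure lborel D \<le> emeasure lborel (cball (0::'a) K)" by (rule emeasure_mono) simp
  then have Dfin: "emeasure lborel D < \<infinity>" using emeasure_lborel_cball_finite[of "0::'a" K] by (rule le_less_trans)
  have "open D" unfolding D_def B_def
    by (intro continuous_open_vimage continuous_intros linear_continuous_at open_ball)
       (use f(1) linear_conv_bounded_linear linear_continuous_at in "auto intro: continuous_intros")
  moreover have "0 \<in> D" using linear_0[OF f(1)] by (simp add: D_def B_def)
  ultimately have Dpos: "emeasure lborel D > 0"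
    by (rule emeasure_lborel_open_pos)
  define c where "c = measure lborel D / \<beta>"
  have eD: "emeasure lborel D = ennreal (measure lborel D)" using Dfin by (intro emeasure_eq_ennreal_measure) simp
  have mD: "measure lborel D > 0" using Dpos eD by simp
  have c: "c > 0" using mD \<open>\<beta> > 0\<close> by (simp add: c_def)
  have main: "emeasure lborel (f -` A) = ennreal c * emeasure lborel A" if A: "A \<in> sets borel" for A
  proof -
    have "emeasure lborel (f -` A) * ennreal \<beta> = ennreal (measure lborel D) * emeasure lborel A"
      using linear_vimage_measure[OF f A B] eB eD by (simp add: D_def)
    then have "emeasure lborel (f -` A) * ennreal \<beta> * ennreal (1 / \<beta>) = ennreal (measure lborel D) * emeasure lborel A * ennreal (1 / \<beta>)"
      by simp
    moreover have "ennreal \<beta> * ennreal (1 / \<beta>) = 1" using \<open>\<beta> > 0\<close> by (simp flip: ennreal_mult)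
    moreover have "ennreal (measure lborel D) * ennreal (1 / \<beta>) = ennreal c" using \<open>\<beta> > 0\<close> mD by (simp add: c_def flip: ennreal_mult)
    ultimately show ?thesis by (metis mult.assoc mult.commute mult.right_neutral)
  qed
  have dens: "distr lborel borel f = density lborel (\<lambda>_. ennreal c)"
    by (rule measure_eqI) (use main in "simp_all add: emeasure_distr emeasure_density_const")
  show ?thesis
  proof (rule that[OF c main])
    fix g :: "'a \<Rightarrow> real" assume g: "g \<in> borel_measurable borel"
    have "(LINT x|lborel. g (f x)) = (LINT x|distr lborel borel f. g x)"
      using g by (intro integral_distr[symmetric]) simp_all
    also have "... = (LINT x|lborel. c *\<^sub>R g x)"
      unfolding dens using g c by (intro integral_density) simp_all
    finally show "(LINT x|lborel. g (f x)) = c * (LINT x|lborel. g x)" by simp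
  qed
qed

text \<open>The unit ball is its own preimage, so the proportionality factor is 1.\<close>

lemma orthogonal_vimage_measure:
  fixes f :: "'a::euclidean_space \<Rightarrow> 'a"
  assumes f: "orthogonal_transformation f" and A: "A \<in> sets borel"
  shows "emeasure lborel (f -` A) = emeasure lborel A"
proof -
  let ?B = "ball (0::'a) 1"
  have "f -` uminus -` ?B = ?B" using orthogonal_transformation_norm[OF f] by (auto simp: dist_norm)
  then have "emeasure lborel (f -` A) * emeasure lborel ?B = emeasure lborel A * emeasure lborel ?B"
    using linear_vimage_measure[OF orthogonal_transformation_linear[OF f] orthogonal_transformation_bij[OF f] A, of ?B]
    by (simp add: mult.commute)
  moreover have "emeasure lborel ?B \<noteq> 0" "emeasure lborel ?B \<noteq> \<infinity>"
  proof -
    show "emeasure lborel ?B \<noteq> \<infinity>" using emeasure_lborel_ball_finite[of "0::'a" 1] by simp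
    have "emeasure lborel ?B > 0" using emeasure_lborel_open_pos[of ?B 0] by simp
    then show "emeasure lborel ?B \<noteq> 0" by simp
  qed
  ultimately show ?thesis
    by (simp add: mult.commute[of _ "emeasure lborel ?B"] ennreal_mult_cancel_left)
qed

section \<open>The Sobolev space and its dual norm\<close>

lemma power2_le_imp_abs_le: "\<bar>x\<bar> \<le> sqrt y" if "x\<^sup>2 \<le> y" for x y :: real
  using real_sqrt_le_mono[OF that] by simp

locale bounded_domain =
  fixes \<Omega> :: "'a::euclidean_space set"
  assumes open_dom: "open \<Omega>" and bounded_dom: "bounded \<Omega>" and nonempty_dom: "\<Omega> \<noteq> {}"
begin

abbreviation test :: "('a \<Rightarrow> real) \<Rightarrow> bool" where "test \<equiv> test_function \<Omega>"

abbreviation I :: "('a \<Rightarrow> real) \<Rightarrow> real" where "I f \<equiv> integral\<^sup>L (lebesgue_on \<Omega>) f"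
abbreviation integ :: "('a \<Rightarrow> real) \<Rightarrow> bool" where "integ f \<equiv> integrable (lebesgue_on \<Omega>) f"

lemma dom_borel: "\<Omega> \<in> sets borel" using open_dom by simp
lemma dom_lebesgue: "\<Omega> \<in> sets lebesgue" using open_dom by simp
lemma dom_lmeasurable: "\<Omega> \<in> lmeasurable" by (rule bounded_borel_lmeasurable[OF bounded_dom dom_borel])

lemma L2_measurable: "L2 \<Omega> f \<Longrightarrow> f \<in> borel_measurable (lebesgue_on \<Omega>)" by (simp add: L2_def)
lemma L2_integrable: "L2 \<Omega> f \<Longrightarrow> integ (\<lambda>x. (norm (f x))\<^sup>2)" by (simp add: L2_def)

lemma L2_continuous: "continuous_on UNIV f \<Longrightarrow> L2 \<Omega> f"
  unfolding L2_def
  by (intro conjI continuous_measurable_lebesgue_on[OF _ dom_lebesgue]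
      integrable_continuous_bounded[OF _ dom_lmeasurable bounded_dom] continuous_intros)

lemma L2_smooth: "smooth f \<Longrightarrow> L2 \<Omega> f" by (rule L2_continuous[OF smooth_continuous])
lemma L2_grad: "smooth f \<Longrightarrow> L2 \<Omega> (grad f)" by (rule L2_continuous[OF continuous_on_grad])

lemma L2_inner_integrable:
  assumes "L2 \<Omega> f" "L2 \<Omega> g"
  shows "integ (\<lambda>x. f x \<bullet> g x)"
proof (rule Bochner_Integration.integrable_bound)
  show "integ (\<lambda>x. (norm (f x))\<^sup>2 + (norm (g x))\<^sup>2)"
    by (intro Bochner_Integration.integrable_add L2_integrable assms)
  show "(\<lambda>x. f x \<bullet> g x) \<in> borel_measurable (lebesgue_on \<Omega>)"
    using L2_measurable[OF assms(1)] L2_measurable[OF assms(2)] by measurable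
  show "AE x in lebesgue_on \<Omega>. norm (f x \<bullet> g x) \<le> norm ((norm (f x))\<^sup>2 + (norm (g x))\<^sup>2)"
  proof (rule AE_I2)
    fix x
    have "norm (f x \<bullet> g x) \<le> norm (f x) * norm (g x)" using Cauchy_Schwarz_ineq2 by simp
    also have "... \<le> (norm (f x))\<^sup>2 + (norm (g x))\<^sup>2"
      using sum_squares_bound[of "norm (f x)" "norm (g x)"] mult_nonneg_nonneg[of "norm (f x)" "norm (g x)", OF norm_ge_zero norm_ge_zero] by linarith
    finally show "norm (f x \<bullet> g x) \<le> norm ((norm (f x))\<^sup>2 + (norm (g x))\<^sup>2)" by simp
  qed
qed

lemma L2_mult_integrable: "L2 \<Omega> f \<Longrightarrow> L2 \<Omega> g \<Longrightarrow> integ (\<lambda>x. f x * g x)"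
  using L2_inner_integrable[of f g] by simp

lemma L2_lin:
  assumes "L2 \<Omega> f" "L2 \<Omega> g" shows "L2 \<Omega> (\<lambda>x. a *\<^sub>R f x + b *\<^sub>R g x)"
  unfolding L2_def
proof
  show "(\<lambda>x. a *\<^sub>R f x + b *\<^sub>R g x) \<in> borel_measurable (lebesgue_on \<Omega>)"
    using L2_measurable[OF assms(1)] L2_measurable[OF assms(2)] by measurable
  have "(norm (a *\<^sub>R f x + b *\<^sub>R g x))\<^sup>2 = a\<^sup>2 * (f x \<bullet> f x) + 2 * a * b * (f x \<bullet> g x) + b\<^sup>2 * (g x \<bullet> g x)" for x
    unfolding power2_norm_eq_inner
    by (simp add: inner_add_left inner_add_right inner_commute power2_eq_square algebra_simps)
  then show "integ (\<lambda>x. (norm (a *\<^sub>R f x + b *\<^sub>R g x))\<^sup>2)"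
    by (simp only:) (intro Bochner_Integration.integrable_add integrable_mult_right L2_inner_integrable assms)
qed

lemma L2_diff: "L2 \<Omega> f \<Longrightarrow> L2 \<Omega> g \<Longrightarrow> L2 \<Omega> (\<lambda>x. f x - g x)"
  using L2_lin[of f g 1 "-1"] by simp

lemma L2_add: "L2 \<Omega> f \<Longrightarrow> L2 \<Omega> g \<Longrightarrow> L2 \<Omega> (\<lambda>x. f x + g x)"
  using L2_lin[of f g 1 1] by simp

lemma L2_const: "L2 \<Omega> (\<lambda>_. c)" by (rule L2_continuous) simp

lemma L2_sum: "(\<And>i. i \<in> J \<Longrightarrow> L2 \<Omega> (f i)) \<Longrightarrow> L2 \<Omega> (\<lambda>x. \<Sum>i\<in>J. f i x)"
  by (induction J rule: infinite_finite_induct) (simp_all add: L2_const L2_add)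

lemma L2_bounded:
  assumes "f \<in> borel_measurable (lebesgue_on \<Omega>)" "\<And>x. x \<in> \<Omega> \<Longrightarrow> norm (f x) \<le> B"
  shows "L2 \<Omega> f"
  unfolding L2_def
proof
  show "integ (\<lambda>x. (norm (f x))\<^sup>2)"
  proof (rule integrable_bounded_on[OF dom_lmeasurable])
    show "(\<lambda>x. (norm (f x))\<^sup>2) \<in> borel_measurable (lebesgue_on \<Omega>)" using assms(1) by measurable
    show "norm ((norm (f x))\<^sup>2) \<le> B\<^sup>2" if "x \<in> \<Omega>" for x
      using power_mono[OF assms(2)[OF that] norm_ge_zero, of 2] by simp
  qed
qed (rule assms(1))

lemma L2_norm_ge_0: "0 \<le> L2_norm \<Omega> f" by (simp add: L2_norm_def)

lemma L2_norm_power2: "(L2_norm \<Omega> f)\<^sup>2 = I (\<lambda>x. (norm (f x))\<^sup>2)"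
  by (simp add: L2_norm_def)

lemma L2_norm_cong_AE:
  assumes "L2 \<Omega> f" "L2 \<Omega> g" "AE x in lebesgue_on \<Omega>. f x = g x"
  shows "L2_norm \<Omega> f = L2_norm \<Omega> g"
  unfolding L2_norm_def
proof (rule arg_cong[where f=sqrt], rule integral_cong_AE)
  show "AE x in lebesgue_on \<Omega>. (norm (f x))\<^sup>2 = (norm (g x))\<^sup>2" using assms(3) by eventually_elim simp
qed (use L2_integrable[OF assms(1)] L2_integrable[OF assms(2)] in "simp_all add: borel_measurable_integrable")

lemma L2_norm_lin_power2:
  assumes "L2 \<Omega> f" "L2 \<Omega> g"
  shows "(L2_norm \<Omega> (\<lambda>x. a *\<^sub>R f x + b *\<^sub>R g x))\<^sup>2
    = a\<^sup>2 * (L2_norm \<Omega> f)\<^sup>2 + 2 * a * b * I (\<lambda>x. f x \<bullet> g x) + b\<^sup>2 * (L2_norm \<Omega> g)\<^sup>2"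
proof -
  have e: "(norm (a *\<^sub>R f x + b *\<^sub>R g x))\<^sup>2 = a\<^sup>2 * (f x \<bullet> f x) + 2 * a * b * (f x \<bullet> g x) + b\<^sup>2 * (g x \<bullet> g x)" for x
    unfolding power2_norm_eq_inner
    by (simp add: inner_add_left inner_add_right inner_commute power2_eq_square algebra_simps)
  have "I (\<lambda>x. a\<^sup>2 * (f x \<bullet> f x) + 2 * a * b * (f x \<bullet> g x) + b\<^sup>2 * (g x \<bullet> g x))
    = I (\<lambda>x. a\<^sup>2 * (f x \<bullet> f x) + 2 * a * b * (f x \<bullet> g x)) + I (\<lambda>x. b\<^sup>2 * (g x \<bullet> g x))"
    by (intro LINT_add Bochner_Integration.integrable_add integrable_mult_right L2_inner_integrable assms)
  also have "I (\<lambda>x. a\<^sup>2 * (f x \<bullet> f x) + 2 * a * b * (f x \<bullet> g x)) = I (\<lambda>x. a\<^sup>2 * (f x \<bullet> f x)) + I (\<lambda>x. 2 * a * b * (f x \<bullet> g x))"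
    by (intro LINT_add integrable_mult_right L2_inner_integrable assms)
  finally show ?thesis unfolding L2_norm_power2 e by (simp add: power2_norm_eq_inner)
qed

lemma L2_Cauchy_Schwarz:
  assumes "L2 \<Omega> f" "L2 \<Omega> g"
  shows "\<bar>I (\<lambda>x. f x \<bullet> g x)\<bar> \<le> L2_norm \<Omega> f * L2_norm \<Omega> g"
proof -
  define A where "A = (L2_norm \<Omega> f)\<^sup>2"
  define B where "B = (L2_norm \<Omega> g)\<^sup>2"
  define c where "c = I (\<lambda>x. f x \<bullet> g x)"
  have q: "0 \<le> a\<^sup>2 * A + 2 * a * b * c + b\<^sup>2 * B" for a b
    using L2_norm_lin_power2[OF assms, of a b] zero_le_power2 unfolding A_def B_def c_def by metis
  have AB: "0 \<le> A" "0 \<le> B" by (simp_all add: A_def B_def)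
  have "c\<^sup>2 \<le> A * B"
  proof (cases "B = 0")
    case True
    show ?thesis
    proof (cases "A = 0")
      case True
      have "0 \<le> 2 * c" "0 \<le> - 2 * c" using q[of 1 1] q[of 1 "-1"] True \<open>B = 0\<close> by simp_all
      then show ?thesis using True by simp
    next
      case False
      have "0 \<le> c\<^sup>2 * A - 2 * c * A * c + A\<^sup>2 * B" using q[of c "-A"] by (simp add: algebra_simps)
      then have "0 \<le> A * (A * B - c\<^sup>2)" by (simp add: algebra_simps power2_eq_square)
      then show ?thesis using AB False by (simp add: zero_le_mult_iff)
    qed
  next
    case False
    have "0 \<le> B\<^sup>2 * A - 2 * c * B * c + c\<^sup>2 * B" using q[of B "-c"] by (simp add: algebra_simps)
    then have "0 \<le> B * (A * B - c\<^sup>2)" by (simp add: algebra_simps power2_eq_square)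
    then show ?thesis using AB False by (simp add: zero_le_mult_iff)
  qed
  then have "\<bar>c\<bar> \<le> sqrt (A * B)" by (rule power2_le_imp_abs_le)
  then show ?thesis by (simp add: A_def B_def c_def real_sqrt_mult L2_norm_ge_0)
qed

lemma L2_Cauchy_Schwarz_real:
  "L2 \<Omega> f \<Longrightarrow> L2 \<Omega> g \<Longrightarrow> \<bar>I (\<lambda>x. f x * g x)\<bar> \<le> L2_norm \<Omega> f * L2_norm \<Omega> g"
  using L2_Cauchy_Schwarz[of f g] by simp

lemma L2_norm_triangle:
  assumes "L2 \<Omega> f" "L2 \<Omega> g"
  shows "L2_norm \<Omega> (\<lambda>x. f x + g x) \<le> L2_norm \<Omega> f + L2_norm \<Omega> g"
proof (rule power2_le_imp_le)
  show "(L2_norm \<Omega> (\<lambda>x. f x + g x))\<^sup>2 \<le> (L2_norm \<Omega> f + L2_norm \<Omega> g)\<^sup>2"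
    using L2_norm_lin_power2[OF assms, of 1 1] L2_Cauchy_Schwarz[OF assms] by (simp add: power2_sum)
qed (simp add: L2_norm_ge_0)

lemma L2_norm_minus_commute: "L2_norm \<Omega> (\<lambda>x. f x - g x) = L2_norm \<Omega> (\<lambda>x. g x - f x)"
  by (simp add: L2_norm_def norm_minus_commute)

lemma L2_norm_triangle_diff:
  assumes "L2 \<Omega> f" "L2 \<Omega> g"
  shows "L2_norm \<Omega> f \<le> L2_norm \<Omega> (\<lambda>x. f x - g x) + L2_norm \<Omega> g"
  using L2_norm_triangle[OF L2_diff[OF assms] assms(2)] by simp

subsection \<open>Weak gradients\<close>

lemma has_weak_grad_L2: "has_weak_grad \<Omega> v g \<Longrightarrow> L2 \<Omega> v \<and> L2 \<Omega> g" by (simp add: has_weak_grad_def)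

lemma has_weak_grad_smooth:
  assumes "smooth \<phi>" shows "has_weak_grad \<Omega> \<phi> (grad \<phi>)"
  unfolding has_weak_grad_def
proof (intro conjI allI impI)
  fix \<psi> and b :: 'a assume t: "test \<psi>" and b: "b \<in> Basis"
  show "I (\<lambda>x. \<phi> x * (grad \<psi> x \<bullet> b)) = - I (\<lambda>x. (grad \<phi> x \<bullet> b) * \<psi> x)"
    using integral_by_parts[OF t assms b bounded_dom dom_borel]
    by (simp add: grad_inner_Basis[OF b] mult.commute)
qed (use assms in "simp_all add: L2_smooth L2_grad")

lemma has_weak_grad_diff:
  assumes "has_weak_grad \<Omega> v g" "has_weak_grad \<Omega> w h"
  shows "has_weak_grad \<Omega> (\<lambda>x. v x - w x) (\<lambda>x. g x - h x)"
  unfolding has_weak_grad_def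
proof (intro conjI allI impI)
  note L = has_weak_grad_L2[OF assms(1)] has_weak_grad_L2[OF assms(2)]
  show "L2 \<Omega> (\<lambda>x. v x - w x)" "L2 \<Omega> (\<lambda>x. g x - h x)" using L by (simp_all add: L2_diff)
  fix \<phi> and b :: 'a assume t: "test \<phi>" and b: "b \<in> Basis"
  then have s: "smooth \<phi>" by (simp add: test_function_smooth)
  have Lb: "L2 \<Omega> (\<lambda>x. grad \<phi> x \<bullet> b)" by (intro L2_continuous continuous_intros continuous_on_grad s)
  have Lp: "L2 \<Omega> (\<lambda>x. \<phi> x *\<^sub>R b)" by (intro L2_continuous continuous_intros smooth_continuous s)
  have i: "integ (\<lambda>x. v x * (grad \<phi> x \<bullet> b))" "integ (\<lambda>x. w x * (grad \<phi> x \<bullet> b))"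
    using L Lb by (simp_all add: L2_mult_integrable)
  have i': "integ (\<lambda>x. (g x \<bullet> b) * \<phi> x)" "integ (\<lambda>x. (h x \<bullet> b) * \<phi> x)"
    using L2_inner_integrable[OF _ Lp, of g] L2_inner_integrable[OF _ Lp, of h] L by (simp_all add: mult.commute)
  show "I (\<lambda>x. (v x - w x) * (grad \<phi> x \<bullet> b)) = - I (\<lambda>x. ((g x - h x) \<bullet> b) * \<phi> x)"
    using assms t b i i' unfolding has_weak_grad_def by (simp add: left_diff_distrib inner_diff_left)
qed

text \<open>The fundamental lemma is applied to each component of the difference. It makes the norm
  of the chosen \<open>weak_grad\<close> independent of the choice.\<close>

lemma has_weak_grad_unique:
  assumes "has_weak_grad \<Omega> v g" "has_weak_grad \<Omega> v h"
  shows "AE x in lebesgue_on \<Omega>. g x = h x"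
proof -
  have d: "has_weak_grad \<Omega> (\<lambda>x. 0) (\<lambda>x. g x - h x)" using has_weak_grad_diff[OF assms] by simp
  have "AE x in lebesgue_on \<Omega>. (g x - h x) \<bullet> b = 0" if b: "b \<in> Basis" for b
  proof (rule fundamental_lemma[OF open_dom])
    show "integ (\<lambda>x. (g x - h x) \<bullet> b)"
      using L2_inner_integrable[OF _ L2_const[of b]] has_weak_grad_L2[OF d] by blast
    show "I (\<lambda>x. ((g x - h x) \<bullet> b) * \<phi> x) = 0" if "test \<phi>" for \<phi>
    proof -
      have "I (\<lambda>x. 0 * (grad \<phi> x \<bullet> b)) = - I (\<lambda>x. ((g x - h x) \<bullet> b) * \<phi> x)"
        using d that b unfolding has_weak_grad_def by blast
      then show ?thesis by simp
    qed
  qed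
  then have "AE x in lebesgue_on \<Omega>. \<forall>b\<in>Basis. (g x - h x) \<bullet> b = 0"
    by (simp add: AE_finite_all)
  then show ?thesis
  proof eventually_elim
    case (elim x)
    have "g x - h x = 0" by (rule euclidean_eqI) (use elim in simp)
    then show ?case by simp
  qed
qed

lemma has_weak_grad_weak_grad: "v \<in> H1 \<Omega> \<Longrightarrow> has_weak_grad \<Omega> v (weak_grad \<Omega> v)"
  unfolding H1_def weak_grad_def by (metis (mono_tags, lifting) mem_Collect_eq someI_ex)

lemma weak_grad_norm_eq:
  assumes "has_weak_grad \<Omega> v g" shows "L2_norm \<Omega> (weak_grad \<Omega> v) = L2_norm \<Omega> g"
proof -
  have "v \<in> H1 \<Omega>" using assms by (auto simp: H1_def)
  then have w: "has_weak_grad \<Omega> v (weak_grad \<Omega> v)" by (rule has_weak_grad_weak_grad)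
  show ?thesis
    using L2_norm_cong_AE[OF _ _ has_weak_grad_unique[OF w assms]] has_weak_grad_L2[OF w] has_weak_grad_L2[OF assms] by blast
qed

definition gnorm :: "('a \<Rightarrow> real) \<Rightarrow> real" where "gnorm \<phi> = L2_norm \<Omega> (grad \<phi>)"

lemma gnorm_ge_0: "0 \<le> gnorm \<phi>" by (simp add: gnorm_def L2_norm_ge_0)

lemma test_smooth: "test \<phi> \<Longrightarrow> smooth \<phi>" by (simp add: test_function_smooth)

lemma test_function_zero: "test (\<lambda>_. 0)"
  by (rule test_functionI[where K="{}"]) (simp_all add: smooth_const)

lemma test_function_H10: "test \<phi> \<Longrightarrow> \<phi> \<in> H10 \<Omega>"
proof -
  assume t: "test \<phi>"
  have z: "H1_norm \<Omega> (\<lambda>x. \<phi> x - \<phi> x) = 0"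
  proof -
    have "has_weak_grad \<Omega> (\<lambda>x::'a. 0::real) (grad (\<lambda>x. 0))" by (rule has_weak_grad_smooth[OF smooth_const])
    moreover have "grad (\<lambda>x::'a. 0::real) = (\<lambda>x. 0)" by (intro ext grad_eqI) simp
    ultimately have "L2_norm \<Omega> (weak_grad \<Omega> (\<lambda>x. 0)) = L2_norm \<Omega> (\<lambda>x. 0::'a)" using weak_grad_norm_eq by metis
    then show ?thesis by (simp add: H1_norm_def L2_norm_def)
  qed
  show ?thesis using t z has_weak_grad_smooth[OF test_smooth[OF t]] unfolding H10_def H1_def
    by (auto intro!: exI[of _ \<phi>])
qed

lemma H10_dense:
  assumes "v \<in> H10 \<Omega>" "0 < \<epsilon>"
  obtains \<phi> where "test \<phi>" "L2_norm \<Omega> (\<lambda>x. v x - \<phi> x) < \<epsilon>"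
    "L2_norm \<Omega> (\<lambda>x. weak_grad \<Omega> v x - grad \<phi> x) < \<epsilon>"
proof -
  have v: "v \<in> H1 \<Omega>" using assms by (simp add: H10_def)
  obtain \<phi> where p: "test \<phi>" "H1_norm \<Omega> (\<lambda>x. v x - \<phi> x) < \<epsilon>"
    using assms by (auto simp: H10_def)
  have w: "L2_norm \<Omega> (weak_grad \<Omega> (\<lambda>x. v x - \<phi> x)) = L2_norm \<Omega> (\<lambda>x. weak_grad \<Omega> v x - grad \<phi> x)"
    by (rule weak_grad_norm_eq[OF has_weak_grad_diff[OF has_weak_grad_weak_grad[OF v] has_weak_grad_smooth[OF test_smooth[OF p(1)]]]])
  have "L2_norm \<Omega> (\<lambda>x. v x - \<phi> x) \<le> H1_norm \<Omega> (\<lambda>x. v x - \<phi> x)"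
    unfolding H1_norm_def by (rule real_le_rsqrt) simp
  moreover have "L2_norm \<Omega> (\<lambda>x. weak_grad \<Omega> v x - grad \<phi> x) \<le> H1_norm \<Omega> (\<lambda>x. v x - \<phi> x)"
    unfolding H1_norm_def w by (rule real_le_rsqrt) simp
  ultimately show ?thesis using p(2) by (intro that[OF p(1)]) linarith+
qed

lemma H10_L2: "v \<in> H10 \<Omega> \<Longrightarrow> L2 \<Omega> v \<and> L2 \<Omega> (weak_grad \<Omega> v)"
  using has_weak_grad_L2[OF has_weak_grad_weak_grad] by (simp add: H10_def)

lemma poincare:
  obtains C where "C > 0" "\<And>\<phi>. test \<phi> \<Longrightarrow> L2_norm \<Omega> \<phi> \<le> C * gnorm \<phi>"
    "\<And>v. v \<in> H10 \<Omega> \<Longrightarrow> L2_norm \<Omega> v \<le> C * L2_norm \<Omega> (weak_grad \<Omega> v)"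
proof -
  obtain C where C: "C > 0" "\<And>\<phi>. test \<phi> \<Longrightarrow>
    I (\<lambda>x. (\<phi> x)\<^sup>2) \<le> C * I (\<lambda>x. (norm (grad \<phi> x))\<^sup>2)"
    using poincare_test_function[OF bounded_dom dom_borel] by metis
  have t: "L2_norm \<Omega> \<phi> \<le> sqrt C * gnorm \<phi>" if "test \<phi>" for \<phi>
    using real_sqrt_le_mono[OF C(2)[OF that]] by (simp add: L2_norm_def gnorm_def real_sqrt_mult)
  show ?thesis
  proof (rule that[of "sqrt C"])
    fix v assume v: "v \<in> H10 \<Omega>"
    show "L2_norm \<Omega> v \<le> sqrt C * L2_norm \<Omega> (weak_grad \<Omega> v)"
    proof (rule field_le_epsilon)
      fix e :: real assume e: "0 < e"
      \<comment> \<open>One error \<open>d\<close> arises in the function and another in its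
        gradient, the latter multiplied by \<open>sqrt C\<close>; together they amount to
        \<open>e\<close>.\<close>
      define d where "d = e / (1 + sqrt C)"
      have s: "0 < 1 + sqrt C" using C(1) by (simp add: add_pos_nonneg)
      then have "0 < d" "d * (1 + sqrt C) = e" using e by (simp_all add: d_def)
      then have d: "0 < d" "d + sqrt C * d = e" by (simp_all add: algebra_simps)
      obtain \<phi> where p: "test \<phi>" "L2_norm \<Omega> (\<lambda>x. v x - \<phi> x) < d"
        "L2_norm \<Omega> (\<lambda>x. weak_grad \<Omega> v x - grad \<phi> x) < d" using H10_dense[OF v d(1)] by metis
      note sm = test_smooth[OF p(1)]
      have "L2_norm \<Omega> v \<le> d + L2_norm \<Omega> \<phi>"
        using L2_norm_triangle_diff[of v \<phi>] H10_L2[OF v] L2_smooth[OF sm] p(2) by fastforce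
      also have "L2_norm \<Omega> \<phi> \<le> sqrt C * gnorm \<phi>" by (rule t[OF p(1)])
      also have "gnorm \<phi> \<le> d + L2_norm \<Omega> (weak_grad \<Omega> v)"
        using L2_norm_triangle_diff[of "grad \<phi>" "weak_grad \<Omega> v"] H10_L2[OF v] L2_grad[OF sm] p(3)
          L2_norm_minus_commute[of "grad \<phi>" "weak_grad \<Omega> v"] unfolding gnorm_def by fastforce
      finally show "L2_norm \<Omega> v \<le> sqrt C * L2_norm \<Omega> (weak_grad \<Omega> v) + e"
        using d(2) C(1) by (simp add: distrib_left)
    qed
  qed (use C(1) t in simp_all)
qed

subsection \<open>The dual norm\<close>

text \<open>Agreement is demanded on \<open>L2\<close> arguments only: for other total functions the
  Bochner integral is not additive, so the functional of a sum need not be the sum of the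
  functionals there.\<close>

definition dual_of :: "(('a \<Rightarrow> real) \<Rightarrow> real) \<Rightarrow> ('a \<Rightarrow> real) \<Rightarrow> bool" where
  "dual_of F f \<longleftrightarrow> L2 \<Omega> f \<and> (\<forall>v. L2 \<Omega> v \<longrightarrow> F v = I (\<lambda>x. f x * v x))"

text \<open>This makes the supremum in \<open>Hm1_norm\<close> one over a nonempty set.\<close>

lemma H10_nontrivial: "\<exists>\<phi>. test \<phi> \<and> \<not> (AE x in lebesgue_on \<Omega>. \<phi> x = 0)"
proof -
  obtain x where x: "x \<in> \<Omega>" using nonempty_dom by blast
  then obtain a c where ac: "x \<in> box a c" "cbox a c \<subseteq> \<Omega>"
    using open_contains_cbox[of \<Omega>] open_dom by metis
  have t: "test (box_bump 1 a c)"
    by (rule test_functionI[where K="cbox a c"])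
      (use ac box_subset_cbox in "auto simp: smooth_box_bump box_bump_nonzero")
  moreover have "\<not> (AE x in lebesgue_on \<Omega>. box_bump 1 a c x = 0)"
  proof
    assume "AE x in lebesgue_on \<Omega>. box_bump 1 a c x = 0"
    then have "AE x in lebesgue. x \<in> \<Omega> \<longrightarrow> x \<notin> box a c"
      using dom_lebesgue by (simp add: AE_restrict_space_iff box_bump_nonzero[of 1 a c, simplified, THEN iffD1] flip: box_bump_nonzero[of 1 a c, simplified])
    then have "AE x in lebesgue. x \<notin> box a c"
      by eventually_elim (use ac box_subset_cbox in blast)
    then have "negligible (box a c)" by (simp add: AE_iff_null_sets negligible_iff_null_sets)
    then show False using open_not_negligible[OF open_box] ac(1) by blast
  qed
  ultimately show ?thesis by blast
qed

text \<open>The Poincare inequality bounds the quotients and keeps their denominators positive, so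
  the supremum is a genuine one. The third part passes from test functions to all of
  \<open>H10\<close> by density and reduces every later upper estimate to test functions.\<close>

lemma Hm1_norm_props:
  assumes F: "dual_of F f"
  shows "0 \<le> Hm1_norm \<Omega> F"
    and "\<And>v. v \<in> H10 \<Omega> \<Longrightarrow> F v \<le> Hm1_norm \<Omega> F * L2_norm \<Omega> (weak_grad \<Omega> v)"
    and "\<And>M. 0 \<le> M \<Longrightarrow> (\<And>\<phi>. test \<phi> \<Longrightarrow> F \<phi> \<le> M * gnorm \<phi>) \<Longrightarrow> Hm1_norm \<Omega> F \<le> M"
proof -
  let ?w = "\<lambda>v. L2_norm \<Omega> (weak_grad \<Omega> v)"
  define V where "V = {v \<in> H10 \<Omega>. \<not> (AE x in lebesgue_on \<Omega>. v x = 0)}"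
  have n: "Hm1_norm \<Omega> F = (SUP v\<in>V. F v / ?w v)" by (simp add: Hm1_norm_def V_def)
  have f: "L2 \<Omega> f" and Ff: "\<And>v. L2 \<Omega> v \<Longrightarrow> F v = I (\<lambda>x. f x * v x)" using F by (simp_all add: dual_of_def)
  obtain C where C: "C > 0" "\<And>v. v \<in> H10 \<Omega> \<Longrightarrow> L2_norm \<Omega> v \<le> C * ?w v" using poincare by metis
  have bd: "\<bar>F v\<bar> \<le> L2_norm \<Omega> f * (C * ?w v)" if "v \<in> H10 \<Omega>" for v
  proof -
    have "\<bar>F v\<bar> \<le> L2_norm \<Omega> f * L2_norm \<Omega> v"
      using L2_Cauchy_Schwarz_real[OF f] Ff H10_L2[OF that] by simp
    also have "... \<le> L2_norm \<Omega> f * (C * ?w v)" by (intro mult_left_mono C(2) that L2_norm_ge_0)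
    finally show ?thesis .
  qed
  have wpos: "0 < ?w v" if "v \<in> V" for v
  proof (rule ccontr)
    assume "\<not> 0 < ?w v"
    then have "?w v = 0" using L2_norm_ge_0 by (metis less_eq_real_def)
    then have "L2_norm \<Omega> v = 0" using C(2)[of v] that L2_norm_ge_0[of v] by (simp add: V_def)
    then have "I (\<lambda>x. (norm (v x))\<^sup>2) = 0" using L2_norm_power2[of v] by simp
    moreover have "integ (\<lambda>x. (norm (v x))\<^sup>2)" using H10_L2[of v] that L2_integrable[of v] by (simp add: V_def)
    ultimately have "AE x in lebesgue_on \<Omega>. (norm (v x))\<^sup>2 = 0"
      using integral_nonneg_eq_0_iff_AE[of "lebesgue_on \<Omega>" "\<lambda>x. (norm (v x))\<^sup>2"] by simp
    then have "AE x in lebesgue_on \<Omega>. v x = 0" by eventually_elim simp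
    then show False using that by (simp add: V_def)
  qed
  have bdd: "bdd_above ((\<lambda>v. F v / ?w v) ` V)"
  proof (rule bdd_aboveI2)
    fix v assume v: "v \<in> V"
    then have "F v \<le> (L2_norm \<Omega> f * C) * ?w v" using bd[of v] by (simp add: V_def mult.assoc)
    then show "F v / ?w v \<le> L2_norm \<Omega> f * C" using wpos[OF v] by (simp add: pos_divide_le_eq)
  qed
  obtain \<phi> where p: "test \<phi>" "\<phi> \<in> V" using H10_nontrivial test_function_H10 by (auto simp: V_def)
  \<comment> \<open>The quotients of \<phi> and of its negative have opposite signs, so one of them
    shows that the supremum is nonnegative.\<close>
  have mp: "(\<lambda>x. - \<phi> x) \<in> V" "test (\<lambda>x. - \<phi> x)"
    using test_function_lin[OF p(1) p(1), of "-1" 0] test_function_H10[of "\<lambda>x. - \<phi> x"] p(2) by (auto simp: V_def)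
  show n0: "0 \<le> Hm1_norm \<Omega> F"
  proof -
    have "F (\<lambda>x. - \<phi> x) = - F \<phi>" using Ff[OF L2_smooth[OF test_smooth[OF p(1)]]] Ff[OF L2_smooth[OF test_smooth[OF mp(2)]]] by simp
    then have "0 \<le> F \<phi> / ?w \<phi> \<or> 0 \<le> F (\<lambda>x. - \<phi> x) / ?w (\<lambda>x. - \<phi> x)"
      using L2_norm_ge_0[of "weak_grad \<Omega> \<phi>"] L2_norm_ge_0[of "weak_grad \<Omega> (\<lambda>x. - \<phi> x)"]
      by (cases "0 \<le> F \<phi>") (simp_all add: divide_nonpos_nonneg)
    then show ?thesis unfolding n using cSUP_upper[OF p(2) bdd] cSUP_upper[OF mp(1) bdd] by linarith
  qed
  show "F v \<le> Hm1_norm \<Omega> F * ?w v" if v: "v \<in> H10 \<Omega>" for v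
  proof (cases "v \<in> V")
    case True
    then show ?thesis unfolding n using cSUP_upper[OF True bdd] wpos[OF True] by (simp add: pos_divide_le_eq)
  next
    case False
    then have "AE x in lebesgue_on \<Omega>. v x = 0" using v by (simp add: V_def)
    then have "I (\<lambda>x. f x * v x) = I (\<lambda>x. 0)"
      using L2_measurable[OF f] L2_measurable[of v] H10_L2[OF v] by (intro integral_cong_AE) auto
    then show ?thesis using Ff H10_L2[OF v] mult_nonneg_nonneg[OF n0 L2_norm_ge_0[of "weak_grad \<Omega> v"]] by simp
  qed
  show "Hm1_norm \<Omega> F \<le> M" if M: "0 \<le> M" "\<And>\<phi>. test \<phi> \<Longrightarrow> F \<phi> \<le> M * gnorm \<phi>" for M
    unfolding n
  proof (rule cSUP_least)
    show "V \<noteq> {}" using p(2) by blast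
    fix v assume v: "v \<in> V"
    then have vH: "v \<in> H10 \<Omega>" by (simp add: V_def)
    have "F v \<le> M * ?w v"
    proof (rule field_le_epsilon)
      fix e :: real assume e: "0 < e"
      \<comment> \<open>The error of the function is multiplied by the norm of \<open>f\<close>,
        that of the gradient by \<open>M\<close>; the summand 1 keeps the denominator
        positive.\<close>
      define d where "d = e / (L2_norm \<Omega> f + M + 1)"
      have s: "0 < L2_norm \<Omega> f + M + 1" using L2_norm_ge_0[of f] M(1) by simp
      have d: "0 < d" "d * (L2_norm \<Omega> f + M + 1) = e" using s e by (simp_all add: d_def)
      obtain \<phi> where p: "test \<phi>" "L2_norm \<Omega> (\<lambda>x. v x - \<phi> x) < d"
        "L2_norm \<Omega> (\<lambda>x. weak_grad \<Omega> v x - grad \<phi> x) < d" using H10_dense[OF vH d(1)] by metis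
      note sm = test_smooth[OF p(1)]
      have L: "L2 \<Omega> v" "L2 \<Omega> \<phi>" using H10_L2[OF vH] L2_smooth[OF sm] by simp_all
      have "F v = I (\<lambda>x. f x * (v x - \<phi> x)) + F \<phi>"
        using L2_mult_integrable[OF f L(1)] L2_mult_integrable[OF f L(2)] Ff[OF L(1)] Ff[OF L(2)]
        by (simp add: right_diff_distrib)
      also have "I (\<lambda>x. f x * (v x - \<phi> x)) \<le> L2_norm \<Omega> f * d"
        using L2_Cauchy_Schwarz_real[OF f L2_diff[OF L]] mult_left_mono[OF less_imp_le[OF p(2)] L2_norm_ge_0[of f]] by linarith
      also have "F \<phi> \<le> M * (d + ?w v)"
      proof -
        have "gnorm \<phi> \<le> d + ?w v"
          using L2_norm_triangle_diff[of "grad \<phi>" "weak_grad \<Omega> v"] H10_L2[OF vH] L2_grad[OF sm] p(3)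
            L2_norm_minus_commute[of "grad \<phi>" "weak_grad \<Omega> v"] unfolding gnorm_def by fastforce
        then show ?thesis using M(2)[OF p(1)] mult_left_mono[OF _ M(1)] by (meson order_trans)
      qed
      finally have "F v \<le> L2_norm \<Omega> f * d + M * (d + ?w v)" by simp
      then show "F v \<le> M * ?w v + e" using d by (simp add: algebra_simps)
    qed
    then show "F v / ?w v \<le> M" using wpos[OF v] by (simp add: pos_divide_le_eq)
  qed
qed

lemma Hm1_norm_test:
  "dual_of F f \<Longrightarrow> test \<phi> \<Longrightarrow> F \<phi> \<le> Hm1_norm \<Omega> F * gnorm \<phi>"
  using Hm1_norm_props(2)[OF _ test_function_H10, of F f \<phi>]
    weak_grad_norm_eq[OF has_weak_grad_smooth[OF test_smooth[of \<phi>]]] by (simp add: gnorm_def)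

text \<open>The square of the dual norm is the supremum of \<open>2 F \<phi> - gnorm \<phi> ^ 2\<close>; in this form the parallelogram
  law needs no representing element, hence no completeness.\<close>

lemma gnorm_cmult: "smooth \<phi> \<Longrightarrow> gnorm (\<lambda>x. t * \<phi> x) = \<bar>t\<bar> * gnorm \<phi>"
  by (simp add: gnorm_def L2_norm_def grad_cmult power_mult_distrib real_sqrt_mult)

lemma dual_cmult: "dual_of F f \<Longrightarrow> L2 \<Omega> v \<Longrightarrow> F (\<lambda>x. t * v x) = t * F v"
  using L2_lin[of v v t 0] by (simp add: dual_of_def mult.left_commute)

lemma dual_add: "dual_of F f \<Longrightarrow> L2 \<Omega> v \<Longrightarrow> L2 \<Omega> w \<Longrightarrow> F (\<lambda>x. v x + w x) = F v + F w"
  by (simp add: dual_of_def L2_add distrib_left L2_mult_integrable)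

text \<open>Applying the hypothesis to all multiples \<open>t * \<phi>\<close> and choosing
  \<open>t = F \<phi> / (gnorm \<phi>)\<^sup>2\<close> gives
  \<open>(F \<phi>)\<^sup>2 \<le> K * (gnorm \<phi>)\<^sup>2\<close>. If \<open>gnorm \<phi>\<close>
  is zero, large \<open>t\<close> force \<open>F \<phi> \<le> 0\<close>.\<close>

lemma Hm1_norm_sup2:
  assumes F: "dual_of F f" and K: "\<And>\<phi>. test \<phi> \<Longrightarrow> 2 * F \<phi> - (gnorm \<phi>)\<^sup>2 \<le> K"
  shows "(Hm1_norm \<Omega> F)\<^sup>2 \<le> K"
proof -
  have "gnorm (\<lambda>_. 0) = 0" "F (\<lambda>_. 0) = 0"
    using gnorm_cmult[OF smooth_const[of 0], of 0] dual_cmult[OF F L2_const[of 0], of 0] by simp_all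
  then have K0: "0 \<le> K" using K[OF test_function_zero] by simp
  have "F \<phi> \<le> sqrt K * gnorm \<phi>" if t: "test \<phi>" for \<phi>
  proof -
    have s: "smooth \<phi>" by (rule test_smooth[OF t])
    have q: "2 * t * F \<phi> - t\<^sup>2 * (gnorm \<phi>)\<^sup>2 \<le> K" for t
    proof -
      have "test (\<lambda>x. t * \<phi> x)" using test_function_lin[OF \<open>test \<phi>\<close> \<open>test \<phi>\<close>, of t 0] by simp
      from K[OF this] show ?thesis by (simp add: gnorm_cmult[OF s] dual_cmult[OF F L2_smooth[OF s]] power_mult_distrib mult.assoc)
    qed
    show ?thesis
    proof (cases "gnorm \<phi> = 0")
      case True
      have "F \<phi> \<le> 0"
      proof (rule ccontr)
        assume "\<not> F \<phi> \<le> 0"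
        then have "2 * ((K + 1) / F \<phi>) * F \<phi> \<le> K" using q[of "(K + 1) / F \<phi>"] True by simp
        then show False using \<open>\<not> F \<phi> \<le> 0\<close> K0 by simp
      qed
      then show ?thesis using True by simp
    next
      case False
      then have g: "0 < gnorm \<phi>" using gnorm_ge_0[of \<phi>] by simp
      have e: "2 * (F \<phi> / (gnorm \<phi>)\<^sup>2) * F \<phi> - (F \<phi> / (gnorm \<phi>)\<^sup>2)\<^sup>2 * (gnorm \<phi>)\<^sup>2 = (F \<phi>)\<^sup>2 / (gnorm \<phi>)\<^sup>2"
        using g by (simp add: field_simps power2_eq_square)
      have "(F \<phi>)\<^sup>2 / (gnorm \<phi>)\<^sup>2 \<le> K" using q[of "F \<phi> / (gnorm \<phi>)\<^sup>2"] unfolding e .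
      then have "(F \<phi>)\<^sup>2 \<le> K * (gnorm \<phi>)\<^sup>2" using g by (simp add: pos_divide_le_eq)
      then have "\<bar>F \<phi>\<bar> \<le> sqrt (K * (gnorm \<phi>)\<^sup>2)" by (rule power2_le_imp_abs_le)
      then show ?thesis using g by (simp add: real_sqrt_mult)
    qed
  qed
  then have "Hm1_norm \<Omega> F \<le> sqrt K" by (intro Hm1_norm_props(3)[OF F]) (simp_all add: K0)
  then have "(Hm1_norm \<Omega> F)\<^sup>2 \<le> (sqrt K)\<^sup>2" by (intro power_mono Hm1_norm_props(1)[OF F])
  then show ?thesis using K0 by simp
qed

lemma dual_of_lin: "dual_of F f \<Longrightarrow> dual_of G g \<Longrightarrow> dual_of (\<lambda>v. a * F v + b * G v) (\<lambda>x. a * f x + b * g x)"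
  unfolding dual_of_def using L2_lin[of f g a b]
  by (auto simp: distrib_right mult.assoc L2_mult_integrable)

lemma gnorm_parallelogram:
  assumes "smooth a" "smooth b"
  shows "(gnorm (\<lambda>x. a x + b x))\<^sup>2 + (gnorm (\<lambda>x. a x - b x))\<^sup>2 = 2 * (gnorm a)\<^sup>2 + 2 * (gnorm b)\<^sup>2"
proof -
  have "gnorm (\<lambda>x. a x + b x) = L2_norm \<Omega> (\<lambda>x. 1 *\<^sub>R grad a x + 1 *\<^sub>R grad b x)"
    "gnorm (\<lambda>x. a x - b x) = L2_norm \<Omega> (\<lambda>x. 1 *\<^sub>R grad a x + (-1) *\<^sub>R grad b x)"
    by (simp_all add: gnorm_def grad_add[OF assms, abs_def] grad_diff[OF assms, abs_def] fun_eq_iff)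
  then show ?thesis
    by (simp only: L2_norm_lin_power2[OF L2_grad[OF assms(1)] L2_grad[OF assms(2)]] gnorm_def[symmetric]) simp
qed

text \<open>Arguments \<open>a\<close> for \<open>F + G\<close> and \<open>b\<close> for
  \<open>F - G\<close> are recombined: \<open>F\<close> is evaluated at \<open>a + b\<close> and
  \<open>G\<close> at \<open>a - b\<close>, and the parallelogram law of \<open>gnorm\<close>
  accounts for the energies. The supremum is taken over \<open>a\<close> for fixed \<open>b\<close>,
  and then over \<open>b\<close>.\<close>

lemma Hm1_parallelogram_le:
  assumes F: "dual_of F f" and G: "dual_of G g"
  shows "(Hm1_norm \<Omega> (\<lambda>v. F v + G v))\<^sup>2 + (Hm1_norm \<Omega> (\<lambda>v. F v - G v))\<^sup>2 \<le> 2 * (Hm1_norm \<Omega> F)\<^sup>2 + 2 * (Hm1_norm \<Omega> G)\<^sup>2"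
proof -
  let ?n = "Hm1_norm \<Omega>"
  have dp: "dual_of (\<lambda>v. F v + G v) (\<lambda>x. f x + g x)" and dm: "dual_of (\<lambda>v. F v - G v) (\<lambda>x. f x - g x)"
    using dual_of_lin[OF F G, of 1 1] dual_of_lin[OF F G, of 1 "-1"] by simp_all
  have half: "2 * H p - (gnorm p)\<^sup>2 / 2 \<le> 2 * (?n H)\<^sup>2" if "dual_of H h" "test p" for H h p
    using Hm1_norm_test[OF that] zero_le_power2[of "2 * ?n H - gnorm p"] by (simp add: power2_diff power_mult_distrib)
  have key: "(2 * (F a + G a) - (gnorm a)\<^sup>2) + (2 * (F b - G b) - (gnorm b)\<^sup>2) \<le> 2 * (?n F)\<^sup>2 + 2 * (?n G)\<^sup>2"
    if a: "test a" and b: "test b" for a b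
  proof -
    note s = test_smooth[OF a] test_smooth[OF b]
    note L = L2_smooth[OF s(1)] L2_smooth[OF s(2)]
    have tp: "test (\<lambda>x. a x + b x)" and tm: "test (\<lambda>x. a x - b x)"
      using test_function_lin[OF a b, of 1 1] test_function_lin[OF a b, of 1 "-1"] by simp_all
    have "F (\<lambda>x. a x + b x) = F a + F b" by (rule dual_add[OF F L])
    moreover have "G (\<lambda>x. a x - b x) = G a - G b"
      using dual_add[OF G L(1) L2_lin[OF L(2) L(2), of "-1" 0]] dual_cmult[OF G L(2), of "-1"] by simp
    ultimately show ?thesis
      using half[OF F tp] half[OF G tm] gnorm_parallelogram[OF s] by simp
  qed
  have "(?n (\<lambda>v. F v + G v))\<^sup>2 \<le> 2 * (?n F)\<^sup>2 + 2 * (?n G)\<^sup>2 - (2 * (F b - G b) - (gnorm b)\<^sup>2)"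
    if "test b" for b
    by (rule Hm1_norm_sup2[OF dp]) (use key[OF _ that] in fastforce)
  then have "(?n (\<lambda>v. F v - G v))\<^sup>2 \<le> 2 * (?n F)\<^sup>2 + 2 * (?n G)\<^sup>2 - (?n (\<lambda>v. F v + G v))\<^sup>2"
    by (intro Hm1_norm_sup2[OF dm]) fastforce
  then show ?thesis by simp
qed

lemma Hm1_norm_cong: "dual_of F f \<Longrightarrow> dual_of G f \<Longrightarrow> Hm1_norm \<Omega> F = Hm1_norm \<Omega> G"
  unfolding Hm1_norm_def by (rule SUP_cong) (auto simp: dual_of_def H10_L2)

lemma Hm1_norm_scale:
  assumes F: "dual_of F f" shows "(Hm1_norm \<Omega> (\<lambda>v. t * F v))\<^sup>2 = t\<^sup>2 * (Hm1_norm \<Omega> F)\<^sup>2"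
proof -
  have le: "(Hm1_norm \<Omega> (\<lambda>v. t * F v))\<^sup>2 \<le> t\<^sup>2 * (Hm1_norm \<Omega> F)\<^sup>2" if F: "dual_of F f" for F f t
  proof -
    have d: "dual_of (\<lambda>v. t * F v) (\<lambda>x. t * f x)" using dual_of_lin[OF F F, of t 0] by simp
    have "Hm1_norm \<Omega> (\<lambda>v. t * F v) \<le> \<bar>t\<bar> * Hm1_norm \<Omega> F"
    proof (rule Hm1_norm_props(3)[OF d])
      show "0 \<le> \<bar>t\<bar> * Hm1_norm \<Omega> F" using Hm1_norm_props(1)[OF F] by simp
      fix \<phi> assume p: "test \<phi>"
      have "test (\<lambda>x. - \<phi> x)" using test_function_lin[OF p p, of "-1" 0] by simp
      then have "- F \<phi> \<le> Hm1_norm \<Omega> F * gnorm \<phi>"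
        using Hm1_norm_test[OF F, of "\<lambda>x. - \<phi> x"] gnorm_cmult[OF test_smooth[OF p], of "-1"]
          dual_cmult[OF F L2_smooth[OF test_smooth[OF p]], of "-1"] by simp
      then have "\<bar>F \<phi>\<bar> \<le> Hm1_norm \<Omega> F * gnorm \<phi>" using Hm1_norm_test[OF F p] by simp
      then have "\<bar>t\<bar> * \<bar>F \<phi>\<bar> \<le> \<bar>t\<bar> * (Hm1_norm \<Omega> F * gnorm \<phi>)" by (rule mult_left_mono) simp
      moreover have "t * F \<phi> \<le> \<bar>t\<bar> * \<bar>F \<phi>\<bar>" using abs_ge_self[of "t * F \<phi>"] by (simp add: abs_mult)
      ultimately show "t * F \<phi> \<le> \<bar>t\<bar> * Hm1_norm \<Omega> F * gnorm \<phi>" by simp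
    qed
    then have "(Hm1_norm \<Omega> (\<lambda>v. t * F v))\<^sup>2 \<le> (\<bar>t\<bar> * Hm1_norm \<Omega> F)\<^sup>2" by (intro power_mono Hm1_norm_props(1)[OF d])
    then show ?thesis by (simp add: power_mult_distrib)
  qed
  show ?thesis
  proof (cases "t = 0")
    case True
    then show ?thesis using le[OF F, of 0] by simp
  next
    case False
    have d: "dual_of (\<lambda>v. t * F v) (\<lambda>x. t * f x)" using dual_of_lin[OF F F, of t 0] by simp
    have "(Hm1_norm \<Omega> F)\<^sup>2 \<le> (1 / t)\<^sup>2 * (Hm1_norm \<Omega> (\<lambda>v. t * F v))\<^sup>2" using le[OF d, of "1 / t"] False by simp
    then have "t\<^sup>2 * (Hm1_norm \<Omega> F)\<^sup>2 \<le> (Hm1_norm \<Omega> (\<lambda>v. t * F v))\<^sup>2" using False by (simp add: power_divide field_simps)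
    then show ?thesis using le[OF F, of t] by simp
  qed
qed

text \<open>The reverse inequality is the same one for \<open>F + G\<close> and
  \<open>F - G\<close>, whose sum and difference are \<open>2 F\<close> and
  \<open>2 G\<close>.\<close>

lemma Hm1_parallelogram:
  assumes F: "dual_of F f" and G: "dual_of G g"
  shows "(Hm1_norm \<Omega> (\<lambda>v. F v + G v))\<^sup>2 + (Hm1_norm \<Omega> (\<lambda>v. F v - G v))\<^sup>2 = 2 * (Hm1_norm \<Omega> F)\<^sup>2 + 2 * (Hm1_norm \<Omega> G)\<^sup>2"
proof (rule antisym[OF Hm1_parallelogram_le[OF F G]])
  have dp: "dual_of (\<lambda>v. F v + G v) (\<lambda>x. f x + g x)" and dm: "dual_of (\<lambda>v. F v - G v) (\<lambda>x. f x - g x)"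
    using dual_of_lin[OF F G, of 1 1] dual_of_lin[OF F G, of 1 "-1"] by simp_all
  have "(\<lambda>v. (F v + G v) + (F v - G v)) = (\<lambda>v. 2 * F v)" "(\<lambda>v. (F v + G v) - (F v - G v)) = (\<lambda>v. 2 * G v)" by auto
  then show "2 * (Hm1_norm \<Omega> F)\<^sup>2 + 2 * (Hm1_norm \<Omega> G)\<^sup>2 \<le> (Hm1_norm \<Omega> (\<lambda>v. F v + G v))\<^sup>2 + (Hm1_norm \<Omega> (\<lambda>v. F v - G v))\<^sup>2"
    using Hm1_parallelogram_le[OF dp dm] Hm1_norm_scale[OF F, of 2] Hm1_norm_scale[OF G, of 2] by simp
qed

end

subsection \<open>Polarization\<close>

text \<open>Cauchy's functional equation: after subtraction of \<open>t * f 1\<close> the function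
  vanishes at the integers, hence is periodic and bounded on the whole line; a bounded additive
  function is zero.\<close>

lemma additive_bounded_linear:
  fixes f :: "real \<Rightarrow> real"
  assumes add: "\<And>s t. f (s + t) = f s + f t" and bdd: "\<And>t. \<bar>t\<bar> \<le> 1 \<Longrightarrow> \<bar>f t\<bar> \<le> K"
  shows "f t = t * f 1"
proof -
  define g where "g t = f t - t * f 1" for t
  have ga: "g (s + t) = g s + g t" for s t by (simp add: g_def add algebra_simps)
  have g0: "g 0 = 0" using ga[of 0 0] by simp
  have gn: "g (real n * t) = real n * g t" for n t
    by (induction n) (simp_all add: g0 ga distrib_right)
  have g1: "g 1 = 0" by (simp add: g_def)
  have gm: "g (- t) = - g t" for t using ga[of t "- t"] g0 by simp
  have gi: "g (of_int k) = 0" for k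
  proof (cases k)
    case (nonneg n)
    then show ?thesis using gn[of n 1] g1 by simp
  next
    case (neg n)
    then show ?thesis using gn[of "Suc n" 1] g1 gm[of "real (Suc n)"] by simp
  qed
  have gb: "\<bar>g t\<bar> \<le> K + \<bar>f 1\<bar>" for t
  proof -
    have "g t = g (frac t + of_int \<lfloor>t\<rfloor>)" by (simp add: frac_def)
    then have "g t = g (frac t)" using ga[of "frac t" "of_int \<lfloor>t\<rfloor>"] gi by simp
    moreover have fr: "\<bar>frac t\<bar> \<le> 1" using frac_ge_0[of t] frac_lt_1[of t] by simp
    have "\<bar>g (frac t)\<bar> \<le> \<bar>f (frac t)\<bar> + \<bar>frac t * f 1\<bar>" unfolding g_def by (rule abs_triangle_ineq4)
    moreover have "\<bar>frac t * f 1\<bar> \<le> 1 * \<bar>f 1\<bar>" unfolding abs_mult by (rule mult_right_mono[OF fr]) simp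
    ultimately show ?thesis using bdd[OF fr] by simp
  qed
  have "g t = 0"
  proof (rule ccontr)
    assume "g t \<noteq> 0"
    then obtain n :: nat where "real n * \<bar>g t\<bar> > K + \<bar>f 1\<bar>" using reals_Archimedean3[of "\<bar>g t\<bar>"] by auto
    then show False using gb[of "real n * t"] by (simp add: gn abs_mult)
  qed
  then show ?thesis by (simp add: g_def)
qed

text \<open>The parallelogram law makes the polarization additive. Real homogeneity then needs only
  boundedness for \<open>\<bar>t\<bar> \<le> 1\<close>, which follows from the parallelogram law and
  nonnegativity of \<open>Q\<close>.\<close>

lemma jordan_von_neumann:
  fixes Q :: "('i \<Rightarrow> real) \<Rightarrow> real"
  assumes par: "\<And>x y. Q (\<lambda>i. x i + y i) + Q (\<lambda>i. x i - y i) = 2 * Q x + 2 * Q y"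
    and scale: "\<And>t x. Q (\<lambda>i. t * x i) = t\<^sup>2 * Q x" and nonneg: "\<And>x. 0 \<le> Q x"
    and J: "finite J"
  defines "B \<equiv> \<lambda>x y. (Q (\<lambda>i. x i + y i) - Q (\<lambda>i. x i - y i)) / 4"
  assumes x: "\<And>i. i \<notin> J \<Longrightarrow> x i = 0"
  shows "Q x = (\<Sum>i\<in>J. \<Sum>j\<in>J. x i * x j * B (indicator {i}) (indicator {j}))"
proof -
  have Q0: "Q (\<lambda>i. 0) = 0" using scale[of 0 "\<lambda>_. 0"] by simp
  have Qm: "Q (\<lambda>i. y i - x i) = Q (\<lambda>i. x i - y i)" for x y using scale[of "-1" "\<lambda>i. x i - y i"] by simp
  have Bsym: "B x y = B y x" for x y
  proof -
    have "Q (\<lambda>i. x i + y i) = Q (\<lambda>i. y i + x i)" by (rule arg_cong[where f=Q]) (simp add: fun_eq_iff)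
    then show ?thesis unfolding B_def by (simp only: Qm[of x y])
  qed
  have Bdiag: "B x x = Q x" for x
  proof -
    have "(\<lambda>i. x i + x i) = (\<lambda>i. 2 * x i)" "(\<lambda>i. x i - x i) = (\<lambda>i. 0)" by (simp_all add: fun_eq_iff)
    then show ?thesis unfolding B_def using scale[of 2 x] Q0 by simp
  qed
  have B2: "B x z + B y z = B (\<lambda>i. x i + y i) (\<lambda>i. 2 * z i) / 2" for x y z
  proof -
    have "Q (\<lambda>i. x i + z i) + Q (\<lambda>i. y i + z i) = (Q (\<lambda>i. x i + y i + 2 * z i) + Q (\<lambda>i. x i - y i)) / 2"
    proof -
      have "(\<lambda>i. x i + z i + (y i + z i)) = (\<lambda>i. x i + y i + 2 * z i)"
        "(\<lambda>i. x i + z i - (y i + z i)) = (\<lambda>i. x i - y i)" by (simp_all add: fun_eq_iff)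
      then show ?thesis using par[of "\<lambda>i. x i + z i" "\<lambda>i. y i + z i"] by simp
    qed
    moreover have "Q (\<lambda>i. x i - z i) + Q (\<lambda>i. y i - z i) = (Q (\<lambda>i. x i + y i - 2 * z i) + Q (\<lambda>i. x i - y i)) / 2"
    proof -
      have "(\<lambda>i. x i - z i + (y i - z i)) = (\<lambda>i. x i + y i - 2 * z i)"
        "(\<lambda>i. x i - z i - (y i - z i)) = (\<lambda>i. x i - y i)" by (simp_all add: fun_eq_iff)
      then show ?thesis using par[of "\<lambda>i. x i - z i" "\<lambda>i. y i - z i"] by simp
    qed
    ultimately show ?thesis by (simp add: B_def field_simps)
  qed
  have B0: "B (\<lambda>i. 0) z = 0" for z using scale[of "-1" z] by (simp add: B_def)
  \<comment> \<open>With the second summand zero \<open>B2\<close> reads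
    \<open>B x z = B x (2 z) / 2\<close>; for \<open>x + y\<close> in place of \<open>x\<close> this
    is the right-hand side of \<open>B2\<close>.\<close>
  have Badd: "B (\<lambda>i. x i + y i) z = B x z + B y z" for x y z
    using B2[of "\<lambda>i. x i + y i" z "\<lambda>i. 0"] B2[of x z y] by (simp add: B0)
  have Bscale: "B (\<lambda>i. t * x i) z = t * B x z" for t x z
  proof -
    have "B (\<lambda>i. t * x i) z = t * B (\<lambda>i. 1 * x i) z"
    proof (rule additive_bounded_linear[where K="(Q x + Q z) / 2"])
      show "B (\<lambda>i. (s + t) * x i) z = B (\<lambda>i. s * x i) z + B (\<lambda>i. t * x i) z" for s t
        using Badd[of "\<lambda>i. s * x i" "\<lambda>i. t * x i" z] by (simp add: distrib_right)
      fix t :: real assume t: "\<bar>t\<bar> \<le> 1"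
      have "t\<^sup>2 * Q x \<le> 1 * Q x" using t by (intro mult_right_mono nonneg) (simp add: abs_square_le_1)
      then have "Q (\<lambda>i. t * x i + z i) + Q (\<lambda>i. t * x i - z i) \<le> 2 * Q x + 2 * Q z"
        using par[of "\<lambda>i. t * x i" z] scale[of t x] by simp
      then show "\<bar>B (\<lambda>i. t * x i) z\<bar> \<le> (Q x + Q z) / 2"
        using nonneg[of "\<lambda>i. t * x i + z i"] nonneg[of "\<lambda>i. t * x i - z i"] by (simp add: B_def)
    qed
    then show ?thesis by simp
  qed
  have Bsum: "B (\<lambda>k. \<Sum>i\<in>A. c i * e i k) z = (\<Sum>i\<in>A. c i * B (e i) z)" if "finite A" for A c z and e :: "'i \<Rightarrow> 'i \<Rightarrow> real"
    using that by (induction A rule: finite_induct) (simp_all add: B0 Badd Bscale)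
  have rep: "x = (\<lambda>k. \<Sum>i\<in>J. x i * indicator {i} k)"
  proof
    fix k
    have "(\<Sum>i\<in>J. x i * indicator {i} k) = (\<Sum>i\<in>J. if i = k then x k else 0)"
      by (intro sum.cong) (auto simp: indicator_def)
    then show "x k = (\<Sum>i\<in>J. x i * indicator {i} k)" using J x[of k] by simp
  qed
  have "Q x = B x x" by (simp add: Bdiag)
  also have "... = (\<Sum>i\<in>J. x i * B (indicator {i}) x)"
    by (subst rep, subst Bsum[OF J], rule refl)
  also have "... = (\<Sum>i\<in>J. x i * (\<Sum>j\<in>J. x j * B (indicator {j}) (indicator {i})))"
  proof (rule sum.cong[OF refl])
    fix i
    have "B (indicator {i}) x = B x (indicator {i})" by (rule Bsym)
    also have "... = (\<Sum>j\<in>J. x j * B (indicator {j}) (indicator {i}))"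
      by (subst rep, subst Bsum[OF J], rule refl)
    finally show "x i * B (indicator {i}) x = x i * (\<Sum>j\<in>J. x j * B (indicator {j}) (indicator {i}))" by simp
  qed
  also have "... = (\<Sum>i\<in>J. \<Sum>j\<in>J. x i * x j * B (indicator {i}) (indicator {j}))"
    by (simp add: sum_distrib_left mult.assoc Bsym)
  finally show ?thesis .
qed

context bounded_domain
begin

lemma dual_of_L2_functional: "L2 \<Omega> f \<Longrightarrow> dual_of (L2_functional \<Omega> f) f"
  by (simp add: dual_of_def L2_functional_def)

text \<open>\<open>Hm1_inner\<close> is given by polarization only, so that the quadratic form of
  the Gram matrix is the squared dual norm has to be derived from the parallelogram law. It is
  applied to the coefficients, not to the functionals, which are linear on \<open>L2\<close>
  arguments only.\<close>

lemma Hm1_inner_gram: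
  assumes J: "finite J" and L: "\<And>i. i \<in> J \<Longrightarrow> L2 \<Omega> (f i)"
  shows "(Hm1_norm \<Omega> (L2_functional \<Omega> (\<lambda>x. \<Sum>i\<in>J. c i * f i x)))\<^sup>2
    = (\<Sum>i\<in>J. \<Sum>j\<in>J. c i * c j * Hm1_inner \<Omega> (L2_functional \<Omega> (f i)) (L2_functional \<Omega> (f j)))"
proof -
  define u where "u c = (\<lambda>x. \<Sum>i\<in>J. c i * f i x)" for c :: "'b \<Rightarrow> real"
  define Q where "Q c = (Hm1_norm \<Omega> (L2_functional \<Omega> (u c)))\<^sup>2" for c
  define F where "F c = L2_functional \<Omega> (u c)" for c
  have Lu: "L2 \<Omega> (u c)" for c
    unfolding u_def by (intro L2_sum) (use L2_lin[OF L L, of _ _ _ 0] in simp)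
  have d: "dual_of (F c) (u c)" for c unfolding F_def by (rule dual_of_L2_functional[OF Lu])
  have uadd: "u (\<lambda>i. a i + b i) = (\<lambda>x. u a x + u b x)" for a b by (simp add: u_def fun_eq_iff distrib_right sum.distrib)
  have udiff: "u (\<lambda>i. a i - b i) = (\<lambda>x. u a x - u b x)" for a b by (simp add: u_def fun_eq_iff left_diff_distrib sum_subtractf)
  have uscale: "u (\<lambda>i. t * a i) = (\<lambda>x. t * u a x)" for t a by (simp add: u_def fun_eq_iff sum_distrib_left mult.assoc)
  have dadd: "dual_of (\<lambda>v. F a v + F b v) (u (\<lambda>i. a i + b i))" for a b
    using dual_of_lin[OF d[of a] d[of b], of 1 1] by (simp add: uadd)
  have ddiff: "dual_of (\<lambda>v. F a v - F b v) (u (\<lambda>i. a i - b i))" for a b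
    using dual_of_lin[OF d[of a] d[of b], of 1 "-1"] by (simp add: udiff)
  have dscale: "dual_of (\<lambda>v. t * F a v) (u (\<lambda>i. t * a i))" for t a
    using dual_of_lin[OF d[of a] d[of a], of t 0] by (simp add: uscale)
  have Qadd: "Q (\<lambda>i. a i + b i) = (Hm1_norm \<Omega> (\<lambda>v. F a v + F b v))\<^sup>2" for a b
    unfolding Q_def using Hm1_norm_cong[OF d[unfolded F_def] dadd] by simp
  have Qdiff: "Q (\<lambda>i. a i - b i) = (Hm1_norm \<Omega> (\<lambda>v. F a v - F b v))\<^sup>2" for a b
    unfolding Q_def using Hm1_norm_cong[OF d[unfolded F_def] ddiff] by simp
  have Qscale: "Q (\<lambda>i. t * a i) = (Hm1_norm \<Omega> (\<lambda>v. t * F a v))\<^sup>2" for a t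
    unfolding Q_def using Hm1_norm_cong[OF d[unfolded F_def] dscale] by simp
  have QF: "Q a = (Hm1_norm \<Omega> (F a))\<^sup>2" for a by (simp add: Q_def F_def)
  \<comment> \<open>The expansion requires coefficients that vanish off \<open>J\<close>; the
    function \<open>u\<close> ignores them there.\<close>
  define c' where "c' i = (if i \<in> J then c i else 0)" for i
  have uc: "u c = u c'" by (simp add: u_def c'_def fun_eq_iff)
  have uf: "u (indicator {i}) = f i" if "i \<in> J" for i
  proof
    fix x
    have "u (indicator {i}) x = (\<Sum>j\<in>J. if j = i then f i x else 0)"
      unfolding u_def by (intro sum.cong) (auto simp: indicator_def)
    then show "u (indicator {i}) x = f i x" using J that by simp
  qed
  have "Q c' = (\<Sum>i\<in>J. \<Sum>j\<in>J. c' i * c' j *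
      ((Q (\<lambda>k. indicator {i} k + indicator {j} k) - Q (\<lambda>k. indicator {i} k - indicator {j} k)) / 4))"
  proof (rule jordan_von_neumann)
    show "Q (\<lambda>i. x i + y i) + Q (\<lambda>i. x i - y i) = 2 * Q x + 2 * Q y" for x y
      unfolding Qadd Qdiff QF by (rule Hm1_parallelogram[OF d d])
    show "Q (\<lambda>i. t * x i) = t\<^sup>2 * Q x" for t x unfolding Qscale QF by (rule Hm1_norm_scale[OF d])
    show "0 \<le> Q x" for x by (simp add: Q_def)
  qed (simp_all add: J c'_def)
  also have "... = (\<Sum>i\<in>J. \<Sum>j\<in>J. c i * c j * Hm1_inner \<Omega> (L2_functional \<Omega> (f i)) (L2_functional \<Omega> (f j)))"
    by (intro sum.cong refl) (simp add: c'_def Hm1_inner_def Qadd Qdiff F_def uf)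
  finally show ?thesis by (simp add: Q_def uc[symmetric]) (simp add: u_def)
qed

lemma Hm1_inner_commute:
  assumes "L2 \<Omega> f" "L2 \<Omega> g"
  shows "Hm1_inner \<Omega> (L2_functional \<Omega> f) (L2_functional \<Omega> g) = Hm1_inner \<Omega> (L2_functional \<Omega> g) (L2_functional \<Omega> f)"
proof -
  let ?F = "L2_functional \<Omega> f" and ?G = "L2_functional \<Omega> g"
  note d = dual_of_L2_functional[OF assms(1)] dual_of_L2_functional[OF assms(2)]
  have "(Hm1_norm \<Omega> (\<lambda>v. ?G v - ?F v))\<^sup>2 = (Hm1_norm \<Omega> (\<lambda>v. ?F v - ?G v))\<^sup>2"
    using Hm1_norm_scale[OF dual_of_lin[OF d, of 1 "-1"], of "-1"] by simp
  then show ?thesis by (simp add: Hm1_inner_def add.commute)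
qed

subsection \<open>Weak divergence\<close>

lemma has_weak_div_bound:
  assumes "has_weak_div \<Omega> \<sigma> f"
  shows "Hm1_norm \<Omega> (L2_functional \<Omega> f) \<le> L2_norm \<Omega> \<sigma>"
proof (rule Hm1_norm_props(3)[OF dual_of_L2_functional])
  show "L2 \<Omega> f" using assms by (simp add: has_weak_div_def)
  show "0 \<le> L2_norm \<Omega> \<sigma>" by (rule L2_norm_ge_0)
  fix \<phi> assume t: "test \<phi>"
  have "L2_functional \<Omega> f \<phi> = - I (\<lambda>x. \<sigma> x \<bullet> grad \<phi> x)"
    using assms t by (simp add: has_weak_div_def L2_functional_def)
  also have "... \<le> L2_norm \<Omega> \<sigma> * gnorm \<phi>"
    using L2_Cauchy_Schwarz[of \<sigma> "grad \<phi>"] assms L2_grad[OF test_smooth[OF t]]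
    unfolding gnorm_def has_weak_div_def by (simp add: abs_le_iff)
  finally show "L2_functional \<Omega> f \<phi> \<le> L2_norm \<Omega> \<sigma> * gnorm \<phi>" .
qed

lemma has_weak_div_sum:
  assumes "finite J" "\<And>i. i \<in> J \<Longrightarrow> has_weak_div \<Omega> (\<sigma> i) (d i)"
  shows "has_weak_div \<Omega> (\<lambda>x. \<Sum>i\<in>J. c i *\<^sub>R \<sigma> i x) (\<lambda>x. \<Sum>i\<in>J. c i * d i x)"
  unfolding has_weak_div_def
proof (intro conjI allI impI)
  have L: "L2 \<Omega> (\<sigma> i)" "L2 \<Omega> (d i)" if "i \<in> J" for i using assms(2)[OF that] by (simp_all add: has_weak_div_def)
  show "L2 \<Omega> (\<lambda>x. \<Sum>i\<in>J. c i *\<^sub>R \<sigma> i x)"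
    by (intro L2_sum) (use L2_lin[OF L(1) L(1), of _ _ _ 0] in simp)
  show "L2 \<Omega> (\<lambda>x. \<Sum>i\<in>J. c i * d i x)"
    by (intro L2_sum) (use L2_lin[OF L(2) L(2), of _ _ _ 0] in simp)
  fix \<phi> assume t: "test \<phi>"
  note s = test_smooth[OF t]
  have "I (\<lambda>x. (\<Sum>i\<in>J. c i *\<^sub>R \<sigma> i x) \<bullet> grad \<phi> x) = (\<Sum>i\<in>J. c i * I (\<lambda>x. \<sigma> i x \<bullet> grad \<phi> x))"
    unfolding inner_sum_left inner_scaleR_left
    by (subst LINT_sum) (simp_all add: L2_inner_integrable L L2_grad[OF s])
  also have "... = (\<Sum>i\<in>J. c i * - I (\<lambda>x. d i x * \<phi> x))"
    using assms(2) t by (intro sum.cong refl) (simp add: has_weak_div_def)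
  also have "... = - (\<Sum>i\<in>J. c i * I (\<lambda>x. d i x * \<phi> x))" by (simp add: sum_negf)
  also have "(\<Sum>i\<in>J. c i * I (\<lambda>x. d i x * \<phi> x)) = I (\<lambda>x. (\<Sum>i\<in>J. c i * d i x) * \<phi> x)"
    unfolding sum_distrib_right mult.assoc
    by (subst LINT_sum) (simp_all add: L2_mult_integrable L L2_smooth[OF s])
  finally show "I (\<lambda>x. (\<Sum>i\<in>J. c i *\<^sub>R \<sigma> i x) \<bullet> grad \<phi> x) = - I (\<lambda>x. (\<Sum>i\<in>J. c i * d i x) * \<phi> x)" .
qed

end

section \<open>Barycentric coordinates\<close>

definition vert :: "'a::euclidean_space set \<Rightarrow> 'a set" where
  "vert T = {v. v extreme_point_of closure T}"

text \<open>The choice is unique because the vertices are affinely independent, and it is made for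
  every point of the space: the coordinates are globally affine and may be negative.\<close>

definition bary :: "'a::euclidean_space set \<Rightarrow> 'a \<Rightarrow> 'a \<Rightarrow> real" where
  "bary T v x = (SOME u. sum u (vert T) = 1 \<and> (\<Sum>v\<in>vert T. u v *\<^sub>R v) = x) v"

text \<open>The adjoint of a linear functional, evaluated at 1, is the vector that represents the
  functional by the inner product.\<close>

definition bgrad :: "'a::euclidean_space set \<Rightarrow> 'a \<Rightarrow> 'a" where
  "bgrad T v = adjoint (\<lambda>x. bary T v x - bary T v 0) 1"

text \<open>The relatively open facet in coordinates; \<open>is_facet_iff\<close> shows that these
  are exactly the facets of the statement.\<close>

definition opp_facet :: "'a::euclidean_space set \<Rightarrow> 'a \<Rightarrow> 'a set" where
  "opp_facet T p = {x. bary T p x = 0 \<and> (\<forall>v\<in>vert T - {p}. 0 < bary T v x)}"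

locale osimplex =
  fixes T :: "'a::euclidean_space set"
  assumes osimplex: "open_simplex T"
begin

abbreviation V where "V \<equiv> vert T"
abbreviation lam where "lam \<equiv> bary T"
abbreviation gl where "gl \<equiv> bgrad T"

lemma vert_props: "finite V" "card V = Suc DIM('a)" "\<not> affine_dependent V" "closure T = convex hull V"
    "T = interior (convex hull V)" "affine hull V = UNIV" "T \<noteq> {}"
proof -
  obtain C where C: "\<not> affine_dependent C" "int (card C) = int DIM('a) + 1" "T = interior (convex hull C)"
    using osimplex unfolding open_simplex_def simplex_def by auto
  have cC: "card C = Suc DIM('a)" using C(2) by linarith
  have aff: "affine hull C = UNIV" by (rule affine_independent_span_eq[OF C(1) cC])
  have fin: "finite C" by (rule aff_independent_finite[OF C(1)])
  have "rel_interior (convex hull C) = interior (convex hull C)"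
    by (rule rel_interior_interior) (simp add: aff)
  moreover have "rel_interior (convex hull C) \<noteq> {}"
    using cC by (subst rel_interior_eq_empty) auto
  ultimately have ne: "interior (convex hull C) \<noteq> {}" by simp
  have cl: "closure T = convex hull C"
    unfolding C(3) convex_closure_interior[OF convex_convex_hull ne]
    by (rule closure_closed[OF compact_imp_closed[OF finite_imp_compact_convex_hull[OF fin]]])
  have VC: "V = C"
    unfolding vert_def cl extreme_point_of_convex_hull_affine_independent[OF C(1)] by simp
  show "finite V" "card V = Suc DIM('a)" "\<not> affine_dependent V" "closure T = convex hull V"
    "T = interior (convex hull V)" "affine hull V = UNIV" "T \<noteq> {}"
    using fin cC C cl aff ne VC by simp_all
qed

lemma finV: "finite V" by (rule vert_props(1))

lemma bary_props: "(\<Sum>v\<in>V. lam v x) = 1" "(\<Sum>v\<in>V. lam v x *\<^sub>R v) = x"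
proof -
  have "x \<in> affine hull V" by (simp add: vert_props(6))
  then have "\<exists>u. sum u V = 1 \<and> (\<Sum>v\<in>V. u v *\<^sub>R v) = x" unfolding affine_hull_finite[OF finV] by blast
  from someI_ex[OF this] show "(\<Sum>v\<in>V. lam v x) = 1" "(\<Sum>v\<in>V. lam v x *\<^sub>R v) = x"
    by (simp_all add: bary_def)
qed

lemma bary_unique:
  assumes "sum u V = 1" "(\<Sum>v\<in>V. u v *\<^sub>R v) = x" "v \<in> V"
  shows "lam v x = u v"
proof (rule ccontr)
  assume ne: "lam v x \<noteq> u v"
  have "sum (\<lambda>w. lam w x - u w) V = 0" using assms(1) bary_props(1)[of x] by (simp add: sum_subtractf)
  moreover have "(\<Sum>w\<in>V. (lam w x - u w) *\<^sub>R w) = 0"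
    using assms(2) bary_props(2)[of x] by (simp add: scaleR_left_diff_distrib sum_subtractf)
  ultimately have "affine_dependent V"
    unfolding affine_dependent_explicit_finite[OF finV] using ne assms(3)
    by (intro exI[of _ "\<lambda>w. lam w x - u w"]) auto
  then show False using vert_props(3) by blast
qed

text \<open>Three points, so that one identity yields additivity (coefficients 1, 1, -1 with the
  origin) as well as homogeneity of the linear part.\<close>

lemma bary_lin:
  assumes "v \<in> V" "a + b + c = 1"
  shows "lam v (a *\<^sub>R x + b *\<^sub>R y + c *\<^sub>R z) = a * lam v x + b * lam v y + c * lam v z"
proof (rule bary_unique[OF _ _ assms(1)])
  show "(\<Sum>v\<in>V. a * lam v x + b * lam v y + c * lam v z) = 1"
    using assms(2) by (simp add: sum.distrib sum_distrib_left[symmetric] bary_props)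
  have "(\<Sum>v\<in>V. (a * lam v x + b * lam v y + c * lam v z) *\<^sub>R v)
    = a *\<^sub>R (\<Sum>v\<in>V. lam v x *\<^sub>R v) + b *\<^sub>R (\<Sum>v\<in>V. lam v y *\<^sub>R v) + c *\<^sub>R (\<Sum>v\<in>V. lam v z *\<^sub>R v)"
    by (simp add: scaleR_add_left sum.distrib scaleR_sum_right)
  then show "(\<Sum>v\<in>V. (a * lam v x + b * lam v y + c * lam v z) *\<^sub>R v) = a *\<^sub>R x + b *\<^sub>R y + c *\<^sub>R z"
    by (simp add: bary_props)
qed

lemma bary_grad:
  assumes v: "v \<in> V"
  shows "lam v x = lam v y + gl v \<bullet> (x - y)"
proof -
  let ?f = "\<lambda>x. lam v x - lam v 0"
  have "linear ?f"
  proof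
    show "?f (x + y) = ?f x + ?f y" for x y
      using bary_lin[OF v, of 1 1 "-1" x y 0] by simp
    show "?f (r *\<^sub>R x) = r *\<^sub>R ?f x" for r x
      using bary_lin[OF v, of r "1 - r" 0 x 0 0] by (simp add: algebra_simps)
  qed
  then have "gl v \<bullet> z = ?f z" for z
    unfolding bgrad_def using adjoint_works[of ?f z 1] by (simp add: inner_commute)
  from this[of x] this[of y] show ?thesis by (simp add: inner_diff_right)
qed

lemma bary_vertex: "v \<in> V \<Longrightarrow> w \<in> V \<Longrightarrow> lam v w = (if v = w then 1 else 0)"
proof (rule bary_unique[where u="\<lambda>v. if v = w then 1 else 0"])
  assume "w \<in> V"
  then show "(\<Sum>v\<in>V. if v = w then 1 else 0) = (1::real)" using finV by simp
  have "(\<Sum>v\<in>V. (if v = w then 1 else 0) *\<^sub>R v) = (\<Sum>v\<in>V. if v = w then w else 0)"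
    by (rule sum.cong) auto
  then show "(\<Sum>v\<in>V. (if v = w then 1 else 0) *\<^sub>R v) = w" using \<open>w \<in> V\<close> finV by simp
qed

lemma V_ge2: "2 \<le> card V" using vert_props(2) by (simp add: Suc_le_eq)

lemma other_vertex: obtains w where "w \<in> V" "w \<noteq> v"
proof -
  have "\<not> V \<subseteq> {v}" using V_ge2 card_mono[of "{v}" V] by auto
  then show ?thesis using that by blast
qed

lemma mem_closure: "x \<in> closure T \<longleftrightarrow> (\<forall>v\<in>V. 0 \<le> lam v x)"
proof
  assume "x \<in> closure T"
  then obtain u where u: "\<forall>v\<in>V. 0 \<le> u v" "sum u V = 1" "(\<Sum>v\<in>V. u v *\<^sub>R v) = x"
    unfolding vert_props(4) convex_hull_finite[OF finV] by blast
  then show "\<forall>v\<in>V. 0 \<le> lam v x" by (simp add: bary_unique[OF u(2,3)])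
next
  assume "\<forall>v\<in>V. 0 \<le> lam v x"
  then show "x \<in> closure T" unfolding vert_props(4) convex_hull_finite[OF finV] mem_Collect_eq
    by (intro exI[of _ "\<lambda>v. lam v x"] conjI bary_props)
qed

lemma mem_T: "x \<in> T \<longleftrightarrow> (\<forall>v\<in>V. 0 < lam v x)"
proof -
  have "interior (convex hull V) = rel_interior (convex hull V)"
    by (rule rel_interior_interior[symmetric]) (simp add: vert_props(6))
  then have T: "T = {y. \<exists>u. (\<forall>x \<in> V. 0 < u x) \<and> sum u V = 1 \<and> sum (\<lambda>x. u x *\<^sub>R x) V = y}"
    using vert_props(5) rel_interior_convex_hull_explicit[OF vert_props(3)] by simp
  show ?thesis
  proof
    assume "x \<in> T"
    then obtain u where u: "\<forall>v\<in>V. 0 < u v" "sum u V = 1" "(\<Sum>v\<in>V. u v *\<^sub>R v) = x" using T by auto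
    then show "\<forall>v\<in>V. 0 < lam v x" by (simp add: bary_unique[OF u(2,3)])
  next
    assume "\<forall>v\<in>V. 0 < lam v x"
    then have "x \<in> {y. \<exists>u. (\<forall>x \<in> V. 0 < u x) \<and> sum u V = 1 \<and> sum (\<lambda>x. u x *\<^sub>R x) V = y}"
      unfolding mem_Collect_eq by (intro exI[of _ "\<lambda>v. lam v x"] conjI bary_props)
    then show "x \<in> T" by (subst T)
  qed
qed

lemma open_T: "open T" using vert_props(5) open_interior by metis

lemma vertex_in_closure: "v \<in> V \<Longrightarrow> v \<in> closure T" by (simp add: mem_closure bary_vertex)

lemma T_subset_closure: "T \<subseteq> closure T" by (rule closure_subset)

lemma bounded_T: "bounded T" and bounded_closure_T: "bounded (closure T)"
proof -
  show "bounded (closure T)" unfolding vert_props(4)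
    by (intro compact_imp_bounded finite_imp_compact_convex_hull finV)
  then show "bounded T" by (rule bounded_subset[OF _ T_subset_closure])
qed

lemma bary_le_1: "x \<in> closure T \<Longrightarrow> v \<in> V \<Longrightarrow> lam v x \<le> 1"
proof -
  assume x: "x \<in> closure T" and v: "v \<in> V"
  have "lam v x \<le> (\<Sum>v\<in>V. lam v x)"
  proof (rule member_le_sum[OF v])
    have all: "\<forall>w\<in>V. 0 \<le> lam w x" using x by (simp only: mem_closure)
    show "0 \<le> lam w x" if "w \<in> V - {v}" for w using all that by (simp only: Diff_iff)
  qed (rule finV)
  then show ?thesis by (simp only: bary_props(1))
qed

lemma continuous_bary: "v \<in> V \<Longrightarrow> continuous_on UNIV (lam v)"
proof -
  assume "v \<in> V"
  then have "lam v x = lam v 0 + gl v \<bullet> x" for x using bary_grad[of v x 0] by (simp only: diff_zero)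
  then have "lam v = (\<lambda>x. lam v 0 + gl v \<bullet> x)" by (intro ext)
  moreover have "continuous_on UNIV (\<lambda>x. lam v 0 + gl v \<bullet> x)" by (intro continuous_intros)
  ultimately show ?thesis by (simp only:)
qed

lemma dist_le_diameter: "x \<in> closure T \<Longrightarrow> y \<in> closure T \<Longrightarrow> norm (x - y) \<le> diameter T"
  using diameter_bounded_bound[OF bounded_closure_T] diameter_closure[OF bounded_T] by (metis dist_norm)

lemma bgrad_nonzero: "v \<in> V \<Longrightarrow> gl v \<noteq> 0"
proof
  assume v: "v \<in> V" "gl v = 0"
  obtain w where "w \<in> V" "w \<noteq> v" using other_vertex by blast
  then show False using bary_grad[OF v(1), of v w] bary_vertex v by auto
qed

lemma sum_bgrad: "(\<Sum>v\<in>V. gl v) = 0"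
proof -
  let ?s = "\<Sum>v\<in>V. gl v"
  have "(\<Sum>v\<in>V. lam v ?s) = (\<Sum>v\<in>V. lam v 0 + gl v \<bullet> ?s)"
    by (rule sum.cong[OF refl]) (use bary_grad[of _ ?s 0] in simp)
  then have "?s \<bullet> ?s = 0" by (simp add: sum.distrib bary_props inner_sum_left)
  then show ?thesis by simp
qed

lemma diameter_pos: "0 < diameter T"
proof -
  obtain v where v: "v \<in> V" using V_ge2 by (metis all_not_in_conv card.empty not_numeral_le_zero)
  obtain w where w: "w \<in> V" "w \<noteq> v" using other_vertex by blast
  have "0 < norm (w - v)" using w by simp
  also have "... \<le> diameter T" using v w by (intro dist_le_diameter vertex_in_closure)
  finally show ?thesis .
qed

lemma bgrad_diameter: "v \<in> V \<Longrightarrow> 1 \<le> norm (gl v) * diameter T"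
proof -
  assume v: "v \<in> V"
  obtain w where w: "w \<in> V" "w \<noteq> v" using other_vertex by blast
  have "1 = gl v \<bullet> (v - w)" using bary_grad[OF v, of v w] bary_vertex v w by simp
  also have "... \<le> norm (gl v) * norm (v - w)" by (rule norm_cauchy_schwarz)
  also have "... \<le> norm (gl v) * diameter T" by (intro mult_left_mono dist_le_diameter vertex_in_closure v w) simp
  finally show ?thesis .
qed

lemma bary_eq_by_vertices:
  assumes "\<And>x. f x = f 0 + g \<bullet> x"
  shows "f x = (\<Sum>v\<in>V. lam v x * f v)"
proof -
  have "f x = f 0 + g \<bullet> (\<Sum>v\<in>V. lam v x *\<^sub>R v)" using assms[of x] by (simp add: bary_props)
  also have "... = (\<Sum>v\<in>V. lam v x) * f 0 + (\<Sum>v\<in>V. lam v x * (g \<bullet> v))"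
    unfolding inner_sum_right inner_scaleR_right by (simp add: bary_props(1))
  also have "... = (\<Sum>v\<in>V. lam v x * f v)"
  proof -
    have "lam v x * f v = lam v x * f 0 + lam v x * (g \<bullet> v)" for v by (subst assms[of v]) (rule distrib_left)
    then show ?thesis by (simp add: sum.distrib sum_distrib_right)
  qed
  finally show ?thesis .
qed

subsection \<open>Facets\<close>

lemma facet_coeffs:
  assumes p: "p \<in> V"
  shows "\<lbrakk>sum u (V - {p}) = 1; v \<in> V\<rbrakk> \<Longrightarrow> lam v (\<Sum>v\<in>V - {p}. u v *\<^sub>R v) = (if v = p then 0 else u v)"
    and "lam p x = 0 \<Longrightarrow> (\<Sum>v\<in>V - {p}. lam v x) = 1 \<and> (\<Sum>v\<in>V - {p}. lam v x *\<^sub>R v) = x"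
proof -
  have ins: "sum u V = u p + sum u (V - {p})" for u :: "'a \<Rightarrow> real" using sum.remove[OF finV p] .
  have insv: "sum u V = u p + sum u (V - {p})" for u :: "'a \<Rightarrow> 'a" using sum.remove[OF finV p] .
  show "lam v (\<Sum>v\<in>V - {p}. u v *\<^sub>R v) = (if v = p then 0 else u v)" if u: "sum u (V - {p}) = 1" "v \<in> V"
  proof (rule bary_unique[OF _ _ u(2), where u="\<lambda>v. if v = p then 0 else u v"])
    have "(\<Sum>v\<in>V - {p}. if v = p then 0 else u v) = sum u (V - {p})" by (rule sum.cong) auto
    then show "(\<Sum>v\<in>V. if v = p then 0 else u v) = 1" using ins[of "\<lambda>v. if v = p then 0 else u v"] u(1) by simp
    have "(\<Sum>v\<in>V - {p}. (if v = p then 0 else u v) *\<^sub>R v) = (\<Sum>v\<in>V - {p}. u v *\<^sub>R v)" by (rule sum.cong) auto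
    then show "(\<Sum>v\<in>V. (if v = p then 0 else u v) *\<^sub>R v) = (\<Sum>v\<in>V - {p}. u v *\<^sub>R v)"
      using insv[of "\<lambda>v. (if v = p then 0 else u v) *\<^sub>R v"] by simp
  qed
  show "(\<Sum>v\<in>V - {p}. lam v x) = 1 \<and> (\<Sum>v\<in>V - {p}. lam v x *\<^sub>R v) = x" if z: "lam p x = 0"
  proof
    show "(\<Sum>v\<in>V - {p}. lam v x) = 1" using ins[of "\<lambda>v. lam v x"] bary_props(1)[of x] z by simp
    have "x = (\<Sum>v\<in>V. lam v x *\<^sub>R v)" by (rule bary_props(2)[symmetric])
    also have "... = (\<Sum>v\<in>V - {p}. lam v x *\<^sub>R v)" using insv[of "\<lambda>v. lam v x *\<^sub>R v"] z by simp
    finally show "(\<Sum>v\<in>V - {p}. lam v x *\<^sub>R v) = x" by (rule sym)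
  qed
qed

lemma opp_facet_hull:
  assumes p: "p \<in> V"
  shows "opp_facet T p = rel_interior (convex hull (V - {p}))"
    and "closure (opp_facet T p) = convex hull (V - {p})"
    and "closure (opp_facet T p) = {x \<in> closure T. lam p x = 0}"
    and "opp_facet T p \<noteq> {}"
proof -
  have ind: "\<not> affine_dependent (V - {p})" using vert_props(3) affine_independent_subset by blast
  have finVp: "finite (V - {p})" using finV by simp
  show A: "opp_facet T p = rel_interior (convex hull (V - {p}))"
    unfolding rel_interior_convex_hull_explicit[OF ind]
  proof (intro equalityI subsetI)
    fix x assume "x \<in> opp_facet T p"
    then have x: "lam p x = 0" "\<forall>v\<in>V - {p}. 0 < lam v x" by (simp_all add: opp_facet_def)
    then show "x \<in> {y. \<exists>u. (\<forall>x\<in>V - {p}. 0 < u x) \<and> sum u (V - {p}) = 1 \<and> (\<Sum>x\<in>V - {p}. u x *\<^sub>R x) = y}"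
      using facet_coeffs(2)[OF p x(1)] unfolding mem_Collect_eq by (intro exI[of _ "\<lambda>v. lam v x"] conjI) simp_all
  next
    fix x assume "x \<in> {y. \<exists>u. (\<forall>x\<in>V - {p}. 0 < u x) \<and> sum u (V - {p}) = 1 \<and> (\<Sum>x\<in>V - {p}. u x *\<^sub>R x) = y}"
    then obtain u where u: "\<forall>x\<in>V - {p}. 0 < u x" "sum u (V - {p}) = 1" "(\<Sum>x\<in>V - {p}. u x *\<^sub>R x) = x" by blast
    have "lam v x = (if v = p then 0 else u v)" if "v \<in> V" for v using facet_coeffs(1)[OF p u(2) that] u(3) by simp
    then show "x \<in> opp_facet T p" using u(1) p by (simp add: opp_facet_def)
  qed
  have cc: "compact (convex hull (V - {p}))" by (rule finite_imp_compact_convex_hull[OF finVp])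
  show B: "closure (opp_facet T p) = convex hull (V - {p})"
    unfolding A using convex_closure_rel_interior[OF convex_convex_hull, of "V - {p}"] cc
    by (simp add: compact_imp_closed)
  show "closure (opp_facet T p) = {x \<in> closure T. lam p x = 0}"
    unfolding B convex_hull_finite[OF finVp]
  proof (intro equalityI subsetI)
    fix x assume "x \<in> {y. \<exists>u. (\<forall>x\<in>V - {p}. 0 \<le> u x) \<and> sum u (V - {p}) = 1 \<and> (\<Sum>x\<in>V - {p}. u x *\<^sub>R x) = y}"
    then obtain u where u: "\<forall>x\<in>V - {p}. 0 \<le> u x" "sum u (V - {p}) = 1" "(\<Sum>x\<in>V - {p}. u x *\<^sub>R x) = x" by blast
    have "lam v x = (if v = p then 0 else u v)" if "v \<in> V" for v using facet_coeffs(1)[OF p u(2) that] u(3) by simp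
    then show "x \<in> {x \<in> closure T. lam p x = 0}" using u(1) p by (simp add: mem_closure)
  next
    fix x assume "x \<in> {x \<in> closure T. lam p x = 0}"
    then have x: "lam p x = 0" "\<forall>v\<in>V - {p}. 0 \<le> lam v x" by (simp_all add: mem_closure)
    then show "x \<in> {y. \<exists>u. (\<forall>x\<in>V - {p}. 0 \<le> u x) \<and> sum u (V - {p}) = 1 \<and> (\<Sum>x\<in>V - {p}. u x *\<^sub>R x) = y}"
      using facet_coeffs(2)[OF p x(1)] unfolding mem_Collect_eq by (intro exI[of _ "\<lambda>v. lam v x"] conjI) simp_all
  qed
  have "V - {p} \<noteq> {}" using other_vertex[of p] by blast
  then have "convex hull (V - {p}) \<noteq> {}" by simp
  then show "opp_facet T p \<noteq> {}" unfolding A by (simp add: rel_interior_eq_empty)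
qed

lemma is_facet_iff: "is_facet E T \<longleftrightarrow> (\<exists>p\<in>V. E = opp_facet T p)"
proof -
  have ne: "convex hull (V - {p}) \<noteq> {}" for p
  proof -
    have "V - {p} \<noteq> {}" using other_vertex[of p] by blast
    then show ?thesis by simp
  qed
  have "is_facet E T \<longleftrightarrow> (\<exists>p\<in>V. E = rel_interior (convex hull (V - {p})))"
    unfolding is_facet_def vert_props(4) facet_of_convex_hull_affine_independent[OF vert_props(3)] using ne by blast
  then show ?thesis by (simp add: opp_facet_hull(1))
qed

text \<open>A facet determines its vertices as a point set. Hence two elements with a common facet
  differ in one vertex each.\<close>

lemma opp_facet_extreme: "p \<in> V \<Longrightarrow> {v. v extreme_point_of closure (opp_facet T p)} = V - {p}"
proof -
  assume p: "p \<in> V"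
  have "\<not> affine_dependent (V - {p})" using vert_props(3) affine_independent_subset by blast
  from extreme_point_of_convex_hull_affine_independent[OF this] show ?thesis
    unfolding opp_facet_hull(2)[OF p] by auto
qed

lemma vertex_in_facet: "p \<in> V \<Longrightarrow> a \<in> V \<Longrightarrow> a \<in> closure (opp_facet T p) \<longleftrightarrow> a \<noteq> p"
  by (simp add: opp_facet_hull(3) vertex_in_closure bary_vertex)

lemma opposite_vertex_eq:
  assumes "p \<in> V" shows "opposite_vertex T (opp_facet T p) = p"
  unfolding opposite_vertex_def
proof (rule the_equality)
  show "p extreme_point_of closure T \<and> p \<notin> closure (opp_facet T p)"
    using assms vertex_in_facet[OF assms assms] by (simp add: vert_def)
  show "q = p" if "q extreme_point_of closure T \<and> q \<notin> closure (opp_facet T p)" for q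
    using that vertex_in_facet[OF assms, of q] by (auto simp: vert_def)
qed

lemma opp_facet_subset: "p \<in> V \<Longrightarrow> opp_facet T p \<subseteq> closure T"
proof -
  assume "p \<in> V"
  then have "closure (opp_facet T p) \<subseteq> closure T" using opp_facet_hull(3) by simp
  then show ?thesis using closure_subset[of "opp_facet T p"] by (rule order_trans[rotated])
qed

lemma borel_opp_facet: "p \<in> V \<Longrightarrow> opp_facet T p \<in> sets borel"
proof -
  assume p: "p \<in> V"
  have c: "lam v \<in> borel_measurable borel" if "v \<in> V" for v
    by (rule borel_measurable_continuous_onI[OF continuous_bary[OF that]])
  have "opp_facet T p = {x. lam p x = 0} \<inter> (\<Inter>v\<in>V - {p}. {x. 0 < lam v x})"
    by (auto simp: opp_facet_def)
  also have "... \<in> sets borel"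
  proof (rule sets.Int)
    show "{x. lam p x = 0} \<in> sets borel" using measurable_sets[OF c[OF p], of "{0}"] by (simp add: vimage_def)
    have "V - {p} \<noteq> {}" using other_vertex[of p] by blast
    then show "(\<Inter>v\<in>V - {p}. {x. 0 < lam v x}) \<in> sets borel"
    proof (intro sets.finite_INT)
      fix v assume "v \<in> V - {p}"
      then show "{x. 0 < lam v x} \<in> sets borel" using measurable_sets[OF c, of v "{0<..}"] by (simp add: vimage_def)
    qed (use finV in simp_all)
  qed
  finally show ?thesis .
qed

end

subsection \<open>Volumes of simplices and facets\<close>

lemma orthonormal_transformation:
  fixes B :: "'a::euclidean_space set"
  assumes B: "pairwise real_inner_class.orthogonal B" "\<forall>b\<in>B. norm b = 1" "card B = DIM('a)" "finite B"
  obtains f :: "'a \<Rightarrow> 'a" and \<sigma> :: "'a \<Rightarrow> 'a" where "orthogonal_transformation f" "bij_betw \<sigma> Basis B"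
    "\<And>x. f x = (\<Sum>b\<in>Basis. (x \<bullet> b) *\<^sub>R \<sigma> b)" "\<And>x b. b \<in> Basis \<Longrightarrow> f x \<bullet> \<sigma> b = x \<bullet> b"
proof -
  obtain \<sigma> where s: "bij_betw \<sigma> (Basis :: 'a set) B"
    using finite_same_card_bij[of Basis B] B(3,4) finite_Basis by metis
  have sB: "\<sigma> b \<in> B" if "b \<in> Basis" for b using s that by (auto simp: bij_betw_def)
  have o: "\<sigma> b \<bullet> \<sigma> c = (if b = c then 1 else 0)" if "b \<in> Basis" "c \<in> Basis" for b c
  proof (cases "b = c")
    case True
    then show ?thesis using bspec[OF B(2) sB[OF that(1)]] by (simp add: norm_eq_1)
  next
    case False
    then have "\<sigma> b \<noteq> \<sigma> c" using s that by (auto simp: bij_betw_def inj_on_def)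
    then have "real_inner_class.orthogonal (\<sigma> b) (\<sigma> c)"
      using pairwiseD[OF B(1) sB[OF that(1)] sB[OF that(2)]] by blast
    then show ?thesis using False by (simp add: real_inner_class.orthogonal_def)
  qed
  define f where "f x = (\<Sum>b\<in>Basis. (x \<bullet> b) *\<^sub>R \<sigma> b)" for x :: 'a
  have fs: "f x \<bullet> \<sigma> c = x \<bullet> c" if c: "c \<in> Basis" for x c
  proof -
    have "f x \<bullet> \<sigma> c = (\<Sum>b\<in>Basis. if b = c then x \<bullet> c else 0)"
      unfolding f_def inner_sum_left inner_scaleR_left by (rule sum.cong) (use o c in auto)
    then show ?thesis using c by simp
  qed
  have "orthogonal_transformation f" unfolding orthogonal_transformation_def
  proof
    show "linear f" unfolding f_def
      by (intro linearI) (simp_all add: inner_add_left scaleR_add_left sum.distrib scaleR_sum_right)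
    show "\<forall>v w. f v \<bullet> f w = v \<bullet> w"
    proof (intro allI)
      fix v w
      have "f v \<bullet> f w = (\<Sum>b\<in>Basis. (v \<bullet> b) * (\<sigma> b \<bullet> f w))"
        by (subst f_def) (simp add: inner_sum_left)
      also have "... = (\<Sum>b\<in>Basis. (v \<bullet> b) * (w \<bullet> b))"
        by (rule sum.cong) (simp_all add: inner_commute[of "\<sigma> _"] fs)
      finally show "f v \<bullet> f w = v \<bullet> w" by (simp add: euclidean_inner[of v w])
    qed
  qed
  then show ?thesis using that[OF _ s f_def fs] by blast
qed

text \<open>A rotation takes \<open>e\<close> to a coordinate direction. In the rotated coordinates
  the set lies in a box of side \<open>w\<close> in that direction and \<open>2 * d\<close> in the
  others.\<close>

lemma slab_measure:
  fixes S :: "'a::euclidean_space set"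
  assumes e: "norm e = 1" and S: "S \<in> sets borel" and d: "0 \<le> d" "0 \<le> w"
    and sub: "\<And>x. x \<in> S \<Longrightarrow> \<alpha> \<le> e \<bullet> x \<and> e \<bullet> x \<le> \<alpha> + w" "\<And>x. x \<in> S \<Longrightarrow> norm (x - p) \<le> d"
  shows "emeasure lborel S \<le> ennreal (w * (2 * d) ^ (DIM('a) - 1))"
proof -
  obtain B where B: "e \<in> B" "pairwise real_inner_class.orthogonal B" "\<And>x. x \<in> B \<Longrightarrow> norm x = 1"
    "independent B" "card B = DIM('a)" using vector_in_orthonormal_basis[OF e] by metis
  have nB: "\<forall>b\<in>B. norm b = 1" using B(3) by blast
  obtain f :: "'a \<Rightarrow> 'a" and \<sigma> :: "'a \<Rightarrow> 'a" where f': "orthogonal_transformation f" "bij_betw \<sigma> Basis B"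
    "\<And>x. f x = (\<Sum>b\<in>Basis. (x \<bullet> b) *\<^sub>R \<sigma> b)" "\<And>x b. b \<in> Basis \<Longrightarrow> f x \<bullet> \<sigma> b = x \<bullet> b"
    by (rule orthonormal_transformation[OF B(2) nB B(5) finiteI_independent[OF B(4)]]) blast
  note f = f'(1,2,4)
  obtain b0 where b0: "b0 \<in> Basis" "\<sigma> b0 = e" using f(2) B(1) by (metis bij_betw_def imageE)
  define lo where "lo b = (if b = b0 then \<alpha> else p \<bullet> \<sigma> b - d)" for b
  define hi where "hi b = (if b = b0 then \<alpha> + w else p \<bullet> \<sigma> b + d)" for b
  define l :: 'a where "l = (\<Sum>b\<in>Basis. lo b *\<^sub>R b)"
  define h :: 'a where "h = (\<Sum>b\<in>Basis. hi b *\<^sub>R b)"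
  have lh: "l \<bullet> b = lo b" "h \<bullet> b = hi b" if "b \<in> Basis" for b using that by (simp_all add: l_def h_def)
  have le: "lo b \<le> hi b" for b using d by (simp add: lo_def hi_def)
  have "f -` S \<subseteq> cbox l h"
  proof
    fix x assume "x \<in> f -` S"
    then have x: "f x \<in> S" by simp
    have "lo b \<le> x \<bullet> b \<and> x \<bullet> b \<le> hi b" if b: "b \<in> Basis" for b
    proof (cases "b = b0")
      case True
      then have "x \<bullet> b = e \<bullet> f x" using f(3)[OF b0(1), of x] b0(2) by (simp add: inner_commute)
      then show ?thesis using sub(1)[OF x] True by (simp add: lo_def hi_def)
    next
      case False
      have "\<bar>(f x - p) \<bullet> \<sigma> b\<bar> \<le> norm (f x - p) * norm (\<sigma> b)" by (rule Cauchy_Schwarz_ineq2)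
      also have "... \<le> d" using sub(2)[OF x] B(3)[of "\<sigma> b"] f(2) b by (auto simp: bij_betw_def)
      finally show ?thesis using False f(3)[OF b, of x] by (simp add: lo_def hi_def inner_diff_left abs_le_iff)
    qed
    then show "x \<in> cbox l h" by (simp add: mem_box lh)
  qed
  then have "emeasure lborel (f -` S) \<le> emeasure lborel (cbox l h)" by (intro emeasure_mono) simp_all
  also have "... = ennreal (\<Prod>b\<in>Basis. hi b - lo b)"
  proof -
    have "(\<Prod>b\<in>Basis. (h - l) \<bullet> b) = (\<Prod>b\<in>Basis. hi b - lo b)"
      by (rule prod.cong) (simp_all add: inner_diff_left lh)
    then show ?thesis using le by (simp add: emeasure_lborel_cbox_eq lh)
  qed
  also have "(\<Prod>b\<in>Basis. hi b - lo b) = (hi b0 - lo b0) * (\<Prod>b\<in>Basis - {b0}. hi b - lo b)"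
    by (rule prod.remove[OF finite_Basis b0(1)])
  also have "(\<Prod>b\<in>Basis - {b0}. hi b - lo b) = (\<Prod>b\<in>Basis - {b0}. 2 * d)"
    by (rule prod.cong) (auto simp: lo_def hi_def)
  also have "... = (2 * d) ^ (DIM('a) - 1)" using b0(1) by (simp add: card_Diff_singleton)
  finally show ?thesis using orthogonal_vimage_measure[OF f(1) S] by (simp add: lo_def hi_def)
qed

interpretation lborel_product: product_sigma_finite "\<lambda>_. lborel :: real measure"
  by standard

text \<open>Rotation invariance together with a renaming of the factors of the product measure. It
  connects the volume of an element with \<open>flat_measure\<close>, which is computed in
  coordinates of an orthonormal basis of the facet directions.\<close>

lemma lborel_orthonormal:
  fixes B :: "'a::euclidean_space set"
  assumes B: "pairwise real_inner_class.orthogonal B" "\<And>b. b \<in> B \<Longrightarrow> norm b = 1" "card B = DIM('a)" "finite B"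
  shows "lborel = distr (\<Pi>\<^sub>M b\<in>B. lborel) borel (\<lambda>f. \<Sum>b\<in>B. f b *\<^sub>R b)"
proof -
  have nB: "\<forall>b\<in>B. norm b = 1" using B(2) by blast
  obtain f :: "'a \<Rightarrow> 'a" and \<sigma> :: "'a \<Rightarrow> 'a" where f: "orthogonal_transformation f" "bij_betw \<sigma> Basis B"
    "\<And>x. f x = (\<Sum>b\<in>Basis. (x \<bullet> b) *\<^sub>R \<sigma> b)" "\<And>x b. b \<in> Basis \<Longrightarrow> f x \<bullet> \<sigma> b = x \<bullet> b"
    by (rule orthonormal_transformation[OF B(1) nB B(3,4)]) blast
  define \<tau> where "\<tau> = inv_into Basis \<sigma>"
  have t: "\<tau> b \<in> Basis" "\<sigma> (\<tau> b) = b" if "b \<in> B" for b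
    using f(2) that unfolding \<tau>_def bij_betw_def by (auto simp: inv_into_into f_inv_into_f)
  have ts: "\<tau> (\<sigma> b) = b" "\<sigma> b \<in> B" if "b \<in> Basis" for b
    using f(2) that unfolding \<tau>_def bij_betw_def by auto
  define R where "R g = (\<lambda>b\<in>B. g (\<tau> b))" for g :: "'a \<Rightarrow> real"
  have Rm: "R \<in> (\<Pi>\<^sub>M b\<in>Basis. lborel) \<rightarrow>\<^sub>M (\<Pi>\<^sub>M b\<in>B. lborel)"
    unfolding R_def by (intro measurable_restrict measurable_component_singleton) (simp_all add: t)
  have reindex: "distr (\<Pi>\<^sub>M b\<in>Basis. lborel) (\<Pi>\<^sub>M b\<in>B. lborel) R = (\<Pi>\<^sub>M b\<in>B. lborel)"
  proof (rule lborel_product.PiM_eqI[OF B(4)])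
    fix A :: "'a \<Rightarrow> real set" assume A: "\<And>i. i \<in> B \<Longrightarrow> A i \<in> sets lborel"
    have PA: "Pi\<^sub>E B A \<in> sets (\<Pi>\<^sub>M b\<in>B. lborel)" by (rule sets_PiM_I_finite[OF B(4) A])
    have "R -` Pi\<^sub>E B A \<inter> space (\<Pi>\<^sub>M b\<in>Basis. lborel) = Pi\<^sub>E Basis (\<lambda>b. A (\<sigma> b))"
    proof (intro equalityI subsetI)
      fix g assume "g \<in> R -` Pi\<^sub>E B A \<inter> space (\<Pi>\<^sub>M b\<in>(Basis::'a set). (lborel::real measure))"
      then have g: "R g \<in> Pi\<^sub>E B A" "g \<in> extensional Basis" by (auto simp: space_PiM PiE_def)
      have "g b \<in> A (\<sigma> b)" if b: "b \<in> Basis" for b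
        using PiE_mem[OF g(1) ts(2)[OF b]] ts[OF b] by (simp add: R_def)
      then show "g \<in> Pi\<^sub>E Basis (\<lambda>b. A (\<sigma> b))" using g(2) by (auto simp: PiE_def)
    next
      fix g assume g: "g \<in> Pi\<^sub>E Basis (\<lambda>b. A (\<sigma> b))"
      have "g (\<tau> b) \<in> A b" if "b \<in> B" for b using PiE_mem[OF g t(1)[OF that]] t(2)[OF that] by simp
      then have "R g \<in> Pi\<^sub>E B A" by (auto simp: R_def)
      then show "g \<in> R -` Pi\<^sub>E B A \<inter> space (\<Pi>\<^sub>M b\<in>(Basis::'a set). (lborel::real measure))"
        using g by (auto simp: space_PiM PiE_def)
    qed
    then have "emeasure (distr (\<Pi>\<^sub>M b\<in>Basis. lborel) (\<Pi>\<^sub>M b\<in>B. lborel) R) (Pi\<^sub>E B A)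
      = emeasure (\<Pi>\<^sub>M b\<in>Basis. lborel) (Pi\<^sub>E Basis (\<lambda>b. A (\<sigma> b)))"
      using emeasure_distr[OF Rm PA] by simp
    also have "... = (\<Prod>b\<in>Basis. emeasure lborel (A (\<sigma> b)))"
      by (rule lborel_product.emeasure_PiM) (use A ts in simp_all)
    also have "... = (\<Prod>b\<in>B. emeasure lborel (A b))"
      by (rule prod.reindex_bij_betw[OF f(2)])
    finally show "emeasure (distr (\<Pi>\<^sub>M b\<in>Basis. lborel) (\<Pi>\<^sub>M b\<in>B. lborel) R) (Pi\<^sub>E B A)
      = (\<Prod>b\<in>B. emeasure lborel (A b))" .
  qed simp
  have fm: "f \<in> borel_measurable borel" by (rule linear_bij_measurable[OF orthogonal_transformation_linear[OF f(1)]])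
  have "distr lborel borel f = lborel"
  proof (rule measure_eqI)
    fix A assume "A \<in> sets (distr lborel borel f)"
    then have "A \<in> sets borel" by simp
    then show "emeasure (distr lborel borel f) A = emeasure lborel A"
      using orthogonal_vimage_measure[OF f(1)] fm by (simp add: emeasure_distr)
  qed simp
  then have "lborel = distr (distr (\<Pi>\<^sub>M b\<in>Basis. lborel) borel (\<lambda>f. \<Sum>b\<in>Basis. f b *\<^sub>R b)) borel f"
    by (simp add: lborel_eq[symmetric])
  also have "... = distr (\<Pi>\<^sub>M b\<in>Basis. lborel) borel (f \<circ> (\<lambda>g. \<Sum>b\<in>Basis. g b *\<^sub>R b))"
    by (rule distr_distr) (use fm in measurable)
  also have "f \<circ> (\<lambda>g. \<Sum>b\<in>Basis. g b *\<^sub>R b) = (\<lambda>g. \<Sum>b\<in>B. g b *\<^sub>R b) \<circ> R"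
  proof
    fix g :: "'a \<Rightarrow> real"
    have "(f \<circ> (\<lambda>g. \<Sum>b\<in>Basis. g b *\<^sub>R b)) g = (\<Sum>b\<in>Basis. g b *\<^sub>R \<sigma> b)"
      by (simp add: f(3))
    also have "... = (\<Sum>b\<in>Basis. g (\<tau> (\<sigma> b)) *\<^sub>R \<sigma> b)" by (rule sum.cong) (simp_all add: ts)
    also have "... = (\<Sum>b\<in>B. g (\<tau> b) *\<^sub>R b)" by (rule sum.reindex_bij_betw[OF f(2)])
    finally show "(f \<circ> (\<lambda>g. \<Sum>b\<in>Basis. g b *\<^sub>R b)) g = ((\<lambda>g. \<Sum>b\<in>B. g b *\<^sub>R b) \<circ> R) g" by (simp add: R_def)
  qed
  also have "distr (\<Pi>\<^sub>M b\<in>Basis. lborel) borel ((\<lambda>g. \<Sum>b\<in>B. g b *\<^sub>R b) \<circ> R)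
    = distr (distr (\<Pi>\<^sub>M b\<in>Basis. lborel) (\<Pi>\<^sub>M b\<in>B. lborel) R) borel (\<lambda>g. \<Sum>b\<in>B. g b *\<^sub>R b)"
    by (rule distr_distr[symmetric, OF _ Rm]) measurable
  finally show ?thesis by (simp only: reindex)
qed

text \<open>Slices of an element parallel to a facet are compared with the facet after a shift
  within its plane; the shift preserves the product measure.\<close>

lemma product_translation:
  assumes B: "finite B" and A: "A \<in> sets (\<Pi>\<^sub>M b\<in>B. lborel :: real measure)"
  shows "emeasure (\<Pi>\<^sub>M b\<in>B. lborel) {x \<in> space (\<Pi>\<^sub>M b\<in>B. lborel). (\<lambda>b\<in>B. x b - c b) \<in> A} = emeasure (\<Pi>\<^sub>M b\<in>B. lborel) A"
proof -
  let ?N = "\<Pi>\<^sub>M b\<in>B. lborel :: real measure"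
  define t where "t x = (\<lambda>b\<in>B. x b - c b)" for x :: "'a \<Rightarrow> real"
  have tm: "t \<in> ?N \<rightarrow>\<^sub>M ?N" unfolding t_def by (intro measurable_restrict) measurable
  have "distr ?N ?N t = ?N"
  proof (rule lborel_product.PiM_eqI[OF B])
    fix C :: "'a \<Rightarrow> real set" assume C: "\<And>i. i \<in> B \<Longrightarrow> C i \<in> sets lborel"
    have m: "(\<lambda>y. y - c i) -` C i \<in> sets lborel" if "i \<in> B" for i
      using measurable_sets[of "\<lambda>y. y - c i" borel borel "C i"] C[OF that] by simp
    have PC: "Pi\<^sub>E B C \<in> sets ?N" by (rule sets_PiM_I_finite[OF B C])
    have "t -` Pi\<^sub>E B C \<inter> space ?N = Pi\<^sub>E B (\<lambda>i. (\<lambda>y. y - c i) -` C i)"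
      by (auto simp: t_def space_PiM PiE_def Pi_def extensional_def)
    then have "emeasure (distr ?N ?N t) (Pi\<^sub>E B C) = emeasure ?N (Pi\<^sub>E B (\<lambda>i. (\<lambda>y. y - c i) -` C i))"
      using emeasure_distr[OF tm PC] by simp
    also have "... = (\<Prod>i\<in>B. emeasure lborel ((\<lambda>y. y - c i) -` C i))"
      by (rule lborel_product.emeasure_PiM[OF B m])
    also have "... = (\<Prod>i\<in>B. emeasure lborel (C i))"
    proof (rule prod.cong[OF refl])
      fix i assume i: "i \<in> B"
      have "emeasure lborel (C i) = emeasure (distr lborel borel ((+) (- c i))) (C i)" by (simp add: lborel_distr_plus)
      also have "... = emeasure lborel ((+) (- c i) -` C i)" using C[OF i] by (simp add: emeasure_distr)
      also have "(+) (- c i) -` C i = (\<lambda>y. y - c i) -` C i" by auto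
      finally show "emeasure lborel ((\<lambda>y. y - c i) -` C i) = emeasure lborel (C i)" by simp
    qed
    finally show "emeasure (distr ?N ?N t) (Pi\<^sub>E B C) = (\<Prod>i\<in>B. emeasure lborel (C i))" .
  qed simp
  moreover have "emeasure (distr ?N ?N t) A = emeasure ?N (t -` A \<inter> space ?N)" by (rule emeasure_distr[OF tm A])
  moreover have "t -` A \<inter> space ?N = {x \<in> space ?N. (\<lambda>b\<in>B. x b - c b) \<in> A}" by (auto simp: t_def)
  ultimately show ?thesis by simp
qed

context osimplex
begin

abbreviation vol where "vol \<equiv> measure lebesgue T"

lemma T_borel: "T \<in> sets borel" using open_T by simp

lemma T_lmeasurable: "T \<in> lmeasurable" by (rule bounded_borel_lmeasurable[OF bounded_T T_borel])

lemma emeasure_T: "emeasure lborel T = ennreal vol"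
proof -
  have "emeasure lborel T = emeasure lebesgue T" using T_borel by simp
  also have "... = ennreal vol" using T_lmeasurable by (simp add: emeasure_eq_measure2)
  finally show ?thesis .
qed

lemma vol_pos: "0 < vol"
proof -
  obtain x where "x \<in> T" using vert_props(7) by blast
  then have "0 < emeasure lborel T" by (rule emeasure_lborel_open_pos[OF open_T])
  then show ?thesis unfolding emeasure_T by simp
qed

text \<open>The element lies between the hyperplanes where \<open>lam v\<close> is 0 and 1, at
  distance \<open>1 / norm (gl v)\<close>, and within distance \<open>diameter T\<close> of
  \<open>v\<close>.\<close>

lemma bgrad_volume:
  assumes v: "v \<in> V"
  shows "norm (gl v) * vol \<le> (2 * diameter T) ^ (DIM('a) - 1)"
proof -
  let ?g = "gl v"
  have g: "0 < norm ?g" using bgrad_nonzero[OF v] by simp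
  have "emeasure lborel T \<le> ennreal (1 / norm ?g * (2 * diameter T) ^ (DIM('a) - 1))"
  proof (rule slab_measure[where e="?g /\<^sub>R norm ?g" and p=v and \<alpha>="- lam v 0 / norm ?g"])
    show "norm (?g /\<^sub>R norm ?g) = 1" using g by simp
    show "0 \<le> diameter T" using diameter_pos by simp
    fix x assume "x \<in> T"
    then have x: "x \<in> closure T" using T_subset_closure by blast
    have "?g \<bullet> x = lam v x - lam v 0" using bary_grad[OF v, of x 0] by simp
    moreover have "0 \<le> lam v x" "lam v x \<le> 1" using x v bary_le_1[OF x v] by (simp_all add: mem_closure)
    ultimately show "- lam v 0 / norm ?g \<le> (?g /\<^sub>R norm ?g) \<bullet> x \<and> (?g /\<^sub>R norm ?g) \<bullet> x \<le> - lam v 0 / norm ?g + 1 / norm ?g"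
      using g by (simp add: field_simps)
    show "norm (x - v) \<le> diameter T" by (rule dist_le_diameter[OF x vertex_in_closure[OF v]])
  qed (use T_borel in simp_all)
  then have "vol \<le> 1 / norm ?g * (2 * diameter T) ^ (DIM('a) - 1)"
    unfolding emeasure_T using g diameter_pos by (simp add: ennreal_le_iff)
  then show ?thesis using g by (simp add: field_simps)
qed

text \<open>The facet lies in a cube of side \<open>2 * diameter T\<close>. For the second part,
  every slice of the element parallel to the facet is a translate of a part of the facet, and the
  height \<open>1 / norm (gl p)\<close> is at most the diameter.\<close>

lemma flat_measure_facet:
  assumes p: "p \<in> V"
  shows "flat_measure (opp_facet T p) \<le> (2 * diameter T) ^ (DIM('a) - 1)"
    and "vol \<le> flat_measure (opp_facet T p) * diameter T"
proof -
  define E where "E = opp_facet T p"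
  define D where "D = span {x - y |x y. x \<in> E \<and> y \<in> E}"
  define P where "P B \<longleftrightarrow> pairwise real_inner_class.orthogonal B \<and> (\<forall>b\<in>B. norm b = 1) \<and> span B = D" for B
  define B where "B = (SOME B. P B)"
  have "\<exists>B. P B"
  proof (rule orthonormal_basis_subspace[OF subspace_span[of "{x - y |x y. x \<in> E \<and> y \<in> E}"], folded D_def])
    fix B assume "pairwise real_inner_class.orthogonal B" "\<And>x. x \<in> B \<Longrightarrow> norm x = 1" "span B = D"
    then show "\<exists>B. P B" unfolding P_def by (intro exI[of _ B] conjI ballI)
  qed
  then have "P B" unfolding B_def by (rule someI_ex)
  then have B: "pairwise real_inner_class.orthogonal B" "\<And>b. b \<in> B \<Longrightarrow> norm b = 1" "span B = D" by (simp_all add: P_def)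
  define N where "N = (\<Pi>\<^sub>M b\<in>B. lborel :: real measure)"
  define Cd where "Cd = (\<lambda>x. \<lambda>b\<in>B. x \<bullet> b) ` E"
  have fm: "flat_measure E = measure N Cd"
    unfolding flat_measure_def Let_def N_def Cd_def B_def P_def D_def by simp
  obtain x0 where x0: "x0 \<in> E" using opp_facet_hull(4)[OF p] by (auto simp: E_def)
  have lx0: "lam p x0 = 0" "\<And>v. v \<in> V - {p} \<Longrightarrow> 0 < lam v x0" using x0 by (simp_all add: E_def opp_facet_def)
  define g where "g = gl p"
  have g: "0 < norm g" using bgrad_nonzero[OF p] by (simp add: g_def)
  have D: "D = {h. g \<bullet> h = 0}"
  proof (intro equalityI subsetI)
    have "g \<bullet> (x - y) = 0" if "x \<in> E" "y \<in> E" for x y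
      using bary_grad[OF p, of x y] that by (simp add: E_def opp_facet_def g_def)
    then have "{x - y |x y. x \<in> E \<and> y \<in> E} \<subseteq> {h. g \<bullet> h = 0}" by blast
    then have "D \<subseteq> {h. g \<bullet> h = 0}" unfolding D_def by (rule span_minimal[OF _ subspace_hyperplane])
    then show "h \<in> {h. g \<bullet> h = 0}" if "h \<in> D" for h using that by blast
    fix h assume "h \<in> {h. g \<bullet> h = 0}"
    then have h: "g \<bullet> h = 0" by simp
    have "\<forall>\<^sub>F e in at_right (0::real). \<forall>v\<in>V - {p}. 0 < lam v x0 + e * (gl v \<bullet> h)"
    proof (rule eventually_ball_finite)
      show "\<forall>v\<in>V - {p}. \<forall>\<^sub>F e in at_right 0. 0 < lam v x0 + e * (gl v \<bullet> h)"
      proof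
        fix v assume v: "v \<in> V - {p}"
        have "((\<lambda>e. lam v x0 + e * (gl v \<bullet> h)) \<longlongrightarrow> lam v x0 + 0 * (gl v \<bullet> h)) (at_right 0)" by (intro tendsto_intros)
        then show "\<forall>\<^sub>F e in at_right 0. 0 < lam v x0 + e * (gl v \<bullet> h)"
          using lx0(2)[OF v] by (intro order_tendstoD(1)) simp_all
      qed
    qed (use finV in simp)
    moreover have "\<forall>\<^sub>F e in at_right (0::real). 0 < e" by (rule eventually_at_right_less)
    ultimately have "\<forall>\<^sub>F e in at_right (0::real). 0 < e \<and> (\<forall>v\<in>V - {p}. 0 < lam v x0 + e * (gl v \<bullet> h))"
      by eventually_elim simp
    then obtain e where e: "0 < e" "\<forall>v\<in>V - {p}. 0 < lam v x0 + e * (gl v \<bullet> h)"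
      using eventually_happens' by (metis (no_types, lifting) trivial_limit_at_right_real)
    \<comment> \<open>Since \<open>h\<close> is orthogonal to the gradient of \<open>lam p\<close>
      and the other coordinates of \<open>x0\<close> are positive, a short step in direction
      \<open>h\<close> stays in the relatively open facet.\<close>
    have "x0 + e *\<^sub>R h \<in> E"
      using e lx0(1) h bary_grad[of _ "x0 + e *\<^sub>R h" x0] p by (simp add: E_def opp_facet_def g_def)
    then have "(x0 + e *\<^sub>R h) - x0 \<in> D" unfolding D_def using x0 by (intro span_base) blast
    then have "e *\<^sub>R h \<in> D" by simp
    then have "(1 / e) *\<^sub>R (e *\<^sub>R h) \<in> D" unfolding D_def by (rule span_scale)
    then show "h \<in> D" using e(1) by simp
  qed
  \<comment> \<open>The unit normal completes \<open>B\<close> to an orthonormal basis of the whole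
    space.\<close>
  define \<nu> where "\<nu> = g /\<^sub>R norm g"
  have n1: "norm \<nu> = 1" using g by (simp add: \<nu>_def)
  have gn: "g \<bullet> z = norm g * (\<nu> \<bullet> z)" for z using g by (simp add: \<nu>_def)
  have bD: "b \<in> D" if "b \<in> B" for b using span_base[OF that] B(3) by simp
  have nb: "\<nu> \<bullet> b = 0" if "b \<in> B" for b using bD[OF that] D by (simp add: \<nu>_def)
  have nnB: "\<nu> \<notin> B"
  proof
    assume "\<nu> \<in> B"
    then have "\<nu> \<bullet> \<nu> = 0" by (rule nb)
    then show False using n1 by simp
  qed
  let ?B' = "insert \<nu> B"
  have o': "pairwise real_inner_class.orthogonal ?B'"
    unfolding pairwise_insert using B(1) nb by (auto simp: real_inner_class.orthogonal_def inner_commute)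
  have n': "norm b = 1" if "b \<in> ?B'" for b using that n1 B(2) by auto
  have ind': "independent ?B'"
    by (rule pairwise_orthogonal_independent[OF o']) (use n' in force)
  have finB': "finite ?B'" by (rule finiteI_independent[OF ind'])
  have finB: "finite B" using finB' by simp
  have "x \<in> span ?B'" for x
  proof -
    have "x - (\<nu> \<bullet> x) *\<^sub>R \<nu> \<in> D"
    proof -
      have "\<nu> \<bullet> (x - (\<nu> \<bullet> x) *\<^sub>R \<nu>) = 0" using n1 by (simp add: inner_diff_right norm_eq_1)
      then show ?thesis unfolding D mem_Collect_eq gn by simp
    qed
    then have "x - (\<nu> \<bullet> x) *\<^sub>R \<nu> \<in> span ?B'" using B(3) span_mono[of B ?B'] by blast
    moreover have "(\<nu> \<bullet> x) *\<^sub>R \<nu> \<in> span ?B'" by (intro span_scale span_base) simp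
    ultimately have "(x - (\<nu> \<bullet> x) *\<^sub>R \<nu>) + (\<nu> \<bullet> x) *\<^sub>R \<nu> \<in> span ?B'" by (rule span_add)
    then show ?thesis by simp
  qed
  then have sp': "span ?B' = UNIV" by blast
  have card': "card ?B' = DIM('a)" using dim_span_eq_card_independent[OF ind'] sp' by simp
  have cardB: "card B = DIM('a) - 1" using card' nnB finB by simp
  have exp: "(\<Sum>b\<in>B. (h \<bullet> b) *\<^sub>R b) = h" if "h \<in> D" for h
    using orthonormal_basis_expand[OF B(1,2) _ finB, of h] that B(3) by simp
  \<comment> \<open>The component of \<open>x0\<close> orthogonal to the facet directions, common to
    all points of the facet; the remaining coordinates then determine such a point.\<close>
  define zp where "zp = x0 - (\<Sum>b\<in>B. (x0 \<bullet> b) *\<^sub>R b)"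
  have zrep: "zp + (\<Sum>b\<in>B. (z \<bullet> b) *\<^sub>R b) = z" if "z \<in> E" for z
  proof -
    have "z - x0 \<in> D" unfolding D_def using that x0 by (intro span_base) blast
    from exp[OF this] show ?thesis by (simp add: zp_def inner_diff_left scaleR_left_diff_distrib sum_subtractf algebra_simps)
  qed
  have ob: "(\<Sum>b\<in>B. f b *\<^sub>R b) \<bullet> c = f c" if "c \<in> B" for f c
  proof -
    have "(\<Sum>b\<in>B. f b *\<^sub>R b) \<bullet> c = (\<Sum>b\<in>B. if b = c then f c else 0)"
      unfolding inner_sum_left
      by (rule sum.cong) (use B(1,2) that in "auto simp: pairwise_def real_inner_class.orthogonal_def norm_eq_1")
    then show ?thesis using that finB by simp
  qed
  have CdN: "Cd = {f \<in> space N. zp + (\<Sum>b\<in>B. f b *\<^sub>R b) \<in> E}"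
  proof (intro equalityI subsetI)
    fix f assume "f \<in> Cd"
    then obtain z where z: "z \<in> E" "f = (\<lambda>b\<in>B. z \<bullet> b)" by (auto simp: Cd_def)
    have "(\<Sum>b\<in>B. f b *\<^sub>R b) = (\<Sum>b\<in>B. (z \<bullet> b) *\<^sub>R b)" by (rule sum.cong) (simp_all add: z)
    then show "f \<in> {f \<in> space N. zp + (\<Sum>b\<in>B. f b *\<^sub>R b) \<in> E}"
      using zrep[OF z(1)] z by (simp add: N_def space_PiM)
  next
    fix f assume "f \<in> {f \<in> space N. zp + (\<Sum>b\<in>B. f b *\<^sub>R b) \<in> E}"
    then have f: "f \<in> extensional B" "zp + (\<Sum>b\<in>B. f b *\<^sub>R b) \<in> E" by (auto simp: N_def space_PiM PiE_def)
    have "f = (\<lambda>b\<in>B. (zp + (\<Sum>b\<in>B. f b *\<^sub>R b)) \<bullet> b)"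
    proof (rule extensionalityI[OF f(1)])
      show "(\<lambda>b\<in>B. (zp + (\<Sum>b\<in>B. f b *\<^sub>R b)) \<bullet> b) \<in> extensional B" by simp
      show "f c = (\<lambda>b\<in>B. (zp + (\<Sum>b\<in>B. f b *\<^sub>R b)) \<bullet> b) c" if "c \<in> B" for c
        using that by (simp add: inner_add_left ob zp_def inner_diff_left)
    qed
    then show "f \<in> Cd" unfolding Cd_def using f(2) by blast
  qed
  have Cdm: "Cd \<in> sets N"
  proof -
    have "(\<lambda>f. zp + (\<Sum>b\<in>B. f b *\<^sub>R b)) \<in> N \<rightarrow>\<^sub>M borel" unfolding N_def by measurable
    from measurable_sets[OF this borel_opp_facet[OF p]] show ?thesis
      unfolding CdN E_def by (simp add: vimage_def Int_def conj_commute)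
  qed
  let ?d = "diameter T"
  have d0: "0 \<le> ?d" using diameter_pos by simp
  have bound: "emeasure N Cd \<le> ennreal ((2 * ?d) ^ (DIM('a) - 1))"
  proof -
    have "Cd \<subseteq> Pi\<^sub>E B (\<lambda>b. {x0 \<bullet> b - ?d .. x0 \<bullet> b + ?d})"
    proof
      fix f assume "f \<in> Cd"
      then obtain z where z: "z \<in> E" "f = (\<lambda>b\<in>B. z \<bullet> b)" by (auto simp: Cd_def)
      have "norm (z - x0) \<le> ?d"
        by (rule dist_le_diameter) (use z(1) x0 opp_facet_subset[OF p] in "auto simp: E_def")
      then have "\<bar>(z - x0) \<bullet> b\<bar> \<le> ?d" if "b \<in> B" for b
        using Cauchy_Schwarz_ineq2[of "z - x0" b] B(2)[OF that] by simp
      then show "f \<in> Pi\<^sub>E B (\<lambda>b. {x0 \<bullet> b - ?d .. x0 \<bullet> b + ?d})"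
        unfolding z(2) by (intro restrict_PiE_iff[THEN iffD2]) (auto simp: inner_diff_left abs_le_iff algebra_simps)
    qed
    then have "emeasure N Cd \<le> emeasure N (Pi\<^sub>E B (\<lambda>b. {x0 \<bullet> b - ?d .. x0 \<bullet> b + ?d}))"
      by (rule emeasure_mono) (simp add: N_def sets_PiM_I_finite finB)
    also have "... = (\<Prod>b\<in>B. emeasure lborel {x0 \<bullet> b - ?d .. x0 \<bullet> b + ?d})"
      unfolding N_def by (rule lborel_product.emeasure_PiM[OF finB]) simp
    also have "... = (\<Prod>b\<in>B. ennreal (2 * ?d))" using d0 by (intro prod.cong) auto
    also have "... = ennreal ((2 * ?d) ^ (DIM('a) - 1))" using d0 cardB by (simp add: ennreal_power)
    finally show ?thesis .
  qed
  have eN: "emeasure N Cd = ennreal (measure N Cd)"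
    by (rule emeasure_eq_ennreal_measure) (use bound in "auto simp: top_unique")
  have "measure N Cd \<le> (2 * ?d) ^ (DIM('a) - 1)" using bound d0 unfolding eN by (simp add: ennreal_le_iff)
  then show "flat_measure (opp_facet T p) \<le> (2 * diameter T) ^ (DIM('a) - 1)" using fm by (simp add: E_def)
  obtain v1 where v1: "v1 \<in> V" "v1 \<noteq> p" using other_vertex by blast
  have Tm: "indicator T \<in> borel_measurable (borel :: 'a measure)" using T_borel by simp
  define y0 where "y0 = \<nu> \<bullet> x0"
  \<comment> \<open>Cavalieri: the slice at height \<open>y\<close> is empty unless \<open>y\<close>
    lies in an interval of length \<open>1 / norm g\<close>, and it never exceeds the facet in
    measure.\<close>
  have slice: "(\<integral>\<^sup>+ x. indicator T (\<Sum>b\<in>?B'. (x(\<nu> := y)) b *\<^sub>R b) \<partial>N) \<le> emeasure N Cd * indicator {y0 .. y0 + 1 / norm g} y" for y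
  proof -
    define A where "A = {x \<in> space N. y *\<^sub>R \<nu> + (\<Sum>b\<in>B. x b *\<^sub>R b) \<in> T}"
    have sB: "(\<Sum>b\<in>?B'. (x(\<nu> := y)) b *\<^sub>R b) = y *\<^sub>R \<nu> + (\<Sum>b\<in>B. x b *\<^sub>R b)" for x
    proof -
      have "(\<Sum>b\<in>B. (x(\<nu> := y)) b *\<^sub>R b) = (\<Sum>b\<in>B. x b *\<^sub>R b)" by (rule sum.cong) (use nnB in auto)
      then show ?thesis using nnB finB by simp
    qed
    have Am: "A \<in> sets N"
    proof -
      have "(\<lambda>f. y *\<^sub>R \<nu> + (\<Sum>b\<in>B. f b *\<^sub>R b)) \<in> N \<rightarrow>\<^sub>M borel" unfolding N_def by measurable
      from measurable_sets[OF this T_borel] show ?thesis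
        unfolding A_def by (simp add: vimage_def Int_def conj_commute)
    qed
    have "(\<integral>\<^sup>+ x. indicator T (\<Sum>b\<in>?B'. (x(\<nu> := y)) b *\<^sub>R b) \<partial>N) = (\<integral>\<^sup>+ x. indicator A x \<partial>N)"
      unfolding sB by (rule nn_integral_cong) (simp add: A_def indicator_def)
    also have "... = emeasure N A" using Am by simp
    also have "... \<le> emeasure N Cd * indicator {y0 .. y0 + 1 / norm g} y"
    proof (cases "A = {}")
      case False
      define t where "t = norm g * (y - y0)"
      have tz: "lam p z = t" if "z = y *\<^sub>R \<nu> + (\<Sum>b\<in>B. x b *\<^sub>R b)" for z x
      proof -
        have "\<nu> \<bullet> z = y" using n1 nb unfolding that by (simp add: inner_add_right inner_sum_right norm_eq_1)
        then show ?thesis using bary_grad[OF p, of z x0] lx0(1) gn[of "z - x0"]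
          by (simp add: t_def g_def y0_def inner_diff_right)
      qed
      obtain x where "x \<in> A" using False by blast
      then have zT: "y *\<^sub>R \<nu> + (\<Sum>b\<in>B. x b *\<^sub>R b) \<in> closure T" using T_subset_closure by (auto simp: A_def)
      then have t01: "0 \<le> t" "t \<le> 1" using tz[OF refl, of x] p bary_le_1[OF zT p] unfolding mem_closure by auto
      then have yy: "y \<in> {y0 .. y0 + 1 / norm g}" using g by (simp add: t_def zero_le_mult_iff field_simps)
      have "A \<subseteq> {x \<in> space N. (\<lambda>b\<in>B. x b - t * ((p - v1) \<bullet> b)) \<in> Cd}"
      proof
        fix x assume xA: "x \<in> A"
        define z where "z = y *\<^sub>R \<nu> + (\<Sum>b\<in>B. x b *\<^sub>R b)"
        have zT: "z \<in> T" and xN: "x \<in> space N" using xA by (simp_all add: A_def z_def)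
        have lz: "lam p z = t" by (rule tz) (simp add: z_def)
        \<comment> \<open>Moving parallel to the edge from \<open>p\<close> to \<open>v1\<close>
          lowers \<open>lam p\<close> from \<open>t\<close> to 0, raises \<open>lam v1\<close> by
          \<open>t\<close> and leaves the other coordinates unchanged, so the point arrives in the
          facet.\<close>
        define z' where "z' = z - t *\<^sub>R (p - v1)"
        have lz': "lam v z' = lam v z - t * (lam v p - lam v v1)" if "v \<in> V" for v
          using bary_grad[OF that, of z' z] bary_grad[OF that, of p v1] by (simp add: z'_def)
        have "z' \<in> E" unfolding E_def opp_facet_def mem_Collect_eq
        proof
          show "lam p z' = 0" using lz'[OF p] lz v1 p by (simp add: bary_vertex)
          show "\<forall>v\<in>V - {p}. 0 < lam v z'"
          proof
            fix v assume v: "v \<in> V - {p}"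
            have "0 < lam v z" using zT v by (simp add: mem_T)
            then show "0 < lam v z'" using lz'[of v] v v1 p t01 by (auto simp: bary_vertex intro: add_pos_nonneg)
          qed
        qed
        moreover have "(\<lambda>b\<in>B. x b - t * ((p - v1) \<bullet> b)) = (\<lambda>b\<in>B. z' \<bullet> b)"
        proof (rule restrict_ext)
          fix b assume b: "b \<in> B"
          have "z \<bullet> b = x b" using nb[OF b] ob[OF b, of x] by (simp add: z_def inner_add_left)
          then show "x b - t * ((p - v1) \<bullet> b) = z' \<bullet> b" by (simp add: z'_def inner_diff_left)
        qed
        ultimately show "x \<in> {x \<in> space N. (\<lambda>b\<in>B. x b - t * ((p - v1) \<bullet> b)) \<in> Cd}"
          using xN by (auto simp: Cd_def)
      qed
      then have "emeasure N A \<le> emeasure N {x \<in> space N. (\<lambda>b\<in>B. x b - t * ((p - v1) \<bullet> b)) \<in> Cd}"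
      proof (rule emeasure_mono)
        have "(\<lambda>x. \<lambda>b\<in>B. x b - t * ((p - v1) \<bullet> b)) \<in> N \<rightarrow>\<^sub>M N" unfolding N_def by (intro measurable_restrict) measurable
        from measurable_sets[OF this Cdm]
        show "{x \<in> space N. (\<lambda>b\<in>B. x b - t * ((p - v1) \<bullet> b)) \<in> Cd} \<in> sets N"
          by (simp add: vimage_def Int_def conj_commute)
      qed
      also have "... = emeasure N Cd" using product_translation[OF finB, of Cd "\<lambda>b. t * ((p - v1) \<bullet> b)"] Cdm by (simp add: N_def)
      finally show ?thesis using yy by simp
    qed simp
    finally show ?thesis .
  qed
  have "emeasure lborel T = emeasure (distr (\<Pi>\<^sub>M b\<in>?B'. lborel) borel (\<lambda>f. \<Sum>b\<in>?B'. f b *\<^sub>R b)) T"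
    by (subst lborel_orthonormal[OF o' n' card' finB'], simp_all)
  also have "... = (\<integral>\<^sup>+ z. indicator T z \<partial>distr (\<Pi>\<^sub>M b\<in>?B'. lborel) borel (\<lambda>f. \<Sum>b\<in>?B'. f b *\<^sub>R b))"
    using T_borel by simp
  also have "... = (\<integral>\<^sup>+ f. indicator T (\<Sum>b\<in>?B'. f b *\<^sub>R b) \<partial>(\<Pi>\<^sub>M b\<in>?B'. lborel))"
    by (rule nn_integral_distr) (use Tm in measurable)
  also have "... = (\<integral>\<^sup>+ y. (\<integral>\<^sup>+ x. indicator T (\<Sum>b\<in>?B'. (x(\<nu> := y)) b *\<^sub>R b) \<partial>N) \<partial>lborel)"
    unfolding N_def
    by (rule lborel_product.product_nn_integral_insert_rev[OF finB nnB]) (use T_borel in measurable)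
  also have "... \<le> (\<integral>\<^sup>+ y. emeasure N Cd * indicator {y0 .. y0 + 1 / norm g} y \<partial>lborel)"
    by (rule nn_integral_mono) (rule slice)
  also have "... = emeasure N Cd * ennreal (1 / norm g)" using g by (simp add: nn_integral_cmult)
  also have "... = ennreal (measure N Cd * (1 / norm g))"
    unfolding eN by (subst ennreal_mult) (use g in simp_all)
  finally have "vol \<le> measure N Cd * (1 / norm g)" unfolding emeasure_T using g by (simp add: ennreal_le_iff)
  also have "... \<le> measure N Cd * ?d"
    using bgrad_diameter[OF p] g by (intro mult_left_mono) (simp_all add: g_def field_simps)
  finally show "vol \<le> flat_measure (opp_facet T p) * diameter T" using fm by (simp add: E_def)
qed

end

subsection \<open>Normal fluxes\<close>

lemma lborel_integral_dilation:
  fixes f :: "'a::euclidean_space \<Rightarrow> real"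
  assumes s: "s > 0" and f: "f \<in> borel_measurable borel"
  shows "(LINT x|lborel. f x) = s ^ DIM('a) * (LINT x|lborel. f (t + s *\<^sub>R x))"
proof -
  have m: "(\<lambda>x. t + s *\<^sub>R x) \<in> borel_measurable borel" by measurable
  have "(LINT x|lborel. f x) = (LINT x|density (distr lborel borel (\<lambda>x. t + s *\<^sub>R x)) (\<lambda>_. \<bar>s\<bar> ^ DIM('a)). f x)"
    using lborel_affine[of s t] s by simp
  also have "... = (LINT x|distr lborel borel (\<lambda>x. t + s *\<^sub>R x). s ^ DIM('a) *\<^sub>R f x)"
    using s f by (subst integral_density) simp_all
  also have "... = (LINT x|lborel. s ^ DIM('a) *\<^sub>R f (t + s *\<^sub>R x))"
    using m f by (subst integral_distr) simp_all
  finally show ?thesis by simp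
qed

context osimplex
begin

abbreviation IT :: "('a \<Rightarrow> real) \<Rightarrow> real" where "IT f \<equiv> integral\<^sup>L (lebesgue_on T) f"

lemma IT_lborel: "f \<in> borel_measurable borel \<Longrightarrow> IT f = (LINT x|lborel. indicator T x * f x)"
  by (rule lebesgue_on_eq_lborel(1)[OF T_borel])

lemma IT_integrable: "continuous_on UNIV f \<Longrightarrow> integrable (lebesgue_on T) f" for f :: "'a \<Rightarrow> real"
  by (rule integrable_continuous_bounded[OF _ T_lmeasurable bounded_T])

text \<open>The divergence theorem for \<open>g x *\<^sub>R (x - p)\<close> in the case of vanishing boundary integral. Dilating \<open>T\<close> by
  \<open>s > 1\<close> from \<open>p\<close> adds a layer along the facet whose volume, as well as the size of \<open>g\<close> on it, is of order \<open>s - 1\<close>.\<close>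

lemma flux_zero:
  assumes p: "p \<in> V"
    and der: "\<And>x. (g has_derivative (\<lambda>h. G x \<bullet> h)) (at x)" and G: "continuous_on UNIV G"
    and zero: "\<And>x. x \<in> opp_facet T p \<Longrightarrow> g x = 0"
  shows "IT (\<lambda>x. real DIM('a) * g x + G x \<bullet> (x - p)) = 0"
proof -
  let ?n = "DIM('a)"
  let ?d = "diameter T"
  have d0: "0 < ?d" by (rule diameter_pos)
  have cg: "continuous_on UNIV g"
    by (intro continuous_at_imp_continuous_on ballI has_derivative_continuous[OF der])
  have gb: "g \<in> borel_measurable borel" by (rule borel_measurable_continuous_onI[OF cg])
  \<comment> \<open>This ball contains all dilates of the closed element from \<open>p\<close> by
    factors up to 2, so one bound for \<open>g\<close> and one for \<open>G\<close> serve all of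
    them.\<close>
  define U where "U = cball p (2 * ?d)"
  obtain L where L: "L > 0" "\<And>x. x \<in> U \<Longrightarrow> norm (G x) \<le> L"
    using continuous_bounded_on[OF G, of U] by (metis U_def bounded_cball)
  obtain M where M: "M > 0" "\<And>x. x \<in> U \<Longrightarrow> norm (g x) \<le> M"
    using continuous_bounded_on[OF cg, of U] by (metis U_def bounded_cball)
  have lip: "\<bar>g x - g y\<bar> \<le> L * norm (x - y)" if "x \<in> U" "y \<in> U" for x y
  proof -
    have "norm (g x - g y) \<le> L * norm (x - y)"
    proof (rule differentiable_bound[of U g "\<lambda>x h. G x \<bullet> h"])
      show "convex U" by (simp add: U_def)
      show "(g has_derivative (\<bullet>) (G x)) (at x within U)" for x by (rule has_derivative_at_withinI[OF der])
      show "onorm ((\<bullet>) (G x)) \<le> L" if "x \<in> U" for x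
      proof (rule onorm_le)
        fix h show "norm (G x \<bullet> h) \<le> L * norm h"
          using Cauchy_Schwarz_ineq2[of "G x" h] mult_right_mono[OF L(2)[OF that] norm_ge_zero[of h]] by simp
      qed
    qed (use that in simp_all)
    then show ?thesis by simp
  qed
  \<comment> \<open>The integral of \<open>g\<close> over the dilated element, pulled back to
    \<open>T\<close> with its Jacobian. The derivative of \<open>F\<close> at \<open>s = 1\<close>
    is the integrand of the claim.\<close>
  define F where "F s x = s ^ ?n * g (p + s *\<^sub>R (x - p))" for s x
  define F' where "F' s x = real ?n * s ^ (?n - 1) * g (p + s *\<^sub>R (x - p)) + s ^ ?n * (G (p + s *\<^sub>R (x - p)) \<bullet> (x - p))" for s x
  have dF: "((\<lambda>s. F s x) has_real_derivative F' s x) (at s)" for s x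
  proof -
    have 1: "((\<lambda>s. p + s *\<^sub>R (x - p)) has_derivative (\<lambda>h. h *\<^sub>R (x - p))) (at s)"
      by (auto intro!: derivative_eq_intros)
    have "((\<lambda>s. g (p + s *\<^sub>R (x - p))) has_derivative (\<lambda>h. G (p + s *\<^sub>R (x - p)) \<bullet> (h *\<^sub>R (x - p)))) (at s)"
      by (rule has_derivative_compose[OF 1 der])
    moreover have "(\<lambda>h. G (p + s *\<^sub>R (x - p)) \<bullet> (h *\<^sub>R (x - p))) = (*) (G (p + s *\<^sub>R (x - p)) \<bullet> (x - p))"
      by (auto simp: fun_eq_iff)
    ultimately have 2: "((\<lambda>s. g (p + s *\<^sub>R (x - p))) has_real_derivative G (p + s *\<^sub>R (x - p)) \<bullet> (x - p)) (at s)"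
      by (simp add: has_field_derivative_def)
    show ?thesis unfolding F_def F'_def
      by (rule DERIV_cong[OF DERIV_mult[OF DERIV_pow 2]]) simp
  qed
  have inU: "p + s *\<^sub>R (x - p) \<in> U" if "x \<in> closure T" "0 \<le> s" "s \<le> 2" for x s
  proof -
    have "norm (s *\<^sub>R (x - p)) \<le> 2 * ?d"
      using that dist_le_diameter[OF that(1) vertex_in_closure[OF p]] by (simp add: mult_mono)
    then show ?thesis by (simp add: U_def dist_norm)
  qed
  define K where "K = real ?n * 2 ^ ?n * M + 2 ^ ?n * (L * ?d)"
  have F'b: "\<bar>F' s x\<bar> \<le> K" if x: "x \<in> closure T" and s: "0 \<le> s" "s \<le> 2" for s x
  proof -
    let ?y = "p + s *\<^sub>R (x - p)"
    have "s ^ (?n - 1) \<le> 2 ^ (?n - 1)" by (rule power_mono[OF s(2,1)])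
    also have "(2::real) ^ (?n - 1) \<le> 2 ^ ?n" by (rule power_increasing) simp_all
    finally have sp: "s ^ (?n - 1) \<le> 2 ^ ?n" .
    have sn: "s ^ ?n \<le> 2 ^ ?n" by (rule power_mono[OF s(2,1)])
    have 1: "\<bar>real ?n * s ^ (?n - 1) * g ?y\<bar> \<le> real ?n * 2 ^ ?n * M"
      unfolding abs_mult using sp s M(2)[OF inU[OF x s]] by (intro mult_mono) simp_all
    have "\<bar>G ?y \<bullet> (x - p)\<bar> \<le> norm (G ?y) * norm (x - p)" by (rule Cauchy_Schwarz_ineq2)
    also have "... \<le> L * ?d"
      by (rule mult_mono[OF L(2)[OF inU[OF x s]] dist_le_diameter[OF x vertex_in_closure[OF p]]]) (use L in simp_all)
    finally have 2: "\<bar>s ^ ?n * (G ?y \<bullet> (x - p))\<bar> \<le> 2 ^ ?n * (L * ?d)"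
      unfolding abs_mult using sn s by (intro mult_mono) simp_all
    show ?thesis unfolding F'_def K_def using 1 2 by linarith
  qed
  define J where "J s = IT (F s)" for s
  have cF: "continuous_on UNIV (F s)" for s
    unfolding F_def by (intro continuous_intros continuous_on_compose2[OF cg]) auto
  have D: "(J has_real_derivative IT (F' 1)) (at 1)"
    unfolding J_def
  proof (rule DERIV_integral[where d=1 and B=K])
    show "finite_measure (lebesgue_on T)" by (rule finite_measure_lebesgue_on[OF T_lmeasurable])
    show "((\<lambda>s. F s x) has_real_derivative F' 1 x) (at 1)" for x by (rule dF)
    show "\<bar>F s x - F 1 x\<bar> \<le> K * \<bar>s - 1\<bar>" if "x \<in> space (lebesgue_on T)" "\<bar>s - 1\<bar> < 1" for s x
    proof -
      have x: "x \<in> closure T" using that(1) T_subset_closure by auto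
      have "norm (F s x - F 1 x) \<le> K * norm (s - 1)"
        by (rule field_differentiable_bound[of "{0..2}" "\<lambda>s. F s x" "\<lambda>s. F' s x"])
          (use that(2) F'b[OF x] in "auto intro: DERIV_subset[OF dF]")
      then show ?thesis by simp
    qed
    show "integrable (lebesgue_on T) (F s)" for s by (rule IT_integrable[OF cF])
    have "continuous_on UNIV (F' 1)"
      unfolding F'_def by (intro continuous_intros continuous_on_compose2[OF cg] continuous_on_compose2[OF G]) auto
    then show "F' 1 \<in> borel_measurable (lebesgue_on T)"
      by (rule continuous_measurable_lebesgue_on) (use T_borel in simp)
  qed simp
  define Ts where "Ts s = {y. p + (1 / s) *\<^sub>R (y - p) \<in> T}" for s
  have Tsb: "Ts s \<in> sets borel" for s
  proof -
    have "(\<lambda>y. p + (1 / s) *\<^sub>R (y - p)) \<in> borel_measurable borel" by measurable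
    from measurable_sets[OF this T_borel] show ?thesis by (simp add: Ts_def vimage_def)
  qed
  have memTs: "p - s *\<^sub>R p + s *\<^sub>R x \<in> Ts s \<longleftrightarrow> x \<in> T" if "s > 0" for s x
  proof -
    have "p + (1 / s) *\<^sub>R (p - s *\<^sub>R p + s *\<^sub>R x - p) = x" using that by (simp add: scaleR_diff_right scaleR_add_right)
    then show ?thesis by (simp add: Ts_def)
  qed
  then have ind: "indicator (Ts s) (p - s *\<^sub>R p + s *\<^sub>R x) = (indicator T x :: real)" if "s > 0" for s x
    using that by (simp add: indicator_def)
  have Js: "J s = (LINT y|lborel. indicator (Ts s) y * g y)" if s: "s > 0" for s
  proof -
    have "(LINT y|lborel. indicator (Ts s) y * g y)
      = s ^ ?n * (LINT x|lborel. indicator (Ts s) (p - s *\<^sub>R p + s *\<^sub>R x) * g (p - s *\<^sub>R p + s *\<^sub>R x))"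
      by (rule lborel_integral_dilation[OF s]) (use Tsb gb in measurable)
    also have "... = (LINT x|lborel. indicator T x * F s x)"
    proof -
      have "s ^ ?n * (indicator (Ts s) (p - s *\<^sub>R p + s *\<^sub>R x) * g (p - s *\<^sub>R p + s *\<^sub>R x)) = indicator T x * F s x" for x
        unfolding ind[OF s] F_def by (simp add: scaleR_diff_right algebra_simps)
      then show ?thesis by (simp flip: integral_mult_right_zero)
    qed
    also have "... = J s" unfolding J_def by (rule IT_lborel[symmetric, OF borel_measurable_continuous_onI[OF cF]])
    finally show ?thesis by simp
  qed
  have eTs: "emeasure lborel (Ts s) = ennreal (s ^ ?n * vol)" if s: "s > 0" for s
  proof -
    have "emeasure lborel (Ts s) = emeasure (density (distr lborel borel (\<lambda>x. (p - s *\<^sub>R p) + s *\<^sub>R x)) (\<lambda>_. \<bar>s\<bar> ^ ?n)) (Ts s)"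
      using lborel_affine[of s "p - s *\<^sub>R p"] s by simp
    also have "... = ennreal (s ^ ?n) * emeasure lborel ((\<lambda>x. (p - s *\<^sub>R p) + s *\<^sub>R x) -` Ts s)"
      using s Tsb by (subst emeasure_density_const) (simp_all add: emeasure_distr)
    also have "(\<lambda>x. (p - s *\<^sub>R p) + s *\<^sub>R x) -` Ts s = T"
      using memTs[OF s] by auto
    finally show ?thesis using s by (simp add: emeasure_T ennreal_mult)
  qed
  have bTs: "lam v y = s * lam v (p + (1 / s) *\<^sub>R (y - p)) + (1 - s) * lam v p" if "v \<in> V" "s > 0" for v y s
  proof -
    define a where "a = gl v \<bullet> (y - p)"
    have "lam v (p + (1 / s) *\<^sub>R (y - p)) = lam v p + a / s"
      using bary_grad[OF that(1), of "p + (1 / s) *\<^sub>R (y - p)" p]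
      by (simp only: add_diff_cancel_left' inner_scaleR_right a_def[symmetric]) simp
    moreover have "lam v y = lam v p + a" unfolding a_def by (rule bary_grad[OF that(1)])
    ultimately show ?thesis using that(2) by (simp add: field_simps)
  qed
  have sub: "T \<subseteq> Ts s" if s: "s > 1" for s
  proof
    fix y assume y: "y \<in> T"
    have "0 < lam v (p + (1 / s) *\<^sub>R (y - p))" if v: "v \<in> V" for v
    proof -
      have "0 < lam v y" using y v by (simp add: mem_T)
      moreover have "0 \<le> lam v p" using v p by (simp add: bary_vertex)
      then have "(1 - s) * lam v p \<le> 0" using s by (simp add: mult_nonpos_nonneg)
      ultimately have "0 < s * lam v (p + (1 / s) *\<^sub>R (y - p))" using bTs[OF v, of s y] s by simp
      then show ?thesis using s by (simp add: zero_less_mult_iff)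
    qed
    then show "y \<in> Ts s" by (simp add: Ts_def mem_T)
  qed
  have small: "\<bar>g y\<bar> \<le> L * ((s - 1) * ?d)" if s: "1 < s" "s \<le> 2" and y: "y \<in> Ts s" "y \<notin> T" for s y
  proof -
    define x where "x = p + (1 / s) *\<^sub>R (y - p)"
    have xT: "x \<in> T" using y(1) by (simp add: Ts_def x_def)
    have xc: "x \<in> closure T" using xT T_subset_closure by blast
    have yx: "y = p + s *\<^sub>R (x - p)" using s by (simp add: x_def)
    have ly: "lam v y = s * lam v x" if "v \<in> V" "v \<noteq> p" for v
      using bTs[OF that(1), of s y] s bary_vertex[OF that(1) p] that(2) by (simp add: x_def)
    have lyp: "lam p y = s * lam p x + (1 - s)" using bTs[OF p, of s y] s bary_vertex[OF p p] by (simp add: x_def)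
    have "\<exists>v\<in>V. lam v y \<le> 0" using y(2) by (auto simp: mem_T not_less)
    then obtain v where v: "v \<in> V" "lam v y \<le> 0" by blast
    have "v = p"
    proof (rule ccontr)
      assume "v \<noteq> p"
      then have "0 < lam v y" using ly[OF v(1)] xT v(1) s by (simp add: mem_T)
      then show False using v(2) by simp
    qed
    then have lp: "lam p y \<le> 0" using v(2) by simp
    have lp': "1 - s < lam p y" using lyp xT p s by (simp add: mem_T)
    \<comment> \<open>The segment from \<open>p\<close> to \<open>y\<close> crosses the plane
      \<open>lam p = 0\<close> at this parameter. The crossing point \<open>z\<close> lies in the
      facet, where \<open>g\<close> vanishes, and \<open>y\<close> is at most
      \<open>(s - 1) * ?d\<close> away from it.\<close>
    define r where "r = 1 / (1 - lam p y)"
    have r: "0 < r" "r \<le> 1" "1 - r \<le> 1 - 1 / s"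
    proof -
      show "0 < r" "r \<le> 1" using lp by (simp_all add: r_def)
      have "1 / s \<le> r" unfolding r_def using lp lp' s by (intro divide_left_mono) simp_all
      then show "1 - r \<le> 1 - 1 / s" by simp
    qed
    define z where "z = p + r *\<^sub>R (y - p)"
    have lz: "lam v z = r * lam v y + (1 - r) * lam v p" if "v \<in> V" for v
    proof -
      define a where "a = gl v \<bullet> (y - p)"
      have "lam v z = lam v p + r * a"
        using bary_grad[OF that, of z p]
        by (simp only: z_def add_diff_cancel_left' inner_scaleR_right a_def[symmetric])
      moreover have "lam v y = lam v p + a" unfolding a_def by (rule bary_grad[OF that])
      ultimately show ?thesis by (simp add: algebra_simps)
    qed
    have "z \<in> opp_facet T p" unfolding opp_facet_def mem_Collect_eq
    proof
      have "1 - r * (1 - lam p y) = 0" using lp by (simp add: r_def)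
      then show "lam p z = 0" using lz[OF p] bary_vertex[OF p p] by (simp add: algebra_simps)
      show "\<forall>v\<in>V - {p}. 0 < lam v z"
        using lz ly r(1) s xT p by (auto simp: bary_vertex mem_T)
    qed
    then have gz: "g z = 0" by (rule zero)
    have zc: "z \<in> closure T" using \<open>z \<in> opp_facet T p\<close> opp_facet_subset[OF p] by blast
    have "norm (y - z) = (1 - r) * norm (y - p)"
    proof -
      have "y - z = (1 - r) *\<^sub>R (y - p)" by (simp add: z_def algebra_simps)
      then show ?thesis using r(2) by simp
    qed
    also have "norm (y - p) = s * norm (x - p)" using yx s by simp
    also have "(1 - r) * (s * norm (x - p)) \<le> (1 - 1 / s) * (s * ?d)"
      using r s dist_le_diameter[OF xc vertex_in_closure[OF p]] by (intro mult_mono) simp_all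
    also have "... = (s - 1) * ?d" using s by (simp add: field_simps)
    finally have yz: "norm (y - z) \<le> (s - 1) * ?d" .
    have "y \<in> U" unfolding yx by (rule inU[OF xc]) (use s in simp_all)
    moreover have "z \<in> U" using inU[OF zc, of 1] by simp
    ultimately have "\<bar>g y\<bar> \<le> L * norm (y - z)" using lip[of y z] gz by simp
    also have "... \<le> L * ((s - 1) * ?d)" using yz L(1) by (intro mult_left_mono) simp_all
    finally show ?thesis .
  qed
  have Jdiff: "\<bar>J s - J 1\<bar> \<le> L * ((s - 1) * ?d) * ((s ^ ?n - 1) * vol)" if s: "1 < s" "s \<le> 2" for s
  proof -
    let ?W = "Ts s - T"
    have Wb: "?W \<in> sets borel" using Tsb T_borel by simp
    have iT: "integrable lborel (\<lambda>y. indicator T y * g y)"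
      using IT_integrable[OF cg] lebesgue_on_eq_lborel(2)[OF T_borel gb] by simp
    have eW: "emeasure lborel ?W = ennreal ((s ^ ?n - 1) * vol)"
    proof -
      have "emeasure lborel ?W = emeasure lborel (Ts s) - emeasure lborel T"
        by (rule emeasure_Diff) (use Tsb T_borel sub[OF s(1)] emeasure_T in simp_all)
      also have "... = ennreal (s ^ ?n * vol - vol)"
        using eTs[of s] s emeasure_T vol_pos by (simp add: ennreal_minus)
      finally show ?thesis by (simp add: algebra_simps)
    qed
    have iW: "integrable lborel (\<lambda>y. indicator ?W y * (L * ((s - 1) * ?d)))"
      using integrable_real_indicator[of ?W lborel] Wb eW by (intro integrable_mult_left) simp
    have iWg: "integrable lborel (\<lambda>y. indicator ?W y * g y)"
    proof (rule Bochner_Integration.integrable_bound[OF iW])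
      show "AE y in lborel. norm (indicator ?W y * g y) \<le> norm (indicator ?W y * (L * ((s - 1) * ?d)))"
      proof (rule AE_I2)
        fix y
        show "norm (indicator ?W y * g y) \<le> norm (indicator ?W y * (L * ((s - 1) * ?d)))"
        proof (cases "y \<in> ?W")
          case True
          then have "\<bar>g y\<bar> \<le> L * ((s - 1) * ?d)" using small[OF s] by blast
          then show ?thesis using True by simp
        qed simp
      qed
    qed (use Wb gb in measurable)
    have split: "indicator (Ts s) y * g y = indicator T y * g y + indicator ?W y * g y" for y
      using sub[OF s(1)] by (auto simp: indicator_def)
    have "J s = J 1 + (LINT y|lborel. indicator ?W y * g y)"
    proof -
      have "Ts 1 = T" by (simp add: Ts_def)
      then have "J 1 = (LINT y|lborel. indicator T y * g y)" using Js[of 1] by simp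
      moreover have "J s = (LINT y|lborel. indicator T y * g y + indicator ?W y * g y)" using Js[of s] s unfolding split by simp
      ultimately show ?thesis using LINT_add[OF iT iWg] by simp
    qed
    moreover have "\<bar>LINT y|lborel. indicator ?W y * g y\<bar> \<le> (LINT y|lborel. indicator ?W y * (L * ((s - 1) * ?d)))"
    proof -
      have "\<bar>LINT y|lborel. indicator ?W y * g y\<bar> \<le> (LINT y|lborel. \<bar>indicator ?W y * g y\<bar>)"
        using integral_norm_bound[of lborel "\<lambda>y. indicator ?W y * g y"] by simp
      also have "... \<le> (LINT y|lborel. indicator ?W y * (L * ((s - 1) * ?d)))"
      proof (rule integral_mono)
        show "integrable lborel (\<lambda>y. \<bar>indicator ?W y * g y\<bar>)" using iWg by (rule integrable_abs)
        show "\<bar>indicator ?W y * g y\<bar> \<le> indicator ?W y * (L * ((s - 1) * ?d))" for y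
        proof (cases "y \<in> ?W")
          case True
          then have "\<bar>g y\<bar> \<le> L * ((s - 1) * ?d)" using small[OF s] by blast
          then show ?thesis using True by simp
        qed simp
      qed (rule iW)
      finally show ?thesis .
    qed
    moreover have "(LINT y|lborel. indicator ?W y * (L * ((s - 1) * ?d))) = measure lborel ?W * (L * ((s - 1) * ?d))"
      using Wb by simp
    moreover have "measure lborel ?W = (s ^ ?n - 1) * vol"
      using eW s vol_pos by (simp add: measure_def one_le_power)
    ultimately show ?thesis by (simp add: mult.commute)
  qed
  have "IT (F' 1) = 0"
  proof -
    have "((\<lambda>s. (J s - J 1) / (s - 1)) \<longlongrightarrow> IT (F' 1)) (at_right 1)"
      using D unfolding has_field_derivative_iff by (rule tendsto_mono[OF at_le, rotated]) simp
    \<comment> \<open>Divided by \<open>s - 1\<close>, the contribution of the layer is bounded by a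
      multiple of its volume, which vanishes as \<open>s\<close> decreases to 1.\<close>
    moreover have "((\<lambda>s. (J s - J 1) / (s - 1)) \<longlongrightarrow> 0) (at_right 1)"
    proof (rule tendsto_rabs_zero_cancel, rule tendsto_sandwich[OF _ _ tendsto_const])
      show "\<forall>\<^sub>F s in at_right 1. 0 \<le> \<bar>(J s - J 1) / (s - 1)\<bar>" by simp
      show "\<forall>\<^sub>F s in at_right 1. \<bar>(J s - J 1) / (s - 1)\<bar> \<le> L * ?d * ((s ^ ?n - 1) * vol)"
      proof (rule eventually_at_rightI[of 1 2])
        fix s :: real assume "s \<in> {1<..<2}"
        then have s: "1 < s" "s \<le> 2" by simp_all
        then show "\<bar>(J s - J 1) / (s - 1)\<bar> \<le> L * ?d * ((s ^ ?n - 1) * vol)"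
          using Jdiff[OF s] by (simp add: abs_divide divide_le_eq mult_ac)
      qed simp
      have "((\<lambda>s. L * ?d * ((s ^ ?n - 1) * vol)) \<longlongrightarrow> L * ?d * ((1 ^ ?n - 1) * vol)) (at_right 1)"
        by (intro tendsto_intros)
      then show "((\<lambda>s. L * ?d * ((s ^ ?n - 1) * vol)) \<longlongrightarrow> 0) (at_right 1)" by simp
    qed
    ultimately show ?thesis using tendsto_unique trivial_limit_at_right_real by blast
  qed
  moreover have "F' 1 = (\<lambda>x. real ?n * g x + G x \<bullet> (x - p))" by (simp add: F'_def fun_eq_iff)
  ultimately show ?thesis by (simp only:)
qed

end

text \<open>The affine map fixing the common facet and exchanging the opposite vertices reduces the balance of
  the fluxes through that facet to a function vanishing there.\<close>

lemma flux_balance: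
  fixes T1 T2 :: "'a::euclidean_space set"
  assumes T: "open_simplex T1" "open_simplex T2" and p: "p1 \<in> vert T1" "p2 \<in> vert T2"
    and E: "opp_facet T1 p1 = opp_facet T2 p2" and \<phi>: "smooth \<phi>"
  shows "integral\<^sup>L (lebesgue_on T1) (\<lambda>x. real DIM('a) * \<phi> x + grad \<phi> x \<bullet> (x - p1)) / measure lebesgue T1
    = integral\<^sup>L (lebesgue_on T2) (\<lambda>x. real DIM('a) * \<phi> x + grad \<phi> x \<bullet> (x - p2)) / measure lebesgue T2"
proof -
  interpret S1: osimplex T1 by unfold_locales fact
  interpret S2: osimplex T2 by unfold_locales fact
  let ?n = "real DIM('a)"
  have W: "vert T1 - {p1} = vert T2 - {p2}" using S1.opp_facet_extreme[OF p(1)] S2.opp_facet_extreme[OF p(2)] E by simp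
  define L where "L x = (\<Sum>v\<in>vert T1 - {p1}. (bgrad T1 v \<bullet> x) *\<^sub>R v) + (bgrad T1 p1 \<bullet> x) *\<^sub>R p2" for x
  \<comment> \<open>The map keeps the barycentric coordinates and replaces the vertex
    \<open>p1\<close> by \<open>p2\<close>; \<open>L\<close> is its linear part.\<close>
  define \<Phi> where "\<Phi> x = (\<Sum>v\<in>vert T1 - {p1}. bary T1 v x *\<^sub>R v) + bary T1 p1 x *\<^sub>R p2" for x
  have lin: "linear L" unfolding L_def
    by (intro linearI) (simp_all add: inner_add_right scaleR_add_left sum.distrib scaleR_sum_right scaleR_add_right)
  then have bl: "bounded_linear L" by (rule linear_conv_bounded_linear[THEN iffD1])
  have \<Phi>L: "\<Phi> x = \<Phi> y + L (x - y)" for x y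
  proof -
    have "(\<Sum>v\<in>vert T1 - {p1}. bary T1 v x *\<^sub>R v) = (\<Sum>v\<in>vert T1 - {p1}. bary T1 v y *\<^sub>R v + (bgrad T1 v \<bullet> (x - y)) *\<^sub>R v)"
      by (rule sum.cong[OF refl]) (use S1.bary_grad[of _ x y] in "simp add: scaleR_add_left")
    then show ?thesis using S1.bary_grad[OF p(1), of x y] by (simp add: \<Phi>_def L_def sum.distrib scaleR_add_left)
  qed
  define u where "u x v = (if v = p2 then bary T1 p1 x else bary T1 v x)" for x v
  have uW: "(\<Sum>v\<in>vert T2 - {p2}. u x v) = (\<Sum>v\<in>vert T1 - {p1}. bary T1 v x)"
    "(\<Sum>v\<in>vert T2 - {p2}. u x v *\<^sub>R v) = (\<Sum>v\<in>vert T1 - {p1}. bary T1 v x *\<^sub>R v)" for x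
    unfolding W by (rule sum.cong; simp add: u_def)+
  have bu: "bary T2 v (\<Phi> x) = u x v" if v: "v \<in> vert T2" for v x
  proof (rule S2.bary_unique[OF _ _ v])
    show "sum (u x) (vert T2) = 1"
      using sum.remove[OF S2.finV p(2), of "u x"] sum.remove[OF S1.finV p(1), of "\<lambda>v. bary T1 v x"]
        S1.bary_props(1)[of x] uW(1)[of x] by (simp add: u_def)
    show "(\<Sum>v\<in>vert T2. u x v *\<^sub>R v) = \<Phi> x"
      using sum.remove[OF S2.finV p(2), of "\<lambda>v. u x v *\<^sub>R v"] uW(2)[of x] by (simp add: u_def \<Phi>_def add.commute)
  qed
  have mem: "\<Phi> x \<in> T2 \<longleftrightarrow> x \<in> T1" for x
  proof -
    have "(\<forall>v\<in>vert T2. 0 < u x v) \<longleftrightarrow> (\<forall>v\<in>vert T2 - {p2}. 0 < bary T1 v x) \<and> 0 < bary T1 p1 x"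
      using p(2) by (auto simp: u_def)
    then show ?thesis unfolding S1.mem_T S2.mem_T W[symmetric] using bu p(1) by auto
  qed
  have \<Phi>p: "\<Phi> p1 = p2"
  proof -
    have "(\<Sum>v\<in>vert T1 - {p1}. bary T1 v p1 *\<^sub>R v) = 0" by (rule sum.neutral) (simp add: S1.bary_vertex p)
    then show ?thesis by (simp add: \<Phi>_def S1.bary_vertex p)
  qed
  have \<Phi>E: "\<Phi> x = x" if "x \<in> opp_facet T1 p1" for x
    using S1.facet_coeffs(2)[OF p(1), of x] that by (simp add: \<Phi>_def opp_facet_def)
  have "inj L"
  proof (rule linear_injective_0[OF lin, THEN iffD2], intro allI impI)
    fix x assume "L x = 0"
    then have e: "\<Phi> x = \<Phi> 0" using \<Phi>L[of x 0] by simp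
    have "bary T1 v x = bary T1 v 0" if "v \<in> vert T1" for v
    proof (cases "v = p1")
      case True
      then show ?thesis using bu[OF p(2), of x] bu[OF p(2), of 0] e by (simp add: u_def)
    next
      case False
      then have "v \<in> vert T2" "v \<noteq> p2" using that W by blast+
      then show ?thesis using bu[of v x] bu[of v 0] e by (simp add: u_def)
    qed
    then have "(\<Sum>v\<in>vert T1. bary T1 v x *\<^sub>R v) = (\<Sum>v\<in>vert T1. bary T1 v 0 *\<^sub>R v)" by (intro sum.cong) simp_all
    then show "x = 0" by (simp only: S1.bary_props)
  qed
  then have bij: "bij L" using linear_injective_imp_surjective[OF lin] by (simp add: bij_def)
  have "\<exists>c>0. \<forall>h::'a \<Rightarrow> real. h \<in> borel_measurable borel \<longrightarrow> (LINT x|lborel. h (L x)) = c * (LINT x|lborel. h x)"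
    by (rule linear_vimage_scale[OF lin bij]) blast
  then obtain c where c: "c > 0"
    "\<And>h::'a \<Rightarrow> real. h \<in> borel_measurable borel \<Longrightarrow> (LINT x|lborel. h (L x)) = c * (LINT x|lborel. h x)" by blast
  have \<Phi>0: "\<Phi> x = \<Phi> 0 + L x" for x using \<Phi>L[of x 0] by (simp only: diff_zero)
  have \<Phi>fun: "\<Phi> = (\<lambda>x. \<Phi> 0 + L x)" by (rule ext) (rule \<Phi>0)
  have cv: "(LINT x|lborel. h (\<Phi> x)) = c * (LINT x|lborel. h x)" if h: "h \<in> borel_measurable borel" for h :: "'a \<Rightarrow> real"
  proof -
    have "(\<lambda>x. h (\<Phi> x)) = (\<lambda>x. h (\<Phi> 0 + L x))" by (rule ext, rule arg_cong[where f=h], rule \<Phi>0)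
    then have "(LINT x|lborel. h (\<Phi> x)) = (LINT x|lborel. h (\<Phi> 0 + L x))" by (simp only:)
    also have "... = c * (LINT x|lborel. h (\<Phi> 0 + x))"
      using c(2)[of "\<lambda>x. h (\<Phi> 0 + x)"] h by simp
    also have "(LINT x|lborel. h (\<Phi> 0 + x)) = (LINT x|distr lborel borel ((+) (\<Phi> 0)). h x)"
      using h by (subst integral_distr) simp_all
    finally show ?thesis by (simp add: lborel_distr_plus)
  qed
  have ind: "indicator T2 (\<Phi> x) = (indicator T1 x :: real)" for x by (simp add: indicator_def mem)
  have IT2: "S1.IT (\<lambda>x. h (\<Phi> x)) = c * S2.IT h" if h: "continuous_on UNIV h" for h
  proof -
    have hb: "h \<in> borel_measurable borel" by (rule borel_measurable_continuous_onI[OF h])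
    have "(\<lambda>x. \<Phi> 0 + L x) \<in> borel_measurable borel" using linear_bij_measurable[OF lin] by measurable
    then have "\<Phi> \<in> borel_measurable borel" by (subst \<Phi>fun)
    then have "(\<lambda>x. h (\<Phi> x)) \<in> borel_measurable borel" using hb by measurable
    then have "S1.IT (\<lambda>x. h (\<Phi> x)) = (LINT x|lborel. indicator T2 (\<Phi> x) * h (\<Phi> x))" by (simp add: S1.IT_lborel ind)
    also have "... = c * (LINT x|lborel. indicator T2 x * h x)" by (rule cv) (use hb S2.T_borel in measurable)
    finally show ?thesis by (simp add: S2.IT_lborel[OF hb])
  qed
  have volc: "measure lebesgue T1 = c * measure lebesgue T2"
    using IT2[of "\<lambda>_. 1"] by (simp add: measure_restrict_space S1.T_borel S2.T_borel)
  let ?G = "\<lambda>x. adjoint L (grad \<phi> (\<Phi> x)) - grad \<phi> x"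
  have c\<Phi>: "continuous_on UNIV \<Phi>"
  proof -
    have "continuous_on UNIV (\<lambda>x. \<Phi> 0 + L x)" by (intro continuous_intros linear_continuous_on bl)
    then show ?thesis by (subst \<Phi>fun)
  qed
  have c1: "continuous_on UNIV (\<lambda>x. grad \<phi> (\<Phi> x))"
    by (rule continuous_on_compose2[OF continuous_on_grad[OF \<phi>, of UNIV] c\<Phi>]) simp
  have c2: "continuous_on UNIV (\<lambda>x. \<phi> (\<Phi> x))"
    by (rule continuous_on_compose2[OF smooth_continuous[OF \<phi>, of UNIV] c\<Phi>]) simp
  have adj: "adjoint L y \<bullet> h = y \<bullet> L h" for y h using adjoint_works[OF lin, of h y] by (simp add: inner_commute)
  have cadj: "continuous_on UNIV (\<lambda>x. adjoint L (grad \<phi> (\<Phi> x)))"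
  proof -
    have "continuous_on UNIV (adjoint L)"
      by (rule linear_continuous_on[OF linear_conv_bounded_linear[THEN iffD1, OF adjoint_linear[OF lin]]])
    from continuous_on_compose2[OF this c1] show ?thesis by simp
  qed
  \<comment> \<open>Since \<open>\<Phi>\<close> is the identity on the facet,
    \<open>\<phi> \<circ> \<Phi> - \<phi>\<close> vanishes there; its gradient contains the adjoint
    of \<open>L\<close> by the chain rule.\<close>
  have "S1.IT (\<lambda>x. ?n * (\<phi> (\<Phi> x) - \<phi> x) + ?G x \<bullet> (x - p1)) = 0"
  proof (rule S1.flux_zero[OF p(1)])
    fix x
    have 1: "(\<Phi> has_derivative L) (at x)"
    proof -
      have "((\<lambda>x. \<Phi> 0 + L x) has_derivative (\<lambda>h. 0 + L h)) (at x)"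
        by (intro has_derivative_add has_derivative_const bounded_linear_imp_has_derivative bl)
      then have "((\<lambda>x. \<Phi> 0 + L x) has_derivative L) (at x)" by simp
      then show ?thesis by (subst \<Phi>fun)
    qed
    have "((\<lambda>x. \<phi> (\<Phi> x)) has_derivative (\<lambda>h. grad \<phi> (\<Phi> x) \<bullet> L h)) (at x)"
      by (rule has_derivative_compose[OF 1 smooth_has_derivative_grad[OF \<phi>]])
    from has_derivative_diff[OF this smooth_has_derivative_grad[OF \<phi>]]
    have "((\<lambda>x. \<phi> (\<Phi> x) - \<phi> x) has_derivative (\<lambda>h. grad \<phi> (\<Phi> x) \<bullet> L h - grad \<phi> x \<bullet> h)) (at x)" .
    moreover have "(\<lambda>h. grad \<phi> (\<Phi> x) \<bullet> L h - grad \<phi> x \<bullet> h) = (\<bullet>) (?G x)"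
      by (rule ext) (simp only: inner_diff_left adj)
    ultimately show "((\<lambda>x. \<phi> (\<Phi> x) - \<phi> x) has_derivative (\<bullet>) (?G x)) (at x)" by (simp only:)
  next
    show "continuous_on UNIV ?G" by (intro continuous_on_diff cadj continuous_on_grad \<phi>)
    show "\<phi> (\<Phi> x) - \<phi> x = 0" if "x \<in> opp_facet T1 p1" for x using \<Phi>E[OF that] by simp
  qed
  moreover have "?n * (\<phi> (\<Phi> x) - \<phi> x) + ?G x \<bullet> (x - p1)
    = (?n * \<phi> (\<Phi> x) + grad \<phi> (\<Phi> x) \<bullet> (\<Phi> x - p2)) - (?n * \<phi> x + grad \<phi> x \<bullet> (x - p1))" for x
  proof -
    have "L (x - p1) = \<Phi> x - p2" using \<Phi>L[of x p1] \<Phi>p by simp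
    then have "?G x \<bullet> (x - p1) = grad \<phi> (\<Phi> x) \<bullet> (\<Phi> x - p2) - grad \<phi> x \<bullet> (x - p1)"
      by (simp only: inner_diff_left[of "adjoint L _"] adj)
    then show ?thesis by (simp only: right_diff_distrib)
  qed
  moreover have "S1.IT (\<lambda>x. (?n * \<phi> (\<Phi> x) + grad \<phi> (\<Phi> x) \<bullet> (\<Phi> x - p2)) - (?n * \<phi> x + grad \<phi> x \<bullet> (x - p1)))
    = S1.IT (\<lambda>x. ?n * \<phi> (\<Phi> x) + grad \<phi> (\<Phi> x) \<bullet> (\<Phi> x - p2)) - S1.IT (\<lambda>x. ?n * \<phi> x + grad \<phi> x \<bullet> (x - p1))"
    by (intro LINT_diff S1.IT_integrable continuous_intros c1 c2 c\<Phi> smooth_continuous continuous_on_grad \<phi>)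
  moreover have "S1.IT (\<lambda>x. ?n * \<phi> (\<Phi> x) + grad \<phi> (\<Phi> x) \<bullet> (\<Phi> x - p2)) = c * S2.IT (\<lambda>x. ?n * \<phi> x + grad \<phi> x \<bullet> (x - p2))"
    by (rule IT2[of "\<lambda>x. ?n * \<phi> x + grad \<phi> x \<bullet> (x - p2)"]) (intro continuous_intros smooth_continuous continuous_on_grad \<phi>)
  ultimately have "c * S2.IT (\<lambda>x. ?n * \<phi> x + grad \<phi> x \<bullet> (x - p2)) = S1.IT (\<lambda>x. ?n * \<phi> x + grad \<phi> x \<bullet> (x - p1))" by simp
  then show ?thesis using c(1) S2.vol_pos by (simp add: volc field_simps)
qed

context osimplex
begin

lemma bary_segment:
  assumes "v \<in> V"
  shows "lam v (x + t *\<^sub>R (y - x)) = (1 - t) * lam v x + t * lam v y"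
proof -
  define a where "a = gl v \<bullet> (y - x)"
  have "lam v (x + t *\<^sub>R (y - x)) = lam v x + t * a"
    using bary_grad[OF assms, of "x + t *\<^sub>R (y - x)" x]
    by (simp only: add_diff_cancel_left' inner_scaleR_right a_def[symmetric])
  moreover have "lam v y = lam v x + a" unfolding a_def by (rule bary_grad[OF assms])
  ultimately show ?thesis by (simp add: algebra_simps)
qed

lemma bary_affine: "v \<in> V \<Longrightarrow> lam v x = lam v 0 + gl v \<bullet> x"
  using bary_grad[of v x 0] by (simp only: diff_zero)

end

lemma negligible_UN:
  assumes "finite J" "\<And>i. i \<in> J \<Longrightarrow> negligible (A i)"
  shows "negligible (\<Union>i\<in>J. A i)"
  by (rule negligible_Union) (use assms in auto)

lemma open_avoid_negligible:
  fixes S :: "'a::euclidean_space set"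
  assumes "open S" "S \<noteq> {}" "negligible N"
  obtains x where "x \<in> S" "x \<notin> N"
proof -
  have "\<not> S \<subseteq> N" using open_not_negligible[OF assms(1,2)] negligible_subset[OF assms(3)] by blast
  then show ?thesis using that by blast
qed

section \<open>The mesh\<close>

text \<open>\<open>int_cl\<close> is the form in which the Lipschitz boundary is used: a point that
  is surrounded by elements belongs to the domain.\<close>

locale mesh = bounded_domain \<Omega> for \<Omega> :: "'a::euclidean_space set" +
  fixes \<T> :: "'a set set" and \<gamma> :: real and Tp Tm :: "'a set \<Rightarrow> 'a set"
  assumes regular: "regular_mesh \<Omega> \<T>" and shape: "shape_regular \<gamma> \<T>" and lab: "facet_labelling \<Omega> \<T> Tp Tm"
    and int_cl: "interior (closure \<Omega>) = \<Omega>" and dim2: "2 \<le> DIM('a)"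
begin

lemma fin: "finite \<T>" using regular by (simp add: regular_mesh_def)

lemma simp_loc: "T \<in> \<T> \<Longrightarrow> osimplex T"
  using regular unfolding regular_mesh_def osimplex_def by blast

lemma disj: "T \<in> \<T> \<Longrightarrow> T' \<in> \<T> \<Longrightarrow> x \<in> T \<Longrightarrow> x \<in> T' \<Longrightarrow> T = T'"
  using regular unfolding regular_mesh_def pairwise_def disjnt_def by blast

lemma cover: "closure \<Omega> = (\<Union>T\<in>\<T>. closure T)" using regular by (simp add: regular_mesh_def)

lemma elem_subset: "T \<in> \<T> \<Longrightarrow> T \<subseteq> \<Omega>"
proof -
  assume T: "T \<in> \<T>"
  have "T \<subseteq> interior (closure \<Omega>)"
    by (rule interior_maximal) (use T cover closure_subset[of T] osimplex.open_T[OF simp_loc[OF T]] in auto)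
  then show ?thesis by (simp add: int_cl)
qed

lemma mesh_nonempty: "\<T> \<noteq> {}"
  using cover nonempty_dom closure_subset[of \<Omega>] by auto

text \<open>The intersection of two closed elements is a face of both, hence the hull of common
  vertices. A point of it has coordinates supported on these vertices, and they are the same for
  both elements.\<close>

lemma conform:
  assumes T: "T \<in> \<T>" and T': "T' \<in> \<T>" and x: "x \<in> closure T" "x \<in> closure T'"
    and a: "a \<in> vert T" "0 < bary T a x"
  shows "a \<in> vert T' \<and> bary T' a x = bary T a x"
proof -
  interpret S: osimplex T by (rule simp_loc[OF T])
  interpret S': osimplex T' by (rule simp_loc[OF T'])
  have tr: "triangulation (closure ` \<T>)" using regular by (simp add: regular_mesh_def)
  have f: "closure T \<inter> closure T' face_of closure T" "closure T \<inter> closure T' face_of closure T'"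
    using tr T T' unfolding triangulation_def by (blast, metis Int_commute imageI)
  obtain C where C: "C \<subseteq> vert T" "closure T \<inter> closure T' = convex hull C"
    using face_of_convex_hull_subset[OF finite_imp_compact[OF S.finV]] f(1) S.vert_props(4) by metis
  obtain C' where C': "C' \<subseteq> vert T'" "closure T \<inter> closure T' = convex hull C'"
    using face_of_convex_hull_subset[OF finite_imp_compact[OF S'.finV]] f(2) S'.vert_props(4) by metis
  have i: "\<not> affine_dependent C" "\<not> affine_dependent C'"
    using affine_independent_subset[OF S.vert_props(3) C(1)] affine_independent_subset[OF S'.vert_props(3) C'(1)] by simp_all
  have CC: "C = C'"
    using extreme_point_of_convex_hull_affine_independent[OF i(1)] extreme_point_of_convex_hull_affine_independent[OF i(2)]
      C(2) C'(2) by auto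
  have finC: "finite C" using C(1) S.finV finite_subset by blast
  have "x \<in> convex hull C" using x C(2) by blast
  then obtain u where u: "sum u C = 1" "(\<Sum>v\<in>C. u v *\<^sub>R v) = x"
    unfolding convex_hull_finite[OF finC] by blast
  define u' where "u' v = (if v \<in> C then u v else 0)" for v
  have s: "sum u' X = 1" "(\<Sum>v\<in>X. u' v *\<^sub>R v) = x" if X: "C \<subseteq> X" "finite X" for X
  proof -
    have "sum u' X = sum u C" using X by (intro sum.mono_neutral_cong_right) (auto simp: u'_def)
    then show "sum u' X = 1" using u(1) by simp
    have "(\<Sum>v\<in>X. u' v *\<^sub>R v) = (\<Sum>v\<in>C. u v *\<^sub>R v)" using X by (intro sum.mono_neutral_cong_right) (auto simp: u'_def)
    then show "(\<Sum>v\<in>X. u' v *\<^sub>R v) = x" using u(2) by simp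
  qed
  have CT': "C \<subseteq> vert T'" using CC C'(1) by simp
  have bT: "bary T a x = u' a" by (rule S.bary_unique[OF s(1)[OF C(1) S.finV] s(2)[OF C(1) S.finV] a(1)])
  then have "a \<in> C" using a(2) by (auto simp: u'_def split: if_splits)
  then have aT': "a \<in> vert T'" using CT' by blast
  have "bary T' a x = u' a" by (rule S'.bary_unique[OF s(1)[OF CT' S'.finV] s(2)[OF CT' S'.finV] aT'])
  then show ?thesis using aT' bT by simp
qed

section \<open>Vertex patches and their connectedness through facets\<close>

definition patch :: "'a \<Rightarrow> 'a set set" where "patch a = {T \<in> \<T>. a \<in> vert T}"

abbreviation bdry :: "'a set \<Rightarrow> bool" where "bdry E \<equiv> E \<subseteq> frontier \<Omega>"

lemma patchD: "T \<in> patch a \<Longrightarrow> T \<in> \<T>" "T \<in> patch a \<Longrightarrow> a \<in> vert T" by (simp_all add: patch_def)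

lemma finite_patch: "finite (patch a)" using fin by (simp add: patch_def)

lemma facetsI: "T \<in> \<T> \<Longrightarrow> is_facet E T \<Longrightarrow> E \<in> facets \<T>" by (auto simp: facets_def)

lemma facet_neighbours:
  assumes "E \<in> facets \<T>"
  shows "bdry E \<Longrightarrow> {T\<in>\<T>. is_facet E T} = {Tp E} \<and> Tm E = {}"
    and "\<not> bdry E \<Longrightarrow> {T\<in>\<T>. is_facet E T} = {Tp E, Tm E} \<and> Tp E \<noteq> Tm E"
  using lab assms unfolding facet_labelling_def by (meson, meson)

text \<open>By conformity a mesh vertex that lies in another closed element is a vertex of that
  element as well.\<close>

lemma vert_closure_facet:
  assumes "T \<in> \<T>" "is_facet E T" "T' \<in> patch a" "a \<in> closure E"
  shows "T \<in> patch a"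
proof -
  interpret S: osimplex T by (rule simp_loc[OF assms(1)])
  interpret S': osimplex T' by (rule simp_loc[OF patchD(1)[OF assms(3)]])
  have "closure E \<subseteq> closure T" using assms(2) S.opp_facet_hull(3) by (auto simp: S.is_facet_iff)
  then have "a \<in> closure T" using assms(4) by blast
  moreover have "a \<in> vert T'" using assms(3) by (rule patchD)
  ultimately have "a \<in> vert T"
    using conform[OF patchD(1)[OF assms(3)] assms(1), of a a] S'.vertex_in_closure S'.bary_vertex by simp
  then show ?thesis using assms(1) by (simp add: patch_def)
qed

text \<open>A facet-closed part \<open>K\<close> of a vertex patch without boundary facets covers a neighbourhood of every
  point at which the hat function of the vertex is positive: a generic segment that leaves the union
  of \<open>K\<close> would leave it through the relative interior of a facet at \<open>a\<close>.\<close>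

lemma star_interior:
  assumes K: "K \<subseteq> patch a"
    and closed: "\<And>T E. T \<in> K \<Longrightarrow> is_facet E T \<Longrightarrow> a \<in> closure E \<Longrightarrow>
      \<not> bdry E \<and> (\<forall>T'\<in>\<T>. is_facet E T' \<longrightarrow> T' \<in> K)"
    and T0: "T0 \<in> K" and x: "x \<in> closure T0" "0 < bary T0 a x"
  shows "x \<in> interior (\<Union>T\<in>K. closure T)"
proof (rule ccontr)
  define W where "W = (\<Union>T\<in>K. closure T)"
  assume "x \<notin> interior (\<Union>T\<in>K. closure T)"
  then have xW: "x \<notin> interior W" by (simp add: W_def)
  have finK: "finite K" using K finite_patch finite_subset by blast
  have KT: "T \<in> \<T>" "a \<in> vert T" if "T \<in> K" for T using K that by (auto simp: patch_def)
  have loc: "osimplex T" if "T \<in> K" for T by (rule simp_loc[OF KT(1)[OF that]])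
  have cW: "closed W" unfolding W_def using finK by (intro closed_UN) simp_all
  have "\<forall>\<^sub>F z in nhds x. \<forall>T\<in>K. z \<in> closure T \<longrightarrow> x \<in> closure T \<and> 0 < bary T a z"
  proof (rule eventually_ball_finite[OF finK], rule ballI)
    fix T assume T: "T \<in> K"
    interpret S: osimplex T by (rule loc[OF T])
    show "\<forall>\<^sub>F z in nhds x. z \<in> closure T \<longrightarrow> x \<in> closure T \<and> 0 < bary T a z"
    proof (cases "x \<in> closure T")
      case True
      have "0 < bary T a x"
        using conform[OF KT(1)[OF T0] KT(1)[OF T] x(1) True KT(2)[OF T0] x(2)] x(2) by simp
      moreover have "isCont (bary T a) x"
        using S.continuous_bary[OF KT(2)[OF T]] by (simp add: continuous_on_eq_continuous_at)
      ultimately have "\<forall>\<^sub>F z in nhds x. 0 < bary T a z"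
        unfolding isCont_def by (intro order_tendstoD(1)[of "bary T a"]) (simp_all add: tendsto_at_iff_tendsto_nhds)
      then show ?thesis by eventually_elim (use True in simp)
    next
      case False
      then have "\<forall>\<^sub>F z in nhds x. z \<in> - closure T" by (intro eventually_nhds_in_open) auto
      then show ?thesis by eventually_elim simp
    qed
  qed
  \<comment> \<open>In this ball every element of \<open>K\<close> that is met also contains
    \<open>x\<close>, and its hat function is still positive. So a facet through which the segment
    leaves must have \<open>a\<close> among its vertices.\<close>
  then obtain r where r: "r > 0" "\<And>z T. z \<in> ball x r \<Longrightarrow> T \<in> K \<Longrightarrow> z \<in> closure T \<Longrightarrow> x \<in> closure T \<and> 0 < bary T a z"
    unfolding eventually_nhds_metric by (auto simp: dist_commute)
  interpret S0: osimplex T0 by (rule loc[OF T0])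
  define A where "A = T0 \<inter> ball x r"
  have "open A" unfolding A_def using S0.open_T by blast
  have "A \<noteq> {}"
  proof -
    obtain y where "y \<in> T0" "dist y x < r" using x(1) r(1) unfolding closure_approachable by blast
    then show ?thesis by (auto simp: A_def dist_commute)
  qed
  \<comment> \<open>The start of the segment is to avoid the planes of all facets.\<close>
  define NA where "NA = (\<Union>T\<in>K. \<Union>p\<in>vert T. {z. bary T p z = 0})"
  have negNA: "negligible NA" unfolding NA_def
  proof (rule negligible_UN[OF finK])
    fix T assume T: "T \<in> K"
    interpret S: osimplex T by (rule loc[OF T])
    show "negligible (\<Union>p\<in>vert T. {z. bary T p z = 0})"
    proof (rule negligible_UN[OF S.finV])
      fix p assume p: "p \<in> vert T"
      have "bary T p z = 0 \<longleftrightarrow> bgrad T p \<bullet> z = - bary T p 0" for z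
        using S.bary_affine[OF p, of z] by linarith
      then have "{z. bary T p z = 0} = {z. bgrad T p \<bullet> z = - bary T p 0}" by (intro Collect_cong)
      then show "negligible {z. bary T p z = 0}" using S.bgrad_nonzero[OF p] negligible_hyperplane[of "bgrad T p" "- bary T p 0"] by simp
    qed
  qed
  obtain x' where "x' \<in> A" "x' \<notin> NA"
    by (rule open_avoid_negligible[OF \<open>open A\<close> \<open>A \<noteq> {}\<close> negNA])
  then have x': "x' \<in> T0" "x' \<in> ball x r" "x' \<notin> NA" by (simp_all add: A_def)
  have x'n: "bary T p x' \<noteq> 0" if "T \<in> K" "p \<in> vert T" for T p using x'(3) that by (auto simp: NA_def)
  define B where "B = ball x r - W"
  have "open B" unfolding B_def using cW by blast
  have "B \<noteq> {}"
  proof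
    assume "B = {}"
    then have "ball x r \<subseteq> W" by (auto simp: B_def)
    then have "x \<in> interior W" using r(1) by (meson centre_in_ball interiorI open_ball)
    then show False using xW by blast
  qed
  \<comment> \<open>The zero set of \<open>f T p q\<close> is a hyperplane through \<open>x'\<close>
    that contains all points where the coordinates of \<open>p\<close> and \<open>q\<close> both
    vanish. A segment from \<open>x'\<close> that meets such a point would have its endpoint in
    it.\<close>
  define f where "f T p q y = bary T p x' * bary T q y - bary T q x' * bary T p y" for T :: "'a set" and p q y :: 'a
  define NB where "NB = (\<Union>T\<in>K. \<Union>p\<in>vert T. \<Union>q\<in>vert T - {p}. {y. f T p q y = 0})"
  have negNB: "negligible NB" unfolding NB_def
  proof (rule negligible_UN[OF finK])
    fix T assume T: "T \<in> K"
    interpret S: osimplex T by (rule loc[OF T])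
    show "negligible (\<Union>p\<in>vert T. \<Union>q\<in>vert T - {p}. {y. f T p q y = 0})"
    proof (rule negligible_UN[OF S.finV], rule negligible_UN[OF finite_Diff[OF S.finV]])
      fix p q assume p: "p \<in> vert T" and q: "q \<in> vert T - {p}"
      \<comment> \<open>Because \<open>n \<ge> 2\<close> there is a third vertex \<open>s\<close>.
        As \<open>f\<close> vanishes at \<open>s\<close> but not at \<open>q\<close>, its linear
        part \<open>h\<close> is nonzero and its zero set negligible.\<close>
      have "\<not> vert T \<subseteq> {p, q}"
      proof
        assume "vert T \<subseteq> {p, q}"
        then have "card (vert T) \<le> card {p, q}" by (intro card_mono) simp_all
        also have "... \<le> 2" by (rule card_2_iff'[THEN iffD2, THEN eq_refl]) (use q in auto)
        finally show False using S.vert_props(2) dim2 by simp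
      qed
      then obtain s where s: "s \<in> vert T" "s \<noteq> p" "s \<noteq> q" by blast
      define h where "h = bary T p x' *\<^sub>R bgrad T q - bary T q x' *\<^sub>R bgrad T p"
      have fh: "f T p q y = f T p q z + h \<bullet> (y - z)" for y z
      proof -
        define a b where "a = bgrad T p \<bullet> (y - z)" and "b = bgrad T q \<bullet> (y - z)"
        have "bary T p y = bary T p z + a" unfolding a_def by (rule S.bary_grad[OF p])
        moreover have "bary T q y = bary T q z + b" unfolding b_def by (rule S.bary_grad) (use q in simp)
        moreover have "h \<bullet> (y - z) = bary T p x' * b - bary T q x' * a"
          by (simp only: h_def inner_diff_left inner_scaleR_left a_def b_def)
        ultimately show ?thesis by (simp add: f_def algebra_simps)
      qed
      have "f T p q q = bary T p x'" "f T p q s = 0" using p q s by (auto simp: f_def S.bary_vertex)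
      then have "h \<bullet> (q - s) \<noteq> 0" using fh[of q s] x'n[OF T p] by simp
      then have "h \<noteq> 0" by auto
      moreover have "f T p q y = 0 \<longleftrightarrow> h \<bullet> y = - f T p q 0" for y
        using fh[of y 0] unfolding diff_zero by linarith
      then have "{y. f T p q y = 0} = {y. h \<bullet> y = - f T p q 0}" by (intro Collect_cong)
      ultimately show "negligible {y. f T p q y = 0}" using negligible_hyperplane[of h "- f T p q 0"] by simp
    qed
  qed
  obtain y' where "y' \<in> B" "y' \<notin> NB"
    by (rule open_avoid_negligible[OF \<open>open B\<close> \<open>B \<noteq> {}\<close> negNB])
  then have y': "y' \<in> ball x r" "y' \<notin> W" "y' \<notin> NB" by (simp_all add: B_def)
  have y'n: "f T p q y' \<noteq> 0" if "T \<in> K" "p \<in> vert T" "q \<in> vert T" "q \<noteq> p" for T p q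
    using y'(3) that by (auto simp: NB_def)
  define c where "c t = x' + t *\<^sub>R (y' - x')" for t :: real
  have cc: "continuous_on UNIV c" unfolding c_def by (intro continuous_intros)
  have cb: "c t \<in> ball x r" if "0 \<le> t" "t \<le> 1" for t
  proof -
    have "(1 - t) *\<^sub>R x' + t *\<^sub>R y' \<in> ball x r"
      using convex_ball x'(2) y'(1) that by (intro convexD) simp_all
    then show ?thesis by (simp add: c_def algebra_simps)
  qed
  \<comment> \<open>Its maximum is the last parameter at which the segment meets \<open>W\<close>;
    the rest of the proof continues the segment inside \<open>W\<close> beyond it.\<close>
  define S where "S = {0..1} \<inter> c -` W"
  have "compact S" unfolding S_def
    by (intro compact_Int_closed compact_Icc closed_vimage cW) (use cc in simp)
  moreover have "0 \<in> S" using x'(1) T0 closure_subset[of T0] by (auto simp: S_def c_def W_def)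
  ultimately obtain t where t: "t \<in> S" "\<And>s. s \<in> S \<Longrightarrow> s \<le> t" using compact_attains_sup[of S] by blast
  have "1 \<notin> S" using y'(2) by (simp add: S_def c_def)
  then have t01: "0 \<le> t" "t < 1" using t(1) by (auto simp: S_def less_le)
  have beyond: False if ev: "\<forall>\<^sub>F s in at_right t. c s \<in> W"
  proof -
    have "\<forall>\<^sub>F s in at_right t. s < 1" using t01 by (intro order_tendstoD(2)[OF tendsto_ident_at]) simp_all
    moreover have "\<forall>\<^sub>F s in at_right t. t < s" by (rule eventually_at_right_less)
    ultimately have "\<forall>\<^sub>F s in at_right t. s \<in> S \<and> t < s" using ev
      by eventually_elim (use t01 in "simp add: S_def")
    then obtain s where "s \<in> S" "t < s" using eventually_happens'[OF trivial_limit_at_right_real] by blast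
    then show False using t(2) by force
  qed
  define z where "z = c t"
  have zW: "z \<in> W" using t(1) by (simp add: S_def z_def)
  have zb: "z \<in> ball x r" unfolding z_def using cb t01 by simp
  obtain T1 where T1: "T1 \<in> K" "z \<in> closure T1" using zW by (auto simp: W_def)
  interpret S1: osimplex T1 by (rule loc[OF T1(1)])
  have za: "0 < bary T1 a z" using r(2)[OF zb T1] by simp
  have along: "bary T v (c s) = bary T v z + (s - t) * (bgrad T v \<bullet> (y' - x'))" if "T \<in> K" "v \<in> vert T" for T v s
  proof -
    have "c s - z = (s - t) *\<^sub>R (y' - x')" by (simp add: c_def z_def algebra_simps)
    then show ?thesis using osimplex.bary_grad[OF loc[OF that(1)] that(2), of "c s" z] by simp
  qed
  have pos: "\<forall>\<^sub>F s in at_right t. 0 < bary T v (c s)" if "T \<in> K" "v \<in> vert T" "0 < bary T v z" for T v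
  proof -
    have "((\<lambda>s. bary T v z + (s - t) * (bgrad T v \<bullet> (y' - x'))) \<longlongrightarrow> bary T v z + (t - t) * (bgrad T v \<bullet> (y' - x'))) (at_right t)"
      by (intro tendsto_intros)
    then show ?thesis unfolding along[OF that(1,2)] by (rule order_tendstoD(1)) (use that(3) in simp)
  qed
  have posall: "\<forall>\<^sub>F s in at_right t. \<forall>v\<in>X. 0 < bary T v (c s)" if "T \<in> K" "X \<subseteq> vert T" "\<And>v. v \<in> X \<Longrightarrow> 0 < bary T v z" for T X
    by (rule eventually_ball_finite)
      (use finite_subset[OF that(2) osimplex.finV[OF loc[OF that(1)]]] pos[OF that(1)] that(2,3) in blast)+
  show False
  proof (cases "\<forall>v\<in>vert T1. 0 < bary T1 v z")
    case True
    have "\<forall>\<^sub>F s in at_right t. \<forall>v\<in>vert T1. 0 < bary T1 v (c s)" using posall[OF T1(1) order_refl] True by blast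
    then have "\<forall>\<^sub>F s in at_right t. c s \<in> W"
    proof eventually_elim
      case (elim s)
      then have "c s \<in> closure T1" by (simp add: S1.mem_closure less_imp_le)
      then show ?case using T1(1) by (auto simp: W_def)
    qed
    then show False by (rule beyond)
  next
    case False
    then obtain p where p0: "p \<in> vert T1" "\<not> 0 < bary T1 p z" by blast
    moreover have "0 \<le> bary T1 p z" using T1(2) p0(1) by (simp add: S1.mem_closure)
    ultimately have p: "p \<in> vert T1" "bary T1 p z = 0" by simp_all
    \<comment> \<open>Two vanishing coordinates at \<open>z\<close> would put \<open>y'\<close> into
      \<open>NB\<close>; here \<open>t\<close> is nonzero because \<open>x'\<close> lies on no facet
      plane.\<close>
    have q: "0 < bary T1 q z" if "q \<in> vert T1 - {p}" for q
    proof (rule ccontr)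
      assume "\<not> 0 < bary T1 q z"
      then have qz: "bary T1 q z = 0" using T1(2) that by (auto simp: S1.mem_closure not_less intro: antisym)
      have seg: "bary T1 v z = (1 - t) * bary T1 v x' + t * bary T1 v y'" if "v \<in> vert T1" for v
        unfolding z_def c_def by (rule S1.bary_segment[OF that])
      have e: "(1 - t) * bary T1 p x' + t * bary T1 p y' = 0" "(1 - t) * bary T1 q x' + t * bary T1 q y' = 0"
        using seg[OF p(1)] seg[of q] p(2) qz that by simp_all
      have "t * f T1 p q y' = 0"
      proof -
        have "t * f T1 p q y' = bary T1 p x' * (t * bary T1 q y') - bary T1 q x' * (t * bary T1 p y')"
          by (simp add: f_def algebra_simps)
        also have "t * bary T1 q y' = - (1 - t) * bary T1 q x'" using e(2) by (simp add: algebra_simps)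
        also have "t * bary T1 p y' = - (1 - t) * bary T1 p x'" using e(1) by (simp add: algebra_simps)
        finally show ?thesis by (simp add: algebra_simps)
      qed
      moreover have "t \<noteq> 0" using e(1) x'n[OF T1(1) p(1)] by auto
      ultimately show False using y'n[OF T1(1) p(1), of q] that by auto
    qed
    define E where "E = opp_facet T1 p"
    have zE: "z \<in> E" using p(2) q by (simp add: E_def opp_facet_def)
    have E1: "is_facet E T1" using p(1) by (auto simp: S1.is_facet_iff E_def)
    have ap: "a \<noteq> p" using za p(2) by auto
    have "a \<in> closure E" unfolding E_def using S1.vertex_in_facet[OF p(1) KT(2)[OF T1(1)]] ap by simp
    from closed[OF T1(1) E1 this] have nb: "\<not> bdry E" and nK: "\<And>T'. T' \<in> \<T> \<Longrightarrow> is_facet E T' \<Longrightarrow> T' \<in> K" by auto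
    have "E \<in> facets \<T>" by (rule facetsI[OF KT(1)[OF T1(1)] E1])
    from facet_neighbours(2)[OF this nb] obtain T2 where T2: "T2 \<in> \<T>" "is_facet E T2" "T2 \<noteq> T1" by blast
    have T2K: "T2 \<in> K" by (rule nK[OF T2(1,2)])
    interpret S2: osimplex T2 by (rule loc[OF T2K])
    obtain p2 where p2: "p2 \<in> vert T2" "E = opp_facet T2 p2" using T2(2) by (auto simp: S2.is_facet_iff)
    have VV: "vert T1 - {p} = vert T2 - {p2}"
      using S1.opp_facet_extreme[OF p(1)] S2.opp_facet_extreme[OF p2(1)] p2(2) by (simp add: E_def)
    have z2: "bary T2 p2 z = 0" "\<And>v. v \<in> vert T2 - {p2} \<Longrightarrow> 0 < bary T2 v z"
      using zE p2(2) by (auto simp: opp_facet_def)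
    \<comment> \<open>Both coordinates are affine and vanish at the common vertices, so one is a
      multiple of the other.\<close>
    define k where "k = bary T2 p2 p"
    have propk: "bary T2 p2 u = k * bary T1 p u" for u
    proof -
      have "bary T2 p2 u = (\<Sum>v\<in>vert T1. bary T1 v u * bary T2 p2 v)"
        by (rule S1.bary_eq_by_vertices[where g="bgrad T2 p2"]) (rule S2.bary_affine[OF p2(1)])
      also have "... = bary T1 p u * bary T2 p2 p + (\<Sum>v\<in>vert T1 - {p}. bary T1 v u * bary T2 p2 v)"
        by (rule sum.remove[OF S1.finV p(1)])
      also have "(\<Sum>v\<in>vert T1 - {p}. bary T1 v u * bary T2 p2 v) = 0"
      proof (rule sum.neutral, rule ballI)
        fix v assume "v \<in> vert T1 - {p}"
        then have "v \<in> vert T2" "v \<noteq> p2" using VV by auto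
        then show "bary T1 v u * bary T2 p2 v = 0" using S2.bary_vertex[OF p2(1)] by simp
      qed
      finally show ?thesis by (simp add: k_def)
    qed
    \<comment> \<open>A positive factor would place both elements on the same side of the facet, and
      a short step from \<open>z\<close> towards \<open>p\<close> would end in both.\<close>
    have "k < 0"
    proof (rule ccontr)
      assume "\<not> k < 0"
      moreover have "k \<noteq> 0" using propk[of p2] S2.bary_vertex[OF p2(1) p2(1)] by auto
      ultimately have k: "0 < k" by simp
      define u where "u e = z + e *\<^sub>R (p - z)" for e :: real
      have b1: "bary T1 v (u e) = (1 - e) * bary T1 v z + e * bary T1 v p" if "v \<in> vert T1" for v e
        unfolding u_def by (rule S1.bary_segment[OF that])
      have "\<forall>\<^sub>F e in at_right (0::real). \<forall>v\<in>vert T2 - {p2}. 0 < bary T2 v (u e)"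
      proof (rule eventually_ball_finite)
        show "\<forall>v\<in>vert T2 - {p2}. \<forall>\<^sub>F e in at_right 0. 0 < bary T2 v (u e)"
        proof
          fix v assume v: "v \<in> vert T2 - {p2}"
          have "bary T2 v (u e) = bary T2 v z + e * (bgrad T2 v \<bullet> (p - z))" for e
            using S2.bary_grad[of v "u e" z] v by (simp add: u_def)
          moreover have "((\<lambda>e. bary T2 v z + e * (bgrad T2 v \<bullet> (p - z))) \<longlongrightarrow> bary T2 v z + 0 * (bgrad T2 v \<bullet> (p - z))) (at_right 0)"
            by (intro tendsto_intros)
          ultimately show "\<forall>\<^sub>F e in at_right 0. 0 < bary T2 v (u e)"
            using z2(2)[OF v] by (intro order_tendstoD(1)) simp_all
        qed
      qed (use S2.finV in simp)
      moreover have "\<forall>\<^sub>F e in at_right (0::real). 0 < e" by (rule eventually_at_right_less)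
      moreover have "\<forall>\<^sub>F e in at_right (0::real). e < 1" by (intro order_tendstoD(2)[OF tendsto_ident_at]) simp
      ultimately have "\<forall>\<^sub>F e in at_right (0::real). 0 < e \<and> e < 1 \<and> (\<forall>v\<in>vert T2 - {p2}. 0 < bary T2 v (u e))"
        by eventually_elim simp
      then obtain e where e: "0 < e" "e < 1" "\<forall>v\<in>vert T2 - {p2}. 0 < bary T2 v (u e)"
        using eventually_happens'[OF trivial_limit_at_right_real] by blast
      have "0 < bary T1 v (u e)" if v: "v \<in> vert T1" for v
      proof (cases "v = p")
        case True
        then show ?thesis using b1[OF v] e p by (simp add: S1.bary_vertex)
      next
        case False
        then show ?thesis using b1[OF v] e q[of v] v p by (simp add: S1.bary_vertex)
      qed
      then have "u e \<in> T1" "0 < bary T1 p (u e)" using p(1) by (simp_all add: S1.mem_T)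
      moreover have "u e \<in> T2" unfolding S2.mem_T
      proof
        fix v assume "v \<in> vert T2"
        then show "0 < bary T2 v (u e)"
          using e(3) propk[of "u e"] k \<open>0 < bary T1 p (u e)\<close> by (cases "v = p2") auto
      qed
      ultimately show False using disj[OF KT(1)[OF T1(1)] T2(1)] T2(3) by blast
    qed
    have "\<forall>\<^sub>F s in at_right t. \<forall>v\<in>vert T1 - {p}. 0 < bary T1 v (c s)"
      by (rule posall[OF T1(1)]) (use q in auto)
    moreover have "\<forall>\<^sub>F s in at_right t. \<forall>v\<in>vert T2 - {p2}. 0 < bary T2 v (c s)"
      by (rule posall[OF T2K]) (use z2(2) in auto)
    ultimately have "\<forall>\<^sub>F s in at_right t. c s \<in> W"
    proof eventually_elim
      case (elim s)
      \<comment> \<open>Just beyond \<open>z\<close> all other coordinates are still positive, and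
        the sign of \<open>bary T1 p\<close> decides which of the two closed elements contains the
        point.\<close>
      show ?case
      proof (cases "0 \<le> bary T1 p (c s)")
        case True
        then have "c s \<in> closure T1" unfolding S1.mem_closure using elim(1) by (metis Diff_iff less_imp_le singletonD)
        then show ?thesis using T1(1) by (auto simp: W_def)
      next
        case False
        then have "0 < bary T2 p2 (c s)" using propk[of "c s"] \<open>k < 0\<close> by (simp add: mult_neg_neg)
        then have "c s \<in> closure T2" unfolding S2.mem_closure using elim(2) by (metis Diff_iff less_imp_le singletonD)
        then show ?thesis using T2K by (auto simp: W_def)
      qed
    qed
    then show False by (rule beyond)
  qed
qed

definition adj :: "'a \<Rightarrow> ('a set \<times> 'a set) set" where
  "adj a = {(T, T'). T \<in> patch a \<and> T' \<in> patch a \<and> (\<exists>E. is_facet E T \<and> is_facet E T' \<and> a \<in> closure E \<and> \<not> bdry E)}"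

text \<open>Being a boundary vertex is defined through boundary facets, the objects that carry the
  jumps to zero. That every other mesh vertex lies inside the domain is a consequence of
  \<open>interior_vertex\<close>.\<close>

definition bd :: "'a \<Rightarrow> bool" where "bd a \<longleftrightarrow> (\<exists>E\<in>facets \<T>. a \<in> closure E \<and> bdry E)"

text \<open>A component of the adjacency graph that has no boundary facet at \<open>a\<close>
  satisfies the hypotheses of \<open>star_interior\<close>, so it covers a neighbourhood of
  \<open>a\<close>. An element of the patch outside it would overlap one of its members.\<close>

lemma component_props:
  assumes T: "T \<in> patch a" and nb: "\<And>T' E. (T, T') \<in> (adj a)\<^sup>* \<Longrightarrow> is_facet E T' \<Longrightarrow> a \<in> closure E \<Longrightarrow> \<not> bdry E"
  shows "(adj a)\<^sup>* `` {T} = patch a"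
    and "\<And>T0 x. T0 \<in> patch a \<Longrightarrow> x \<in> closure T0 \<Longrightarrow> 0 < bary T0 a x \<Longrightarrow> x \<in> \<Omega>"
proof -
  define K where "K = (adj a)\<^sup>* `` {T}"
  have "T' \<in> patch a" if "(T, T') \<in> (adj a)\<^sup>*" for T'
    using that by (induction) (use T in "auto simp: adj_def")
  then have KP: "K \<subseteq> patch a" by (auto simp: K_def)
  have cl: "\<not> bdry E \<and> (\<forall>T''\<in>\<T>. is_facet E T'' \<longrightarrow> T'' \<in> K)" if T': "T' \<in> K" "is_facet E T'" "a \<in> closure E" for T' E
  proof
    show nbE: "\<not> bdry E" using nb that by (auto simp: K_def)
    show "\<forall>T''\<in>\<T>. is_facet E T'' \<longrightarrow> T'' \<in> K"
    proof (intro ballI impI)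
      fix T'' assume T'': "T'' \<in> \<T>" "is_facet E T''"
      have "T'' \<in> patch a" by (rule vert_closure_facet[OF T'' T that(3)])
      then have "(T', T'') \<in> adj a" using KP T' T'' nbE by (auto simp: adj_def)
      then show "T'' \<in> K" using T'(1) by (auto simp: K_def intro: rtrancl_into_rtrancl)
    qed
  qed
  note star = star_interior[OF KP cl]
  show KE: "(adj a)\<^sup>* `` {T} = patch a"
  proof (rule ccontr)
    assume "\<not> ?thesis"
    then obtain T2 where T2: "T2 \<in> patch a" "T2 \<notin> K" using KP by (auto simp: K_def)
    interpret S: osimplex T by (rule simp_loc[OF patchD(1)[OF T]])
    interpret S2: osimplex T2 by (rule simp_loc[OF patchD(1)[OF T2(1)]])
    have "T \<in> K" by (simp add: K_def)
    then have "a \<in> interior (\<Union>T\<in>K. closure T)"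
      using star[where ?T0.0=T and x=a] S.vertex_in_closure S.bary_vertex patchD(2)[OF T] by simp
    moreover have "a \<in> closure T2" using S2.vertex_in_closure patchD(2)[OF T2(1)] by simp
    ultimately obtain y where "y \<in> T2" "y \<in> interior (\<Union>T\<in>K. closure T)"
      using open_Int_closure_eq_empty[OF open_interior, of "\<Union>T\<in>K. closure T" T2] by blast
    then obtain T' where T': "T' \<in> K" "y \<in> closure T'" using interior_subset by blast
    then have "T2 \<inter> T' \<noteq> {}" using open_Int_closure_eq_empty[OF S2.open_T, of T'] \<open>y \<in> T2\<close> by blast
    then have "T2 = T'" using disj T' KP patchD(1)[OF T2(1)] patchD(1) by blast
    then show False using T' T2 by simp
  qed
  show "x \<in> \<Omega>" if "T0 \<in> patch a" "x \<in> closure T0" "0 < bary T0 a x" for T0 x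
  proof -
    have "x \<in> interior (\<Union>T\<in>K. closure T)" using star[where ?T0.0=T0 and x=x] that KE by (simp add: K_def)
    moreover have "(\<Union>T\<in>K. closure T) \<subseteq> closure \<Omega>" unfolding cover using KP patchD(1) by blast
    ultimately show ?thesis using interior_mono[of "\<Union>T\<in>K. closure T" "closure \<Omega>"] int_cl by blast
  qed
qed

text \<open>The first part lets a single value serve the whole patch; the second places the support
  of the hat function, where it is positive, inside the domain.\<close>

lemma interior_vertex:
  assumes "\<not> bd a" "T \<in> patch a"
  shows "T' \<in> patch a \<Longrightarrow> (T, T') \<in> (adj a)\<^sup>*"
    and "\<And>x. x \<in> closure T \<Longrightarrow> 0 < bary T a x \<Longrightarrow> x \<in> \<Omega>"
proof -
  have P: "T' \<in> patch a" if "(T, T') \<in> (adj a)\<^sup>*" for T'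
    using that by (induction) (use assms(2) in "auto simp: adj_def")
  have nb: "\<not> bdry E" if "(T, T') \<in> (adj a)\<^sup>*" "is_facet E T'" "a \<in> closure E" for T' E
  proof
    assume "bdry E"
    moreover have "E \<in> facets \<T>" by (rule facetsI[OF patchD(1)[OF P[OF that(1)]] that(2)])
    ultimately show False using assms(1) that(3) unfolding bd_def by blast
  qed
  have "(adj a)\<^sup>* `` {T} = patch a" by (rule component_props(1)[OF assms(2) nb])
  then show "(T, T') \<in> (adj a)\<^sup>*" if "T' \<in> patch a" using that by (simp add: Image_singleton set_eq_iff)
  show "x \<in> \<Omega>" if "x \<in> closure T" "0 < bary T a x" for x by (rule component_props(2)[OF assms(2) nb assms(2) that])
qed

text \<open>Otherwise the component of \<open>T\<close> would have no boundary facet at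
  \<open>a\<close>, hence be the entire patch, to which an element with such a facet
  belongs.\<close>

lemma boundary_vertex:
  assumes "bd a" "T \<in> patch a"
  obtains T' E where "(T, T') \<in> (adj a)\<^sup>*" "is_facet E T'" "a \<in> closure E" "bdry E" "T' \<in> patch a"
proof -
  have P: "T' \<in> patch a" if "(T, T') \<in> (adj a)\<^sup>*" for T'
    using that by (induction) (use assms(2) in "auto simp: adj_def")
  have "\<exists>T' E. (T, T') \<in> (adj a)\<^sup>* \<and> is_facet E T' \<and> a \<in> closure E \<and> bdry E"
  proof (rule ccontr)
    assume "\<not> ?thesis"
    then have nb: "\<And>T' E. (T, T') \<in> (adj a)\<^sup>* \<Longrightarrow> is_facet E T' \<Longrightarrow> a \<in> closure E \<Longrightarrow> \<not> bdry E" by blast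
    obtain E where E0: "E \<in> facets \<T>" "a \<in> closure E" "bdry E" using assms(1) unfolding bd_def by blast
    then obtain T' where E: "a \<in> closure E" "bdry E" "T' \<in> \<T>" "is_facet E T'" unfolding facets_def by blast
    have "T' \<in> patch a" by (rule vert_closure_facet[OF E(3,4) assms(2) E(1)])
    moreover have "(adj a)\<^sup>* `` {T} = patch a" by (rule component_props(1)[OF assms(2) nb])
    ultimately have "(T, T') \<in> (adj a)\<^sup>*" by (simp add: Image_singleton set_eq_iff)
    then show False using nb[OF _ E(4,1)] E(2) by simp
  qed
  then show ?thesis using that P by blast
qed

end

section \<open>Smoothing\<close>

definition unit_bump :: "'a::euclidean_space \<Rightarrow> real" where
  "unit_bump = box_bump 1 (- One) One"

definition mollifier :: "real \<Rightarrow> 'a::euclidean_space \<Rightarrow> real" where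
  "mollifier r x = unit_bump (x /\<^sub>R r) / (LINT y|lborel. unit_bump ((y::'a) /\<^sub>R r))"

lemma smooth_scale_arg:
  assumes "smooth f" shows "smooth (\<lambda>x. f (c *\<^sub>R x))"
proof -
  have "C_k k (\<lambda>x. f (c *\<^sub>R x))" if "smooth f" for k f
    using that
  proof (induction k arbitrary: f)
    case 0
    have "continuous_on UNIV (\<lambda>x. f (c *\<^sub>R x))"
      by (rule continuous_on_compose2[OF smooth_continuous[OF 0, of UNIV]]) (auto intro!: continuous_intros)
    then show ?case by simp
  next
    case (Suc k)
    have d: "((\<lambda>x. f (c *\<^sub>R x)) has_derivative (\<lambda>h. pd f (c *\<^sub>R h) (c *\<^sub>R x))) (at x)" for x
      by (rule has_derivative_compose[OF _ differentiable_pd[OF smooth_differentiable[OF Suc.prems]]])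
        (auto intro!: derivative_eq_intros)
    have "pd (\<lambda>x. f (c *\<^sub>R x)) b = (\<lambda>x. c * pd f b (c *\<^sub>R x))" for b
    proof
      fix x
      have "pd (\<lambda>x. f (c *\<^sub>R x)) b x = pd f (c *\<^sub>R b) (c *\<^sub>R x)" by (rule pd_eqI[OF d])
      also have "... = c * pd f b (c *\<^sub>R x)"
        using has_derivative_bounded_linear[OF differentiable_pd[OF smooth_differentiable[OF Suc.prems, of "c *\<^sub>R x"]]]
        by (simp add: linear_simps bounded_linear.linear linear_cmul[of "\<lambda>h. pd f h (c *\<^sub>R x)", unfolded real_scaleR_def])
      finally show "pd (\<lambda>x. f (c *\<^sub>R x)) b x = c * pd f b (c *\<^sub>R x)" .
    qed
    moreover have "C_k k (\<lambda>x. c * pd f b (c *\<^sub>R x))" if "b \<in> Basis" for b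
      by (intro C_k_mult C_k_const Suc.IH smooth_pd Suc.prems that)
    moreover have "(\<lambda>x. f (c *\<^sub>R x)) differentiable (at x)" for x unfolding differentiable_def by (rule exI, rule d)
    ultimately show ?case unfolding C_k_Suc_iff by simp
  qed
  then show ?thesis using assms unfolding smooth_def[of "\<lambda>x. f (c *\<^sub>R x)"] by blast
qed

lemma unit_bump_props: "smooth (unit_bump :: 'a::euclidean_space \<Rightarrow> real)" "0 \<le> unit_bump (x::'a)"
    "unit_bump x \<noteq> 0 \<Longrightarrow> norm x \<le> real DIM('a)" "unit_bump (0::'a) \<noteq> 0"
proof -
  show "smooth (unit_bump :: 'a \<Rightarrow> real)" "0 \<le> unit_bump x" unfolding unit_bump_def
    by (rule smooth_box_bump, rule box_bump_bounds)
  show "norm x \<le> real DIM('a)" if "unit_bump x \<noteq> 0"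
  proof -
    have x: "x \<in> box (- One) One" using that box_bump_nonzero[of 1 "- One" One x] by (simp add: unit_bump_def)
    have "norm x \<le> (\<Sum>b\<in>Basis. \<bar>x \<bullet> b\<bar>)" by (rule norm_le_l1)
    also have "... \<le> (\<Sum>b\<in>(Basis::'a set). 1)" by (rule sum_mono) (use x in "auto simp: mem_box abs_le_iff less_imp_le")
    finally show ?thesis by simp
  qed
  show "unit_bump (0::'a) \<noteq> 0" unfolding unit_bump_def by (subst box_bump_nonzero) (simp_all add: mem_box)
qed

lemma mollifier_props:
  fixes x :: "'a::euclidean_space"
  assumes r: "r > 0"
  shows "smooth (mollifier r :: 'a \<Rightarrow> real)" "0 \<le> mollifier r x"
    "mollifier r x \<noteq> 0 \<Longrightarrow> norm x \<le> r * DIM('a)"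
    "integrable lborel (mollifier r :: 'a \<Rightarrow> real)" "(LINT x|lborel. mollifier r (x::'a)) = 1"
proof -
  let ?u = "\<lambda>y::'a. unit_bump (y /\<^sub>R r)"
  define c where "c = (LINT y|lborel. ?u y)"
  have m: "mollifier r x = ?u x / c" for x by (simp add: mollifier_def c_def)
  have su: "smooth ?u" by (rule smooth_scale_arg[OF unit_bump_props(1)])
  have cu: "continuous_on UNIV ?u" by (rule smooth_continuous[OF su])
  have ub: "?u \<in> borel_measurable borel" by (rule borel_measurable_continuous_onI[OF cu])
  have supp: "norm y \<le> r * DIM('a)" if "?u y \<noteq> 0" for y :: 'a
    using unit_bump_props(3)[OF that] r by (simp add: field_simps)
  define K where "K = cball (0::'a) (r * DIM('a))"
  have "integrable (lebesgue_on K) ?u"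
    by (rule integrable_continuous_bounded[OF cu]) (simp_all add: K_def)
  then have "integrable lborel (\<lambda>y. indicator K y * ?u y)"
    using lebesgue_on_eq_lborel(2)[OF _ ub, of K] by (simp add: K_def)
  moreover have "indicator K y * ?u y = ?u y" for y using supp[of y] by (cases "y \<in> K") (auto simp: K_def)
  ultimately have iu: "integrable lborel ?u" by simp
  have "c \<noteq> 0"
  proof
    assume "c = 0"
    then have "AE y in lborel. ?u y = 0"
      using integral_nonneg_eq_0_iff_AE[OF iu AE_I2[OF unit_bump_props(2)]] by (simp add: c_def)
    moreover have "open {y. ?u y \<noteq> 0}" using open_Collect_neq[OF cu continuous_on_const] by simp
    ultimately have "emeasure lborel {y. ?u y \<noteq> 0} = 0" by (simp add: AE_iff_null null_setsD1)
    moreover have "0 < emeasure lborel {y. ?u y \<noteq> 0}"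
      by (rule emeasure_lborel_open_pos[of _ 0]) (use \<open>open {y. ?u y \<noteq> 0}\<close> unit_bump_props(4) in simp_all)
    ultimately show False by simp
  qed
  moreover have "0 \<le> c" unfolding c_def by (rule Bochner_Integration.integral_nonneg) (rule unit_bump_props(2))
  ultimately have c: "c > 0" by simp
  have "mollifier r = (\<lambda>x::'a. (1 / c) * ?u x)" by (simp add: m fun_eq_iff)
  then show "smooth (mollifier r :: 'a \<Rightarrow> real)" using smooth_cmult[OF su, of "1 / c"] by simp
  show "0 \<le> mollifier r x" unfolding m by (rule divide_nonneg_pos[OF unit_bump_props(2) c])
  show "mollifier r x \<noteq> 0 \<Longrightarrow> norm x \<le> r * DIM('a)" using supp[of x] by (simp add: m)
  show "integrable lborel (mollifier r :: 'a \<Rightarrow> real)" using iu by (simp add: m[abs_def])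
  show "(LINT x|lborel. mollifier r (x::'a)) = 1" using c by (simp add: m c_def)
qed

text \<open>The gauge integral over a box is the setting of \<open>leibniz_rule\<close>. The
  variable sits in \<eta>, so that derivatives fall on the smooth factor and \<open>v\<close> need
  only be continuous.\<close>

definition conv :: "'a::euclidean_space \<Rightarrow> 'a \<Rightarrow> ('a \<Rightarrow> real) \<Rightarrow> ('a \<Rightarrow> real) \<Rightarrow> 'a \<Rightarrow> real" where
  "conv a b v \<eta> x = integral (cbox a b) (\<lambda>t. v t * \<eta> (x - t))"

lemma conv_has_derivative:
  assumes v: "continuous_on UNIV v" and \<eta>: "smooth \<eta>"
  shows "(conv a b v \<eta> has_derivative (\<lambda>h. \<Sum>i\<in>Basis. (h \<bullet> i) * conv a b v (pd \<eta> i) x)) (at x)"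
proof -
  define F where "F x t = (\<Sum>i\<in>Basis. (v t * pd \<eta> i (x - t)) *\<^sub>R blinfun_inner_left i)" for x t :: 'a
  have Fa: "blinfun_apply (F x t) h = v t * (grad \<eta> (x - t) \<bullet> h)" for x t h
  proof -
    have "blinfun_apply (F x t) h = (\<Sum>i\<in>Basis. v t * (pd \<eta> i (x - t) * (i \<bullet> h)))"
      by (simp add: F_def blinfun.sum_left blinfun.scaleR_left inner_commute[of h] mult.assoc)
    also have "... = v t * (grad \<eta> (x - t) \<bullet> h)"
      by (simp add: grad_alt inner_sum_left sum_distrib_left)
    finally show ?thesis .
  qed
  have c1: "continuous_on UNIV (\<lambda>(x, t). F x t)"
    unfolding F_def case_prod_beta
    by (intro continuous_intros continuous_on_compose2[OF v] continuous_on_compose2[OF smooth_continuous[OF smooth_pd[OF \<eta>], of _ UNIV]]) auto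
  have cint: "continuous_on S (\<lambda>t. v t * \<psi> (x - t))" if "smooth \<psi>" for S \<psi> x
    by (intro continuous_intros continuous_on_compose2[OF v] continuous_on_compose2[OF smooth_continuous[OF that, of UNIV]]) auto
  have D: "((\<lambda>x. integral (cbox a b) (\<lambda>t. v t * \<eta> (x - t))) has_derivative integral (cbox a b) (F x)) (at x within UNIV)"
  proof (rule leibniz_rule)
    fix x t :: 'a
    have 1: "((\<lambda>x. x - t) has_derivative (\<lambda>h. h)) (at x)" by (auto intro!: derivative_eq_intros)
    have "((\<lambda>x. v t * \<eta> (x - t)) has_derivative (\<lambda>h. v t * (grad \<eta> (x - t) \<bullet> h))) (at x)"
      by (rule has_derivative_mult_right[OF has_derivative_compose[OF 1 smooth_has_derivative_grad[OF \<eta>]]])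
    then show "((\<lambda>x. v t * \<eta> (x - t)) has_derivative blinfun_apply (F x t)) (at x within UNIV)" by (simp add: Fa[abs_def])
    show "(\<lambda>t. v t * \<eta> (x - t)) integrable_on cbox a b" by (rule integrable_continuous[OF cint[OF \<eta>]])
    show "continuous_on (UNIV \<times> cbox a b) (\<lambda>(x, t). F x t)" by (rule continuous_on_subset[OF c1]) simp
  qed simp_all
  have "continuous_on (cbox a b) (F x)"
    using continuous_on_compose2[OF c1, of "cbox a b" "\<lambda>t. (x, t)"] by (simp add: continuous_on_Pair)
  then have Fi: "F x integrable_on cbox a b" by (rule integrable_continuous)
  have "blinfun_apply (integral (cbox a b) (F x)) h = (\<Sum>i\<in>Basis. (h \<bullet> i) * conv a b v (pd \<eta> i) x)" for h
  proof -
    have "blinfun_apply (integral (cbox a b) (F x)) h = integral (cbox a b) (\<lambda>t. blinfun_apply (F x t) h)"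
      using integral_linear[OF Fi blinfun.bounded_linear_left[of h]] by (simp add: o_def)
    also have "... = integral (cbox a b) (\<lambda>t. \<Sum>i\<in>Basis. (h \<bullet> i) * (v t * pd \<eta> i (x - t)))"
      by (rule arg_cong[where f="integral _"])
        (simp add: fun_eq_iff F_def blinfun.sum_left blinfun.scaleR_left mult.commute)
    also have "... = (\<Sum>i\<in>Basis. integral (cbox a b) (\<lambda>t. (h \<bullet> i) * (v t * pd \<eta> i (x - t))))"
      by (rule integral_sum) (auto intro!: integrable_continuous continuous_on_mult continuous_on_const cint[unfolded] smooth_pd \<eta>)
    finally show ?thesis by (simp add: conv_def)
  qed
  then have "blinfun_apply (integral (cbox a b) (F x)) = (\<lambda>h. \<Sum>i\<in>Basis. (h \<bullet> i) * conv a b v (pd \<eta> i) x)" by (rule ext)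
  moreover have "conv a b v \<eta> = (\<lambda>x. integral (cbox a b) (\<lambda>t. v t * \<eta> (x - t)))" by (simp add: conv_def fun_eq_iff)
  ultimately show ?thesis using D by simp
qed

lemma smooth_conv:
  assumes v: "continuous_on UNIV v" and \<eta>: "smooth \<eta>"
  shows "smooth (conv a b v \<eta>)"
proof -
  have "C_k k (conv a b v \<eta>)" if "smooth \<eta>" for k \<eta>
    using that
  proof (induction k arbitrary: \<eta>)
    case 0
    then show ?case
      using has_derivative_continuous[OF conv_has_derivative[OF v 0]] by (auto intro: continuous_at_imp_continuous_on)
  next
    case (Suc k)
    note d = conv_has_derivative[OF v Suc.prems]
    have "pd (conv a b v \<eta>) i x = conv a b v (pd \<eta> i) x" if "i \<in> Basis" for i x
      using pd_eqI[OF d, of a b i x] that by (simp add: inner_Basis if_distrib[of "\<lambda>t. t * _"] sum.delta cong: if_cong)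
    then have "pd (conv a b v \<eta>) i = conv a b v (pd \<eta> i)" if "i \<in> Basis" for i using that by blast
    moreover have "C_k k (conv a b v (pd \<eta> i))" if "i \<in> Basis" for i by (rule Suc.IH[OF smooth_pd[OF Suc.prems that]])
    moreover have "conv a b v \<eta> differentiable (at x)" for x unfolding differentiable_def by (rule exI, rule d)
    ultimately show ?case unfolding C_k_Suc_iff by simp
  qed
  then show ?thesis using \<eta> unfolding smooth_def[of "conv a b v \<eta>"] by blast
qed

text \<open>In this form the variable sits in \<open>v\<close> instead, so that properties of
  \<open>v\<close> such as a Lipschitz bound pass to the convolution.\<close>

lemma conv_lborel:
  fixes v :: "'a::euclidean_space \<Rightarrow> real"
  assumes v: "continuous_on UNIV v" "\<And>x. x \<notin> cbox a b \<Longrightarrow> v x = 0" and \<eta>: "smooth \<eta>"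
  shows "conv a b v \<eta> x = (LINT z|lborel. v (x - z) * \<eta> z)"
    and "integrable lborel (\<lambda>z. v (x - z) * \<eta> z)"
proof -
  let ?f = "\<lambda>t. v t * \<eta> (x - t)"
  have cf: "continuous_on UNIV ?f"
    by (intro continuous_intros continuous_on_compose2[OF v(1)] continuous_on_compose2[OF smooth_continuous[OF \<eta>, of UNIV]]) auto
  have fb: "?f \<in> borel_measurable borel" by (rule borel_measurable_continuous_onI[OF cf])
  have i: "integrable (lebesgue_on (cbox a b)) ?f" by (rule integrable_continuous_bounded[OF cf]) simp_all
  have ind: "(\<lambda>t. indicator (cbox a b) t * ?f t) = ?f" using v(2) by (auto simp: fun_eq_iff indicator_def)
  have il: "integrable lborel ?f" using i lebesgue_on_eq_lborel(2)[OF _ fb, of "cbox a b"] by (simp add: ind)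
  have "conv a b v \<eta> x = integral\<^sup>L (lebesgue_on (cbox a b)) ?f"
    unfolding conv_def by (rule lebesgue_integral_eq_integral[symmetric, OF i]) simp
  also have "... = (LINT t|lborel. ?f t)" using lebesgue_on_eq_lborel(1)[OF _ fb, of "cbox a b"] by (simp add: ind)
  also have "... = (LINT z|lborel. ?f (x + (-1) *\<^sub>R z))"
  proof -
    have "lborel = density (distr lborel borel (\<lambda>z. x + (-1) *\<^sub>R z)) (\<lambda>_. ennreal (\<bar>-1\<bar> ^ DIM('a)))" by (rule lborel_affine) simp
    then have e: "lborel = distr lborel borel (\<lambda>z. x + (-1) *\<^sub>R z)" by (simp add: density_1)
    have "(LINT t|lborel. ?f t) = (LINT t|distr lborel borel (\<lambda>z. x + (-1) *\<^sub>R z). ?f t)" using e by simp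
    also have "... = (LINT z|lborel. ?f (x + (-1) *\<^sub>R z))" by (rule integral_distr) (use fb in simp_all)
    finally show ?thesis .
  qed
  finally show "conv a b v \<eta> x = (LINT z|lborel. v (x - z) * \<eta> z)" by simp
  have e: "lborel = distr lborel borel (\<lambda>z. x + (-1) *\<^sub>R z)"
  proof -
    have "lborel = density (distr lborel borel (\<lambda>z. x + (-1) *\<^sub>R z)) (\<lambda>_. ennreal (\<bar>-1\<bar> ^ DIM('a)))" by (rule lborel_affine) simp
    then show ?thesis by (simp add: density_1)
  qed
  have "integrable (distr lborel borel (\<lambda>z. x + (-1) *\<^sub>R z)) ?f" using il e by simp
  then have "integrable lborel (\<lambda>z. ?f (x + (-1) *\<^sub>R z))" by (subst (asm) integrable_distr_eq) (use fb in simp_all)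
  then show "integrable lborel (\<lambda>z. v (x - z) * \<eta> z)" by simp
qed

text \<open>Averages of translates inherit the Lipschitz constant, which bounds the gradient. Where
  \<open>v\<close> is affine on a ball larger than the support of the mollifier, all the translates
  involved have the same slope, and so has the average.\<close>

lemma mollification:
  fixes v :: "'a::euclidean_space \<Rightarrow> real" and r :: real
  assumes L: "0 \<le> L" "\<And>x y. \<bar>v x - v y\<bar> \<le> L * norm (x - y)" and supp: "bounded {x. v x \<noteq> 0}" and r: "r > 0"
  obtains \<psi> where "smooth \<psi>" "\<And>x. \<bar>\<psi> x - v x\<bar> \<le> L * (r * real DIM('a))" "\<And>x. norm (grad \<psi> x) \<le> L"
    "\<And>x g e. e > r * real DIM('a) \<Longrightarrow> (\<And>y. y \<in> ball x e \<Longrightarrow> v y = v x + g \<bullet> (y - x)) \<Longrightarrow> grad \<psi> x = g"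
proof -
  have cv: "continuous_on UNIV v"
  proof (rule lipschitz_on_continuous_on[of L])
    show "L-lipschitz_on UNIV v" using L by (intro lipschitz_onI) (simp_all add: dist_norm)
  qed
  obtain a b where ab: "{x. v x \<noteq> 0} \<subseteq> cbox a b" using bounded_subset_cbox_symmetric[OF supp] by blast
  then have ab': "v x = 0" if "x \<notin> cbox a b" for x using that by blast
  let ?\<eta> = "mollifier r :: 'a \<Rightarrow> real"
  note m = mollifier_props[OF r, where 'a='a]
  let ?d = "r * real DIM('a)"
  define \<psi> where "\<psi> = conv a b v ?\<eta>"
  have s: "smooth \<psi>" unfolding \<psi>_def by (rule smooth_conv[OF cv m(1)])
  have p: "\<psi> x = (LINT z|lborel. v (x - z) * ?\<eta> z)" for x unfolding \<psi>_def by (rule conv_lborel(1)[OF cv ab' m(1)])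
  have i: "integrable lborel (\<lambda>z. v (x - z) * ?\<eta> z)" for x by (rule conv_lborel(2)[OF cv ab' m(1)])
  have c: "(LINT z|lborel. k * ?\<eta> z) = k" for k using m(5) by simp
  have ic: "integrable lborel (\<lambda>z. k * ?\<eta> z)" for k using m(4) by simp
  have le: "\<bar>\<psi> x - k\<bar> \<le> M" if "\<And>z. norm z \<le> ?d \<Longrightarrow> \<bar>v (x - z) - k\<bar> \<le> M" for x k M
  proof -
    have e: "\<psi> x - k = (LINT z|lborel. v (x - z) * ?\<eta> z - k * ?\<eta> z)"
      using LINT_diff[OF i ic, of x k] p c by simp
    have "\<bar>\<psi> x - k\<bar> \<le> (LINT z|lborel. \<bar>v (x - z) * ?\<eta> z - k * ?\<eta> z\<bar>)"
      unfolding e using integral_norm_bound[of lborel "\<lambda>z. v (x - z) * ?\<eta> z - k * ?\<eta> z"] by simp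
    also have "... \<le> (LINT z|lborel. M * ?\<eta> z)"
    proof (rule integral_mono)
      show "integrable lborel (\<lambda>z. \<bar>v (x - z) * ?\<eta> z - k * ?\<eta> z\<bar>)"
        by (intro integrable_abs Bochner_Integration.integrable_diff i ic)
      show "\<bar>v (x - z) * ?\<eta> z - k * ?\<eta> z\<bar> \<le> M * ?\<eta> z" for z
      proof (cases "?\<eta> z = 0")
        case False
        have "\<bar>v (x - z) * ?\<eta> z - k * ?\<eta> z\<bar> = \<bar>v (x - z) - k\<bar> * ?\<eta> z"
          using m(2)[of z] by (simp add: left_diff_distrib[symmetric] abs_mult)
        also have "... \<le> M * ?\<eta> z" using that[OF m(3)[OF False]] m(2)[of z] by (rule mult_right_mono)
        finally show ?thesis .
      qed simp
    qed (rule ic)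
    finally show ?thesis using m(5) by simp
  qed
  show ?thesis
  proof (rule that[OF s])
    show "\<bar>\<psi> x - v x\<bar> \<le> L * ?d" for x
    proof (rule le)
      fix z :: 'a assume "norm z \<le> ?d"
      then have "L * norm z \<le> L * ?d" using L(1) by (rule mult_left_mono)
      then show "\<bar>v (x - z) - v x\<bar> \<le> L * ?d" using L(2)[of "x - z" x] by simp
    qed
    have lip: "\<bar>\<psi> x - \<psi> y\<bar> \<le> L * norm (x - y)" for x y
    proof -
      have "\<psi> x - \<psi> y = (LINT z|lborel. v (x - z) * ?\<eta> z - v (y - z) * ?\<eta> z)"
        using LINT_diff[OF i i, of x y] p by simp
      then have "\<bar>\<psi> x - \<psi> y\<bar> \<le> (LINT z|lborel. \<bar>v (x - z) * ?\<eta> z - v (y - z) * ?\<eta> z\<bar>)"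
        using integral_norm_bound[of lborel "\<lambda>z. v (x - z) * ?\<eta> z - v (y - z) * ?\<eta> z"] by simp
      also have "... \<le> (LINT z|lborel. (L * norm (x - y)) * ?\<eta> z)"
      proof (rule integral_mono)
        show "integrable lborel (\<lambda>z. \<bar>v (x - z) * ?\<eta> z - v (y - z) * ?\<eta> z\<bar>)"
          by (intro integrable_abs Bochner_Integration.integrable_diff i)
        show "\<bar>v (x - z) * ?\<eta> z - v (y - z) * ?\<eta> z\<bar> \<le> (L * norm (x - y)) * ?\<eta> z" for z
        proof -
          have "\<bar>v (x - z) * ?\<eta> z - v (y - z) * ?\<eta> z\<bar> = \<bar>v (x - z) - v (y - z)\<bar> * ?\<eta> z"
            using m(2)[of z] by (simp add: left_diff_distrib[symmetric] abs_mult)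
          also have "... \<le> (L * norm (x - y)) * ?\<eta> z" using L(2)[of "x - z" "y - z"] m(2)[of z] by (intro mult_right_mono) simp_all
          finally show ?thesis .
        qed
      qed (rule ic)
      finally show ?thesis using m(5) by simp
    qed
    show "norm (grad \<psi> x) \<le> L" for x
    proof -
      \<comment> \<open>In the direction of the gradient itself the derivative is
        \<open>(norm ?g)\<^sup>2\<close>, while the Lipschitz bound allows at most
        \<open>L * norm ?g\<close>.\<close>
      let ?g = "grad \<psi> x"
      have 1: "((\<lambda>t. x + t *\<^sub>R ?g) has_derivative (\<lambda>t. t *\<^sub>R ?g)) (at 0)" by (auto intro!: derivative_eq_intros)
      have 2: "(\<psi> has_derivative (\<lambda>h. ?g \<bullet> h)) (at (x + 0 *\<^sub>R ?g))" using smooth_has_derivative_grad[OF s, of x] by simp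
      have "((\<lambda>t. \<psi> (x + t *\<^sub>R ?g)) has_derivative (\<lambda>t. ?g \<bullet> (t *\<^sub>R ?g))) (at 0)" by (rule has_derivative_compose[OF 1 2])
      moreover have "(\<lambda>t. ?g \<bullet> (t *\<^sub>R ?g)) = (*) ((norm ?g)\<^sup>2)" by (simp add: fun_eq_iff power2_norm_eq_inner)
      ultimately have "((\<lambda>t. \<psi> (x + t *\<^sub>R ?g)) has_real_derivative (norm ?g)\<^sup>2) (at 0)" by (simp add: has_field_derivative_def)
      then have "((\<lambda>t. (\<psi> (x + t *\<^sub>R ?g) - \<psi> x) / t) \<longlongrightarrow> (norm ?g)\<^sup>2) (at 0)"
        unfolding has_field_derivative_iff by simp
      then have "(norm ?g)\<^sup>2 \<le> L * norm ?g"
      proof (rule tendsto_upperbound)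
        show "\<forall>\<^sub>F t in at 0. (\<psi> (x + t *\<^sub>R ?g) - \<psi> x) / t \<le> L * norm ?g"
        proof (rule eventually_at_topological[THEN iffD2, OF exI[of _ UNIV]], safe)
          fix t :: real assume t: "t \<noteq> 0"
          have "\<bar>(\<psi> (x + t *\<^sub>R ?g) - \<psi> x) / t\<bar> \<le> L * (\<bar>t\<bar> * norm ?g) / \<bar>t\<bar>"
            unfolding abs_divide using lip[of "x + t *\<^sub>R ?g" x] t by (intro divide_right_mono) simp_all
          then have "\<bar>(\<psi> (x + t *\<^sub>R ?g) - \<psi> x) / t\<bar> \<le> L * norm ?g" using t by simp
          then show "(\<psi> (x + t *\<^sub>R ?g) - \<psi> x) / t \<le> L * norm ?g" by linarith
        qed simp_all
      qed simp
      then show ?thesis using L(1) by (cases "norm ?g = 0") (simp_all add: power2_eq_square)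
    qed
    show "grad \<psi> x = g" if e: "e > ?d" and aff: "\<And>y. y \<in> ball x e \<Longrightarrow> v y = v x + g \<bullet> (y - x)" for x g e
    proof (rule grad_eqI)
      have near: "\<psi> y = \<psi> x + g \<bullet> (y - x)" if y: "y \<in> ball x (e - ?d)" for y
      proof -
        have "\<psi> y = (LINT z|lborel. v (x - z) * ?\<eta> z + (g \<bullet> (y - x)) * ?\<eta> z)"
          unfolding p
        proof (rule LINT_cong[OF refl])
          fix z
          show "v (y - z) * ?\<eta> z = v (x - z) * ?\<eta> z + (g \<bullet> (y - x)) * ?\<eta> z"
          proof (cases "?\<eta> z = 0")
            case False
            have z: "norm z \<le> ?d" by (rule m(3)[OF False])
            have "norm (x - (y - z)) \<le> norm (x - y) + norm z" using norm_triangle_ineq[of "x - y" z] by (simp add: algebra_simps)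
            then have "y - z \<in> ball x e" using y z by (simp add: dist_norm)
            moreover have "x - z \<in> ball x e" using z e by (simp add: dist_norm)
            ultimately have "v (y - z) = v (x - z) + g \<bullet> (y - x)"
              using aff[of "y - z"] aff[of "x - z"] by (simp add: inner_diff_right)
            then show ?thesis by (simp add: distrib_right)
          qed simp
        qed
        also have "... = \<psi> x + g \<bullet> (y - x)"
          using LINT_add[OF i ic, of x "g \<bullet> (y - x)"] p c by simp
        finally show ?thesis .
      qed
      have "((\<lambda>y. \<psi> x + g \<bullet> (y - x)) has_derivative (\<lambda>h. g \<bullet> h)) (at x)"
        by (auto intro!: derivative_eq_intros)
      then show "(\<psi> has_derivative (\<bullet>) g) (at x)"
      proof (rule has_derivative_transform_within_open[where s="ball x (e - ?d)"])
        show "x \<in> ball x (e - ?d)" using e by simp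
        show "\<psi> x + g \<bullet> (y - x) = \<psi> y" if "y \<in> ball x (e - ?d)" for y by (rule near[OF that, symmetric])
      qed simp
    qed
  qed
qed

context bounded_domain
begin

text \<open>A Lipschitz function vanishing outside the domain is mollified and then truncated near zero, which
  makes its support compact; on the pieces where it is affine the gradients converge.\<close>

lemma lipschitz_test_approx:
  fixes v :: "'a \<Rightarrow> real"
  assumes L: "0 \<le> L" "\<And>x y. \<bar>v x - v y\<bar> \<le> L * norm (x - y)" and zero: "\<And>x. x \<notin> \<Omega> \<Longrightarrow> v x = 0"
    and G: "G \<in> borel_measurable (lebesgue_on \<Omega>)"
    and aff: "AE x in lebesgue_on \<Omega>. \<exists>e>0. \<forall>y\<in>ball x e. v y = v x + G x \<bullet> (y - x)"
    and Gb: "\<And>x. norm (G x) \<le> M" and \<epsilon>: "0 < \<epsilon>"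
  obtains \<phi> where "test \<phi>" "\<And>x. \<bar>\<phi> x - v x\<bar> \<le> \<epsilon>"
    "I (\<lambda>x. (norm (grad \<phi> x))\<^sup>2) \<le> 49 * I (\<lambda>x. (norm (G x))\<^sup>2) + \<epsilon>"
proof -
  have supp: "bounded {x. v x \<noteq> 0}" by (rule bounded_subset[OF bounded_dom]) (use zero in blast)
  let ?n = "real DIM('a)"
  define r where "r j = 1 / real (Suc j)" for j :: nat
  have r: "r j > 0" for j by (simp add: r_def)
  have r0: "r \<longlonglongrightarrow> 0" unfolding r_def by (rule LIMSEQ_Suc[OF lim_1_over_n])
  have "\<exists>\<psi>. smooth \<psi> \<and> (\<forall>x. \<bar>\<psi> x - v x\<bar> \<le> L * (r j * ?n)) \<and> (\<forall>x. norm (grad \<psi> x) \<le> L) \<and>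
    (\<forall>x g e. e > r j * ?n \<longrightarrow> (\<forall>y\<in>ball x e. v y = v x + g \<bullet> (y - x)) \<longrightarrow> grad \<psi> x = g)" for j
    by (rule mollification[OF L supp r[of j]]) blast
  then obtain \<psi> where \<psi>: "\<And>j. smooth (\<psi> j)" "\<And>j x. \<bar>\<psi> j x - v x\<bar> \<le> L * (r j * ?n)" "\<And>j x. norm (grad (\<psi> j) x) \<le> L"
    "\<And>j x g e. e > r j * ?n \<Longrightarrow> (\<forall>y\<in>ball x e. v y = v x + g \<bullet> (y - x)) \<Longrightarrow> grad (\<psi> j) x = g" by metis
  have lim: "(\<lambda>j. I (\<lambda>x. (norm (grad (\<psi> j) x))\<^sup>2)) \<longlonglongrightarrow> I (\<lambda>x. (norm (G x))\<^sup>2)"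
  proof (rule integral_dominated_convergence[where w="\<lambda>_. L\<^sup>2"])
    show "(\<lambda>x. (norm (G x))\<^sup>2) \<in> borel_measurable (lebesgue_on \<Omega>)" using G by measurable
    show "(\<lambda>x. (norm (grad (\<psi> j) x))\<^sup>2) \<in> borel_measurable (lebesgue_on \<Omega>)" for j
      by (rule continuous_measurable_lebesgue_on[OF _ dom_lebesgue]) (intro continuous_intros continuous_on_grad \<psi>)
    show "integ (\<lambda>_. L\<^sup>2)" by (rule integrable_continuous_bounded[OF _ dom_lmeasurable bounded_dom]) simp
    show "AE x in lebesgue_on \<Omega>. norm ((norm (grad (\<psi> j) x))\<^sup>2) \<le> L\<^sup>2" for j
      by (rule AE_I2) (use \<psi>(3) in "simp add: power_mono")
    show "AE x in lebesgue_on \<Omega>. (\<lambda>j. (norm (grad (\<psi> j) x))\<^sup>2) \<longlonglongrightarrow> (norm (G x))\<^sup>2"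
      using aff
    proof eventually_elim
      case (elim x)
      then obtain e where e: "e > 0" "\<forall>y\<in>ball x e. v y = v x + G x \<bullet> (y - x)" by blast
      have "(\<lambda>j. r j * ?n) \<longlonglongrightarrow> 0 * ?n" by (intro tendsto_intros r0)
      then have "\<forall>\<^sub>F j in sequentially. r j * ?n < e" using e(1) by (intro order_tendstoD(2)) simp_all
      then have "\<forall>\<^sub>F j in sequentially. (norm (G x))\<^sup>2 = (norm (grad (\<psi> j) x))\<^sup>2"
        by eventually_elim (simp add: \<psi>(4)[OF _ e(2)])
      then show ?case by (rule Lim_transform_eventually[OF tendsto_const])
    qed
  qed
  \<comment> \<open>Truncation at \<delta> costs \<open>2 * \<delta>\<close> and mollification less
    than \<open>\<delta> / 2\<close>, in total less than \<epsilon>.\<close>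
  define \<delta> where "\<delta> = \<epsilon> / 4"
  have \<delta>: "0 < \<delta>" using \<epsilon> by (simp add: \<delta>_def)
  \<comment> \<open>The truncation may multiply the energy, and with it this slack, by 49.\<close>
  have ev1: "\<forall>\<^sub>F j in sequentially. I (\<lambda>x. (norm (grad (\<psi> j) x))\<^sup>2) < I (\<lambda>x. (norm (G x))\<^sup>2) + \<epsilon> / 49"
    by (rule order_tendstoD(2)[OF lim]) (use \<epsilon> in simp)
  have lim2: "(\<lambda>j. L * (r j * ?n)) \<longlonglongrightarrow> L * (0 * ?n)" by (intro tendsto_intros r0)
  have ev2: "\<forall>\<^sub>F j in sequentially. L * (r j * ?n) < \<delta> / 2" by (rule order_tendstoD(2)[OF lim2]) (use \<delta> in simp)
  obtain j where j: "I (\<lambda>x. (norm (grad (\<psi> j) x))\<^sup>2) < I (\<lambda>x. (norm (G x))\<^sup>2) + \<epsilon> / 49" "L * (r j * ?n) < \<delta> / 2"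
    using eventually_happens'[OF sequentially_bot eventually_conj[OF ev1 ev2]] by blast
  define \<phi> where "\<phi> x = trunc \<delta> (\<psi> j x)" for x
  have sphi: "smooth \<phi>" unfolding \<phi>_def[abs_def] by (rule smooth_trunc[OF \<psi>(1)])
  have cv: "continuous_on UNIV v"
  proof (rule lipschitz_on_continuous_on[of L])
    show "L-lipschitz_on UNIV v" using L by (intro lipschitz_onI) (simp_all add: dist_norm)
  qed
  show ?thesis
  proof (rule that[of \<phi>])
    show "test \<phi>"
    proof (rule test_functionI[where K="{x. \<delta> / 2 \<le> \<bar>v x\<bar>}"])
      have sub: "{x. \<delta> / 2 \<le> \<bar>v x\<bar>} \<subseteq> \<Omega>" using zero \<delta> by (metis (mono_tags, lifting) abs_zero half_gt_zero leD mem_Collect_eq subsetI)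
      then show "{x. \<delta> / 2 \<le> \<bar>v x\<bar>} \<subseteq> \<Omega>" .
      have "closed {x. \<delta> / 2 \<le> \<bar>v x\<bar>}" by (intro closed_Collect_le continuous_intros cv)
      then show "compact {x. \<delta> / 2 \<le> \<bar>v x\<bar>}" using bounded_subset[OF bounded_dom sub] by (simp add: compact_eq_bounded_closed)
      \<comment> \<open>Where the truncated function is nonzero the mollified one exceeds \<delta>
        in absolute value, and \<open>v\<close> differs from it by less than
        \<open>\<delta> / 2\<close>.\<close>
      show "x \<in> {x. \<delta> / 2 \<le> \<bar>v x\<bar>}" if "\<phi> x \<noteq> 0" for x
      proof -
        have "\<not> \<bar>\<psi> j x\<bar> \<le> \<delta>" using that trunc_eq_0[OF \<delta>] by (auto simp: \<phi>_def)
        then show ?thesis using \<psi>(2)[of j x] j(2) by simp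
      qed
    qed (rule sphi)
    show "\<bar>\<phi> x - v x\<bar> \<le> \<epsilon>" for x
      using trunc_close[OF \<delta>, of "\<psi> j x"] \<psi>(2)[of j x] j(2) unfolding \<phi>_def \<delta>_def by linarith
    have "I (\<lambda>x. (norm (grad \<phi> x))\<^sup>2) \<le> I (\<lambda>x. 49 * (norm (grad (\<psi> j) x))\<^sup>2)"
    proof (rule integral_mono)
      show "integ (\<lambda>x. (norm (grad \<phi> x))\<^sup>2)" by (rule L2_integrable[OF L2_grad[OF sphi]])
      show "integ (\<lambda>x. 49 * (norm (grad (\<psi> j) x))\<^sup>2)" by (intro integrable_mult_right L2_integrable[OF L2_grad[OF \<psi>(1)]])
      fix x
      have "(norm (grad \<phi> x))\<^sup>2 \<le> (7 * norm (grad (\<psi> j) x))\<^sup>2"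
        unfolding \<phi>_def[abs_def] by (intro power_mono norm_grad_trunc[OF \<delta> \<psi>(1)]) simp
      then show "(norm (grad \<phi> x))\<^sup>2 \<le> 49 * (norm (grad (\<psi> j) x))\<^sup>2" by (simp add: power_mult_distrib)
    qed
    then show "I (\<lambda>x. (norm (grad \<phi> x))\<^sup>2) \<le> 49 * I (\<lambda>x. (norm (G x))\<^sup>2) + \<epsilon>" using j(1) by simp
  qed
qed

end

section \<open>Consequences of shape regularity\<close>

text \<open>The bound for the gradient of a barycentric coordinate times the diameter: the power of
  2 comes from \<open>bgrad_volume\<close> and \<open>g\<close> from shape regularity.\<close>

definition kap :: "nat \<Rightarrow> real \<Rightarrow> real" where "kap n g = 2 ^ (n - 1) * g"

context mesh
begin

abbreviation vol :: "'a set \<Rightarrow> real" where "vol \<equiv> measure lebesgue"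

lemma vol_pos: "T \<in> \<T> \<Longrightarrow> 0 < vol T"
  using osimplex.vol_pos[OF simp_loc] .

lemma diam_pos: "T \<in> \<T> \<Longrightarrow> 0 < diameter T"
  using osimplex.diameter_pos[OF simp_loc] .

lemma diam_power: "T \<in> \<T> \<Longrightarrow> diameter T ^ DIM('a) \<le> \<gamma> * vol T"
  using shape vol_pos[of T] by (auto simp: shape_regular_def divide_le_eq)

lemma gamma_pos: "0 < \<gamma>"
proof -
  obtain T where T: "T \<in> \<T>" using mesh_nonempty by blast
  have "0 < diameter T ^ DIM('a)" using diam_pos[OF T] by simp
  then have "0 < \<gamma> * vol T" using diam_power[OF T] by linarith
  then show ?thesis using vol_pos[OF T] by (simp add: zero_less_mult_iff)
qed

lemma kappa_pos: "0 < kap DIM('a) \<gamma>" using gamma_pos by (simp add: kap_def)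

lemma diam_split: "diameter T ^ DIM('a) = diameter T * diameter T ^ (DIM('a) - 1)"
  using dim2 by (cases "DIM('a)") simp_all

lemma bgrad_bound:
  assumes T: "T \<in> \<T>" and v: "v \<in> vert T"
  shows "norm (bgrad T v) * diameter T \<le> kap DIM('a) \<gamma>"
proof -
  interpret S: osimplex T by (rule simp_loc[OF T])
  have h: "0 < diameter T" by (rule diam_pos[OF T])
  have "norm (bgrad T v) * diameter T ^ DIM('a) \<le> norm (bgrad T v) * (\<gamma> * vol T)"
    by (rule mult_left_mono[OF diam_power[OF T]]) simp
  also have "... = \<gamma> * (norm (bgrad T v) * vol T)" by simp
  also have "... \<le> \<gamma> * (2 * diameter T) ^ (DIM('a) - 1)"
    by (rule mult_left_mono[OF S.bgrad_volume[OF v]]) (use gamma_pos in simp)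
  finally have "(norm (bgrad T v) * diameter T) * diameter T ^ (DIM('a) - 1) \<le> kap DIM('a) \<gamma> * diameter T ^ (DIM('a) - 1)"
    by (simp add: kap_def diam_split power_mult_distrib mult_ac)
  then show ?thesis using h by (simp add: mult_le_cancel_right)
qed

text \<open>Along the edge the coordinate of \<open>p\<close> drops from 1 to 0, so an edge cannot
  be short when the gradient is small.\<close>

lemma edge_bound:
  assumes T: "T \<in> \<T>" and pq: "p \<in> vert T" "q \<in> vert T" "p \<noteq> q"
  shows "diameter T \<le> kap DIM('a) \<gamma> * norm (p - q)"
proof -
  interpret S: osimplex T by (rule simp_loc[OF T])
  have "1 = bgrad T p \<bullet> (p - q)" using S.bary_grad[OF pq(1), of p q] S.bary_vertex pq by simp
  also have "... \<le> norm (bgrad T p) * norm (p - q)" by (rule norm_cauchy_schwarz)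
  finally have "diameter T * 1 \<le> diameter T * (norm (bgrad T p) * norm (p - q))"
    using diam_pos[OF T] by (intro mult_left_mono) simp_all
  also have "... = (norm (bgrad T p) * diameter T) * norm (p - q)" by simp
  also have "... \<le> kap DIM('a) \<gamma> * norm (p - q)" by (rule mult_right_mono[OF bgrad_bound[OF T pq(1)]]) simp
  finally show ?thesis by simp
qed

text \<open>As \<open>n \<ge> 2\<close>, the common facet has two vertices; their distance is
  comparable to the one diameter and bounded by the other.\<close>

lemma neighbour_diameter:
  assumes T: "T \<in> \<T>" "T' \<in> \<T>" and E: "is_facet E T" "is_facet E T'"
  shows "diameter T \<le> kap DIM('a) \<gamma> * diameter T'"
proof -
  interpret S: osimplex T by (rule simp_loc[OF T(1)])
  interpret S': osimplex T' by (rule simp_loc[OF T(2)])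
  obtain p where p: "p \<in> vert T" "E = opp_facet T p" using E(1) by (auto simp: S.is_facet_iff)
  obtain p' where p': "p' \<in> vert T'" "E = opp_facet T' p'" using E(2) by (auto simp: S'.is_facet_iff)
  have eq: "vert T - {p} = vert T' - {p'}"
    using S.opp_facet_extreme[OF p(1)] S'.opp_facet_extreme[OF p'(1)] p(2) p'(2) by simp
  have "card (vert T - {p}) = DIM('a)" using p(1) S.vert_props(1,2) by simp
  then have "2 \<le> card (vert T - {p})" using dim2 by simp
  then obtain q r where qr: "q \<in> vert T - {p}" "r \<in> vert T - {p}" "q \<noteq> r"
    using card_le_Suc0_iff_eq[of "vert T - {p}"] S.finV by (metis finite_Diff not_less_eq_eq numeral_2_eq_2)
  have "diameter T \<le> kap DIM('a) \<gamma> * norm (q - r)" using qr by (intro edge_bound T) auto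
  also have "norm (q - r) \<le> diameter T'"
    using qr eq S'.vertex_in_closure by (intro S'.dist_le_diameter) auto
  then have "kap DIM('a) \<gamma> * norm (q - r) \<le> kap DIM('a) \<gamma> * diameter T'" using kappa_pos by (intro mult_left_mono) simp_all
  finally show ?thesis .
qed

abbreviation area :: "'a set \<Rightarrow> real" where "area \<equiv> flat_measure"

lemma area_bounds:
  assumes T: "T \<in> \<T>" and E: "is_facet E T"
  shows "area E \<le> (2 * diameter T) ^ (DIM('a) - 1)" and "diameter T ^ (DIM('a) - 1) \<le> \<gamma> * area E"
    and "vol T \<le> area E * diameter T" and "0 < area E"
proof -
  interpret S: osimplex T by (rule simp_loc[OF T])
  obtain p where p: "p \<in> vert T" "E = opp_facet T p" using E by (auto simp: S.is_facet_iff)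
  show "area E \<le> (2 * diameter T) ^ (DIM('a) - 1)" and v: "vol T \<le> area E * diameter T"
    using S.flat_measure_facet[OF p(1)] p(2) by simp_all
  have h: "0 < diameter T" by (rule diam_pos[OF T])
  show "0 < area E" using v vol_pos[OF T] h by (metis less_le_trans zero_less_mult_pos2)
  have "diameter T * diameter T ^ (DIM('a) - 1) \<le> \<gamma> * vol T" using diam_power[OF T] by (simp add: diam_split)
  also have "... \<le> \<gamma> * (area E * diameter T)" using v gamma_pos by (intro mult_left_mono) simp_all
  finally have "diameter T ^ (DIM('a) - 1) * diameter T \<le> (\<gamma> * area E) * diameter T" by (simp add: mult_ac)
  then show "diameter T ^ (DIM('a) - 1) \<le> \<gamma> * area E" using h by (simp add: mult_le_cancel_right)
qed

lemma vol_le: "T \<in> \<T> \<Longrightarrow> vol T \<le> 2 ^ (DIM('a) - 1) * diameter T ^ DIM('a)"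
proof -
  assume T: "T \<in> \<T>"
  interpret S: osimplex T by (rule simp_loc[OF T])
  obtain p where p: "p \<in> vert T" using S.other_vertex by metis
  have E: "is_facet (opp_facet T p) T" using p by (auto simp: S.is_facet_iff)
  have h: "0 < diameter T" by (rule diam_pos[OF T])
  have "vol T \<le> area (opp_facet T p) * diameter T" by (rule area_bounds(3)[OF T E])
  also have "... \<le> (2 * diameter T) ^ (DIM('a) - 1) * diameter T"
    using h by (intro mult_right_mono area_bounds(1)[OF T E]) simp
  finally show ?thesis by (simp add: diam_split power_mult_distrib mult_ac)
qed

text \<open>The elements of a patch, scaled to the size of the smallest one, are still disjoint and lie in a cube.\<close>

lemma card_patch: "real (card (patch a)) \<le> 2 ^ DIM('a) * \<gamma>"
proof (cases "patch a = {}")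
  case True
  then show ?thesis using gamma_pos by simp
next
  case False
  define \<rho> where "\<rho> = Min (diameter ` patch a)"
  have "\<rho> \<in> diameter ` patch a" unfolding \<rho>_def by (rule Min_in) (use finite_patch False in simp_all)
  then have \<rho>: "0 < \<rho>" using diam_pos patchD by auto
  have \<rho>_le: "\<rho> \<le> diameter T" if "T \<in> patch a" for T
    unfolding \<rho>_def by (rule Min_le) (use that finite_patch in simp_all)
  \<comment> \<open>The homothety with centre \<open>a\<close> and ratio \<open>s T\<close> shrinks
    \<open>T\<close> to diameter \<rho>. Its image lies in \<open>T\<close> and, by shape
    regularity, has volume at least \<open>\<rho> ^ n / \<gamma>\<close>.\<close>
  define s where "s T = \<rho> / diameter T" for T :: "'a set"
  define S where "S T = (\<lambda>x. s T *\<^sub>R x + (1 - s T) *\<^sub>R a) ` T" for T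
  have s: "0 < s T" "s T \<le> 1" if "T \<in> patch a" for T
    using \<rho> \<rho>_le[OF that] diam_pos[OF patchD(1)[OF that]] by (simp_all add: s_def)
  have sub: "S T \<subseteq> T" if T: "T \<in> patch a" for T
  proof
    interpret A: osimplex T by (rule simp_loc[OF patchD(1)[OF T]])
    fix y assume "y \<in> S T"
    then obtain x where x: "x \<in> T" "y = s T *\<^sub>R x + (1 - s T) *\<^sub>R a" by (auto simp: S_def)
    have "0 < bary T v y" if v: "v \<in> vert T" for v
    proof -
      have "bary T v y = s T * bary T v x + (1 - s T) * bary T v a"
        using A.bary_lin[OF v, of "s T" "1 - s T" 0 x a 0] x(2) by simp
      moreover have "0 < s T * bary T v x" using x(1) s[OF T] v A.mem_T by simp
      moreover have "0 \<le> (1 - s T) * bary T v a"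
        using A.bary_vertex[OF v patchD(2)[OF T]] s[OF T] by simp
      ultimately show ?thesis by linarith
    qed
    then show "y \<in> T" by (simp add: A.mem_T)
  qed
  have box: "S T \<subseteq> cbox (a - \<rho> *\<^sub>R One) (a + \<rho> *\<^sub>R One)" if T: "T \<in> patch a" for T
  proof
    interpret A: osimplex T by (rule simp_loc[OF patchD(1)[OF T]])
    fix y assume "y \<in> S T"
    then obtain x where x: "x \<in> T" "y = s T *\<^sub>R x + (1 - s T) *\<^sub>R a" by (auto simp: S_def)
    have "y - a = s T *\<^sub>R (x - a)" by (simp add: x(2) algebra_simps)
    then have "norm (y - a) = s T * norm (x - a)" using s[OF T] by simp
    also have "... \<le> s T * diameter T"
      using s[OF T] x(1) A.vertex_in_closure[OF patchD(2)[OF T]] A.T_subset_closure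
      by (intro mult_left_mono A.dist_le_diameter) auto
    also have "... = \<rho>" using diam_pos[OF patchD(1)[OF T]] by (simp add: s_def)
    finally have n: "norm (y - a) \<le> \<rho>" .
    show "y \<in> cbox (a - \<rho> *\<^sub>R One) (a + \<rho> *\<^sub>R One)"
    proof (unfold mem_box, intro ballI)
      fix i :: 'a assume i: "i \<in> Basis"
      have "\<bar>y \<bullet> i - a \<bullet> i\<bar> \<le> \<rho>" using Basis_le_norm[OF i, of "y - a"] n by (simp add: inner_diff_left)
      then show "(a - \<rho> *\<^sub>R One) \<bullet> i \<le> y \<bullet> i \<and> y \<bullet> i \<le> (a + \<rho> *\<^sub>R One) \<bullet> i"
        using i by (simp add: inner_diff_left inner_add_left abs_le_iff)
    qed
  qed
  have op: "open (S T)" if T: "T \<in> patch a" for T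
  proof -
    have "S T = (\<lambda>x. (1 - s T) *\<^sub>R a + s T *\<^sub>R x) ` T" by (simp add: S_def add.commute)
    then show ?thesis using open_affinity[OF osimplex.open_T[OF simp_loc[OF patchD(1)[OF T]]], of "s T"] s[OF T] by simp
  qed
  have lm: "S T \<in> lmeasurable" if T: "T \<in> patch a" for T
    by (rule bounded_borel_lmeasurable[OF bounded_subset[OF bounded_cbox box[OF T]]]) (use op[OF T] in simp)
  have big: "\<rho> ^ DIM('a) / \<gamma> \<le> vol (S T)" if T: "T \<in> patch a" for T
  proof -
    have h: "0 < diameter T" by (rule diam_pos[OF patchD(1)[OF T]])
    have "vol (S T) = s T ^ DIM('a) * vol T"
      using measure_lebesgue_affine[of "s T" "(1 - s T) *\<^sub>R a" T] s[OF T] by (simp add: S_def)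
    moreover have "diameter T ^ DIM('a) / \<gamma> \<le> vol T"
      using diam_power[OF patchD(1)[OF T]] gamma_pos by (simp add: divide_le_eq mult.commute)
    then have "s T ^ DIM('a) * (diameter T ^ DIM('a) / \<gamma>) \<le> s T ^ DIM('a) * vol T"
      using s[OF T] by (intro mult_left_mono) simp_all
    moreover have "s T ^ DIM('a) * diameter T ^ DIM('a) = \<rho> ^ DIM('a)"
      using h by (simp add: s_def power_mult_distrib[symmetric])
    ultimately show ?thesis by (simp add: mult.commute)
  qed
  have dj: "disjoint_family_on S (patch a)"
    unfolding disjoint_family_on_def using sub disj patchD(1) by blast
  have "real (card (patch a)) * (\<rho> ^ DIM('a) / \<gamma>) \<le> (\<Sum>T\<in>patch a. vol (S T))"
    using sum_bounded_below[of "patch a" "\<rho> ^ DIM('a) / \<gamma>" "\<lambda>T. vol (S T)"] big by simp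
  also have "... = vol (\<Union>T\<in>patch a. S T)"
  proof (rule measure_finite_Union[symmetric, OF finite_patch _ dj])
    show "S ` patch a \<subseteq> sets lebesgue" using lm by auto
    show "emeasure lebesgue (S i) \<noteq> \<infinity>" if "i \<in> patch a" for i
      using fmeasurableD2[OF lm[OF that]] by simp
  qed
  also have "... \<le> vol (cbox (a - \<rho> *\<^sub>R One) (a + \<rho> *\<^sub>R One))"
    using box lm finite_patch by (intro measure_mono_fmeasurable fmeasurable_cbox fmeasurableD fmeasurable.finite_UN) blast+
  also have "... = (\<Prod>i\<in>(Basis::'a set). 2 * \<rho>)"
  proof -
    have "\<forall>i\<in>Basis. (a - \<rho> *\<^sub>R One) \<bullet> i \<le> (a + \<rho> *\<^sub>R One) \<bullet> i" using \<rho> by (simp add: inner_diff_left inner_add_left)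
    then have "vol (cbox (a - \<rho> *\<^sub>R One) (a + \<rho> *\<^sub>R One))
        = (\<Prod>i\<in>Basis. (a + \<rho> *\<^sub>R One) \<bullet> i - (a - \<rho> *\<^sub>R One) \<bullet> i)"
      using content_cbox_cases[of "a - \<rho> *\<^sub>R One" "a + \<rho> *\<^sub>R One"] by simp
    also have "... = (\<Prod>i\<in>(Basis::'a set). 2 * \<rho>)"
      by (rule prod.cong[OF refl]) (simp add: inner_diff_left inner_add_left)
    finally show ?thesis .
  qed
  also have "... = 2 ^ DIM('a) * \<rho> ^ DIM('a)" by (simp add: power_mult_distrib)
  finally have "real (card (patch a)) * \<rho> ^ DIM('a) \<le> (2 ^ DIM('a) * \<gamma>) * \<rho> ^ DIM('a)"
    using gamma_pos by (simp add: field_simps)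
  then show ?thesis using \<rho> by (simp add: mult_le_cancel_right)
qed

end

section \<open>Vertex values controlled by jumps\<close>

text \<open>The exponent is what remains of the factor \<open>area E ^ 2\<close> of the squared divergence coefficients after
  multiplication with the diagonal entry \<open>area E powr (- n / (n - 1))\<close>.\<close>

definition jump_exponent :: "nat \<Rightarrow> real" where "jump_exponent n = (real n - 2) / (real n - 1)"

text \<open>The cost of one step between adjacent elements: the factors 2 split the square, the
  power of \<open>g\<close> pays for the jump and the power of \<open>kap\<close> for the change of
  diameter. The summand 1 makes the powers increase with the length of the path.\<close>

definition step_const :: "nat \<Rightarrow> real \<Rightarrow> real" where
  "step_const n g = 1 + 2 * g powr jump_exponent n + 2 * kap n g ^ (n - 2)"

text \<open>The exponent bounds the number of adjacent pairs in a patch, hence the length of a path;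
  the last factor is the cost at the end of the path.\<close>

definition jump_const :: "nat \<Rightarrow> real \<Rightarrow> real" where
  "jump_const n g = step_const n g ^ nat \<lceil>(2 ^ n * g)\<^sup>2\<rceil> * (1 + g powr jump_exponent n)"

lemma square_add_le: "(x + y)\<^sup>2 \<le> 2 * x\<^sup>2 + 2 * y\<^sup>2" for x y :: real
  using sum_squares_bound[of x y] by (simp add: power2_sum)

abbreviation diam_pow :: "'a::euclidean_space set \<Rightarrow> real" where
  "diam_pow T \<equiv> diameter T ^ (DIM('a) - 2)"

context mesh
begin

abbreviation weight :: "'a set \<Rightarrow> real" where "weight E \<equiv> area E powr jump_exponent DIM('a)"

definition jump :: "('a set \<Rightarrow> real) \<Rightarrow> 'a set \<Rightarrow> real" where
  "jump w E = w (Tp E) - (if bdry E then 0 else w (Tm E))"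

definition vertex_jumps :: "('a set \<Rightarrow> real) \<Rightarrow> 'a \<Rightarrow> real" where
  "vertex_jumps w a = (\<Sum>E | E \<in> facets \<T> \<and> a \<in> closure E. weight E * (jump w E)\<^sup>2)"

lemma finite_facets: "finite (facets \<T>)"
proof -
  have "facets \<T> \<subseteq> (\<Union>T\<in>\<T>. opp_facet T ` vert T)"
    using osimplex.is_facet_iff[OF simp_loc] by (auto simp: facets_def)
  moreover have "finite (\<Union>T\<in>\<T>. opp_facet T ` vert T)"
    using fin osimplex.finV[OF simp_loc] by blast
  ultimately show ?thesis by (rule finite_subset)
qed

lemma vertex_jumps_nonneg: "0 \<le> vertex_jumps w a"
  unfolding vertex_jumps_def by (rule sum_nonneg) simp

lemma jump_le: "E \<in> facets \<T> \<Longrightarrow> a \<in> closure E \<Longrightarrow> weight E * (jump w E)\<^sup>2 \<le> vertex_jumps w a"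
  unfolding vertex_jumps_def by (rule member_le_sum) (use finite_facets in simp_all)

lemma diam_pow_split: "diameter T ^ DIM('a) = diam_pow T * (diameter T)\<^sup>2" for T :: "'a set"
  using power_add[of "diameter T" "DIM('a) - 2" 2] dim2 by (simp only: le_add_diff_inverse2)

text \<open>Raising \<open>diameter T ^ (n - 1) \<le> \<gamma> * area E\<close> to the power
  \<open>(n - 2) / (n - 1)\<close>, which is nonnegative since \<open>n \<ge> 2\<close>.\<close>

lemma diam_le_weight:
  assumes T: "T \<in> \<T>" and E: "is_facet E T"
  shows "diam_pow T \<le> \<gamma> powr jump_exponent DIM('a) * weight E"
proof -
  have h: "0 < diameter T" by (rule diam_pos[OF T])
  have n: "real (DIM('a) - 1) * jump_exponent DIM('a) = real (DIM('a) - 2)"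
    using dim2 by (simp add: jump_exponent_def)
  have a0: "0 \<le> jump_exponent DIM('a)" using dim2 by (simp add: jump_exponent_def)
  have "diam_pow T = (diameter T ^ (DIM('a) - 1)) powr jump_exponent DIM('a)"
    using h n by (simp add: powr_realpow[symmetric] powr_powr)
  also have "... \<le> (\<gamma> * area E) powr jump_exponent DIM('a)"
    by (rule powr_mono2[OF a0]) (use h area_bounds(2)[OF T E] in simp_all)
  also have "... = \<gamma> powr jump_exponent DIM('a) * weight E"
    using gamma_pos area_bounds(4)[OF T E] by (simp add: powr_mult)
  finally show ?thesis .
qed

lemma step_const_ge: "1 \<le> step_const DIM('a) \<gamma>"
  "2 * \<gamma> powr jump_exponent DIM('a) + 2 * kap DIM('a) \<gamma> ^ (DIM('a) - 2) \<le> step_const DIM('a) \<gamma>"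
  using kappa_pos by (simp_all add: step_const_def)

lemma adj_step:
  assumes "(T, T') \<in> adj a"
  shows "diam_pow T * (w T - w T')\<^sup>2 \<le> \<gamma> powr jump_exponent DIM('a) * vertex_jumps w a"
    and "diam_pow T \<le> kap DIM('a) \<gamma> ^ (DIM('a) - 2) * diam_pow T'"
    and "T \<in> patch a" "T' \<in> patch a"
proof -
  obtain E where E: "is_facet E T" "is_facet E T'" "a \<in> closure E" "\<not> bdry E"
    and TP: "T \<in> patch a" "T' \<in> patch a" using assms by (auto simp: adj_def)
  show "T \<in> patch a" "T' \<in> patch a" by (rule TP)+
  have T: "T \<in> \<T>" "T' \<in> \<T>" using TP patchD by auto
  have EF: "E \<in> facets \<T>" by (rule facetsI[OF T(1) E(1)])
  \<comment> \<open>The two elements are those of the labelling in one order or the other, and the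
    square of the jump is insensitive to the order.\<close>
  have "{T, T'} \<subseteq> {Tp E, Tm E}" using facet_neighbours(2)[OF EF E(4)] T E by blast
  then have "(w T - w T')\<^sup>2 \<le> (jump w E)\<^sup>2" using E(4) by (auto simp: jump_def power2_commute)
  then have "diam_pow T * (w T - w T')\<^sup>2 \<le> (\<gamma> powr jump_exponent DIM('a) * weight E) * (jump w E)\<^sup>2"
    using diam_pos[OF T(1)] by (intro mult_mono diam_le_weight T E) simp_all
  also have "... = \<gamma> powr jump_exponent DIM('a) * (weight E * (jump w E)\<^sup>2)" by simp
  also have "... \<le> \<gamma> powr jump_exponent DIM('a) * vertex_jumps w a"
    by (rule mult_left_mono[OF jump_le[OF EF E(3)]]) simp
  finally show "diam_pow T * (w T - w T')\<^sup>2 \<le> \<gamma> powr jump_exponent DIM('a) * vertex_jumps w a" .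
  have "diam_pow T \<le> (kap DIM('a) \<gamma> * diameter T') ^ (DIM('a) - 2)"
    using neighbour_diameter[OF T E(1,2)] diam_pos[OF T(1)] by (intro power_mono) simp_all
  then show "diam_pow T \<le> kap DIM('a) \<gamma> ^ (DIM('a) - 2) * diam_pow T'"
    by (simp add: power_mult_distrib)
qed

text \<open>The reference value \<open>c\<close> and the bound at the end of the path cover both
  situations: at an interior vertex \<open>c\<close> is the value on the last element, at a boundary
  vertex \<open>c\<close> is zero and the last element has one more jump, to the boundary.\<close>

lemma adj_path:
  assumes "(T, T') \<in> adj a ^^ k"
    and "diam_pow T' * (w T' - c)\<^sup>2 \<le> (1 + \<gamma> powr jump_exponent DIM('a)) * vertex_jumps w a"
  shows "diam_pow T * (w T - c)\<^sup>2
    \<le> step_const DIM('a) \<gamma> ^ k * (1 + \<gamma> powr jump_exponent DIM('a)) * vertex_jumps w a"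
  using assms(1)
proof (induction k arbitrary: T)
  case 0
  then show ?case using assms(2) by simp
next
  case (Suc k)
  let ?d = "\<lambda>T. diam_pow T" and ?g = "\<gamma> powr jump_exponent DIM('a)"
  let ?S = "vertex_jumps w a" and ?K = "kap DIM('a) \<gamma> ^ (DIM('a) - 2)" and ?C = "step_const DIM('a) \<gamma>"
  let ?D = "?C ^ k * (1 + ?g)"
  obtain T1 where T1: "(T, T1) \<in> adj a" "(T1, T') \<in> adj a ^^ k" using relpow_Suc_D2[OF Suc.prems] by blast
  note st = adj_step[OF T1(1)]
  have d: "0 < ?d T" using diam_pos[OF patchD(1)[OF st(3)]] by simp
  have K: "0 \<le> ?K" using kappa_pos by simp
  \<comment> \<open>The bare jump term of the first step carries no power of the step constant;
    enlarging it by \<open>?D\<close> allows both terms to be collected.\<close>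
  have "1 * 1 \<le> ?D" using step_const_ge(1) by (intro mult_mono one_le_power) simp_all
  then have g1: "?g * ?S \<le> ?g * ?D * ?S"
    using mult_left_mono[of 1 ?D "?g * ?S"] vertex_jumps_nonneg[of w a] by (simp add: mult_ac)
  have "(w T - c)\<^sup>2 \<le> 2 * (w T - w T1)\<^sup>2 + 2 * (w T1 - c)\<^sup>2" using square_add_le[of "w T - w T1" "w T1 - c"] by simp
  then have "?d T * (w T - c)\<^sup>2 \<le> ?d T * (2 * (w T - w T1)\<^sup>2 + 2 * (w T1 - c)\<^sup>2)" using d by (intro mult_left_mono) simp_all
  also have "... = 2 * (?d T * (w T - w T1)\<^sup>2) + 2 * (?d T * (w T1 - c)\<^sup>2)" by (simp add: distrib_left)
  also have "... \<le> 2 * (?g * ?D * ?S) + 2 * (?K * (?D * ?S))"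
  proof (intro add_mono mult_left_mono)
    show "?d T * (w T - w T1)\<^sup>2 \<le> ?g * ?D * ?S" using st(1)[of w] g1 by linarith
    have "?d T * (w T1 - c)\<^sup>2 \<le> (?K * ?d T1) * (w T1 - c)\<^sup>2" by (rule mult_right_mono[OF st(2)]) simp
    also have "... = ?K * (?d T1 * (w T1 - c)\<^sup>2)" by simp
    also have "... \<le> ?K * (?D * ?S)" by (rule mult_left_mono[OF Suc.IH[OF T1(2)] K])
    finally show "?d T * (w T1 - c)\<^sup>2 \<le> ?K * (?D * ?S)" .
  qed simp_all
  also have "... = (2 * ?g + 2 * ?K) * (?D * ?S)" by (simp add: algebra_simps)
  also have "... \<le> ?C * (?D * ?S)"
    using step_const_ge vertex_jumps_nonneg[of w a] by (intro mult_right_mono mult_nonneg_nonneg) simp_all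
  finally show ?case by (simp add: mult_ac)
qed

text \<open>A path need not be longer than the number of adjacent pairs, and
  \<open>card_patch\<close> bounds this number independently of the mesh.\<close>

lemma adj_connected:
  assumes "(T, T') \<in> (adj a)\<^sup>*"
    and "diam_pow T' * (w T' - c)\<^sup>2 \<le> (1 + \<gamma> powr jump_exponent DIM('a)) * vertex_jumps w a"
  shows "diam_pow T * (w T - c)\<^sup>2 \<le> jump_const DIM('a) \<gamma> * vertex_jumps w a"
proof -
  have sub: "adj a \<subseteq> patch a \<times> patch a" by (auto simp: adj_def)
  have fA: "finite (adj a)" by (rule finite_subset[OF sub]) (use finite_patch in simp)
  have "card (adj a) \<le> card (patch a) * card (patch a)"
    using card_mono[OF _ sub] finite_patch by (simp add: card_cartesian_product)
  then have "real (card (adj a)) \<le> (real (card (patch a)))\<^sup>2" by (metis of_nat_le_iff of_nat_mult power2_eq_square)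
  also have "... \<le> (2 ^ DIM('a) * \<gamma>)\<^sup>2" by (rule power_mono[OF card_patch]) simp
  finally have c: "card (adj a) \<le> nat \<lceil>(2 ^ DIM('a) * \<gamma>)\<^sup>2\<rceil>" by linarith
  obtain k where k: "k \<le> card (adj a)" "(T, T') \<in> adj a ^^ k"
    using assms(1) unfolding rtrancl_finite_eq_relpow[OF fA] by blast
  have "step_const DIM('a) \<gamma> ^ k \<le> step_const DIM('a) \<gamma> ^ nat \<lceil>(2 ^ DIM('a) * \<gamma>)\<^sup>2\<rceil>"
    using k(1) c step_const_ge(1) by (intro power_increasing) simp_all
  then have "step_const DIM('a) \<gamma> ^ k * (1 + \<gamma> powr jump_exponent DIM('a)) * vertex_jumps w a
      \<le> jump_const DIM('a) \<gamma> * vertex_jumps w a"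
    unfolding jump_const_def using vertex_jumps_nonneg[of w a] by (intro mult_right_mono) simp_all
  then show ?thesis using adj_path[OF k(2) assms(2)] by linarith
qed

definition vertex_value :: "('a set \<Rightarrow> real) \<Rightarrow> 'a \<Rightarrow> real" where
  "vertex_value w a = (if bd a then 0 else w (SOME T. T \<in> patch a))"

lemma vertex_value_jumps:
  assumes T: "T \<in> patch a"
  shows "diam_pow T * (w T - vertex_value w a)\<^sup>2 \<le> jump_const DIM('a) \<gamma> * vertex_jumps w a"
proof (cases "bd a")
  case True
  obtain T' E where E: "(T, T') \<in> (adj a)\<^sup>*" "is_facet E T'" "a \<in> closure E" "bdry E" "T' \<in> patch a"
    by (rule boundary_vertex[OF True T]) blast
  have T': "T' \<in> \<T>" by (rule patchD(1)[OF E(5)])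
  have EF: "E \<in> facets \<T>" by (rule facetsI[OF T' E(2)])
  \<comment> \<open>The function is extended by zero, so across a boundary facet the jump is the
    value itself.\<close>
  have "Tp E = T'" using facet_neighbours(1)[OF EF E(4)] T' E(2) by blast
  then have "jump w E = w T'" using E(4) by (simp add: jump_def)
  then have "diam_pow T' * (w T' - 0)\<^sup>2 \<le> (\<gamma> powr jump_exponent DIM('a) * weight E) * (jump w E)\<^sup>2"
    using mult_right_mono[OF diam_le_weight[OF T' E(2)], of "(w T')\<^sup>2"] by simp
  also have "... = \<gamma> powr jump_exponent DIM('a) * (weight E * (jump w E)\<^sup>2)" by simp
  also have "... \<le> \<gamma> powr jump_exponent DIM('a) * vertex_jumps w a"
    by (rule mult_left_mono[OF jump_le[OF EF E(3)]]) simp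
  also have "... \<le> (1 + \<gamma> powr jump_exponent DIM('a)) * vertex_jumps w a"
    by (rule mult_right_mono[OF _ vertex_jumps_nonneg]) simp
  finally show ?thesis using adj_connected[OF E(1), of w 0] True by (simp add: vertex_value_def)
next
  case False
  let ?T = "SOME T. T \<in> patch a"
  have "?T \<in> patch a" by (rule someI[of "\<lambda>T. T \<in> patch a", OF T])
  then have c: "(T, ?T) \<in> (adj a)\<^sup>*" by (rule interior_vertex(1)[OF False T])
  have "0 \<le> (1 + \<gamma> powr jump_exponent DIM('a)) * vertex_jumps w a" by (intro mult_nonneg_nonneg vertex_jumps_nonneg) simp
  then show ?thesis using adj_connected[OF c, of w "w ?T"] False by (simp add: vertex_value_def)
qed

abbreviation jumps :: "('a set \<Rightarrow> real) \<Rightarrow> real" where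
  "jumps w \<equiv> (\<Sum>E\<in>facets \<T>. weight E * (jump w E)\<^sup>2)"

lemma jumps_nonneg: "0 \<le> jumps w" by (rule sum_nonneg) simp

text \<open>Double counting: a facet occurs once for every pair of a vertex \<open>a\<close> of it
  and an element at \<open>a\<close>. Those vertices are among the \<open>n + 1\<close> vertices of
  one element, and each has a patch of bounded size.\<close>

lemma sum_vertex_jumps:
  "(\<Sum>T\<in>\<T>. \<Sum>a\<in>vert T. vertex_jumps w a) \<le> (real DIM('a) + 1) * (2 ^ DIM('a) * \<gamma>) * jumps w"
proof -
  define W where "W E = weight E * (jump w E)\<^sup>2" for E
  define P where "P E = {(T, a). T \<in> \<T> \<and> a \<in> vert T \<and> a \<in> closure E}" for E
  have fV: "finite (vert T)" if "T \<in> \<T>" for T by (rule osimplex.finV[OF simp_loc[OF that]])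
  have fS: "finite (SIGMA T:\<T>. vert T)" using fin fV by (rule finite_SigmaI)
  have "(\<Sum>T\<in>\<T>. \<Sum>a\<in>vert T. vertex_jumps w a) = (\<Sum>(T, a)\<in>(SIGMA T:\<T>. vert T). vertex_jumps w a)"
    by (rule sum.Sigma) (use fin fV in simp_all)
  also have "... = (\<Sum>(T, a)\<in>(SIGMA T:\<T>. vert T). \<Sum>E\<in>facets \<T>. if a \<in> closure E then W E else 0)"
    unfolding vertex_jumps_def W_def
    by (rule sum.cong[OF refl]) (auto simp: case_prod_beta Collect_conj_eq Int_commute sum.inter_restrict[OF finite_facets])
  also have "... = (\<Sum>E\<in>facets \<T>. \<Sum>(T, a)\<in>(SIGMA T:\<T>. vert T). if a \<in> closure E then W E else 0)"
    unfolding case_prod_beta by (rule sum.swap)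
  also have "... \<le> (\<Sum>E\<in>facets \<T>. ((real DIM('a) + 1) * (2 ^ DIM('a) * \<gamma>)) * W E)"
  proof (rule sum_mono)
    fix E assume EF: "E \<in> facets \<T>"
    then obtain T0 where T0: "T0 \<in> \<T>" "is_facet E T0" by (auto simp: facets_def)
    have PS: "P E \<subseteq> (\<lambda>(a, T). (T, a)) ` (SIGMA a:vert T0. patch a)"
    proof (clarsimp simp: P_def image_iff)
      fix T a assume "T \<in> \<T>" "a \<in> vert T" "a \<in> closure E"
      then show "a \<in> vert T0 \<and> T \<in> patch a" using vert_closure_facet[OF T0, of T a] by (auto simp: patch_def)
    qed
    have fP: "finite (SIGMA a:vert T0. patch a)" using fV[OF T0(1)] finite_patch by (intro finite_SigmaI)
    have "card (P E) \<le> card ((\<lambda>(a, T). (T, a)) ` (SIGMA a:vert T0. patch a))" by (rule card_mono[OF finite_imageI[OF fP] PS])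
    also have "... \<le> card (SIGMA a:vert T0. patch a)" by (rule card_image_le[OF fP])
    also have "... = (\<Sum>a\<in>vert T0. card (patch a))" using fV[OF T0(1)] finite_patch by (simp add: card_SigmaI)
    finally have "real (card (P E)) \<le> (\<Sum>a\<in>vert T0. real (card (patch a)))" by (metis of_nat_le_iff of_nat_sum)
    also have "... \<le> (\<Sum>a\<in>vert T0. 2 ^ DIM('a) * \<gamma>)" by (rule sum_mono[OF card_patch])
    also have "... = (real DIM('a) + 1) * (2 ^ DIM('a) * \<gamma>)"
      using osimplex.vert_props(2)[OF simp_loc[OF T0(1)]] by simp
    finally have c: "real (card (P E)) \<le> (real DIM('a) + 1) * (2 ^ DIM('a) * \<gamma>)" .
    have "(\<Sum>(T, a)\<in>(SIGMA T:\<T>. vert T). if a \<in> closure E then W E else 0)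
        = (\<Sum>p\<in>{p \<in> (SIGMA T:\<T>. vert T). snd p \<in> closure E}. W E)"
      unfolding case_prod_beta by (rule sum.inter_filter[symmetric, OF fS])
    also have "{p \<in> (SIGMA T:\<T>. vert T). snd p \<in> closure E} = P E" by (auto simp: P_def)
    also have "(\<Sum>p\<in>P E. W E) = real (card (P E)) * W E" by simp
    also have "... \<le> ((real DIM('a) + 1) * (2 ^ DIM('a) * \<gamma>)) * W E"
      by (rule mult_right_mono[OF c]) (simp add: W_def)
    finally show "(\<Sum>(T, a)\<in>(SIGMA T:\<T>. vert T). if a \<in> closure E then W E else 0)
        \<le> ((real DIM('a) + 1) * (2 ^ DIM('a) * \<gamma>)) * W E" .
  qed
  finally show ?thesis by (simp add: W_def sum_distrib_left)
qed

section \<open>Continuous piecewise affine functions\<close>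

definition affine_piece :: "('a \<Rightarrow> real) \<Rightarrow> 'a set \<Rightarrow> 'a \<Rightarrow> real" where
  "affine_piece \<alpha> T x = (\<Sum>a\<in>vert T. \<alpha> a * bary T a x)"

definition piece_grad :: "('a \<Rightarrow> real) \<Rightarrow> 'a set \<Rightarrow> 'a" where
  "piece_grad \<alpha> T = (\<Sum>a\<in>vert T. \<alpha> a *\<^sub>R bgrad T a)"

text \<open>On common faces the choice of element is immaterial by
  \<open>affine_piece_agree\<close>. The value zero off the closed elements extends the function to
  the whole space, as mollification requires.\<close>

definition nodal :: "('a \<Rightarrow> real) \<Rightarrow> 'a \<Rightarrow> real" where
  "nodal \<alpha> x = (if \<exists>T\<in>\<T>. x \<in> closure T then affine_piece \<alpha> (SOME T. T \<in> \<T> \<and> x \<in> closure T) x else 0)"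

lemma affine_piece_eq:
  assumes T: "T \<in> \<T>"
  shows "affine_piece \<alpha> T y = affine_piece \<alpha> T x + piece_grad \<alpha> T \<bullet> (y - x)"
proof -
  interpret S: osimplex T by (rule simp_loc[OF T])
  have "\<alpha> a * bary T a y = \<alpha> a * bary T a x + (\<alpha> a *\<^sub>R bgrad T a) \<bullet> (y - x)" if "a \<in> vert T" for a
    unfolding S.bary_grad[OF that, of y x] by (simp add: distrib_left)
  then show ?thesis unfolding affine_piece_def piece_grad_def by (simp add: sum.distrib inner_sum_left)
qed

text \<open>By \<open>conform\<close> the positive coordinates at a common point belong to the same
  vertices and agree; the others contribute nothing.\<close>

lemma affine_piece_agree:
  assumes T: "T \<in> \<T>" "x \<in> closure T" and T': "T' \<in> \<T>" "x \<in> closure T'"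
  shows "affine_piece \<alpha> T x = affine_piece \<alpha> T' x"
proof -
  interpret S: osimplex T by (rule simp_loc[OF T(1)])
  interpret S': osimplex T' by (rule simp_loc[OF T'(1)])
  have pos: "{a \<in> vert T. 0 < bary T a x} = {a \<in> vert T'. 0 < bary T' a x}"
  proof (intro equalityI subsetI)
    fix a
    show "a \<in> {a \<in> vert T'. 0 < bary T' a x}" if "a \<in> {a \<in> vert T. 0 < bary T a x}"
      using conform[OF T(1) T'(1) T(2) T'(2), of a] that by simp
    show "a \<in> {a \<in> vert T. 0 < bary T a x}" if "a \<in> {a \<in> vert T'. 0 < bary T' a x}"
      using conform[OF T'(1) T(1) T'(2) T(2), of a] that by simp
  qed
  have "affine_piece \<alpha> T x = (\<Sum>a\<in>{a \<in> vert T. 0 < bary T a x}. \<alpha> a * bary T a x)"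
    unfolding affine_piece_def
    by (rule sum.mono_neutral_right[OF S.finV]) (use T(2) S.mem_closure in "force+")
  also have "... = (\<Sum>a\<in>{a \<in> vert T. 0 < bary T a x}. \<alpha> a * bary T' a x)"
    by (rule sum.cong[OF refl]) (use conform[OF T(1) T'(1) T(2) T'(2)] in simp)
  also have "... = (\<Sum>a\<in>{a \<in> vert T'. 0 < bary T' a x}. \<alpha> a * bary T' a x)" by (simp only: pos)
  also have "... = affine_piece \<alpha> T' x"
    unfolding affine_piece_def
    by (rule sum.mono_neutral_left[OF S'.finV]) (use T'(2) S'.mem_closure in "force+")
  finally show ?thesis .
qed

lemma nodal_eq:
  assumes T: "T \<in> \<T>" "x \<in> closure T"
  shows "nodal \<alpha> x = affine_piece \<alpha> T x"
proof -
  have s: "(SOME T. T \<in> \<T> \<and> x \<in> closure T) \<in> \<T> \<and> x \<in> closure (SOME T. T \<in> \<T> \<and> x \<in> closure T)"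
    by (rule someI[of "\<lambda>T. T \<in> \<T> \<and> x \<in> closure T"]) (use T in simp)
  have "nodal \<alpha> x = affine_piece \<alpha> (SOME T. T \<in> \<T> \<and> x \<in> closure T) x" unfolding nodal_def using T by (intro if_P) blast
  then show ?thesis using affine_piece_agree[OF conjunct1[OF s] conjunct2[OF s] T, of \<alpha>] by (rule trans)
qed

text \<open>At a point outside the domain no hat function of an interior vertex is positive, and
  boundary vertices have value zero.\<close>

lemma nodal_zero:
  assumes \<alpha>: "\<And>a. bd a \<Longrightarrow> \<alpha> a = 0" and x: "x \<notin> \<Omega>"
  shows "nodal \<alpha> x = 0"
proof (cases "\<exists>T\<in>\<T>. x \<in> closure T")
  case True
  then obtain T where T: "T \<in> \<T>" "x \<in> closure T" by blast
  interpret S: osimplex T by (rule simp_loc[OF T(1)])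
  have "\<alpha> a * bary T a x = 0" if a: "a \<in> vert T" for a
  proof (cases "bd a")
    case False
    have "T \<in> patch a" using T a by (simp add: patch_def)
    then have "\<not> 0 < bary T a x" using interior_vertex(2)[OF False _ T(2)] x by blast
    then show ?thesis using T(2) a S.mem_closure by force
  qed (simp add: \<alpha>)
  then show ?thesis using nodal_eq[OF T, of \<alpha>] by (simp add: affine_piece_def)
qed (simp add: nodal_def)

text \<open>The segment between the points may leave the domain. It is covered by the closed
  elements, where the function is affine, and the complement of the domain, where it vanishes. The
  crude constant depends on the mesh; it enters the mollification but not the final
  estimate.\<close>

lemma nodal_lipschitz:
  assumes \<alpha>: "\<And>a. bd a \<Longrightarrow> \<alpha> a = 0"
  shows "\<bar>nodal \<alpha> x - nodal \<alpha> y\<bar> \<le> (\<Sum>T\<in>\<T>. norm (piece_grad \<alpha> T)) * norm (x - y)"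
proof -
  let ?L = "\<Sum>T\<in>\<T>. norm (piece_grad \<alpha> T)"
  define p where "p t = x + t *\<^sub>R (y - x)" for t :: real
  define U where "U T = p -` closure T" for T
  have cp: "continuous_on UNIV p" unfolding p_def by (intro continuous_intros)
  have pp: "norm (p s - p t) = \<bar>s - t\<bar> * norm (x - y)" for s t
  proof -
    have "p s - p t = (s - t) *\<^sub>R (y - x)" by (simp add: p_def algebra_simps)
    then show ?thesis by (simp add: norm_minus_commute)
  qed
  have "(?L * norm (x - y))-lipschitz_on {0..1} (\<lambda>t. nodal \<alpha> (p t))"
  proof (rule lipschitz_on_closed_Union[where I="insert (- \<Omega>) \<T>" and U=U])
    fix T assume "T \<in> insert (- \<Omega>) \<T>"
    then consider "T \<in> \<T>" | "T = - \<Omega>" by blast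
    then show "(?L * norm (x - y))-lipschitz_on (U T) (\<lambda>t. nodal \<alpha> (p t))"
    proof cases
      case 1
      show ?thesis
      proof (rule lipschitz_onI)
        fix s t assume st: "s \<in> U T" "t \<in> U T"
        have "nodal \<alpha> (p s) - nodal \<alpha> (p t) = piece_grad \<alpha> T \<bullet> (p s - p t)"
          using nodal_eq[OF 1] affine_piece_eq[OF 1, of \<alpha> "p s" "p t"] st by (simp add: U_def)
        then have "dist (nodal \<alpha> (p s)) (nodal \<alpha> (p t)) \<le> norm (piece_grad \<alpha> T) * norm (p s - p t)"
          using Cauchy_Schwarz_ineq2[of "piece_grad \<alpha> T" "p s - p t"] by (simp add: dist_real_def)
        also have "... \<le> ?L * norm (p s - p t)"
          using 1 fin by (intro mult_right_mono member_le_sum) simp_all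
        finally show "dist (nodal \<alpha> (p s)) (nodal \<alpha> (p t)) \<le> ?L * norm (x - y) * dist s t"
          by (simp add: pp dist_real_def mult_ac)
      qed (simp add: sum_nonneg)
    next
      case 2
      have "closure (- \<Omega>) = - \<Omega>" by (rule closure_closed[OF closed_Compl[OF open_dom]])
      then have "nodal \<alpha> (p t) = 0" if "t \<in> U T" for t using that 2 by (intro nodal_zero[OF \<alpha>]) (simp_all add: U_def)
      then show ?thesis by (intro lipschitz_onI) (simp_all add: sum_nonneg)
    qed
  next
    show "closed (U T)" for T unfolding U_def by (rule continuous_closed_vimage) (use cp in "simp_all add: continuous_on_eq_continuous_at")
    show "finite (insert (- \<Omega>) \<T>)" using fin by simp
    show "0 \<le> ?L * norm (x - y)" by (simp add: sum_nonneg)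
    have "p t \<in> (\<Union>T\<in>insert (- \<Omega>) \<T>. closure T)" for t
      using cover closure_subset[of \<Omega>] closure_subset[of "- \<Omega>"] by auto
    then show "{0..1} \<subseteq> (\<Union>T\<in>insert (- \<Omega>) \<T>. U T)" by (auto simp: U_def)
  qed
  then have "dist (nodal \<alpha> (p 0)) (nodal \<alpha> (p 1)) \<le> ?L * norm (x - y) * dist (0::real) 1"
    by (rule lipschitz_onD) simp_all
  then show ?thesis by (simp add: p_def dist_real_def)
qed

section \<open>Integrals of piecewise constant functions and approximation of nodal
  functions\<close>

lemma borel_elem: "T \<in> \<T> \<Longrightarrow> T \<in> sets borel" by (rule osimplex.T_borel[OF simp_loc])

lemma elem_lmeasurable: "T \<in> \<T> \<Longrightarrow> T \<in> lmeasurable" by (rule osimplex.T_lmeasurable[OF simp_loc])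

lemma I_indicator:
  assumes T: "T \<in> \<T>" and f: "f \<in> borel_measurable borel"
  shows "I (\<lambda>x. indicator T x * f x) = integral\<^sup>L (lebesgue_on T) f"
    and "integ (\<lambda>x. indicator T x * f x) \<longleftrightarrow> integrable (lebesgue_on T) f"
proof -
  have m: "(\<lambda>x. indicator T x * f x) \<in> borel_measurable borel" using f borel_elem[OF T] by measurable
  have e: "indicator \<Omega> x * (indicator T x * f x) = indicator T x * f x" for x
    using elem_subset[OF T] by (auto simp: indicator_def)
  show "I (\<lambda>x. indicator T x * f x) = integral\<^sup>L (lebesgue_on T) f"
    "integ (\<lambda>x. indicator T x * f x) \<longleftrightarrow> integrable (lebesgue_on T) f"
    using lebesgue_on_eq_lborel[OF dom_borel m] lebesgue_on_eq_lborel[OF borel_elem[OF T] f] by (simp_all add: e)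
qed

lemma I_indicator_const:
  assumes T: "T \<in> \<T>"
  shows "I (\<lambda>x. indicator T x * c) = vol T * c" and "integ (\<lambda>x. indicator T x * c)"
proof -
  interpret finite_measure "lebesgue_on T" by (rule finite_measure_lebesgue_on[OF elem_lmeasurable[OF T]])
  have i: "integrable (lebesgue_on T) (\<lambda>_. c)" by simp
  show "integ (\<lambda>x. indicator T x * c)" by (rule I_indicator(2)[OF T, of "\<lambda>_. c", THEN iffD2, OF _ i]) simp
  have "I (\<lambda>x. indicator T x * c) = integral\<^sup>L (lebesgue_on T) (\<lambda>_. c)" by (rule I_indicator(1)[OF T]) simp
  also have "... = vol T * c" using elem_lmeasurable[OF T] by (simp add: measure_restrict_space)
  finally show "I (\<lambda>x. indicator T x * c) = vol T * c" .
qed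

lemma AE_elements: "AE x in lebesgue_on \<Omega>. \<exists>T\<in>\<T>. x \<in> T"
proof -
  have "negligible (\<Union>T\<in>\<T>. frontier T)"
  proof (rule negligible_UN[OF fin])
    fix T assume "T \<in> \<T>"
    then interpret S: osimplex T by (rule simp_loc)
    have "convex T" using S.vert_props(5) convex_interior convex_convex_hull by metis
    then show "negligible (frontier T)" by (rule negligible_convex_frontier)
  qed
  then have "(\<Union>T\<in>\<T>. frontier T) \<in> null_sets lebesgue" by (simp add: negligible_iff_null_sets)
  then have "AE x in lebesgue. x \<notin> (\<Union>T\<in>\<T>. frontier T)" by (rule AE_not_in)
  then have "AE x in lebesgue. x \<in> \<Omega> \<longrightarrow> (\<exists>T\<in>\<T>. x \<in> T)"
  proof eventually_elim
    case (elim x)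
    show ?case
    proof
      assume "x \<in> \<Omega>"
      then obtain T where T: "T \<in> \<T>" "x \<in> closure T" using cover closure_subset[of \<Omega>] by blast
      then have "x \<in> interior T" using elim by (auto simp: frontier_def)
      then show "\<exists>T\<in>\<T>. x \<in> T" using T(1) interior_subset by blast
    qed
  qed
  then show ?thesis using AE_restrict_space_iff[of \<Omega> lebesgue] dom_lebesgue by simp
qed

lemma sum_indicator:
  fixes c :: "'a set \<Rightarrow> 'b::real_vector"
  assumes T: "T \<in> \<T>" "x \<in> T"
  shows "(\<Sum>T'\<in>\<T>. indicator T' x *\<^sub>R c T') = c T"
proof -
  have "(\<Sum>T'\<in>\<T>. indicator T' x *\<^sub>R c T') = (\<Sum>T'\<in>\<T>. if T' = T then c T else 0)"
    by (rule sum.cong[OF refl]) (use disj T in "auto simp: indicator_def")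
  then show ?thesis using T fin by (simp add: sum.delta)
qed

lemma I_piecewise:
  "I (\<lambda>x. \<Sum>T\<in>\<T>. indicator T x * c T) = (\<Sum>T\<in>\<T>. vol T * c T)" "integ (\<lambda>x. \<Sum>T\<in>\<T>. indicator T x * c T)"
proof -
  have "I (\<lambda>x. \<Sum>T\<in>\<T>. indicator T x * c T) = (\<Sum>T\<in>\<T>. I (\<lambda>x. indicator T x * c T))"
    by (rule LINT_sum) (rule I_indicator_const(2))
  also have "... = (\<Sum>T\<in>\<T>. vol T * c T)" by (rule sum.cong[OF refl]) (rule I_indicator_const(1))
  finally show "I (\<lambda>x. \<Sum>T\<in>\<T>. indicator T x * c T) = (\<Sum>T\<in>\<T>. vol T * c T)" .
  show "integ (\<lambda>x. \<Sum>T\<in>\<T>. indicator T x * c T)"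
    by (rule Bochner_Integration.integrable_sum) (rule I_indicator_const(2))
qed

lemma nodal_test_approx:
  assumes \<alpha>: "\<And>a. bd a \<Longrightarrow> \<alpha> a = 0" and \<epsilon>: "0 < \<epsilon>"
  obtains \<phi> where "test \<phi>" "\<And>x. \<bar>\<phi> x - nodal \<alpha> x\<bar> \<le> \<epsilon>"
    "(gnorm \<phi>)\<^sup>2 \<le> 49 * (\<Sum>T\<in>\<T>. vol T * (norm (piece_grad \<alpha> T))\<^sup>2) + \<epsilon>"
proof -
  define G where "G x = (\<Sum>T\<in>\<T>. indicator T x *\<^sub>R piece_grad \<alpha> T)" for x
  let ?L = "\<Sum>T\<in>\<T>. norm (piece_grad \<alpha> T)"
  have L: "0 \<le> ?L" by (simp add: sum_nonneg)
  have Gm: "G \<in> borel_measurable (lebesgue_on \<Omega>)"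
  proof -
    have "(\<lambda>x. indicator T x *\<^sub>R piece_grad \<alpha> T) \<in> borel_measurable borel" if "T \<in> \<T>" for T
      using borel_elem[OF that] by measurable
    then have "G \<in> borel_measurable borel" unfolding G_def[abs_def] by (intro borel_measurable_sum) auto
    then show ?thesis by (metis borel_measurable_if_lebesgue_on measurable_completion measurable_lborel2 measurable_restrict_space1)
  qed
  have aff: "AE x in lebesgue_on \<Omega>. \<exists>e>0. \<forall>y\<in>ball x e. nodal \<alpha> y = nodal \<alpha> x + G x \<bullet> (y - x)"
    using AE_elements
  proof eventually_elim
    case (elim x)
    then obtain T where T: "T \<in> \<T>" "x \<in> T" by blast
    have G: "G x = piece_grad \<alpha> T" unfolding G_def by (rule sum_indicator[OF T])
    obtain e where e: "e > 0" "ball x e \<subseteq> T"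
      using osimplex.open_T[OF simp_loc[OF T(1)]] T(2) open_contains_ball by blast
    have "nodal \<alpha> y = nodal \<alpha> x + G x \<bullet> (y - x)" if "y \<in> ball x e" for y
    proof -
      have "y \<in> closure T" "x \<in> closure T" using that e(2) T(2) closure_subset[of T] by auto
      then show ?thesis using nodal_eq[OF T(1)] affine_piece_eq[OF T(1), of \<alpha> y x] by (simp add: G)
    qed
    then show ?case using e(1) by blast
  qed
  have Gb: "norm (G x) \<le> ?L" for x
    unfolding G_def by (rule order_trans[OF norm_sum sum_mono]) (simp add: indicator_def)
  have "I (\<lambda>x. (norm (G x))\<^sup>2) = I (\<lambda>x. \<Sum>T\<in>\<T>. indicator T x * (norm (piece_grad \<alpha> T))\<^sup>2)"
  proof (rule LINT_cong[OF refl])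
    fix x
    show "(norm (G x))\<^sup>2 = (\<Sum>T\<in>\<T>. indicator T x * (norm (piece_grad \<alpha> T))\<^sup>2)"
    proof (cases "\<exists>T\<in>\<T>. x \<in> T")
      case True
      then obtain T where T: "T \<in> \<T>" "x \<in> T" by blast
      show ?thesis using sum_indicator[OF T, of "piece_grad \<alpha>"] sum_indicator[OF T, of "\<lambda>T. (norm (piece_grad \<alpha> T))\<^sup>2"]
        by (simp add: G_def)
    next
      case False
      then have "indicator T x = (0::real)" if "T \<in> \<T>" for T using that by (simp add: indicator_def)
      then show ?thesis by (simp add: G_def)
    qed
  qed
  also have "... = (\<Sum>T\<in>\<T>. vol T * (norm (piece_grad \<alpha> T))\<^sup>2)" by (rule I_piecewise)
  finally have IG: "I (\<lambda>x. (norm (G x))\<^sup>2) = (\<Sum>T\<in>\<T>. vol T * (norm (piece_grad \<alpha> T))\<^sup>2)" .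
  show ?thesis
  proof (rule lipschitz_test_approx[OF L nodal_lipschitz[OF \<alpha>] nodal_zero[OF \<alpha>] Gm aff Gb \<epsilon>])
    fix \<phi> assume \<phi>: "test \<phi>" "\<And>x. \<bar>\<phi> x - nodal \<alpha> x\<bar> \<le> \<epsilon>"
      "I (\<lambda>x. (norm (grad \<phi> x))\<^sup>2) \<le> 49 * I (\<lambda>x. (norm (G x))\<^sup>2) + \<epsilon>"
    show thesis by (rule that[OF \<phi>(1,2)]) (use \<phi>(3) in "simp add: gnorm_def L2_norm_power2 IG")
  qed
qed

text \<open>The gradients of the barycentric coordinates sum to zero, so any constant
  \<open>c\<close> may be subtracted from the vertex values. It will be the value of
  \<open>w\<close> on \<open>T\<close>.\<close>

lemma piece_grad_bound:
  assumes T: "T \<in> \<T>"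
  shows "vol T * (norm (piece_grad \<alpha> T))\<^sup>2 \<le> 2 ^ (DIM('a) - 1) * (real DIM('a) + 1) * (kap DIM('a) \<gamma>)\<^sup>2 *
    (diam_pow T * (\<Sum>a\<in>vert T. (c - \<alpha> a)\<^sup>2))"
proof -
  interpret S: osimplex T by (rule simp_loc[OF T])
  let ?h = "diameter T"
  have h: "0 < ?h" by (rule diam_pos[OF T])
  have "piece_grad \<alpha> T = (\<Sum>a\<in>vert T. (\<alpha> a - c) *\<^sub>R bgrad T a)"
    by (simp add: piece_grad_def scaleR_diff_left sum_subtractf scaleR_sum_right[symmetric] S.sum_bgrad)
  then have "norm (piece_grad \<alpha> T) \<le> (\<Sum>a\<in>vert T. \<bar>\<alpha> a - c\<bar> * norm (bgrad T a))" using norm_sum[of "\<lambda>a. (\<alpha> a - c) *\<^sub>R bgrad T a" "vert T"] by simp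
  then have "?h * norm (piece_grad \<alpha> T) \<le> ?h * (\<Sum>a\<in>vert T. \<bar>\<alpha> a - c\<bar> * norm (bgrad T a))" using h by (intro mult_left_mono) simp_all
  also have "... = (\<Sum>a\<in>vert T. \<bar>\<alpha> a - c\<bar> * (norm (bgrad T a) * ?h))" by (simp add: sum_distrib_left mult_ac)
  also have "... \<le> (\<Sum>a\<in>vert T. \<bar>\<alpha> a - c\<bar> * kap DIM('a) \<gamma>)" by (intro sum_mono mult_left_mono bgrad_bound T) simp_all
  also have "... = kap DIM('a) \<gamma> * (\<Sum>a\<in>vert T. \<bar>\<alpha> a - c\<bar>)" by (simp add: sum_distrib_left mult_ac)
  finally have "(?h * norm (piece_grad \<alpha> T))\<^sup>2 \<le> (kap DIM('a) \<gamma> * (\<Sum>a\<in>vert T. \<bar>\<alpha> a - c\<bar>))\<^sup>2" using h by (intro power_mono) simp_all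
  also have "... = (kap DIM('a) \<gamma>)\<^sup>2 * (\<Sum>a\<in>vert T. \<bar>\<alpha> a - c\<bar>)\<^sup>2" by (simp add: power_mult_distrib)
  also have "... \<le> (kap DIM('a) \<gamma>)\<^sup>2 * ((real DIM('a) + 1) * (\<Sum>a\<in>vert T. (c - \<alpha> a)\<^sup>2))"
    using sum_squared_le_sum_of_squares[of "\<lambda>a. \<bar>\<alpha> a - c\<bar>" "vert T"] S.finV S.vert_props(2)
    by (intro mult_left_mono) (simp_all add: power2_commute[of c] mult_ac add.commute)
  finally have b: "?h\<^sup>2 * (norm (piece_grad \<alpha> T))\<^sup>2 \<le> (kap DIM('a) \<gamma>)\<^sup>2 * ((real DIM('a) + 1) * (\<Sum>a\<in>vert T. (c - \<alpha> a)\<^sup>2))"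
    by (simp add: power_mult_distrib)
  have "vol T * (norm (piece_grad \<alpha> T))\<^sup>2 \<le> (2 ^ (DIM('a) - 1) * ?h ^ DIM('a)) * (norm (piece_grad \<alpha> T))\<^sup>2"
    by (rule mult_right_mono[OF vol_le[OF T]]) simp
  also have "... = (2 ^ (DIM('a) - 1) * ?h ^ (DIM('a) - 2)) * (?h\<^sup>2 * (norm (piece_grad \<alpha> T))\<^sup>2)" unfolding diam_pow_split by (simp add: mult_ac)
  also have "... \<le> (2 ^ (DIM('a) - 1) * ?h ^ (DIM('a) - 2)) * ((kap DIM('a) \<gamma>)\<^sup>2 * ((real DIM('a) + 1) * (\<Sum>a\<in>vert T. (c - \<alpha> a)\<^sup>2)))"
    using h by (intro mult_left_mono b) simp
  finally show ?thesis by (simp add: mult_ac)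
qed

text \<open>As the barycentric coordinates sum to 1, the deviation from \<open>c\<close> is an
  average of the deviations at the vertices.\<close>

lemma nodal_mean:
  assumes T: "T \<in> \<T>" and x: "x \<in> closure T"
  shows "(nodal \<alpha> x - c)\<^sup>2 \<le> (real DIM('a) + 1) * (\<Sum>a\<in>vert T. (c - \<alpha> a)\<^sup>2)"
proof -
  interpret S: osimplex T by (rule simp_loc[OF T])
  have "nodal \<alpha> x - c = (\<Sum>a\<in>vert T. \<alpha> a * bary T a x) - c * (\<Sum>a\<in>vert T. bary T a x)"
    using nodal_eq[OF T x, of \<alpha>] S.bary_props(1) by (simp add: affine_piece_def)
  also have "... = (\<Sum>a\<in>vert T. (\<alpha> a - c) * bary T a x)"
    by (simp add: sum_distrib_left sum_subtractf left_diff_distrib)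
  finally have "\<bar>nodal \<alpha> x - c\<bar> \<le> (\<Sum>a\<in>vert T. \<bar>(\<alpha> a - c) * bary T a x\<bar>)" by simp
  also have "... \<le> (\<Sum>a\<in>vert T. \<bar>\<alpha> a - c\<bar>)"
  proof (rule sum_mono)
    fix a assume a: "a \<in> vert T"
    have "0 \<le> bary T a x" "bary T a x \<le> 1" using x a S.mem_closure S.bary_le_1 by auto
    then show "\<bar>(\<alpha> a - c) * bary T a x\<bar> \<le> \<bar>\<alpha> a - c\<bar>" by (simp add: abs_mult mult_left_le)
  qed
  finally have "\<bar>nodal \<alpha> x - c\<bar>\<^sup>2 \<le> (\<Sum>a\<in>vert T. \<bar>\<alpha> a - c\<bar>)\<^sup>2" by (rule power_mono) simp
  also have "... \<le> (real DIM('a) + 1) * (\<Sum>a\<in>vert T. (c - \<alpha> a)\<^sup>2)"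
    using sum_squared_le_sum_of_squares[of "\<lambda>a. \<bar>\<alpha> a - c\<bar>" "vert T"] S.finV S.vert_props(2)
    by (simp add: power2_commute[of c] mult_ac add.commute)
  finally show ?thesis by simp
qed

end

section \<open>Bubbles and the lower bound\<close>

lemma norm_grad_fe:
  assumes "smooth f"
  shows "norm (grad (\<lambda>x. fe (f x)) x) \<le> 2 * norm (grad f x)"
proof -
  define D where "D = flat_exp ((1 - pderiv 1) * [:0,0,1:]) (f x)"
  have D: "D = (if f x > 0 then exp (- (1 / f x)) / (f x)\<^sup>2 else 0)"
    by (auto simp: D_def flat_exp_def power2_eq_square)
  have "\<bar>D\<bar> \<le> 2"
  proof (cases "f x > 0")
    case True
    define u where "u = 1 / f x"
    have u: "u > 0" using True by (simp add: u_def)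
    have "1 + u + u\<^sup>2 / 2 \<le> exp u" using exp_lower_Taylor_quadratic[of u] u by simp
    then have "u\<^sup>2 \<le> 2 * exp u" using u by (simp add: field_simps)
    moreover have "D = u\<^sup>2 / exp u" using True by (simp add: D u_def exp_minus field_simps)
    ultimately show ?thesis by (simp add: divide_le_eq)
  qed (simp add: D)
  have "((\<lambda>x. fe (f x)) has_derivative (\<lambda>h. D * (grad f x \<bullet> h))) (at x)"
    unfolding D_def
    using has_derivative_compose[OF smooth_has_derivative_grad[OF assms] DERIV_flat_exp[unfolded has_field_derivative_def]] .
  then have "grad (\<lambda>x. fe (f x)) x = D *\<^sub>R grad f x" by (intro grad_eqI) simp
  then show ?thesis using \<open>\<bar>D\<bar> \<le> 2\<close> by (simp add: mult_right_mono)
qed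

lemma norm_grad_prod:
  assumes "finite A" "\<And>i. i \<in> A \<Longrightarrow> smooth (f i)" "\<And>i. i \<in> A \<Longrightarrow> 0 \<le> f i x \<and> f i x \<le> 1"
  shows "norm (grad (\<lambda>x. \<Prod>i\<in>A. f i x) x) \<le> (\<Sum>i\<in>A. norm (grad (f i) x))"
  using assms
proof (induction A)
  case empty
  have "grad (\<lambda>x::'b. 1::real) x = 0" by (rule grad_eqI) simp
  then show ?case by simp
next
  case (insert i A)
  let ?P = "\<lambda>x. \<Prod>i\<in>A. f i x"
  have s: "smooth ?P" using insert.prems(1) by (intro smooth_prod) simp
  have P: "0 \<le> ?P x" "?P x \<le> 1" using insert.prems(2) by (auto intro!: prod_nonneg prod_le_1)
  have "grad (\<lambda>x. \<Prod>i\<in>insert i A. f i x) x = f i x *\<^sub>R grad ?P x + ?P x *\<^sub>R grad (f i) x"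
    using grad_mult[OF insert.prems(1)[of i] s, of x] insert.hyps by simp
  then have "norm (grad (\<lambda>x. \<Prod>i\<in>insert i A. f i x) x) \<le> \<bar>f i x\<bar> * norm (grad ?P x) + \<bar>?P x\<bar> * norm (grad (f i) x)"
    using norm_triangle_ineq[of "f i x *\<^sub>R grad ?P x" "?P x *\<^sub>R grad (f i) x"] by simp
  also have "... \<le> 1 * norm (grad ?P x) + 1 * norm (grad (f i) x)"
    using insert.prems(2)[of i] P by (intro add_mono mult_right_mono) simp_all
  also have "... \<le> (\<Sum>j\<in>insert i A. norm (grad (f j) x))" using insert by simp
  finally show ?case .
qed

text \<open>The threshold is a quarter of the coordinate \<open>1 / (n + 1)\<close> of the
  barycentre: positive, so that the support is a compact subset of the open element, and small
  enough to leave a bubble of definite mean.\<close>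

definition bubble :: "'a::euclidean_space set \<Rightarrow> 'a \<Rightarrow> real" where
  "bubble T x = (\<Prod>v\<in>vert T. fe (bary T v x - 1 / (4 * (real DIM('a) + 1))))"

text \<open>A lower bound for the mean of the bubble: on the half-size copy of the element around
  its barycentre, of relative volume \<open>1 / 2 ^ n\<close>, every argument of \<open>fe\<close>
  is at least \<open>1 / (4 * (n + 1))\<close>.\<close>

definition bubble_const :: "nat \<Rightarrow> real" where
  "bubble_const n = fe (1 / (4 * (real n + 1))) ^ Suc n / 2 ^ n"

lemma bubble_const_pos: "0 < bubble_const n"
  by (simp add: bubble_const_def fe_bounds(3))

lemma fe_mono: "s \<le> t \<Longrightarrow> fe s \<le> fe t"
  by (auto simp: flat_exp_def frac_le)

context osimplex
begin

lemma smooth_bary: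
  assumes "v \<in> V" shows "smooth (\<lambda>x. lam v x - c)"
proof -
  have "(\<lambda>x. lam v x - c) = (\<lambda>x. (lam v 0 - c) + x \<bullet> gl v)"
    by (subst bary_affine[OF assms]) (simp add: inner_commute algebra_simps)
  then show ?thesis using smooth_affine[of "lam v 0 - c" "gl v"] by (simp only:)
qed

lemma grad_bary:
  assumes "v \<in> V" shows "grad (\<lambda>x. lam v x - c) x = gl v"
proof (rule grad_eqI)
  have "((\<lambda>x. lam v 0 + gl v \<bullet> x - c) has_derivative (\<lambda>h. gl v \<bullet> h)) (at x)"
    by (auto intro!: derivative_eq_intros)
  moreover have "(\<lambda>x. lam v x - c) = (\<lambda>x. lam v 0 + gl v \<bullet> x - c)" by (subst bary_affine[OF assms]) simp
  ultimately show "((\<lambda>x. lam v x - c) has_derivative (\<bullet>) (gl v)) (at x)" by simp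
qed

lemma smooth_bubble: "smooth (bubble T)"
  unfolding bubble_def[abs_def] by (intro smooth_prod smooth_flat_exp smooth_bary)

lemma bubble_bounds: "0 \<le> bubble T x" "bubble T x \<le> 1"
  unfolding bubble_def by (auto intro!: prod_nonneg prod_le_1 fe_bounds(1,2))

lemma norm_grad_bubble: "norm (grad (bubble T) x) \<le> 2 * (\<Sum>v\<in>V. norm (gl v))"
proof -
  let ?c = "1 / (4 * (real DIM('a) + 1))"
  have "norm (grad (bubble T) x) \<le> (\<Sum>v\<in>V. norm (grad (\<lambda>x. fe (lam v x - ?c)) x))"
    unfolding bubble_def[abs_def] by (intro norm_grad_prod finV smooth_flat_exp smooth_bary conjI fe_bounds(1,2))
  also have "... \<le> (\<Sum>v\<in>V. 2 * norm (gl v))"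
    by (rule sum_mono) (use norm_grad_fe[OF smooth_bary] grad_bary in metis)
  finally show ?thesis by (simp add: sum_distrib_left)
qed

lemma bubble_support: "closure {x. bubble T x \<noteq> 0} \<subseteq> T" "compact (closure {x. bubble T x \<noteq> 0})"
proof -
  let ?c = "1 / (4 * (real DIM('a) + 1))"
  let ?K = "\<Inter>v\<in>V. {x. ?c \<le> lam v x}"
  have "closed ?K" by (intro closed_INT ballI closed_Collect_le continuous_intros continuous_bary)
  moreover have "{x. bubble T x \<noteq> 0} \<subseteq> ?K"
  proof
    fix x assume "x \<in> {x. bubble T x \<noteq> 0}"
    then have "0 < lam v x - ?c" if "v \<in> V" for v
      using that finV fe_bounds(4)[of "lam v x - ?c"] by (auto simp: bubble_def)
    then show "x \<in> ?K" by force
  qed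
  ultimately have s: "closure {x. bubble T x \<noteq> 0} \<subseteq> ?K" by (simp add: closure_minimal)
  moreover have "?K \<subseteq> T"
  proof
    fix x assume x: "x \<in> ?K"
    have "0 < ?c" by simp
    then have "0 < lam v x" if "v \<in> V" for v using x that by (meson INT_D less_le_trans mem_Collect_eq)
    then show "x \<in> T" by (simp add: mem_T)
  qed
  ultimately show 1: "closure {x. bubble T x \<noteq> 0} \<subseteq> T" by (rule order_trans)
  show "compact (closure {x. bubble T x \<noteq> 0})"
    using bounded_subset[OF bounded_T 1] by (simp add: compact_eq_bounded_closed)
qed

lemma bubble_outside: "x \<notin> T \<Longrightarrow> bubble T x = 0" "x \<notin> T \<Longrightarrow> grad (bubble T) x = 0"
proof -
  assume x: "x \<notin> T"
  then have x': "x \<notin> closure {x. bubble T x \<noteq> 0}" using bubble_support(1) by blast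
  then show "grad (bubble T) x = 0" by (rule grad_eq_0_outside)
  show "bubble T x = 0" using x' closure_subset[of "{x. bubble T x \<noteq> 0}"] by blast
qed

lemma bubble_integral: "bubble_const DIM('a) * vol \<le> IT (bubble T)"
proof -
  let ?n = "real DIM('a) + 1"
  define m where "m = (1 / ?n) *\<^sub>R (\<Sum>v\<in>V. v)"
  \<comment> \<open>Averaging with the barycentre gives every coordinate at least half of
    \<open>1 / (n + 1)\<close>.\<close>
  define S where "S = (\<lambda>x. (1 / 2) *\<^sub>R x + (1 / 2) *\<^sub>R m) ` T"
  have lm: "lam v m = 1 / ?n" if "v \<in> V" for v
  proof -
    have 1: "sum (\<lambda>_. 1 / ?n) V = 1" using vert_props(2) by simp
    have 2: "(\<Sum>v\<in>V. (1 / ?n) *\<^sub>R v) = m" by (simp add: m_def scaleR_sum_right)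
    show ?thesis by (rule bary_unique[OF 1 2 that])
  qed
  have lS: "1 / (2 * ?n) \<le> lam v y" if y: "y \<in> S" and v: "v \<in> V" for v y
  proof -
    obtain x where x: "x \<in> T" "y = (1 / 2) *\<^sub>R x + (1 / 2) *\<^sub>R m" using y by (auto simp: S_def)
    have "lam v y = 1 / 2 * lam v x + 1 / 2 * lam v m"
      using bary_lin[OF v, of "1 / 2" "1 / 2" 0 x m 0] x(2) by simp
    moreover have "0 < lam v x" using x(1) v by (simp add: mem_T)
    ultimately have "1 / 2 * lam v m \<le> lam v y" by linarith
    then show ?thesis unfolding lm[OF v] by (simp add: field_simps)
  qed
  have ST: "S \<subseteq> T"
  proof
    fix y assume y: "y \<in> S"
    have "0 < 1 / (2 * ?n)" by simp
    then have "0 < lam v y" if "v \<in> V" for v using lS[OF y that] by linarith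
    then show "y \<in> T" by (simp add: mem_T)
  qed
  have "open S"
    using open_affinity[OF open_T, of "1 / 2" "(1 / 2) *\<^sub>R m"] by (simp add: S_def add.commute)
  then have Sb: "S \<in> sets borel" by simp
  have Sl: "S \<in> lmeasurable" by (rule bounded_borel_lmeasurable[OF bounded_subset[OF bounded_T ST] Sb])
  have vS: "measure lebesgue S = vol / 2 ^ DIM('a)"
    using measure_lebesgue_affine[of "1 / 2" "(1 / 2) *\<^sub>R m" T] by (simp add: S_def power_one_over)
  define \<beta> where "\<beta> = fe (1 / (4 * ?n)) ^ Suc DIM('a)"
  have le: "\<beta> * indicator S x \<le> bubble T x" for x
  proof (cases "x \<in> S")
    case True
    have "\<beta> = (\<Prod>v\<in>V. fe (1 / (4 * ?n)))" using vert_props(2) by (simp add: \<beta>_def)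
    also have "... \<le> bubble T x"
      unfolding bubble_def
    proof (rule prod_mono, intro conjI fe_bounds(1) fe_mono)
      fix v assume v: "v \<in> V"
      define c where "c = 1 / (4 * ?n)"
      have "1 / (2 * ?n) = 2 * c" by (simp add: c_def field_simps)
      then have "c \<le> lam v x - c" using lS[OF True v] by linarith
      then show "1 / (4 * ?n) \<le> lam v x - 1 / (4 * ?n)" by (simp only: c_def)
    qed
    finally show ?thesis using True by simp
  qed (simp add: bubble_bounds)
  have "\<beta> * measure lebesgue S = IT (\<lambda>x. \<beta> * indicator S x)"
  proof -
    have "IT (\<lambda>x. indicator S x) = (LINT x|lborel. indicator T x * indicator S x)" by (rule IT_lborel) (use Sb in measurable)
    also have "(\<lambda>x. indicator T x * indicator S x :: real) = indicator S" using ST by (auto simp: indicator_def fun_eq_iff)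
    also have "(LINT x|lborel. indicator S x) = measure lborel S" using Sb by simp
    also have "... = measure lebesgue S" using Sb by simp
    finally show ?thesis by simp
  qed
  also have "... \<le> IT (bubble T)"
  proof (rule integral_mono)
    have "(indicator S :: 'a \<Rightarrow> real) \<in> borel_measurable (lebesgue_on T)"
      by (rule measurable_restrict_space1[OF borel_measurable_indicator[OF fmeasurableD[OF Sl]]])
    then have "integrable (lebesgue_on T) (indicator S :: 'a \<Rightarrow> real)"
      by (rule integrable_bounded_on[OF T_lmeasurable, where B=1]) (simp add: indicator_def)
    then show "integrable (lebesgue_on T) (\<lambda>x. \<beta> * indicator S x)" by (rule integrable_mult_right)
    show "integrable (lebesgue_on T) (bubble T)" by (rule IT_integrable[OF smooth_continuous[OF smooth_bubble]])
  qed (rule le)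
  finally show ?thesis by (simp add: vS \<beta>_def bubble_const_def)
qed

end

text \<open>The squared gradient bound \<open>2 * (n + 1) * kap / h\<close> of a bubble, times the
  volume bound, divided by the square of the mean; the leading 2 comes from adding the bubbles to a
  function.\<close>

definition bubble_grad_const :: "nat \<Rightarrow> real \<Rightarrow> real" where
  "bubble_grad_const n g = 2 * (2 ^ (n - 1) * (2 * (real n + 1) * kap n g)\<^sup>2) / (bubble_const n)\<^sup>2"

text \<open>The number 98 is \<open>2 * 49\<close>, with 49 from the truncation. The two summands
  are the energy of the nodal function and that of the bubbles; the last factor bounds the
  deviations from the vertex values by the jumps.\<close>

definition lower_const :: "nat \<Rightarrow> real \<Rightarrow> real" where
  "lower_const n g = (98 * (2 ^ (n - 1) * (real n + 1) * (kap n g)\<^sup>2) + 2 * (bubble_grad_const n g * (real n + 1)))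
    * (jump_const n g * ((real n + 1) * (2 ^ n * g)))"

context mesh
begin

abbreviation IT :: "'a set \<Rightarrow> ('a \<Rightarrow> real) \<Rightarrow> real" where "IT T f \<equiv> integral\<^sup>L (lebesgue_on T) f"

section \<open>Test functions with prescribed means\<close>

lemma test_bubble: "T \<in> \<T> \<Longrightarrow> test (bubble T)"
  unfolding test_function_smooth
  using osimplex.smooth_bubble[OF simp_loc] osimplex.bubble_support(2)[OF simp_loc]
    subset_trans[OF osimplex.bubble_support(1)[OF simp_loc] elem_subset] by blast

lemma bubble_mean:
  assumes T: "T \<in> \<T>"
  shows "0 < IT T (bubble T)" and "bubble_const DIM('a) * vol T \<le> IT T (bubble T)"
    and "T' \<in> \<T> \<Longrightarrow> T' \<noteq> T \<Longrightarrow> IT T (bubble T') = 0"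
proof -
  interpret S: osimplex T by (rule simp_loc[OF T])
  show b: "bubble_const DIM('a) * vol T \<le> IT T (bubble T)" by (rule S.bubble_integral)
  have "0 < bubble_const DIM('a) * vol T" using bubble_const_pos vol_pos[OF T] by simp
  then show "0 < IT T (bubble T)" using b by linarith
  assume T': "T' \<in> \<T>" "T' \<noteq> T"
  have z: "bubble T' x = 0" if "x \<in> T" for x
    by (rule osimplex.bubble_outside(1)[OF simp_loc[OF T'(1)]]) (use disj[OF T T'(1) that] T'(2) in auto)
  have "IT T (bubble T') = IT T (\<lambda>_. 0)" by (rule LINT_cong) (simp_all add: z)
  then show "IT T (bubble T') = 0" by simp
qed

lemma integrable_elem: "T \<in> \<T> \<Longrightarrow> smooth f \<Longrightarrow> integrable (lebesgue_on T) f"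
  by (rule osimplex.IT_integrable[OF simp_loc smooth_continuous])

text \<open>Adding multiples of the bubbles to a test function prescribes its means on the elements.\<close>

lemma mean_correction:
  fixes w m :: "'a set \<Rightarrow> real"
  assumes \<phi>: "test \<phi>" and close: "\<And>T x. T \<in> \<T> \<Longrightarrow> x \<in> T \<Longrightarrow> (w T - \<phi> x)\<^sup>2 \<le> m T"
  obtains \<psi> where "test \<psi>" "\<And>T. T \<in> \<T> \<Longrightarrow> IT T \<psi> = vol T * w T"
    "(gnorm \<psi>)\<^sup>2 \<le> 2 * (gnorm \<phi>)\<^sup>2 + bubble_grad_const DIM('a) \<gamma> * (\<Sum>T\<in>\<T>. diam_pow T * m T)"
proof -
  let ?n = "real DIM('a) + 1" and ?k = "kap DIM('a) \<gamma>" and ?b = "bubble_const DIM('a)"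
  \<comment> \<open>The coefficient for which the bubble supplies exactly the missing integral over
    its element; bubbles of other elements do not interfere.\<close>
  define \<mu> where "\<mu> T = (vol T * w T - IT T \<phi>) / IT T (bubble T)" for T
  define g where "g x = (\<Sum>T\<in>\<T>. \<mu> T * bubble T x)" for x
  have s\<phi>: "smooth \<phi>" by (rule test_smooth[OF \<phi>])
  have sb: "smooth (bubble T)" if "T \<in> \<T>" for T by (rule test_smooth[OF test_bubble[OF that]])
  have sg: "smooth g" unfolding g_def[abs_def] by (intro smooth_sum smooth_cmult sb)
  have tg: "test g"
  proof (rule test_functionI[where K="\<Union>T\<in>\<T>. closure {x. bubble T x \<noteq> 0}"])
    show "compact (\<Union>T\<in>\<T>. closure {x. bubble T x \<noteq> 0})"
      using fin osimplex.bubble_support(2)[OF simp_loc] by (intro compact_UN) auto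
    show "(\<Union>T\<in>\<T>. closure {x. bubble T x \<noteq> 0}) \<subseteq> \<Omega>"
      using osimplex.bubble_support(1)[OF simp_loc] elem_subset by blast
    fix x assume "g x \<noteq> 0"
    then obtain T where T: "T \<in> \<T>" "\<mu> T * bubble T x \<noteq> 0" unfolding g_def by (rule sum.not_neutral_contains_not_neutral)
    then show "x \<in> (\<Union>T\<in>\<T>. closure {x. bubble T x \<noteq> 0})"
      using closure_subset[of "{x. bubble T x \<noteq> 0}"] by auto
  qed (rule sg)
  have mu: "(\<mu> T)\<^sup>2 \<le> m T / ?b\<^sup>2" if T: "T \<in> \<T>" for T
  proof -
    interpret fm: finite_measure "lebesgue_on T" by (rule finite_measure_lebesgue_on[OF elem_lmeasurable[OF T]])
    have m0: "0 \<le> m T" using close[OF T] osimplex.vert_props(7)[OF simp_loc[OF T]] by (metis ex_in_conv order_trans zero_le_power2)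
    have c: "IT T (\<lambda>_. c) = vol T * c" for c
      using elem_lmeasurable[OF T] by (simp add: measure_restrict_space)
    have "IT T (\<lambda>x. w T - \<phi> x) = IT T (\<lambda>_. w T) - IT T \<phi>"
      by (rule LINT_diff[OF _ integrable_elem[OF T s\<phi>]]) simp
    then have "vol T * w T - IT T \<phi> = IT T (\<lambda>x. w T - \<phi> x)" unfolding c by (rule sym)
    then have "\<bar>vol T * w T - IT T \<phi>\<bar> \<le> IT T (\<lambda>x. \<bar>w T - \<phi> x\<bar>)"
      using integral_norm_bound[of "lebesgue_on T" "\<lambda>x. w T - \<phi> x"] by simp
    also have "... \<le> IT T (\<lambda>_. sqrt (m T))"
    proof (rule integral_mono)
      show "integrable (lebesgue_on T) (\<lambda>x. \<bar>w T - \<phi> x\<bar>)"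
        by (intro integrable_abs Bochner_Integration.integrable_diff integrable_elem[OF T s\<phi>]) simp
      show "\<bar>w T - \<phi> x\<bar> \<le> sqrt (m T)" if "x \<in> space (lebesgue_on T)" for x
        by (rule power2_le_imp_abs_le[OF close[OF T]]) (use that in simp)
    qed simp
    also have "... = vol T * sqrt (m T)" by (rule c)
    finally have a: "\<bar>vol T * w T - IT T \<phi>\<bar> \<le> vol T * sqrt (m T)" .
    have bp: "0 < ?b * vol T" using bubble_const_pos vol_pos[OF T] by simp
    have "\<bar>\<mu> T\<bar> \<le> (vol T * sqrt (m T)) / (?b * vol T)"
      unfolding \<mu>_def abs_divide using a bubble_mean(1,2)[OF T] bp by (intro frac_le) simp_all
    also have "... = sqrt (m T) / ?b" using vol_pos[OF T] by simp
    finally have "\<bar>\<mu> T\<bar>\<^sup>2 \<le> (sqrt (m T) / ?b)\<^sup>2" by (rule power_mono) simp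
    then show ?thesis using m0 by (simp add: power_divide)
  qed
  have gg: "grad g x = (\<Sum>T\<in>\<T>. \<mu> T *\<^sub>R grad (bubble T) x)" for x
    unfolding g_def[abs_def] using grad_sum[OF smooth_cmult[OF sb], of \<T> "\<lambda>T. T" \<mu> x] grad_cmult[OF sb] by simp
  \<comment> \<open>A pointwise bound for the squared gradient of \<open>g\<close> on
    \<open>T\<close>; the supports are disjoint, so a single bubble is active there.\<close>
  define q where "q T = (\<mu> T)\<^sup>2 * (2 * ?n * ?k / diameter T)\<^sup>2" for T
  have gx: "(norm (grad g x))\<^sup>2 \<le> (\<Sum>T\<in>\<T>. indicator T x * q T)" for x
  proof (cases "\<exists>T\<in>\<T>. x \<in> T")
    case True
    then obtain T where T: "T \<in> \<T>" "x \<in> T" by blast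
    interpret S: osimplex T by (rule simp_loc[OF T(1)])
    have z: "\<mu> T' *\<^sub>R grad (bubble T') x = (if T' = T then \<mu> T *\<^sub>R grad (bubble T) x else 0)" if "T' \<in> \<T>" for T'
    proof (cases "T' = T")
      case False
      then have "x \<notin> T'" using disj[OF T(1) that T(2)] by blast
      then show ?thesis using osimplex.bubble_outside(2)[OF simp_loc[OF that]] False by simp
    qed simp
    have "grad g x = (\<Sum>T'\<in>\<T>. if T' = T then \<mu> T *\<^sub>R grad (bubble T) x else 0)"
      unfolding gg by (rule sum.cong[OF refl z])
    also have "... = \<mu> T *\<^sub>R grad (bubble T) x" using T fin by (simp add: sum.delta)
    finally have e: "norm (grad g x) = \<bar>\<mu> T\<bar> * norm (grad (bubble T) x)" by simp
    have "norm (grad (bubble T) x) \<le> 2 * (\<Sum>v\<in>vert T. norm (bgrad T v))" by (rule S.norm_grad_bubble)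
    also have "... \<le> 2 * (\<Sum>v\<in>vert T. ?k / diameter T)"
      using bgrad_bound[OF T(1)] diam_pos[OF T(1)] by (intro mult_left_mono sum_mono) (simp_all add: pos_le_divide_eq)
    also have "... = 2 * ?n * ?k / diameter T" using S.vert_props(2) by simp
    finally have "norm (grad g x) \<le> \<bar>\<mu> T\<bar> * (2 * ?n * ?k / diameter T)" unfolding e by (rule mult_left_mono) simp
    then have "(norm (grad g x))\<^sup>2 \<le> (\<bar>\<mu> T\<bar> * (2 * ?n * ?k / diameter T))\<^sup>2" by (rule power_mono) simp
    also have "... = q T" by (simp only: q_def power_mult_distrib power2_abs)
    also have "... = (\<Sum>T\<in>\<T>. indicator T x * q T)" using sum_indicator[OF T, of q] by simp
    finally show ?thesis .
  next
    case False
    then have "grad g x = 0" unfolding gg using osimplex.bubble_outside(2)[OF simp_loc] by (intro sum.neutral) auto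
    then show ?thesis by (simp add: q_def sum_nonneg)
  qed
  have "(gnorm g)\<^sup>2 \<le> I (\<lambda>x. \<Sum>T\<in>\<T>. indicator T x * q T)"
    unfolding gnorm_def L2_norm_power2 by (rule integral_mono[OF L2_integrable[OF L2_grad[OF sg]] I_piecewise(2) gx])
  also have "... = (\<Sum>T\<in>\<T>. vol T * q T)" by (rule I_piecewise(1))
  also have "... \<le> (\<Sum>T\<in>\<T>. (bubble_grad_const DIM('a) \<gamma> / 2) * (diam_pow T * m T))"
  proof (rule sum_mono)
    fix T assume T: "T \<in> \<T>"
    let ?h = "diameter T"
    have h: "0 < ?h" by (rule diam_pos[OF T])
    have "vol T * q T \<le> (2 ^ (DIM('a) - 1) * ?h ^ DIM('a)) * ((m T / ?b\<^sup>2) * (2 * ?n * ?k / ?h)\<^sup>2)"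
      unfolding q_def using h by (intro mult_mono[OF vol_le[OF T]] mult_right_mono[OF mu[OF T]]) simp_all
    also have "... = (bubble_grad_const DIM('a) \<gamma> / 2) * (?h ^ (DIM('a) - 2) * m T)"
      unfolding diam_pow_split bubble_grad_const_def using h by (simp add: power_divide)
    finally show "vol T * q T \<le> (bubble_grad_const DIM('a) \<gamma> / 2) * (?h ^ (DIM('a) - 2) * m T)" .
  qed
  also have "... = bubble_grad_const DIM('a) \<gamma> / 2 * (\<Sum>T\<in>\<T>. diam_pow T * m T)"
    by (rule sum_distrib_left[symmetric])
  finally have ng: "2 * (gnorm g)\<^sup>2 \<le> bubble_grad_const DIM('a) \<gamma> * (\<Sum>T\<in>\<T>. diam_pow T * m T)"
    by simp
  define \<psi> where "\<psi> x = \<phi> x + g x" for x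
  show ?thesis
  proof (rule that[of \<psi>])
    show "test \<psi>" using test_function_lin[OF \<phi> tg, of 1 1] by (simp add: \<psi>_def[abs_def])
    show "IT T \<psi> = vol T * w T" if T: "T \<in> \<T>" for T
    proof -
      have ib: "integrable (lebesgue_on T) (bubble T')" if "T' \<in> \<T>" for T' by (rule integrable_elem[OF T sb[OF that]])
      have "IT T g = (\<Sum>T'\<in>\<T>. IT T (\<lambda>x. \<mu> T' * bubble T' x))"
        unfolding g_def[abs_def] by (rule LINT_sum) (intro integrable_mult_right ib)
      also have "... = (\<Sum>T'\<in>\<T>. if T' = T then \<mu> T * IT T (bubble T) else 0)"
        by (rule sum.cong[OF refl]) (use bubble_mean(3)[OF T] in auto)
      also have "... = \<mu> T * IT T (bubble T)" using T fin by (simp add: sum.delta)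
      also have "... = vol T * w T - IT T \<phi>" using bubble_mean(1)[OF T] by (simp add: \<mu>_def)
      finally have "IT T g = vol T * w T - IT T \<phi>" .
      then show ?thesis
        unfolding \<psi>_def[abs_def] using LINT_add[OF integrable_elem[OF T s\<phi>] integrable_elem[OF T sg]] by simp
    qed
    have "grad \<psi> = (\<lambda>x. grad \<phi> x + grad g x)" unfolding \<psi>_def[abs_def] using grad_add[OF s\<phi> sg] by (simp add: fun_eq_iff)
    then have "gnorm \<psi> \<le> gnorm \<phi> + gnorm g" using L2_norm_triangle[OF L2_grad[OF s\<phi>] L2_grad[OF sg]] by (simp add: gnorm_def)
    then have "(gnorm \<psi>)\<^sup>2 \<le> (gnorm \<phi> + gnorm g)\<^sup>2" by (intro power_mono gnorm_ge_0)
    also have "... \<le> 2 * (gnorm \<phi>)\<^sup>2 + 2 * (gnorm g)\<^sup>2" by (rule square_add_le)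
    finally show "(gnorm \<psi>)\<^sup>2 \<le> 2 * (gnorm \<phi>)\<^sup>2 + bubble_grad_const DIM('a) \<gamma> * (\<Sum>T\<in>\<T>. diam_pow T * m T)"
      using ng by linarith
  qed
qed

lemma bubble_grad_const_nonneg: "0 \<le> bubble_grad_const n g"
  by (simp add: bubble_grad_const_def)

text \<open>The slack \<eta> pays for replacing the nodal function, which is not smooth, by a test
  function. Both its energy and its distance from \<open>w\<close> are bounded by the same sums of
  squared deviations at the vertices.\<close>

lemma prescribed_means:
  fixes w :: "'a set \<Rightarrow> real"
  assumes \<eta>: "0 < \<eta>"
  obtains \<psi> where "test \<psi>" "\<And>T. T \<in> \<T> \<Longrightarrow> IT T \<psi> = vol T * w T"
    "(gnorm \<psi>)\<^sup>2 \<le> lower_const DIM('a) \<gamma> * jumps w + \<eta>"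
proof -
  let ?n = "real DIM('a) + 1" and ?B = "bubble_grad_const DIM('a) \<gamma>"
  define \<alpha> where "\<alpha> = vertex_value w"
  define H where "H = (\<Sum>T\<in>\<T>. diam_pow T)"
  have H: "0 \<le> H" unfolding H_def using diam_pos by (intro sum_nonneg) (simp add: less_imp_le)
  define d where "d T = (\<Sum>a\<in>vert T. (w T - \<alpha> a)\<^sup>2)" for T
  have sumd: "(\<Sum>T\<in>\<T>. diam_pow T * d T) \<le> jump_const DIM('a) \<gamma> * (?n * (2 ^ DIM('a) * \<gamma>)) * jumps w"
  proof -
    have "(\<Sum>T\<in>\<T>. diam_pow T * d T)
        = (\<Sum>T\<in>\<T>. \<Sum>a\<in>vert T. diam_pow T * (w T - \<alpha> a)\<^sup>2)" by (simp add: d_def sum_distrib_left)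
    also have "... \<le> (\<Sum>T\<in>\<T>. \<Sum>a\<in>vert T. jump_const DIM('a) \<gamma> * vertex_jumps w a)"
      unfolding \<alpha>_def by (intro sum_mono vertex_value_jumps) (simp add: patch_def)
    also have "... = jump_const DIM('a) \<gamma> * (\<Sum>T\<in>\<T>. \<Sum>a\<in>vert T. vertex_jumps w a)" by (simp add: sum_distrib_left)
    also have "... \<le> jump_const DIM('a) \<gamma> * (?n * (2 ^ DIM('a) * \<gamma>) * jumps w)"
      using step_const_ge(1) by (intro mult_left_mono sum_vertex_jumps) (simp add: jump_const_def)
    finally show ?thesis by (simp only: mult.assoc)
  qed
  \<comment> \<open>The remainder is
    \<open>2 * \<epsilon> + 2 * ?B * H * \<epsilon>\<^sup>2\<close>. With
    \<open>\<epsilon> \<le> 1\<close> the square is absorbed, and the quotient makes the total at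
    most \<eta>.\<close>
  define \<epsilon> where "\<epsilon> = min 1 (\<eta> / (2 + 2 * ?B * H))"
  have den: "0 < 2 + 2 * ?B * H" using bubble_grad_const_nonneg H by (intro add_pos_nonneg mult_nonneg_nonneg) simp_all
  have \<epsilon>: "0 < \<epsilon>" "\<epsilon> \<le> 1" "\<epsilon> * (2 + 2 * ?B * H) \<le> \<eta>"
    using \<eta> den by (simp_all add: \<epsilon>_def pos_le_divide_eq[symmetric])
  have bd0: "\<alpha> a = 0" if "bd a" for a using that by (simp add: \<alpha>_def vertex_value_def)
  obtain \<phi> where \<phi>: "test \<phi>" "\<And>x. \<bar>\<phi> x - nodal \<alpha> x\<bar> \<le> \<epsilon>"
    "(gnorm \<phi>)\<^sup>2 \<le> 49 * (\<Sum>T\<in>\<T>. vol T * (norm (piece_grad \<alpha> T))\<^sup>2) + \<epsilon>"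
    using nodal_test_approx[of \<alpha> \<epsilon>, OF bd0 \<epsilon>(1)] by blast
  let ?P = "2 ^ (DIM('a) - 1) * ?n * (kap DIM('a) \<gamma>)\<^sup>2"
  have "(\<Sum>T\<in>\<T>. vol T * (norm (piece_grad \<alpha> T))\<^sup>2) \<le> (\<Sum>T\<in>\<T>. ?P * (diam_pow T * d T))"
    unfolding d_def by (rule sum_mono[OF piece_grad_bound])
  also have "... = ?P * (\<Sum>T\<in>\<T>. diam_pow T * d T)" by (simp only: sum_distrib_left)
  finally have g1: "2 * (gnorm \<phi>)\<^sup>2 \<le> 98 * ?P * (\<Sum>T\<in>\<T>. diam_pow T * d T) + 2 * \<epsilon>" using \<phi>(3) by linarith
  \<comment> \<open>The distance from \<open>w\<close> is split at the nodal function: the first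
    part is bounded by the deviations \<open>d T\<close>, the second by \<epsilon>.\<close>
  define m where "m T = 2 * (?n * d T) + 2 * \<epsilon>\<^sup>2" for T
  have cl: "(w T - \<phi> x)\<^sup>2 \<le> m T" if T: "T \<in> \<T>" and x: "x \<in> T" for T x
  proof -
    have xc: "x \<in> closure T" using x closure_subset by blast
    have "(w T - \<phi> x)\<^sup>2 = ((w T - nodal \<alpha> x) + (nodal \<alpha> x - \<phi> x))\<^sup>2" by simp
    also have "... \<le> 2 * (w T - nodal \<alpha> x)\<^sup>2 + 2 * (nodal \<alpha> x - \<phi> x)\<^sup>2" by (rule square_add_le)
    also have "... \<le> m T"
    proof -
      have "(nodal \<alpha> x - \<phi> x)\<^sup>2 \<le> \<epsilon>\<^sup>2" using \<phi>(2)[of x] power2_abs[of "\<phi> x - nodal \<alpha> x"]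
        by (metis abs_ge_zero power2_commute power_mono)
      then show ?thesis using nodal_mean[OF T xc, of \<alpha> "w T"] by (simp add: m_def d_def power2_commute[of "w T" "nodal \<alpha> x"])
    qed
    finally show ?thesis .
  qed
  obtain \<psi> where \<psi>: "test \<psi>" "\<And>T. T \<in> \<T> \<Longrightarrow> IT T \<psi> = vol T * w T"
    "(gnorm \<psi>)\<^sup>2 \<le> 2 * (gnorm \<phi>)\<^sup>2 + ?B * (\<Sum>T\<in>\<T>. diam_pow T * m T)"
    using mean_correction[of \<phi> w m, OF \<phi>(1) cl] by blast
  have "(\<Sum>T\<in>\<T>. diam_pow T * m T) = 2 * ?n * (\<Sum>T\<in>\<T>. diam_pow T * d T) + 2 * \<epsilon>\<^sup>2 * H"
    unfolding m_def H_def by (simp add: sum_distrib_left distrib_left sum.distrib mult_ac)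
  then have "(gnorm \<psi>)\<^sup>2 \<le> (98 * ?P + 2 * (?B * ?n)) * (\<Sum>T\<in>\<T>. diam_pow T * d T) + (2 * \<epsilon> + 2 * ?B * H * \<epsilon>\<^sup>2)"
    using \<psi>(3) g1 by (simp add: algebra_simps)
  also have "... \<le> (98 * ?P + 2 * (?B * ?n)) * (jump_const DIM('a) \<gamma> * (?n * (2 ^ DIM('a) * \<gamma>)) * jumps w) + \<eta>"
  proof (rule add_mono[OF mult_left_mono[OF sumd]])
    show "0 \<le> 98 * ?P + 2 * (?B * ?n)" using bubble_grad_const_nonneg by (intro add_nonneg_nonneg mult_nonneg_nonneg) simp_all
    have "\<epsilon>\<^sup>2 \<le> \<epsilon>" using \<epsilon> by (simp add: power2_eq_square mult_left_le)
    then have "2 * ?B * H * \<epsilon>\<^sup>2 \<le> 2 * ?B * H * \<epsilon>" using bubble_grad_const_nonneg H by (intro mult_left_mono mult_nonneg_nonneg) simp_all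
    then show "2 * \<epsilon> + 2 * ?B * H * \<epsilon>\<^sup>2 \<le> \<eta>" using \<epsilon>(3) by (simp add: algebra_simps)
  qed
  also have "... = lower_const DIM('a) \<gamma> * jumps w + \<eta>" by (simp only: lower_const_def mult.assoc)
  finally have b: "(gnorm \<psi>)\<^sup>2 \<le> lower_const DIM('a) \<gamma> * jumps w + \<eta>" .
  show ?thesis by (rule that[OF \<psi>(1) _ b]) (rule \<psi>(2))
qed

section \<open>The lower bound for the dual norm\<close>

lemma L2_indicator: "T \<in> \<T> \<Longrightarrow> L2 \<Omega> (indicator T :: 'a \<Rightarrow> real)"
  by (rule L2_bounded[where B=1, OF measurable_restrict_space1[OF borel_measurable_indicator[OF fmeasurableD[OF elem_lmeasurable]]]])
    (simp_all add: indicator_def)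

lemma L2_piecewise: "L2 \<Omega> (\<lambda>x. \<Sum>T\<in>\<T>. c T * indicator T x)" for c :: "'a set \<Rightarrow> real"
proof (rule L2_sum)
  fix T assume "T \<in> \<T>"
  then show "L2 \<Omega> (\<lambda>x. c T * indicator T x)" using L2_lin[OF L2_indicator L2_const[of "0::real"], of T "c T" 0] by simp
qed

lemma I_piecewise_mult:
  assumes "smooth \<psi>"
  shows "I (\<lambda>x. (\<Sum>T\<in>\<T>. c T * indicator T x) * \<psi> x) = (\<Sum>T\<in>\<T>. c T * IT T \<psi>)"
proof -
  have b: "\<psi> \<in> borel_measurable borel" by (rule borel_measurable_continuous_onI[OF smooth_continuous[OF assms]])
  have "I (\<lambda>x. (\<Sum>T\<in>\<T>. c T * indicator T x) * \<psi> x) = I (\<lambda>x. \<Sum>T\<in>\<T>. c T * (indicator T x * \<psi> x))"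
    by (simp only: sum_distrib_right mult.assoc)
  also have "... = (\<Sum>T\<in>\<T>. I (\<lambda>x. c T * (indicator T x * \<psi> x)))"
    by (rule LINT_sum) (intro integrable_mult_right, simp only: I_indicator(2)[OF _ b] integrable_elem[OF _ assms])
  also have "... = (\<Sum>T\<in>\<T>. c T * IT T \<psi>)" by (rule sum.cong[OF refl]) (simp only: integral_mult_right_zero I_indicator(1)[OF _ b])
  finally show ?thesis .
qed

lemma dual_lower_bound:
  "(\<Sum>T\<in>\<T>. x T * (vol T * w T))
    \<le> sqrt (lower_const DIM('a) \<gamma>) * Hm1_norm \<Omega> (L2_functional \<Omega> (\<lambda>y. \<Sum>T\<in>\<T>. x T * indicator T y)) * sqrt (jumps w)"
proof (rule field_le_epsilon)
  fix e :: real assume e: "0 < e"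
  define F where "F = L2_functional \<Omega> (\<lambda>y. \<Sum>T\<in>\<T>. x T * indicator T y)"
  define N where "N = Hm1_norm \<Omega> F"
  have dF: "dual_of F (\<lambda>y. \<Sum>T\<in>\<T>. x T * indicator T y)" unfolding F_def by (rule dual_of_L2_functional[OF L2_piecewise])
  have N: "0 \<le> N" unfolding N_def by (rule Hm1_norm_props(1)[OF dF])
  \<comment> \<open>The error \<delta> of the energy is multiplied by the dual norm
    \<open>N\<close>; the summand 1 covers the case that \<open>N\<close> is zero.\<close>
  define \<delta> where "\<delta> = e / (N + 1)"
  have \<delta>: "0 < \<delta>" using e N by (simp add: \<delta>_def)
  obtain \<psi> where \<psi>: "test \<psi>" "\<And>T. T \<in> \<T> \<Longrightarrow> IT T \<psi> = vol T * w T"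
    "(gnorm \<psi>)\<^sup>2 \<le> lower_const DIM('a) \<gamma> * jumps w + \<delta>\<^sup>2"
    using prescribed_means[of "\<delta>\<^sup>2" w] \<delta> by (auto simp: zero_less_power)
  have lc: "0 \<le> lower_const DIM('a) \<gamma>"
    unfolding lower_const_def jump_const_def using step_const_ge(1) bubble_grad_const_nonneg gamma_pos
    by (intro mult_nonneg_nonneg add_nonneg_nonneg) simp_all
  have "(\<Sum>T\<in>\<T>. x T * (vol T * w T)) = (\<Sum>T\<in>\<T>. x T * IT T \<psi>)" using \<psi>(2) by simp
  also have "... = F \<psi>" using I_piecewise_mult[OF test_smooth[OF \<psi>(1)], of x] by (simp add: F_def L2_functional_def)
  also have "... \<le> N * gnorm \<psi>" unfolding N_def by (rule Hm1_norm_test[OF dF \<psi>(1)])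
  also have "... \<le> N * (sqrt (lower_const DIM('a) \<gamma> * jumps w) + \<delta>)"
  proof (rule mult_left_mono[OF _ N])
    have "gnorm \<psi> \<le> sqrt (lower_const DIM('a) \<gamma> * jumps w + \<delta>\<^sup>2)" by (rule real_le_rsqrt[OF \<psi>(3)])
    also have "... \<le> sqrt (lower_const DIM('a) \<gamma> * jumps w) + sqrt (\<delta>\<^sup>2)"
      using lc jumps_nonneg[of w] by (intro sqrt_add_le_add_sqrt mult_nonneg_nonneg) simp_all
    finally show "gnorm \<psi> \<le> sqrt (lower_const DIM('a) \<gamma> * jumps w) + \<delta>" using \<delta> by simp
  qed
  also have "... = sqrt (lower_const DIM('a) \<gamma>) * N * sqrt (jumps w) + N * \<delta>" by (simp add: real_sqrt_mult algebra_simps)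
  also have "N * \<delta> \<le> e" using N e by (simp add: \<delta>_def field_simps)
  finally show "(\<Sum>T\<in>\<T>. x T * (vol T * w T)) \<le> sqrt (lower_const DIM('a) \<gamma>) *
      Hm1_norm \<Omega> (L2_functional \<Omega> (\<lambda>y. \<Sum>T\<in>\<T>. x T * indicator T y)) * sqrt (jumps w) + e"
    by (simp add: N_def F_def)
qed

end

section \<open>Raviart--Thomas functions\<close>

text \<open>A facet belongs to at most two elements, which gives the 2; an element has
  \<open>n + 1\<close> facets, which enters by the Cauchy-Schwarz inequality; the rest is the
  constant of \<open>area_power\<close>.\<close>

definition upper_const :: "nat \<Rightarrow> real \<Rightarrow> real" where
  "upper_const n g = 2 * ((real n + 1) * (2 ^ (n - 2) * g))"

lemma power_powr: "0 < b \<Longrightarrow> real k * a = real l \<Longrightarrow> (b ^ k) powr a = b ^ l" for a b :: real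
  by (simp add: powr_realpow[symmetric] powr_powr)

context mesh
begin

text \<open>The entries of the divergence matrix in explicit form; \<open>div_coeffs_eq\<close>
  identifies them with the chosen coefficients.\<close>

definition rt_coeff :: "'a set \<Rightarrow> 'a set \<Rightarrow> real" where
  "rt_coeff E T = (if T = Tp E then area E / vol T else if \<not> bdry E \<and> T = Tm E then - (area E / vol T) else 0)"

lemma Tp_facet: "E \<in> facets \<T> \<Longrightarrow> Tp E \<in> \<T> \<and> is_facet E (Tp E)"
  using facet_neighbours[of E] by blast

lemma Tm_facet: "E \<in> facets \<T> \<Longrightarrow> \<not> bdry E \<Longrightarrow> Tm E \<in> \<T> \<and> is_facet E (Tm E) \<and> Tp E \<noteq> Tm E"
  using facet_neighbours(2)[of E] by blast

lemma rt_coeff_sum: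
  assumes E: "E \<in> facets \<T>"
  shows "(\<Sum>T\<in>\<T>. rt_coeff E T * f T)
    = area E * (f (Tp E) / vol (Tp E) - (if bdry E then 0 else f (Tm E) / vol (Tm E)))"
proof -
  let ?c = "area E / vol (Tp E) * f (Tp E)"
  let ?d = "if bdry E then 0 else - (area E / vol (Tm E) * f (Tm E))"
  have "(\<Sum>T\<in>\<T>. rt_coeff E T * f T) = (\<Sum>T\<in>\<T>. (if T = Tp E then ?c else 0) + (if T = Tm E then ?d else 0))"
    by (rule sum.cong[OF refl]) (use Tm_facet[OF E] in "auto simp: rt_coeff_def")
  also have "... = (if Tp E \<in> \<T> then ?c else 0) + (if Tm E \<in> \<T> then ?d else 0)"
    unfolding sum.distrib by (simp only: sum.delta[OF fin])
  also have "... = ?c + ?d" using Tp_facet[OF E] Tm_facet[OF E] by auto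
  finally show ?thesis by (simp add: right_diff_distrib)
qed

lemma rt_coeff_nonzero: "E \<in> facets \<T> \<Longrightarrow> rt_coeff E T \<noteq> 0 \<Longrightarrow> is_facet E T"
  using Tp_facet Tm_facet by (auto simp: rt_coeff_def split: if_splits)

lemma rt_coeff_abs: "E \<in> facets \<T> \<Longrightarrow> T \<in> \<T> \<Longrightarrow> \<bar>rt_coeff E T\<bar> \<le> area E / vol T"
  using Tp_facet[of E] area_bounds(4)[of "Tp E" E] vol_pos[of T] by (auto simp: rt_coeff_def abs_divide)

text \<open>One formula for all elements. For an element without the facet the opposite vertex has
  no meaning, but its coefficient is zero.\<close>

lemma rt_function_sum:
  assumes E: "E \<in> facets \<T>"
  shows "rt_function Tp Tm E x
    = (\<Sum>T\<in>\<T>. indicator T x *\<^sub>R ((rt_coeff E T / real DIM('a)) *\<^sub>R (x - opposite_vertex T E)))"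
proof (cases "\<exists>T\<in>\<T>. x \<in> T")
  case True
  then obtain T where T: "T \<in> \<T>" "x \<in> T" by blast
  have p: "x \<in> Tp E \<longleftrightarrow> T = Tp E" using T disj[OF T(1)] Tp_facet[OF E] by blast
  have m: "x \<in> Tm E \<longleftrightarrow> \<not> bdry E \<and> T = Tm E"
  proof (cases "bdry E")
    case True
    then show ?thesis using facet_neighbours(1)[OF E] by blast
  next
    case False
    then show ?thesis using T disj[OF T(1)] Tm_facet[OF E] by blast
  qed
  have "rt_function Tp Tm E x = (rt_coeff E T / real DIM('a)) *\<^sub>R (x - opposite_vertex T E)"
    unfolding rt_function_def p m rt_coeff_def by (auto simp: mult.commute)
  then show ?thesis using sum_indicator[OF T, of "\<lambda>T. (rt_coeff E T / real DIM('a)) *\<^sub>R (x - opposite_vertex T E)"] by simp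
next
  case False
  then have "x \<notin> Tp E" "x \<notin> Tm E" using Tp_facet[OF E] Tm_facet[OF E] facet_neighbours(1)[OF E] by (blast, cases "bdry E", blast+)
  moreover have "indicator T x = (0::real)" if "T \<in> \<T>" for T using False that by (simp add: indicator_def)
  ultimately show ?thesis by (simp add: rt_function_def)
qed

lemma L2_indicator_mult:
  fixes f :: "'a \<Rightarrow> 'a"
  assumes T: "T \<in> \<T>" and f: "continuous_on UNIV f"
  shows "L2 \<Omega> (\<lambda>x. indicator T x *\<^sub>R f x)"
proof -
  obtain B where B: "B > 0" "\<And>x. x \<in> \<Omega> \<Longrightarrow> norm (f x) \<le> B" using continuous_bounded_on[OF f bounded_dom] by blast
  have "(indicator T :: 'a \<Rightarrow> real) \<in> borel_measurable (lebesgue_on \<Omega>)" by (rule L2_measurable[OF L2_indicator[OF T]])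
  then have "(\<lambda>x. indicator T x *\<^sub>R f x) \<in> borel_measurable (lebesgue_on \<Omega>)"
    by (rule borel_measurable_scaleR[OF _ continuous_measurable_lebesgue_on[OF f dom_lebesgue]])
  then show ?thesis by (rule L2_bounded[where B=B]) (use B in "auto simp: indicator_def")
qed

lemma L2_rt: "E \<in> facets \<T> \<Longrightarrow> L2 \<Omega> (rt_function Tp Tm E)"
proof -
  assume E: "E \<in> facets \<T>"
  have "L2 \<Omega> (\<lambda>x. \<Sum>T\<in>\<T>. indicator T x *\<^sub>R ((rt_coeff E T / real DIM('a)) *\<^sub>R (x - opposite_vertex T E)))"
    by (intro L2_sum L2_indicator_mult continuous_intros)
  moreover have "rt_function Tp Tm E = (\<lambda>x. \<Sum>T\<in>\<T>. indicator T x *\<^sub>R ((rt_coeff E T / real DIM('a)) *\<^sub>R (x - opposite_vertex T E)))"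
    by (rule ext) (rule rt_function_sum[OF E])
  ultimately show ?thesis by (simp only:)
qed

lemma opposite_vertex_props:
  assumes T: "T \<in> \<T>" and E: "is_facet E T"
  shows "opposite_vertex T E \<in> vert T" and "E = opp_facet T (opposite_vertex T E)"
proof -
  interpret S: osimplex T by (rule simp_loc[OF T])
  obtain p where p: "p \<in> vert T" "E = opp_facet T p" using E by (auto simp: S.is_facet_iff)
  have "opposite_vertex T E = p" unfolding p(2) by (rule S.opposite_vertex_eq[OF p(1)])
  then show "opposite_vertex T E \<in> vert T" "E = opp_facet T (opposite_vertex T E)" using p by simp_all
qed

text \<open>On an element the field is a multiple of \<open>x - p\<close> with divergence
  \<open>n\<close>, so the claim amounts to the cancellation of the weighted fluxes
  \<open>\<Phi> T\<close>. At a boundary facet the flux vanishes with the test function; at an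
  interior one \<open>flux_balance\<close> applies.\<close>

lemma rt_weak_div:
  assumes E: "E \<in> facets \<T>"
  shows "has_weak_div \<Omega> (rt_function Tp Tm E) (\<lambda>x. \<Sum>T\<in>\<T>. rt_coeff E T * indicator T x)"
  unfolding has_weak_div_def
proof (intro conjI allI impI L2_rt[OF E] L2_piecewise)
  fix \<phi> assume \<phi>: "test \<phi>"
  let ?n = "real DIM('a)"
  have s: "smooth \<phi>" by (rule test_smooth[OF \<phi>])
  define G where "G T x = (x - opposite_vertex T E) \<bullet> grad \<phi> x" for T x
  have cG: "continuous_on UNIV (G T)" for T unfolding G_def by (intro continuous_intros continuous_on_grad[OF s])
  have bG: "G T \<in> borel_measurable borel" for T by (rule borel_measurable_continuous_onI[OF cG])
  have iG: "integrable (lebesgue_on T) (G T)" if "T \<in> \<T>" for T by (rule osimplex.IT_integrable[OF simp_loc[OF that] cG])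
  define \<Phi> where "\<Phi> T = IT T (\<lambda>x. ?n * \<phi> x + grad \<phi> x \<bullet> (x - opposite_vertex T E))" for T
  have \<Phi>: "\<Phi> T = ?n * IT T \<phi> + IT T (G T)" if T: "T \<in> \<T>" for T
    using LINT_add[OF integrable_mult_right[OF integrable_elem[OF T s]] iG[OF T], of ?n]
    by (simp add: \<Phi>_def G_def inner_commute)
  have "rt_function Tp Tm E x \<bullet> grad \<phi> x = (\<Sum>T\<in>\<T>. (rt_coeff E T / ?n) * (indicator T x * G T x))" for x
    unfolding rt_function_sum[OF E] by (simp add: inner_sum_left G_def mult_ac)
  then have "I (\<lambda>x. rt_function Tp Tm E x \<bullet> grad \<phi> x) = I (\<lambda>x. \<Sum>T\<in>\<T>. (rt_coeff E T / ?n) * (indicator T x * G T x))" by simp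
  also have "... = (\<Sum>T\<in>\<T>. I (\<lambda>x. (rt_coeff E T / ?n) * (indicator T x * G T x)))"
    by (rule LINT_sum) (intro integrable_mult_right, simp only: I_indicator(2)[OF _ bG] iG)
  also have "... = (\<Sum>T\<in>\<T>. (rt_coeff E T / ?n) * IT T (G T))"
    by (rule sum.cong[OF refl]) (simp only: integral_mult_right_zero I_indicator(1)[OF _ bG])
  also have "... = (\<Sum>T\<in>\<T>. (rt_coeff E T * \<Phi> T) / ?n - rt_coeff E T * IT T \<phi>)"
    by (rule sum.cong[OF refl]) (simp add: \<Phi> field_simps)
  also have "... = (\<Sum>T\<in>\<T>. rt_coeff E T * \<Phi> T) / ?n - (\<Sum>T\<in>\<T>. rt_coeff E T * IT T \<phi>)"
    by (simp only: sum_subtractf sum_divide_distrib)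
  also have "(\<Sum>T\<in>\<T>. rt_coeff E T * \<Phi> T) = 0"
  proof -
    have Tp: "Tp E \<in> \<T>" "is_facet E (Tp E)" using Tp_facet[OF E] by simp_all
    show ?thesis
    proof (cases "bdry E")
      case True
      interpret S: osimplex "Tp E" by (rule simp_loc[OF Tp(1)])
      have "\<phi> x = 0" if "x \<in> E" for x
      proof -
        have "x \<notin> \<Omega>" using True that open_dom by (auto simp: frontier_def interior_open)
        then show ?thesis using \<phi> closure_subset[of "{x. \<phi> x \<noteq> 0}"] by (auto simp: test_function_def)
      qed
      then have "\<Phi> (Tp E) = 0"
        unfolding \<Phi>_def using opposite_vertex_props[OF Tp]
        by (intro S.flux_zero smooth_has_derivative_grad s continuous_on_grad) auto
      then show ?thesis unfolding rt_coeff_sum[OF E] using True by simp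
    next
      case False
      have Tm: "Tm E \<in> \<T>" "is_facet E (Tm E)" using Tm_facet[OF E False] by simp_all
      have op: "open_simplex T" if "T \<in> \<T>" for T using simp_loc[OF that] by (rule osimplex.osimplex)
      have "\<Phi> (Tp E) / vol (Tp E) = \<Phi> (Tm E) / vol (Tm E)"
        unfolding \<Phi>_def
        by (rule flux_balance[OF op[OF Tp(1)] op[OF Tm(1)] opposite_vertex_props(1)[OF Tp] opposite_vertex_props(1)[OF Tm] _ s])
          (simp only: opposite_vertex_props(2)[OF Tp, symmetric] opposite_vertex_props(2)[OF Tm, symmetric])
      then show ?thesis unfolding rt_coeff_sum[OF E] using False by simp
    qed
  qed
  also have "(\<Sum>T\<in>\<T>. rt_coeff E T * IT T \<phi>) = I (\<lambda>x. (\<Sum>T\<in>\<T>. rt_coeff E T * indicator T x) * \<phi> x)"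
    by (rule I_piecewise_mult[OF s, symmetric])
  finally show "I (\<lambda>x. rt_function Tp Tm E x \<bullet> grad \<phi> x) = - I (\<lambda>x. (\<Sum>T\<in>\<T>. rt_coeff E T * indicator T x) * \<phi> x)" by simp
qed

text \<open>Testing with the bubble of one element isolates the coefficient of that element.\<close>

lemma weak_div_unique:
  assumes c: "has_weak_div \<Omega> \<sigma> (\<lambda>x. \<Sum>T\<in>\<T>. c T * indicator T x)"
    and d: "has_weak_div \<Omega> \<sigma> (\<lambda>x. \<Sum>T\<in>\<T>. d T * indicator T x)" and T: "T \<in> \<T>"
  shows "c T = d T"
proof -
  have b: "test (bubble T)" by (rule test_bubble[OF T])
  have e: "I (\<lambda>x. (\<Sum>T\<in>\<T>. c T * indicator T x) * bubble T x) = c T * IT T (bubble T)" for c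
  proof -
    have "I (\<lambda>x. (\<Sum>T\<in>\<T>. c T * indicator T x) * bubble T x) = (\<Sum>T'\<in>\<T>. c T' * IT T' (bubble T))"
      by (rule I_piecewise_mult[OF test_smooth[OF b]])
    also have "... = (\<Sum>T'\<in>\<T>. if T' = T then c T * IT T (bubble T) else 0)"
      by (rule sum.cong[OF refl]) (use bubble_mean(3)[OF _ T] in auto)
    also have "... = c T * IT T (bubble T)" using fin T by (simp add: sum.delta)
    finally show ?thesis .
  qed
  have "I (\<lambda>x. \<sigma> x \<bullet> grad (bubble T) x) = - I (\<lambda>x. (\<Sum>T\<in>\<T>. c T * indicator T x) * bubble T x)"
    using c b unfolding has_weak_div_def by blast
  moreover have "I (\<lambda>x. \<sigma> x \<bullet> grad (bubble T) x) = - I (\<lambda>x. (\<Sum>T\<in>\<T>. d T * indicator T x) * bubble T x)"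
    using d b unfolding has_weak_div_def by blast
  ultimately have "I (\<lambda>x. (\<Sum>T\<in>\<T>. c T * indicator T x) * bubble T x) = I (\<lambda>x. (\<Sum>T\<in>\<T>. d T * indicator T x) * bubble T x)" by linarith
  then show ?thesis unfolding e using bubble_mean(1)[OF T] by simp
qed

lemma div_coeffs_eq:
  assumes E: "E \<in> facets \<T>" and T: "T \<in> \<T>"
  shows "div_coeffs \<Omega> \<T> (rt_function Tp Tm E) T = rt_coeff E T"
proof -
  have "has_weak_div \<Omega> (rt_function Tp Tm E) (\<lambda>x. \<Sum>T\<in>\<T>. div_coeffs \<Omega> \<T> (rt_function Tp Tm E) T * indicator T x)"
    unfolding div_coeffs_def
    by (rule someI[of "\<lambda>c. has_weak_div \<Omega> (rt_function Tp Tm E) (\<lambda>x. \<Sum>T\<in>\<T>. c T * indicator T x)", OF rt_weak_div[OF E]])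
  then show ?thesis by (rule weak_div_unique[OF _ rt_weak_div[OF E] T])
qed

text \<open>The exponent 2 is split as \<open>n / (n - 1) + (n - 2) / (n - 1)\<close>. The second
  part is at most \<open>(2 * h) ^ (n - 2)\<close>; together with \<open>h\<^sup>2\<close> it gives
  \<open>h ^ n\<close>, which shape regularity compares with the volume.\<close>

lemma area_power:
  assumes T: "T \<in> \<T>" and E: "is_facet E T"
  shows "(area E)\<^sup>2 * (diameter T)\<^sup>2 / vol T
    \<le> 2 ^ (DIM('a) - 2) * \<gamma> * area E powr (real DIM('a) / (real DIM('a) - 1))"
proof -
  let ?h = "diameter T" and ?a = "area E" and ?n = "real DIM('a)"
  have h: "0 < ?h" by (rule diam_pos[OF T])
  have a: "0 < ?a" by (rule area_bounds(4)[OF T E])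
  have n: "real (DIM('a) - 1) * jump_exponent DIM('a) = real (DIM('a) - 2)"
    using dim2 by (simp add: jump_exponent_def)
  have a0: "0 \<le> jump_exponent DIM('a)" using dim2 by (simp add: jump_exponent_def)
  have "?a powr jump_exponent DIM('a) \<le> ((2 * ?h) ^ (DIM('a) - 1)) powr jump_exponent DIM('a)"
    by (rule powr_mono2[OF a0]) (use a area_bounds(1)[OF T E] in simp_all)
  also have "... = (2 * ?h) ^ (DIM('a) - 2)"
    by (rule power_powr[OF _ n]) (use h in simp)
  finally have w: "?a powr jump_exponent DIM('a) \<le> (2 * ?h) ^ (DIM('a) - 2)" .
  have "?n / (?n - 1) + jump_exponent DIM('a) = 2"
    unfolding jump_exponent_def add_divide_distrib[symmetric] using dim2 by (simp add: divide_eq_eq)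
  then have "?a\<^sup>2 = ?a powr (?n / (?n - 1)) * ?a powr jump_exponent DIM('a)"
    using a by (simp add: powr_add[symmetric])
  also have "... \<le> ?a powr (?n / (?n - 1)) * (2 * ?h) ^ (DIM('a) - 2)" by (rule mult_left_mono[OF w]) simp
  finally have sq: "?a\<^sup>2 \<le> ?a powr (?n / (?n - 1)) * (2 * ?h) ^ (DIM('a) - 2)" .
  have "?a\<^sup>2 * ?h\<^sup>2 \<le> (?a powr (?n / (?n - 1)) * (2 * ?h) ^ (DIM('a) - 2)) * ?h\<^sup>2" by (rule mult_right_mono[OF sq]) simp
  also have "... = 2 ^ (DIM('a) - 2) * ?a powr (?n / (?n - 1)) * ?h ^ DIM('a)"
    unfolding diam_pow_split by (simp add: power_mult_distrib mult_ac)
  also have "... \<le> 2 ^ (DIM('a) - 2) * ?a powr (?n / (?n - 1)) * (\<gamma> * vol T)"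
    by (rule mult_left_mono[OF diam_power[OF T]]) simp
  finally show ?thesis using vol_pos[OF T] by (simp add: pos_divide_le_eq mult_ac)
qed

text \<open>On an element only the functions of its own facets are nonzero, each bounded by
  \<open>area E * diameter T / vol T\<close>. The squared sum costs a factor \<open>n + 1\<close>,
  and after integration \<open>area_power\<close> produces the reciprocal diagonal entries.\<close>

lemma rt_upper_bound:
  "(Hm1_norm \<Omega> (L2_functional \<Omega> (\<lambda>x. \<Sum>T\<in>\<T>. (\<Sum>E\<in>facets \<T>. c E * rt_coeff E T) * indicator T x)))\<^sup>2
    \<le> upper_const DIM('a) \<gamma> * (\<Sum>E\<in>facets \<T>. (c E)\<^sup>2 * area E powr (real DIM('a) / (real DIM('a) - 1)))"
proof -
  let ?n = "real DIM('a)"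
  define \<sigma> where "\<sigma> x = (\<Sum>E\<in>facets \<T>. c E *\<^sub>R rt_function Tp Tm E x)" for x
  define F where "F T = {E \<in> facets \<T>. is_facet E T}" for T
  define q where "q T = (?n + 1) * (\<Sum>E\<in>F T. (c E)\<^sup>2 * ((area E)\<^sup>2 * (diameter T)\<^sup>2 / (vol T)\<^sup>2))" for T
  have cF: "card (F T) \<le> Suc DIM('a)" if T: "T \<in> \<T>" for T
  proof -
    interpret S: osimplex T by (rule simp_loc[OF T])
    have "F T \<subseteq> opp_facet T ` vert T" using S.is_facet_iff by (auto simp: F_def)
    then have "card (F T) \<le> card (vert T)" using surj_card_le[OF S.finV] by blast
    then show ?thesis by (simp add: S.vert_props(2))
  qed
  have q0: "0 \<le> q T" for T unfolding q_def by (intro mult_nonneg_nonneg sum_nonneg) simp_all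
  have hw: "has_weak_div \<Omega> \<sigma> (\<lambda>x. \<Sum>E\<in>facets \<T>. c E * (\<Sum>T\<in>\<T>. rt_coeff E T * indicator T x))"
    unfolding \<sigma>_def by (rule has_weak_div_sum[OF finite_facets rt_weak_div])
  have eq: "(\<lambda>x. \<Sum>E\<in>facets \<T>. c E * (\<Sum>T\<in>\<T>. rt_coeff E T * indicator T x))
      = (\<lambda>x. \<Sum>T\<in>\<T>. (\<Sum>E\<in>facets \<T>. c E * rt_coeff E T) * indicator T x :: real)"
  proof
    fix x
    have "(\<Sum>E\<in>facets \<T>. c E * (\<Sum>T\<in>\<T>. rt_coeff E T * indicator T x))
        = (\<Sum>E\<in>facets \<T>. \<Sum>T\<in>\<T>. c E * rt_coeff E T * indicator T x)" by (simp only: sum_distrib_left mult.assoc)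
    also have "... = (\<Sum>T\<in>\<T>. \<Sum>E\<in>facets \<T>. c E * rt_coeff E T * indicator T x)" by (rule sum.swap)
    finally show "(\<Sum>E\<in>facets \<T>. c E * (\<Sum>T\<in>\<T>. rt_coeff E T * indicator T x))
        = (\<Sum>T\<in>\<T>. (\<Sum>E\<in>facets \<T>. c E * rt_coeff E T) * indicator T x)" by (simp only: sum_distrib_right)
  qed
  have L\<sigma>: "L2 \<Omega> \<sigma>" using hw by (simp add: has_weak_div_def)
  have px: "(norm (\<sigma> x))\<^sup>2 \<le> (\<Sum>T\<in>\<T>. indicator T x * q T)" for x
  proof (cases "\<exists>T\<in>\<T>. x \<in> T")
    case True
    then obtain T where T: "T \<in> \<T>" "x \<in> T" by blast
    interpret S: osimplex T by (rule simp_loc[OF T(1)])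
    have b: "norm (c E *\<^sub>R rt_function Tp Tm E x) \<le> (if E \<in> F T then \<bar>c E\<bar> * (area E * diameter T / vol T) else 0)"
      if E: "E \<in> facets \<T>" for E
    proof -
      have rt: "rt_function Tp Tm E x = (rt_coeff E T / ?n) *\<^sub>R (x - opposite_vertex T E)"
        unfolding rt_function_sum[OF E] by (rule sum_indicator[OF T])
      show ?thesis
      proof (cases "E \<in> F T")
        case True
        have "norm (x - opposite_vertex T E) \<le> diameter T"
          using True T opposite_vertex_props(1)[of T E] S.vertex_in_closure S.T_subset_closure
          by (intro S.dist_le_diameter) (auto simp: F_def)
        moreover have "\<bar>rt_coeff E T / ?n\<bar> \<le> area E / vol T"
        proof -
          have "\<bar>rt_coeff E T / ?n\<bar> \<le> \<bar>rt_coeff E T\<bar>"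
            using mult_left_mono[of 1 ?n "\<bar>rt_coeff E T\<bar>"] dim2 by (simp add: abs_divide divide_le_eq)
          then show ?thesis using rt_coeff_abs[OF E T(1)] by linarith
        qed
        ultimately have "norm (rt_function Tp Tm E x) \<le> area E / vol T * diameter T"
          unfolding rt norm_scaleR
          using True area_bounds(4)[OF T(1)] vol_pos[OF T(1)] by (intro mult_mono) (auto simp: F_def less_imp_le)
        then have "\<bar>c E\<bar> * norm (rt_function Tp Tm E x) \<le> \<bar>c E\<bar> * (area E / vol T * diameter T)"
          by (rule mult_left_mono) simp
        then show ?thesis using True by simp
      next
        case False
        then have "rt_coeff E T = 0" using rt_coeff_nonzero[OF E] E by (auto simp: F_def)
        then show ?thesis using False by (simp add: rt)
      qed
    qed
    have "norm (\<sigma> x) \<le> (\<Sum>E\<in>facets \<T>. if E \<in> F T then \<bar>c E\<bar> * (area E * diameter T / vol T) else 0)"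
      unfolding \<sigma>_def by (rule order_trans[OF norm_sum sum_mono[OF b]])
    also have "... = (\<Sum>E\<in>F T. \<bar>c E\<bar> * (area E * diameter T / vol T))"
      by (rule sum.mono_neutral_cong_right[OF finite_facets]) (auto simp: F_def)
    finally have "(norm (\<sigma> x))\<^sup>2 \<le> (\<Sum>E\<in>F T. \<bar>c E\<bar> * (area E * diameter T / vol T))\<^sup>2" by (rule power_mono) simp
    also have "... \<le> (\<Sum>E\<in>F T. (\<bar>c E\<bar> * (area E * diameter T / vol T))\<^sup>2) * card (F T)"
      by (rule sum_squared_le_sum_of_squares)
    also have "... \<le> (\<Sum>E\<in>F T. (\<bar>c E\<bar> * (area E * diameter T / vol T))\<^sup>2) * (?n + 1)"
      using cF[OF T(1)] by (intro mult_left_mono sum_nonneg) simp_all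
    also have "... = q T" by (simp add: q_def power_mult_distrib power_divide mult.commute)
    also have "... = (\<Sum>T\<in>\<T>. indicator T x * q T)" using sum_indicator[OF T, of q] by simp
    finally show ?thesis .
  next
    case False
    then have "indicator T x = (0::real)" if "T \<in> \<T>" for T using that by (simp add: indicator_def)
    then have "rt_function Tp Tm E x = 0" if "E \<in> facets \<T>" for E unfolding rt_function_sum[OF that] by simp
    then have "\<sigma> x = 0" by (simp add: \<sigma>_def)
    then show ?thesis using q0 by (simp add: sum_nonneg)
  qed
  have "(Hm1_norm \<Omega> (L2_functional \<Omega> (\<lambda>x. \<Sum>T\<in>\<T>. (\<Sum>E\<in>facets \<T>. c E * rt_coeff E T) * indicator T x)))\<^sup>2 \<le> (L2_norm \<Omega> \<sigma>)\<^sup>2"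
    using has_weak_div_bound[OF hw] Hm1_norm_props(1)[OF dual_of_L2_functional[OF L2_piecewise]] unfolding eq by (intro power_mono)
  also have "... \<le> I (\<lambda>x. \<Sum>T\<in>\<T>. indicator T x * q T)"
    unfolding L2_norm_power2 by (rule integral_mono[OF L2_integrable[OF L\<sigma>] I_piecewise(2) px])
  also have "... = (\<Sum>T\<in>\<T>. vol T * q T)" by (rule I_piecewise(1))
  also have "... \<le> (\<Sum>T\<in>\<T>. \<Sum>E\<in>F T. (?n + 1) * ((c E)\<^sup>2 * (2 ^ (DIM('a) - 2) * \<gamma> * area E powr (?n / (?n - 1)))))"
  proof (rule sum_mono)
    fix T assume T: "T \<in> \<T>"
    have "vol T * q T = (\<Sum>E\<in>F T. (?n + 1) * ((c E)\<^sup>2 * ((area E)\<^sup>2 * (diameter T)\<^sup>2 / vol T)))"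
      unfolding q_def sum_distrib_left using vol_pos[OF T] by (intro sum.cong[OF refl]) (simp add: power2_eq_square)
    also have "... \<le> (\<Sum>E\<in>F T. (?n + 1) * ((c E)\<^sup>2 * (2 ^ (DIM('a) - 2) * \<gamma> * area E powr (?n / (?n - 1)))))"
      using T by (intro sum_mono mult_left_mono area_power) (simp_all add: F_def)
    finally show "vol T * q T \<le> (\<Sum>E\<in>F T. (?n + 1) * ((c E)\<^sup>2 * (2 ^ (DIM('a) - 2) * \<gamma> * area E powr (?n / (?n - 1)))))" .
  qed
  \<comment> \<open>The sums are exchanged to count the at most two elements of each facet.\<close>
  also have "... = (\<Sum>E\<in>facets \<T>. \<Sum>T | T \<in> \<T> \<and> is_facet E T. (?n + 1) * ((c E)\<^sup>2 * (2 ^ (DIM('a) - 2) * \<gamma> * area E powr (?n / (?n - 1)))))"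
    unfolding F_def by (rule sum.swap_restrict[OF fin finite_facets])
  also have "... \<le> (\<Sum>E\<in>facets \<T>. 2 * ((?n + 1) * ((c E)\<^sup>2 * (2 ^ (DIM('a) - 2) * \<gamma> * area E powr (?n / (?n - 1))))))"
  proof (rule sum_mono)
    fix E assume E: "E \<in> facets \<T>"
    have "{T \<in> \<T>. is_facet E T} \<subseteq> {Tp E, Tm E}" using facet_neighbours[OF E] by blast
    then have "card {T \<in> \<T>. is_facet E T} \<le> card {Tp E, Tm E}" by (rule card_mono[rotated]) simp
    also have "... \<le> 2" by (simp add: card_insert_if)
    finally have "real (card {T \<in> \<T>. is_facet E T}) \<le> 2" by simp
    then show "(\<Sum>T | T \<in> \<T> \<and> is_facet E T. (?n + 1) * ((c E)\<^sup>2 * (2 ^ (DIM('a) - 2) * \<gamma> * area E powr (?n / (?n - 1)))))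
        \<le> 2 * ((?n + 1) * ((c E)\<^sup>2 * (2 ^ (DIM('a) - 2) * \<gamma> * area E powr (?n / (?n - 1)))))"
      unfolding sum_constant using gamma_pos by (intro mult_right_mono) simp_all
  qed
  also have "... = upper_const DIM('a) \<gamma> * (\<Sum>E\<in>facets \<T>. (c E)\<^sup>2 * area E powr (?n / (?n - 1)))"
    by (simp add: upper_const_def sum_distrib_left mult_ac)
  finally show ?thesis .
qed

end

section \<open>The condition number\<close>

text \<open>Near a boundary point the domain lies strictly below the graph, so the open set strictly
  above it misses the closure. Moving up along \<open>e\<close> leaves the argument of \<zeta>
  unchanged and enters that set.\<close>

lemma lipschitz_boundary_interior:
  fixes \<Omega> :: "'a::euclidean_space set"
  assumes "open \<Omega>" "lipschitz_boundary \<Omega>"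
  shows "interior (closure \<Omega>) = \<Omega>"
proof (intro equalityI subsetI)
  show "x \<in> interior (closure \<Omega>)" if "x \<in> \<Omega>" for x
    using interior_maximal[OF closure_subset assms(1)] that by blast
next
  fix x assume x: "x \<in> interior (closure \<Omega>)"
  show "x \<in> \<Omega>"
  proof (rule ccontr)
    assume nx: "x \<notin> \<Omega>"
    have "x \<in> closure \<Omega>" using x interior_subset by blast
    then have "x \<in> frontier \<Omega>" using nx assms(1) by (simp add: frontier_def interior_open)
    then obtain U e L \<zeta> where U: "open U" "x \<in> U" and e: "norm e = 1"
      and \<zeta>: "L-lipschitz_on {y. y \<bullet> e = 0} (\<zeta> :: 'a \<Rightarrow> real)"
      and eq: "\<Omega> \<inter> U = {z \<in> U. z \<bullet> e < \<zeta> (z - (z \<bullet> e) *\<^sub>R e)}"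
      using assms(2) unfolding lipschitz_boundary_def by meson
    define f where "f z = \<zeta> (z - (z \<bullet> e) *\<^sub>R e)" for z
    have ee: "e \<bullet> e = 1" using e by (simp add: norm_eq_1)
    have cf: "continuous_on UNIV f"
      unfolding f_def
    proof (rule continuous_on_compose2[OF lipschitz_on_continuous_on[OF \<zeta>]])
      show "continuous_on UNIV (\<lambda>z. z - (z \<bullet> e) *\<^sub>R e)" by (intro continuous_intros)
      show "range (\<lambda>z. z - (z \<bullet> e) *\<^sub>R e) \<subseteq> {y. y \<bullet> e = 0}" by (auto simp: inner_diff_left ee)
    qed
    have "open (U \<inter> interior (closure \<Omega>))" using U(1) by (intro open_Int open_interior)
    then obtain r where r: "0 < r" "ball x r \<subseteq> U \<inter> interior (closure \<Omega>)"
      using x U(2) open_contains_ball by blast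
    define y where "y = x + (r / 2) *\<^sub>R e"
    have "y \<in> ball x r" using r(1) e by (simp add: y_def dist_norm)
    then have y: "y \<in> U" "y \<in> closure \<Omega>" using r(2) interior_subset by blast+
    define W where "W = U \<inter> {z. f z < z \<bullet> e}"
    have "open W" unfolding W_def by (intro open_Int U open_Collect_less cf continuous_intros)
    moreover have "W \<inter> \<Omega> = {}"
    proof -
      have "z \<bullet> e < f z" if "z \<in> \<Omega>" "z \<in> U" for z
      proof -
        have "z \<in> {z \<in> U. z \<bullet> e < \<zeta> (z - (z \<bullet> e) *\<^sub>R e)}" unfolding eq[symmetric] using that by simp
        then show ?thesis by (simp add: f_def)
      qed
      then show ?thesis unfolding W_def by fastforce
    qed
    ultimately have "W \<inter> closure \<Omega> = {}" by (simp add: open_Int_closure_eq_empty)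
    moreover have "y \<in> W"
    proof -
      have "f x \<le> x \<bullet> e" using nx U(2) eq by (force simp: f_def)
      moreover have "f y = f x" by (simp add: f_def y_def inner_add_left ee algebra_simps)
      moreover have "y \<bullet> e = x \<bullet> e + r / 2" by (simp add: y_def inner_add_left ee)
      ultimately show ?thesis using y(1) r(1) by (simp add: W_def)
    qed
    ultimately show False using y(2) by blast
  qed
qed

lemma lower_const_pos:
  assumes "0 < \<gamma>"
  shows "0 < lower_const n \<gamma>"
proof -
  have n: "0 < real n + 1" by simp
  have k: "0 < kap n \<gamma>" using assms by (simp add: kap_def)
  have s: "0 < step_const n \<gamma>"
    unfolding step_const_def using k by (intro add_pos_nonneg mult_nonneg_nonneg) simp_all
  have j: "0 < jump_const n \<gamma>"
    unfolding jump_const_def by (intro mult_pos_pos zero_less_power s add_pos_nonneg) simp_all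
  have "0 < 98 * (2 ^ (n - 1) * (real n + 1) * (kap n \<gamma>)\<^sup>2)" by (intro mult_pos_pos zero_less_power n k) simp_all
  moreover have "0 \<le> 2 * (bubble_grad_const n \<gamma> * (real n + 1))" by (simp add: bubble_grad_const_def)
  moreover have "0 < jump_const n \<gamma> * ((real n + 1) * (2 ^ n * \<gamma>))" by (intro mult_pos_pos zero_less_power n j assms) simp
  ultimately show ?thesis unfolding lower_const_def by (rule mult_pos_pos[OF add_pos_nonneg])
qed

section \<open>Assembly of the matrix estimates\<close>

context mesh
begin

lemma cond_number_bound:
  assumes Ts: "distinct Ts" "set Ts = \<T>" and Es: "distinct Es" "set Es = facets \<T>"
  defines "A \<equiv> gram_matrix \<Omega> Ts" and "J \<equiv> div_matrix \<Omega> Tp Tm Ts Es"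
  shows "spectrum (J * facet_matrix Es * transpose_mat J * A) \<noteq> {}"
    and "0 < Min (spectrum (J * facet_matrix Es * transpose_mat J * A))"
    and "cond_number (J * facet_matrix Es * transpose_mat J * A) \<le> upper_const DIM('a) \<gamma> * lower_const DIM('a) \<gamma>"
proof -
  let ?p = "real DIM('a) / (real DIM('a) - 1)"
  define m where "m = length Ts"
  define e where "e = length Es"
  define d where "d j = area (Es ! j) powr (- ?p)" for j
  define T where "T i = Ts ! i" for i
  have Tin: "T i \<in> \<T>" if "i < m" for i using that Ts(2) by (auto simp: T_def m_def)
  have Ein: "Es ! j \<in> facets \<T>" if "j < e" for j using that Es(2) nth_mem unfolding e_def by blast
  have Ea: "0 < area (Es ! j)" if "j < e" for j using area_bounds(4) Tp_facet[OF Ein[OF that]] by blast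
  have bT: "bij_betw T {..<m} \<T>" unfolding T_def m_def using bij_betw_nth[OF Ts(1)] Ts(2) by simp
  have bE: "bij_betw ((!) Es) {..<e} (facets \<T>)" unfolding e_def using bij_betw_nth[OF Es(1)] Es(2) by simp
  have sT: "(\<Sum>S\<in>\<T>. f S) = (\<Sum>i<m. f (T i))" for f :: "'a set \<Rightarrow> real" by (rule sum.reindex_bij_betw[OF bT, symmetric])
  have sE: "(\<Sum>E\<in>facets \<T>. f E) = (\<Sum>j<e. f (Es ! j))" for f :: "'a set \<Rightarrow> real" by (rule sum.reindex_bij_betw[OF bE, symmetric])
  \<comment> \<open>The estimates of the mesh concern functions on elements and facets; these are
    the functions that belong to numbered vectors.\<close>
  define onT where "onT x S = x $ inv_into {..<m} T S" for x :: "real Matrix.vec" and S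
  define onE where "onE c S = c $ inv_into {..<e} ((!) Es) S" for c :: "real Matrix.vec" and S
  have onT: "onT x (T i) = x $ i" if "i < m" for x i
    using that bij_betw_inv_into_left[OF bT] by (simp add: onT_def)
  have onE: "onE c (Es ! j) = c $ j" if "j < e" for c j
    using that bij_betw_inv_into_left[OF bE] by (simp add: onE_def)
  have Ac: "A \<in> carrier_mat m m" by (simp add: A_def gram_matrix_def m_def)
  have Jc: "J \<in> carrier_mat m e" by (simp add: J_def div_matrix_def m_def e_def)
  have Aij: "A $$ (i, j) = Hm1_inner \<Omega> (L2_functional \<Omega> (indicator (T i))) (L2_functional \<Omega> (indicator (T j)))"
    if "i < m" "j < m" for i j using that by (simp add: A_def gram_matrix_def m_def T_def)
  have Jij: "J $$ (i, j) = rt_coeff (Es ! j) (T i)" if "i < m" "j < e" for i j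
    using that Ts(2) div_coeffs_eq[OF Ein[OF that(2)] Tin[OF that(1)]] by (simp add: J_def div_matrix_def m_def e_def T_def)
  have energy: "scalar_prod x (A *\<^sub>v x) = (Hm1_norm \<Omega> (L2_functional \<Omega> (\<lambda>y. \<Sum>S\<in>\<T>. onT x S * indicator S y)))\<^sup>2"
    if x: "x \<in> carrier_vec m" for x
  proof -
    have "(\<lambda>y. \<Sum>S\<in>\<T>. onT x S * indicator S y) = (\<lambda>y. \<Sum>i\<in>{..<m}. x $ i * indicator (T i) y)"
      unfolding sT by (simp add: onT)
    then have "(Hm1_norm \<Omega> (L2_functional \<Omega> (\<lambda>y. \<Sum>S\<in>\<T>. onT x S * indicator S y)))\<^sup>2
        = (\<Sum>i<m. \<Sum>j<m. x $ i * x $ j * Hm1_inner \<Omega> (L2_functional \<Omega> (indicator (T i))) (L2_functional \<Omega> (indicator (T j))))"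
      using Hm1_inner_gram[of "{..<m}" "\<lambda>i. indicator (T i)" "\<lambda>i. x $ i"] L2_indicator[OF Tin] by simp
    also have "... = (\<Sum>i<m. x $ i * (\<Sum>j<m. A $$ (i, j) * x $ j))"
      by (simp add: Aij sum_distrib_left mult_ac)
    also have "... = scalar_prod x (A *\<^sub>v x)"
      using x Ac by (simp add: scalar_prod_def atLeast0LessThan)
    finally show ?thesis by simp
  qed
  have N0: "0 \<le> Hm1_norm \<Omega> (L2_functional \<Omega> (\<lambda>y. \<Sum>S\<in>\<T>. onT x S * indicator S y))" for x
    by (rule Hm1_norm_props(1)[OF dual_of_L2_functional[OF L2_piecewise]])
  have Jt: "(transpose_mat J *\<^sub>v y) $ j = area (Es ! j) * jump (\<lambda>S. onT y S / vol S) (Es ! j)"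
    if y: "y \<in> carrier_vec m" and j: "j < e" for y j
  proof -
    have "(transpose_mat J *\<^sub>v y) $ j = (\<Sum>i<m. J $$ (i, j) * y $ i)"
      using y j Jc by (simp add: scalar_prod_def atLeast0LessThan)
    also have "... = (\<Sum>S\<in>\<T>. rt_coeff (Es ! j) S * onT y S)" unfolding sT using j by (simp add: Jij onT)
    finally show ?thesis unfolding rt_coeff_sum[OF Ein[OF j]] jump_def .
  qed
  have jmp: "(\<Sum>j<e. d j * ((transpose_mat J *\<^sub>v y) $ j)\<^sup>2) = jumps (\<lambda>S. onT y S / vol S)"
    if y: "y \<in> carrier_vec m" for y
  proof -
    have "d j * ((transpose_mat J *\<^sub>v y) $ j)\<^sup>2 = weight (Es ! j) * (jump (\<lambda>S. onT y S / vol S) (Es ! j))\<^sup>2"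
      if j: "j < e" for j
    proof -
      \<comment> \<open>The squared area from the divergence coefficients meets the diagonal entry
        and leaves the weight of the jump.\<close>
      have "- ?p + 2 = jump_exponent DIM('a)" using dim2 by (simp add: jump_exponent_def field_simps)
      then have "area (Es ! j) powr (- ?p) * (area (Es ! j))\<^sup>2 = weight (Es ! j)"
        using Ea[OF j] powr_add[of "area (Es ! j)" "- ?p" 2] by simp
      then show ?thesis unfolding Jt[OF y j] d_def by (simp add: power_mult_distrib)
    qed
    then show ?thesis unfolding sE by simp
  qed
  have lower: "scalar_prod x y \<le> sqrt (lower_const DIM('a) \<gamma>) * sqrt (scalar_prod x (A *\<^sub>v x)) *
        sqrt (\<Sum>j<e. d j * ((transpose_mat J *\<^sub>v y) $ j)\<^sup>2)"
    if x: "x \<in> carrier_vec m" and y: "y \<in> carrier_vec m" for x y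
  proof -
    have "scalar_prod x y = (\<Sum>i<m. x $ i * y $ i)" using y by (simp add: scalar_prod_def atLeast0LessThan)
    \<comment> \<open>The piecewise constant function \<open>y / vol\<close> has the integrals
      \<open>y\<close> over the elements, as \<open>dual_lower_bound\<close> requires.\<close>
    also have "... = (\<Sum>S\<in>\<T>. onT x S * (vol S * (onT y S / vol S)))"
      unfolding sT by (rule sum.cong[OF refl]) (use vol_pos[OF Tin] in "simp add: onT less_imp_neq[symmetric]")
    also have "... \<le> sqrt (lower_const DIM('a) \<gamma>) * sqrt (scalar_prod x (A *\<^sub>v x)) *
        sqrt (\<Sum>j<e. d j * ((transpose_mat J *\<^sub>v y) $ j)\<^sup>2)"
      using dual_lower_bound[of "onT x" "\<lambda>S. onT y S / vol S"] N0[of x] unfolding jmp[OF y] energy[OF x] by simp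
    finally show ?thesis .
  qed
  have pos: "0 < scalar_prod x (A *\<^sub>v x)" if x: "x \<in> carrier_vec m" "x \<noteq> 0\<^sub>v m" for x
  proof -
    have "0 < scalar_prod x x"
    proof -
      obtain i where i: "i < m" "x $ i \<noteq> 0" using x by (metis carrier_vecD eq_vecI index_zero_vec)
      have "scalar_prod x x = (\<Sum>i<m. (x $ i)\<^sup>2)" using x(1) by (simp add: scalar_prod_def atLeast0LessThan power2_eq_square)
      also have "... > 0" by (rule sum_pos2[of _ i]) (use i in simp_all)
      finally show ?thesis .
    qed
    \<comment> \<open>Definiteness of the Gram matrix comes from the lower bound with
      \<open>y = x\<close>: zero energy would force \<open>scalar_prod x x \<le> 0\<close>.\<close>
    then have "scalar_prod x (A *\<^sub>v x) \<noteq> 0" using lower[OF x(1) x(1)] by auto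
    then show ?thesis using energy[OF x(1)] by simp
  qed
  have upper: "scalar_prod (J *\<^sub>v c) (A *\<^sub>v (J *\<^sub>v c)) \<le> upper_const DIM('a) \<gamma> * (\<Sum>j<e. (c $ j)\<^sup>2 / d j)"
    if c: "c \<in> carrier_vec e" for c
  proof -
    have Jcv: "J *\<^sub>v c \<in> carrier_vec m" by (rule mult_mat_vec_carrier[OF Jc c])
    have "onT (J *\<^sub>v c) S = (\<Sum>E\<in>facets \<T>. onE c E * rt_coeff E S)" if "S \<in> \<T>" for S
    proof -
      obtain i where i: "i < m" "S = T i" using bT \<open>S \<in> \<T>\<close> by (auto simp: bij_betw_def)
      have "onT (J *\<^sub>v c) S = (\<Sum>j<e. J $$ (i, j) * c $ j)"
        using i c Jc by (simp add: onT scalar_prod_def atLeast0LessThan)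
      also have "... = (\<Sum>E\<in>facets \<T>. onE c E * rt_coeff E S)" unfolding sE using i by (simp add: Jij onE mult.commute)
      finally show ?thesis .
    qed
    then have "scalar_prod (J *\<^sub>v c) (A *\<^sub>v (J *\<^sub>v c))
        = (Hm1_norm \<Omega> (L2_functional \<Omega> (\<lambda>y. \<Sum>S\<in>\<T>. (\<Sum>E\<in>facets \<T>. onE c E * rt_coeff E S) * indicator S y)))\<^sup>2"
      unfolding energy[OF Jcv] by simp
    also have "... \<le> upper_const DIM('a) \<gamma> * (\<Sum>E\<in>facets \<T>. (onE c E)\<^sup>2 * area E powr ?p)" by (rule rt_upper_bound)
    also have "(\<Sum>E\<in>facets \<T>. (onE c E)\<^sup>2 * area E powr ?p) = (\<Sum>j<e. (c $ j)\<^sup>2 / d j)"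
      unfolding sE by (rule sum.cong[OF refl]) (simp add: onE d_def powr_minus divide_inverse)
    finally show ?thesis .
  qed
  have symA: "transpose_mat A = A"
    by (rule eq_matI) (use Ac in "auto simp: Aij intro!: Hm1_inner_commute L2_indicator Tin")
  have m0: "0 < m" using mesh_nonempty Ts(2) by (auto simp: m_def)
  have d0: "0 < d j" if "j < e" for j using Ea[OF that] by (simp add: d_def)
  have lc: "0 < lower_const DIM('a) \<gamma>" by (rule lower_const_pos[OF gamma_pos])
  have D: "facet_matrix Es = mat_diag e d" by (simp add: facet_matrix_def e_def d_def[abs_def])
  have sq: "0 < sqrt (lower_const DIM('a) \<gamma>)" using lc by simp
  note res = cond_number_diag_preconditioner[where d=d and e=e and ?C1.0="upper_const DIM('a) \<gamma>"
      and ?C2.0="sqrt (lower_const DIM('a) \<gamma>)", OF Ac Jc m0 symA]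
  show "spectrum (J * facet_matrix Es * transpose_mat J * A) \<noteq> {}"
    unfolding D by (rule res(1); (rule sq | erule (1) pos | erule d0 | erule upper | erule (1) lower))
  show "0 < Min (spectrum (J * facet_matrix Es * transpose_mat J * A))"
    unfolding D by (rule res(2); (rule sq | erule (1) pos | erule d0 | erule upper | erule (1) lower))
  have "cond_number (J * mat_diag e d * transpose_mat J * A) \<le> upper_const DIM('a) \<gamma> * (sqrt (lower_const DIM('a) \<gamma>))\<^sup>2"
    by (rule res(3); (rule sq | erule (1) pos | erule d0 | erule upper | erule (1) lower))
  then show "cond_number (J * facet_matrix Es * transpose_mat J * A) \<le> upper_const DIM('a) \<gamma> * lower_const DIM('a) \<gamma>"
    unfolding D using lc by simp
qed

end

theorem mainTheorem5:
  fixes \<Omega> :: "(real ^ 'n) set" and \<gamma> :: real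
  assumes "CARD('n) \<ge> 2"
    and "polyhedral_lipschitz_domain \<Omega>"
  shows "\<exists>C_cond :: real. \<forall>\<T> Tp Tm Ts Es A I D B_inv.
    regular_mesh \<Omega> \<T> \<and> shape_regular \<gamma> \<T> \<and> facet_labelling \<Omega> \<T> Tp Tm \<and>
    distinct Ts \<and> set Ts = \<T> \<and> distinct Es \<and> set Es = facets \<T> \<and>
    A = gram_matrix \<Omega> Ts \<and>
    I = div_matrix \<Omega> Tp Tm Ts Es \<and>
    D = facet_matrix Es \<and>
    B_inv = I * D * transpose_mat I \<longrightarrow>
    spectrum (B_inv * A) \<noteq> {} \<and> 0 < Min (spectrum (B_inv * A)) \<and>
    cond_number (B_inv * A) \<le> C_cond"
proof (intro exI[of _ "upper_const DIM(real ^ 'n) \<gamma> * lower_const DIM(real ^ 'n) \<gamma>"] allI impI, elim conjE)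
  fix \<T> Tp Tm Ts Es A I D B_inv
  assume mesh: "regular_mesh \<Omega> \<T>" "shape_regular \<gamma> \<T>" "facet_labelling \<Omega> \<T> Tp Tm"
    and lists: "distinct Ts" "set Ts = \<T>" "distinct Es" "set Es = facets \<T>"
    and mats: "A = gram_matrix \<Omega> Ts" "I = div_matrix \<Omega> Tp Tm Ts Es" "D = facet_matrix Es" "B_inv = I * D * transpose_mat I"
  have dom: "open \<Omega>" "bounded \<Omega>" "\<Omega> \<noteq> {}" "lipschitz_boundary \<Omega>"
    using assms(2) by (simp_all add: polyhedral_lipschitz_domain_def)
  \<comment> \<open>The geometry of the domain enters through \<open>int_cl\<close>, supplied by
    \<open>lipschitz_boundary_interior\<close>; the number of coordinates is the dimension in
    \<open>dim2\<close>.\<close>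
  interpret mesh \<Omega> \<T> \<gamma> Tp Tm
    by unfold_locales (use dom mesh assms(1) lipschitz_boundary_interior in simp_all)
  show "spectrum (B_inv * A) \<noteq> {} \<and> 0 < Min (spectrum (B_inv * A)) \<and>
      cond_number (B_inv * A) \<le> upper_const DIM(real ^ 'n) \<gamma> * lower_const DIM(real ^ 'n) \<gamma>"
    unfolding mats using cond_number_bound[OF lists] by blast
qed

end
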